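(* Let $k$ be an algebraically closed field of characteristic $2$. Let $A$ denote the graded Hopf algebra $$A=k\langle a,b,g\rangle/(g^2=1,\ a^2=b^2=0,\ ab=ba,\ ga=ag,\ gb=bg)$$ with $\Delta(g)=g\otimes g$, $\Delta(a)=a\otimes1+g\otimes a$, $\Delta(b)=b\otimes1+1\otimes b+ag\otimes a$. For $\epsilon_1\in\{0,1\}$ and $\tau\in k$, let $Q(\epsilon_1,\tau)$ denote the quotient of the free algebra $k\langle g,x,y\rangle$ by the relations $$g^2=1,\quad gx-xg=\epsilon_1(g-1),\quad gy-yg=\epsilon_1(1+g+x+xg),$$ $$xy-yx=\tau(1-g),\quad x^2=\epsilon_1x,\quad y^2=\epsilon_1y+\tau(x+xg),$$ with $\Delta(g)=g\otimes g$, $\Delta(x)=x\otimes1+g\otimes x$, $\Delta(y)=y\otimes1+1\otimes y+xg\otimes x$. Let $H$ be a pointed Hopf algebra over $k$ of dimension $8$ whose associated graded Hopf algebra $\operatorname{gr}H$ (with respect to the coradical filtration) is isomorphic to $A$. Then $H$ is isomorphic, as a Hopf algebra, to $Q(\epsilon_1,\tau)$, where either $\epsilon_1=0$ and $\tau\in\{0,1\}$ (two classes), or $\epsilon_1=1$ and $\tau\in k$ (one infinite family). Conversely, for each such choice of parameters, $Q(\epsilon_1,\tau)$ is a pointed Hopf algebra of dimension $8$ whose associated graded Hopf algebra is $A$.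
   Context: A Hopf algebra $H$ is pointed if its coradical $H_0$ (the sum of all simple subcoalgebras) is the group algebra of its group $G(H)$ of grouplike elements. The coradical filtration is $H_0\subseteq H_1\subseteq\cdots$ with $H_n=\Delta^{-1}(H\otimes H_{n-1}+H_0\otimes H)$, and $\operatorname{gr}H=\bigoplus_{n\ge0}H_n/H_{n-1}$ (with $H_{-1}=0$), a graded Hopf algebra when $H$ is pointed. Counits are given by $\varepsilon(g)=1$ and $\varepsilon=0$ on the other generators; antipodes are then determined. *)

theory Defs
  imports
    "HOL-Algebra.QuotRing"
    "HOL-Algebra.Module"
    "HOL-Algebra.Algebraic_Closure_Type"
    "HOL-Library.Poly_Mapping"
begin

section \<open>Vector spaces and algebras over a field type\<close>

text \<open>
  The base field is a type \<open>'k\<close> of class field.  Vector spaces are modules (in the sense of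
  HOL-Algebra) over the ring record of that type; the record type \<open>module\<close> also has slots for
  a multiplication and a unit, which are junk for objects that are only vector spaces.
\<close>

abbreviation base_ring :: "'k::field ring" where
  "base_ring \<equiv> ring_of_type_algebra"

definition lin_span :: "('k::field, 'a, 'm) module_scheme \<Rightarrow> 'a set \<Rightarrow> 'a set" where
  "lin_span M S = \<Inter>{N. submodule N base_ring M \<and> S \<subseteq> N}"

definition is_basis :: "('k::field, 'a, 'm) module_scheme \<Rightarrow> 'a set \<Rightarrow> bool" where
  "is_basis M B \<longleftrightarrow> finite B \<and> B \<subseteq> carrier M \<and>
     (\<forall>x\<in>carrier M. \<exists>!c. c \<in> B \<rightarrow>\<^sub>E UNIV \<and> x = (\<Oplus>\<^bsub>M\<^esub>b\<in>B. c b \<odot>\<^bsub>M\<^esub> b))"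

definition has_dimension :: "('k::field, 'a, 'm) module_scheme \<Rightarrow> nat \<Rightarrow> bool" where
  "has_dimension M n \<longleftrightarrow> (\<exists>B. is_basis M B \<and> card B = n)"

definition linear_map ::
    "('k::field, 'a, 'm) module_scheme \<Rightarrow> ('k, 'b, 'n) module_scheme \<Rightarrow> ('a \<Rightarrow> 'b) \<Rightarrow> bool" where
  "linear_map M N f \<longleftrightarrow> f \<in> carrier M \<rightarrow> carrier N \<and>
     (\<forall>x\<in>carrier M. \<forall>y\<in>carrier M. f (x \<oplus>\<^bsub>M\<^esub> y) = f x \<oplus>\<^bsub>N\<^esub> f y) \<and>
     (\<forall>c. \<forall>x\<in>carrier M. f (c \<odot>\<^bsub>M\<^esub> x) = c \<odot>\<^bsub>N\<^esub> f x)"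

text \<open>Unlike the locale \<open>algebra\<close> of HOL-Algebra, the multiplication need not commute.\<close>

locale k_algebra = ring M + module base_ring M
  for M :: "('k::field, 'a, 'm) module_scheme" (structure) +
  assumes smult_mult_left:
    "\<lbrakk>x \<in> carrier M; y \<in> carrier M\<rbrakk> \<Longrightarrow> (c \<odot> x) \<otimes> y = c \<odot> (x \<otimes> y)"
  and smult_mult_right:
    "\<lbrakk>x \<in> carrier M; y \<in> carrier M\<rbrakk> \<Longrightarrow> x \<otimes> (c \<odot> y) = c \<odot> (x \<otimes> y)"

text \<open>
  Quotient by a subspace (the multiplication is meaningful if the subspace is a two-sided ideal).
\<close>

definition quot :: "('k::field, 'a, 'm) module_scheme \<Rightarrow> 'a set \<Rightarrow> ('k, 'a set) module" where
  "quot M N =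
     \<lparr>carrier = carrier (M Quot N),
      monoid.mult = monoid.mult (M Quot N),
      one = one (M Quot N),
      ring.zero = ring.zero (M Quot N),
      add = add (M Quot N),
      Module.module.smult = (\<lambda>c Z. \<Union>x\<in>Z. N +>\<^bsub>M\<^esub> (c \<odot>\<^bsub>M\<^esub> x))\<rparr>"

definition list_sum :: "('a, 'm) ring_scheme \<Rightarrow> 'a list \<Rightarrow> 'a" where
  "list_sum M xs = foldr (\<lambda>x s. x \<oplus>\<^bsub>M\<^esub> s) xs \<zero>\<^bsub>M\<^esub>"


section \<open>Tensor products\<close>

text \<open>
  The tensor product is the quotient of the space of formal linear combinations of pairs by the
  span of the bilinearity relations; its elements are cosets.
\<close>

type_synonym ('k, 'a, 'b) tensor = "('a \<times> 'b \<Rightarrow>\<^sub>0 'k) set"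

definition formal_pairs ::
    "('k::field, 'a, 'm) module_scheme \<Rightarrow> ('k, 'b, 'n) module_scheme \<Rightarrow>
     ('k, 'a \<times> 'b \<Rightarrow>\<^sub>0 'k) module" where
  "formal_pairs M N =
     \<lparr>carrier = {p. Poly_Mapping.keys p \<subseteq> carrier M \<times> carrier N},
      monoid.mult = undefined, one = undefined,
      ring.zero = 0, add = (+),
      Module.module.smult = (\<lambda>c. Poly_Mapping.map ((*) c))\<rparr>"

definition bilinearity_relations ::
    "('k::field, 'a, 'm) module_scheme \<Rightarrow> ('k, 'b, 'n) module_scheme \<Rightarrow> ('k, 'a, 'b) tensor" where
  "bilinearity_relations M N =
     {Poly_Mapping.single (x \<oplus>\<^bsub>M\<^esub> x', y) 1 - Poly_Mapping.single (x, y) 1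
        - Poly_Mapping.single (x', y) 1 |
        x x' y. x \<in> carrier M \<and> x' \<in> carrier M \<and> y \<in> carrier N} \<union>
     {Poly_Mapping.single (x, y \<oplus>\<^bsub>N\<^esub> y') 1 - Poly_Mapping.single (x, y) 1
        - Poly_Mapping.single (x, y') 1 |
        x y y'. x \<in> carrier M \<and> y \<in> carrier N \<and> y' \<in> carrier N} \<union>
     {Poly_Mapping.single (c \<odot>\<^bsub>M\<^esub> x, y) 1 - Poly_Mapping.single (x, y) c |
        c x y. x \<in> carrier M \<and> y \<in> carrier N} \<union>
     {Poly_Mapping.single (x, c \<odot>\<^bsub>N\<^esub> y) 1 - Poly_Mapping.single (x, y) c |
        c x y. x \<in> carrier M \<and> y \<in> carrier N}"

definition tensor_relations ::
    "('k::field, 'a, 'm) module_scheme \<Rightarrow> ('k, 'b, 'n) module_scheme \<Rightarrow> ('k, 'a, 'b) tensor" where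
  "tensor_relations M N = lin_span (formal_pairs M N) (bilinearity_relations M N)"

definition tensor_space ::
    "('k::field, 'a, 'm) module_scheme \<Rightarrow> ('k, 'b, 'n) module_scheme \<Rightarrow>
     ('k, ('k, 'a, 'b) tensor) module" where
  "tensor_space M N = quot (formal_pairs M N) (tensor_relations M N)"

definition pure_tensor ::
    "('k::field, 'a, 'm) module_scheme \<Rightarrow> ('k, 'b, 'n) module_scheme \<Rightarrow>
     'a \<Rightarrow> 'b \<Rightarrow> ('k, 'a, 'b) tensor" where
  "pure_tensor M N x y =
     tensor_relations M N +>\<^bsub>formal_pairs M N\<^esub> Poly_Mapping.single (x, y) 1"

text \<open>
  The linear map into \<open>W\<close> induced by a bilinear map \<open>\<beta>\<close>.  For bilinear \<open>\<beta>\<close> the value does not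
  depend on the chosen representative.
\<close>

definition tensor_lift ::
    "('k::field, 'c, 'l) module_scheme \<Rightarrow> ('a \<Rightarrow> 'b \<Rightarrow> 'c) \<Rightarrow> ('k, 'a, 'b) tensor \<Rightarrow> 'c" where
  "tensor_lift W \<beta> t =
     (let p = (SOME p. p \<in> t) in
      \<Oplus>\<^bsub>W\<^esub>z\<in>Poly_Mapping.keys p. Poly_Mapping.lookup p z \<odot>\<^bsub>W\<^esub> \<beta> (fst z) (snd z))"

text \<open>The tensor product of two algebras, with \<open>(u \<otimes> v) (u' \<otimes> v') = u u' \<otimes> v v'\<close>.\<close>

definition tensor_alg ::
    "('k::field, 'a, 'm) module_scheme \<Rightarrow> ('k, 'b, 'n) module_scheme \<Rightarrow>
     ('k, ('k, 'a, 'b) tensor) module" where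
  "tensor_alg M N = (tensor_space M N)
     \<lparr>monoid.mult := (\<lambda>s t.
        tensor_lift (tensor_space M N) (\<lambda>u v.
          tensor_lift (tensor_space M N) (\<lambda>u' v'.
            pure_tensor M N (u \<otimes>\<^bsub>M\<^esub> u') (v \<otimes>\<^bsub>N\<^esub> v')) t) s),
      one := pure_tensor M N \<one>\<^bsub>M\<^esub> \<one>\<^bsub>N\<^esub>\<rparr>"

definition tensor_map ::
    "('k::field, 'c, 'm) module_scheme \<Rightarrow> ('k, 'd, 'n) module_scheme \<Rightarrow>
     ('a \<Rightarrow> 'c) \<Rightarrow> ('b \<Rightarrow> 'd) \<Rightarrow> ('k, 'a, 'b) tensor \<Rightarrow> ('k, 'c, 'd) tensor" where
  "tensor_map M N f g =
     tensor_lift (tensor_space M N) (\<lambda>u v. pure_tensor M N (f u) (g v))"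

text \<open>The canonical map from \<open>(M \<otimes> M) \<otimes> M\<close> to \<open>M \<otimes> (M \<otimes> M)\<close>.\<close>

definition tensor_assoc ::
    "('k::field, 'a, 'm) module_scheme \<Rightarrow>
     ('k, ('k, 'a, 'a) tensor, 'a) tensor \<Rightarrow> ('k, 'a, ('k, 'a, 'a) tensor) tensor" where
  "tensor_assoc M =
     (let MM = tensor_space M M; T = tensor_space M MM in
      tensor_lift T (\<lambda>t w.
        tensor_lift T (\<lambda>u v. pure_tensor M MM u (pure_tensor M M v w)) t))"

text \<open>The image of \<open>U \<otimes> V\<close> in \<open>M \<otimes> M\<close>, for subspaces \<open>U\<close> and \<open>V\<close> of \<open>M\<close>.\<close>

definition tensor_sub ::
    "('k::field, 'a, 'm) module_scheme \<Rightarrow> 'a set \<Rightarrow> 'a set \<Rightarrow> ('k, 'a, 'a) tensor set" where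
  "tensor_sub M U V = lin_span (tensor_space M M) {pure_tensor M M u v | u v. u \<in> U \<and> v \<in> V}"


section \<open>Hopf algebras\<close>

record (overloaded) ('k, 'a) bialg = "('k, 'a) module" +
  comul :: "'a \<Rightarrow> ('a \<times> 'a \<Rightarrow>\<^sub>0 'k) set"
  counit :: "'a \<Rightarrow> 'k"

locale k_coalgebra = module base_ring H
  for H :: "('k::field, 'a, 'm) bialg_scheme" (structure) +
  assumes comul_linear: "linear_map H (tensor_space H H) (comul H)"
  and counit_add:
    "\<lbrakk>x \<in> carrier H; y \<in> carrier H\<rbrakk> \<Longrightarrow> counit H (x \<oplus> y) = counit H x + counit H y"
  and counit_smult: "x \<in> carrier H \<Longrightarrow> counit H (c \<odot> x) = c * counit H x"
  and coassoc: "x \<in> carrier H \<Longrightarrow>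
    tensor_assoc H (tensor_map (tensor_space H H) H (comul H) (\<lambda>v. v) (comul H x)) =
    tensor_map H (tensor_space H H) (\<lambda>u. u) (comul H) (comul H x)"
  and counit_left: "x \<in> carrier H \<Longrightarrow> tensor_lift H (\<lambda>u v. counit H u \<odot> v) (comul H x) = x"
  and counit_right: "x \<in> carrier H \<Longrightarrow> tensor_lift H (\<lambda>u v. counit H v \<odot> u) (comul H x) = x"

locale k_bialgebra = k_algebra H + k_coalgebra H
  for H :: "('k::field, 'a, 'm) bialg_scheme" (structure) +
  assumes comul_hom: "comul H \<in> ring_hom H (tensor_alg H H)"
  and counit_hom: "counit H \<in> ring_hom H base_ring"

definition is_antipode :: "('k::field, 'a, 'm) bialg_scheme \<Rightarrow> ('a \<Rightarrow> 'a) \<Rightarrow> bool" where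
  "is_antipode H S \<longleftrightarrow> linear_map H H S \<and>
     (\<forall>x\<in>carrier H.
        tensor_lift H (\<lambda>u v. S u \<otimes>\<^bsub>H\<^esub> v) (comul H x) = counit H x \<odot>\<^bsub>H\<^esub> \<one>\<^bsub>H\<^esub> \<and>
        tensor_lift H (\<lambda>u v. u \<otimes>\<^bsub>H\<^esub> S v) (comul H x) = counit H x \<odot>\<^bsub>H\<^esub> \<one>\<^bsub>H\<^esub>)"

text \<open>
  An antipode is unique if it exists, and bialgebra homomorphisms commute with antipodes; so the
  antipode is a property here, and isomorphisms of Hopf algebras are those of bialgebras.
\<close>

locale hopf_algebra = k_bialgebra +
  assumes antipode_exists: "\<exists>S. is_antipode H S"

definition hopf_iso ::
    "('k::field, 'a, 'm) bialg_scheme \<Rightarrow> ('k, 'b, 'n) bialg_scheme \<Rightarrow> ('a \<Rightarrow> 'b) set" where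
  "hopf_iso H K = {f. f \<in> ring_iso H K \<and> linear_map H K f \<and>
     (\<forall>x\<in>carrier H. comul K (f x) = tensor_map K K f f (comul H x)) \<and>
     (\<forall>x\<in>carrier H. counit K (f x) = counit H x)}"

definition hopf_isomorphic ::
    "('k::field, 'a, 'm) bialg_scheme \<Rightarrow> ('k, 'b, 'n) bialg_scheme \<Rightarrow> bool" where
  "hopf_isomorphic H K \<longleftrightarrow> hopf_iso H K \<noteq> {}"


section \<open>Pointedness and the coradical filtration\<close>

definition grouplikes :: "('k::field, 'a, 'm) bialg_scheme \<Rightarrow> 'a set" where
  "grouplikes H = {g \<in> carrier H. comul H g = pure_tensor H H g g \<and> counit H g = 1}"

definition subcoalgebra :: "('k::field, 'a, 'm) bialg_scheme \<Rightarrow> 'a set \<Rightarrow> bool" where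
  "subcoalgebra H D \<longleftrightarrow> submodule D base_ring H \<and> comul H ` D \<subseteq> tensor_sub H D D"

definition simple_subcoalgebra :: "('k::field, 'a, 'm) bialg_scheme \<Rightarrow> 'a set \<Rightarrow> bool" where
  "simple_subcoalgebra H D \<longleftrightarrow> subcoalgebra H D \<and> D \<noteq> {\<zero>\<^bsub>H\<^esub>} \<and>
     (\<forall>E. subcoalgebra H E \<and> E \<subseteq> D \<longrightarrow> E = {\<zero>\<^bsub>H\<^esub>} \<or> E = D)"

definition coradical :: "('k::field, 'a, 'm) bialg_scheme \<Rightarrow> 'a set" where
  "coradical H = lin_span H (\<Union>{D. simple_subcoalgebra H D})"

definition pointed :: "('k::field, 'a, 'm) bialg_scheme \<Rightarrow> bool" where
  "pointed H \<longleftrightarrow> coradical H = lin_span H (grouplikes H)"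

primrec coradical_filtration :: "('k::field, 'a, 'm) bialg_scheme \<Rightarrow> nat \<Rightarrow> 'a set" where
  "coradical_filtration H 0 = coradical H"
| "coradical_filtration H (Suc n) =
     {x \<in> carrier H. comul H x \<in>
        tensor_sub H (carrier H) (coradical_filtration H n)
        <+>\<^bsub>tensor_space H H\<^esub> tensor_sub H (coradical H) (carrier H)}"

text \<open>\<open>previous_filtration H n\<close> is the (n-1)-st term, with the convention that term -1 is 0.\<close>

definition previous_filtration :: "('k::field, 'a, 'm) bialg_scheme \<Rightarrow> nat \<Rightarrow> 'a set" where
  "previous_filtration H n =
     (case n of 0 \<Rightarrow> {\<zero>\<^bsub>H\<^esub>} | Suc m \<Rightarrow> coradical_filtration H m)"


section \<open>The associated graded Hopf algebra\<close>

definition gr_piece :: "('k::field, 'a, 'm) bialg_scheme \<Rightarrow> nat \<Rightarrow> ('k, 'a set) module" where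
  "gr_piece H n = quot (H\<lparr>carrier := coradical_filtration H n\<rparr>) (previous_filtration H n)"

text \<open>The class of an element \<open>x\<close> of the n-th filtration term, placed in degree n.\<close>

definition gr_class :: "('k::field, 'a, 'm) bialg_scheme \<Rightarrow> nat \<Rightarrow> 'a \<Rightarrow> nat \<Rightarrow> 'a set" where
  "gr_class H n x =
     (\<lambda>m. if m = n then previous_filtration H n +>\<^bsub>H\<^esub> x else \<zero>\<^bsub>gr_piece H m\<^esub>)"

text \<open>
  The direct sum of the pieces, as finitely supported families, with the product
  \<open>[x] [y] = [x y]\<close> of \<open>[x]\<close> in degree i and \<open>[y]\<close> in degree j placed in degree i + j.
\<close>

definition gr_alg :: "('k::field, 'a, 'm) bialg_scheme \<Rightarrow> ('k, nat \<Rightarrow> 'a set) module" where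
  "gr_alg H =
     \<lparr>carrier = {f. (\<forall>n. f n \<in> carrier (gr_piece H n)) \<and>
                    finite {n. f n \<noteq> \<zero>\<^bsub>gr_piece H n\<^esub>}},
      monoid.mult = (\<lambda>f h n. \<Oplus>\<^bsub>gr_piece H n\<^esub>i\<in>{..n}.
        (\<Union>x\<in>f i. \<Union>y\<in>h (n - i). previous_filtration H n +>\<^bsub>H\<^esub> (x \<otimes>\<^bsub>H\<^esub> y))),
      one = gr_class H 0 \<one>\<^bsub>H\<^esub>,
      ring.zero = (\<lambda>n. \<zero>\<^bsub>gr_piece H n\<^esub>),
      add = (\<lambda>f h n. f n \<oplus>\<^bsub>gr_piece H n\<^esub> h n),
      Module.module.smult = (\<lambda>c f n. c \<odot>\<^bsub>gr_piece H n\<^esub> f n)\<rparr>"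

text \<open>
  The comultiplication of the class of \<open>x\<close> in degree n: write \<open>\<Delta>(x)\<close> as a finite sum of pure
  tensors \<open>u \<otimes> v\<close>, with \<open>u\<close> in the i-th and \<open>v\<close> in the (n-i)-th filtration term, and replace each
  \<open>u\<close> and \<open>v\<close> by its class in degree i and n-i.  Such a sum exists because the coradical
  filtration is a coalgebra filtration, and the result does not depend on it.
\<close>

definition gr_comul ::
    "('k::field, 'a, 'm) bialg_scheme \<Rightarrow> nat \<Rightarrow> 'a \<Rightarrow>
     ('k, nat \<Rightarrow> 'a set, nat \<Rightarrow> 'a set) tensor" where
  "gr_comul H n x = (THE t. \<exists>ts.
     (\<forall>(i, u, v) \<in> set ts. i \<le> n \<and> u \<in> coradical_filtration H i \<and>
        v \<in> coradical_filtration H (n - i)) \<and>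
     comul H x = list_sum (tensor_space H H) (map (\<lambda>(i, u, v). pure_tensor H H u v) ts) \<and>
     t = list_sum (tensor_space (gr_alg H) (gr_alg H))
           (map (\<lambda>(i, u, v). pure_tensor (gr_alg H) (gr_alg H)
              (gr_class H i u) (gr_class H (n - i) v)) ts))"

definition gr :: "('k::field, 'a, 'm) bialg_scheme \<Rightarrow> ('k, nat \<Rightarrow> 'a set) bialg" where
  "gr H = module.extend (gr_alg H)
     \<lparr>comul = (\<lambda>f. \<Oplus>\<^bsub>tensor_space (gr_alg H) (gr_alg H)\<^esub>n\<in>{n. f n \<noteq> \<zero>\<^bsub>gr_piece H n\<^esub>}.
        gr_comul H n (SOME x. x \<in> f n)),
      counit = (\<lambda>f. counit H (SOME x. x \<in> f 0))\<rparr>"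

definition gr_component ::
    "('k::field, 'a, 'm) bialg_scheme \<Rightarrow> nat \<Rightarrow> (nat \<Rightarrow> 'a set) set" where
  "gr_component H n = {f \<in> carrier (gr H). \<forall>m. m \<noteq> n \<longrightarrow> f m = \<zero>\<^bsub>gr_piece H m\<^esub>}"


section \<open>Hopf algebras given by generators and relations\<close>

text \<open>
  The free algebra is the monoid algebra (type \<open>poly_mapping\<close>) of the free monoid, which is the
  type of lists wrapped up so that \<open>+\<close> is concatenation.
\<close>

datatype 'i fword = FWord (letters: "'i list")

instantiation fword :: (type) monoid_add
begin

definition "0 = FWord []"

definition "v + w = FWord (letters v @ letters w)"

instance
  by standard (simp_all add: zero_fword_def plus_fword_def)

end

type_synonym ('k, 'i) free_algebra = "'i fword \<Rightarrow>\<^sub>0 'k"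

definition gen :: "'i \<Rightarrow> ('k::field, 'i) free_algebra" where
  "gen i = Poly_Mapping.single (FWord [i]) 1"

definition scal :: "'k::field \<Rightarrow> ('k, 'i) free_algebra" where
  "scal c = Poly_Mapping.single 0 c"

definition free_alg :: "('k::field, ('k, 'i) free_algebra) module" where
  "free_alg = ring.extend ring_of_type_algebra \<lparr>Module.module.smult = (\<lambda>c p. scal c * p)\<rparr>"

definition presented_alg ::
    "('k::field, 'i) free_algebra set \<Rightarrow> ('k, ('k, 'i) free_algebra set) module" where
  "presented_alg R = quot free_alg (Idl\<^bsub>free_alg\<^esub> R)"

definition presented_class ::
    "('k::field, 'i) free_algebra set \<Rightarrow> ('k, 'i) free_algebra \<Rightarrow> ('k, 'i) free_algebra set" where
  "presented_class R p = (Idl\<^bsub>free_alg\<^esub> R) +>\<^bsub>free_alg\<^esub> p"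

text \<open>The algebra homomorphism from the free algebra to \<open>B\<close> that maps generator \<open>i\<close> to \<open>f i\<close>.\<close>

definition free_lift ::
    "('k::field, 'b, 'n) module_scheme \<Rightarrow> ('i \<Rightarrow> 'b) \<Rightarrow> ('k, 'i) free_algebra \<Rightarrow> 'b" where
  "free_lift B f p = (\<Oplus>\<^bsub>B\<^esub>w\<in>Poly_Mapping.keys p. Poly_Mapping.lookup p w \<odot>\<^bsub>B\<^esub>
     foldr (\<lambda>i b. f i \<otimes>\<^bsub>B\<^esub> b) (letters w) \<one>\<^bsub>B\<^esub>)"

definition base_alg :: "('k::field, 'k) module" where
  "base_alg = ring.extend ring_of_type_algebra \<lparr>Module.module.smult = (*)\<rparr>"

text \<open>
  Generators and relations \<open>R\<close>, the comultiplication and counit being the algebra homomorphisms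
  with the prescribed values on generators: \<open>\<Delta>(i)\<close> is the sum of \<open>p \<otimes> q\<close> over the list \<open>\<delta> i\<close> of
  pairs \<open>(p, q)\<close>, and \<open>\<epsilon>(i) = e i\<close>.  They are evaluated on a representative; this makes sense
  when they vanish on \<open>R\<close>.
\<close>

definition presented_bialg ::
    "('k::field, 'i) free_algebra set \<Rightarrow>
     ('i \<Rightarrow> (('k, 'i) free_algebra \<times> ('k, 'i) free_algebra) list) \<Rightarrow> ('i \<Rightarrow> 'k) \<Rightarrow>
     ('k, ('k, 'i) free_algebra set) bialg" where
  "presented_bialg R \<delta> e =
     (let P = presented_alg R; PP = tensor_alg P P in
      module.extend P
       \<lparr>comul = (\<lambda>Z. free_lift PP
          (\<lambda>i. list_sum PP (map (\<lambda>(p, q).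
             pure_tensor P P (presented_class R p) (presented_class R q)) (\<delta> i)))
          (SOME p. p \<in> Z)),
        counit = (\<lambda>Z. free_lift base_alg e (SOME p. p \<in> Z))\<rparr>)"


section \<open>The graded Hopf algebra A\<close>

datatype A_gen = A_a | A_b | A_g

definition A_relations :: "('k::field, A_gen) free_algebra set" where
  "A_relations =
     (let a = gen A_a; b = gen A_b; g = gen A_g in
      {g\<^sup>2 - 1, a\<^sup>2, b\<^sup>2, a * b - b * a, g * a - a * g, g * b - b * g})"

fun A_delta ::
    "A_gen \<Rightarrow> (('k::field, A_gen) free_algebra \<times> ('k, A_gen) free_algebra) list" where
  "A_delta A_g = [(gen A_g, gen A_g)]"
| "A_delta A_a = [(gen A_a, 1), (gen A_g, gen A_a)]"
| "A_delta A_b = [(gen A_b, 1), (1, gen A_b), (gen A_a * gen A_g, gen A_a)]"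

fun A_counit :: "A_gen \<Rightarrow> 'k::field" where
  "A_counit A_g = 1"
| "A_counit A_a = 0"
| "A_counit A_b = 0"

definition A_alg :: "('k::field, ('k, A_gen) free_algebra set) bialg" where
  "A_alg = presented_bialg A_relations A_delta A_counit"

text \<open>
  The grading: \<open>g\<close> is in degree 0 and \<open>a\<close> in degree 1, so that \<open>b\<close> has to be in degree 2 for \<open>\<Delta>\<close>
  to be homogeneous.
\<close>

fun A_degree :: "A_gen \<Rightarrow> nat" where
  "A_degree A_g = 0"
| "A_degree A_a = 1"
| "A_degree A_b = 2"

definition A_component :: "nat \<Rightarrow> ('k::field, A_gen) free_algebra set set" where
  "A_component n = lin_span (A_alg :: ('k, _) bialg)
     {presented_class A_relations (Poly_Mapping.single w 1) | w.
        sum_list (map A_degree (letters w)) = n}"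

definition graded_iso_to_A :: "('k::field, 'a, 'm) bialg_scheme \<Rightarrow> bool" where
  "graded_iso_to_A H \<longleftrightarrow>
     (\<exists>f \<in> hopf_iso (gr H) A_alg. \<forall>n. f ` gr_component H n = A_component n)"


section \<open>The Hopf algebras Q\<close>

datatype Q_gen = Q_g | Q_x | Q_y

definition Q_relations :: "'k::field \<Rightarrow> 'k \<Rightarrow> ('k, Q_gen) free_algebra set" where
  "Q_relations \<epsilon> \<tau> =
     (let g = gen Q_g; x = gen Q_x; y = gen Q_y in
      {g\<^sup>2 - 1,
       (g * x - x * g) - scal \<epsilon> * (g - 1),
       (g * y - y * g) - scal \<epsilon> * (1 + g + x + x * g),
       (x * y - y * x) - scal \<tau> * (1 - g),
       x\<^sup>2 - scal \<epsilon> * x,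
       y\<^sup>2 - (scal \<epsilon> * y + scal \<tau> * (x + x * g))})"

fun Q_delta ::
    "Q_gen \<Rightarrow> (('k::field, Q_gen) free_algebra \<times> ('k, Q_gen) free_algebra) list" where
  "Q_delta Q_g = [(gen Q_g, gen Q_g)]"
| "Q_delta Q_x = [(gen Q_x, 1), (gen Q_g, gen Q_x)]"
| "Q_delta Q_y = [(gen Q_y, 1), (1, gen Q_y), (gen Q_x * gen Q_g, gen Q_x)]"

fun Q_counit :: "Q_gen \<Rightarrow> 'k::field" where
  "Q_counit Q_g = 1"
| "Q_counit Q_x = 0"
| "Q_counit Q_y = 0"

definition Q_alg :: "'k::field \<Rightarrow> 'k \<Rightarrow> ('k, ('k, Q_gen) free_algebra set) bialg" where
  "Q_alg \<epsilon> \<tau> = presented_bialg (Q_relations \<epsilon> \<tau>) Q_delta Q_counit"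

definition Q_parameters :: "('k::field \<times> 'k) set" where
  "Q_parameters = {0} \<times> {0, 1} \<union> {1} \<times> UNIV"

end

theory Submission
 imports Defs
begin

text \<open>
 Linear functionals replace tensors throughout: on a finite dimensional space a tensor is determined by
 its evaluations at pairs of functionals, so a comultiplication is the same thing as the convolution of
 functionals, and the coradical filtration is described by convolutions of annihilators.

 The algebra \<open>Q\<close> has the eight monomials \<open>g\<^sup>i x\<^sup>j y\<^sup>k\<close> as a basis, by an explicit regular representation;
 in top degree its structure constants do not depend on the parameters, which gives the associated
 graded algebra. Conversely, the generators of \<open>gr H\<close> are lifted to \<open>H\<close>: the failure of a lift to have the
 prescribed comultiplication is a cocycle on the first filtration term, and the relations hold up to
 primitive or skew-primitive elements, of which there are few. Associativity kills the remaining
 parameter, and scaling the generators normalizes \<open>\<epsilon>\<close> and, for \<open>\<epsilon> = 0\<close>, also \<open>\<tau>\<close>.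
\<close>

section \<open>Vector spaces and their quotients\<close>

text \<open>Elements of a tensor product are cosets of formal sums and cannot be compared by
  computation; evaluation at pairs of functionals turns an identity of tensors into one of scalars,
  which normalization in characteristic two settles. Writing
  \<open>\<epsilon> * \<epsilon> = \<epsilon>\<close> instead of \<epsilon> = 0 or \<epsilon> = 1
  lets one computation serve both values.

  The obstacle to the converse is that the isomorphism of \<open>gr H\<close> with A is not assumed
  to be graded. Degrees have to be recovered from the comultiplication: the preimages of 1, g, a, g
  a and b have degree at most 0, 0, 1, 1 and 2, since a group-like element lives in degree 0 and the
  coradical filtration is defined by wedges. Only the top components are lifted to \<open>H\<close>,
  so the lifts are at first controlled only modulo lower terms. Once all relations hold in
  \<open>H\<close>, the map from Q to \<open>H\<close> is injective because suitable convolutions of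
  functionals detect the eight monomials, and dimension 8 makes it bijective.\<close>

abbreviation vspace :: "('k::field, 'a, 'm) module_scheme \<Rightarrow> bool" where
 "vspace M \<equiv> module base_ring M"

lemma base_ring_simps [simp]:
 "carrier (base_ring :: 'k::field ring) = UNIV"
 "monoid.mult (base_ring :: 'k ring) = (*)"
 "one (base_ring :: 'k ring) = 1"
 "ring.zero (base_ring :: 'k ring) = 0"
 "add (base_ring :: 'k ring) = (+)"
 by (auto simp: ring_of_type_algebra_def)

lemma cring_base_ring: "cring (base_ring :: 'k::field ring)"
 by (rule cring_from_type_algebra)

lemma vspaceI:
 fixes M :: "('k::field, 'a, 'm) module_scheme" (structure)
 assumes "abelian_group M"
  and "\<And>c x. x \<in> carrier M \<Longrightarrow> c \<odot> x \<in> carrier M"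
  and "\<And>c d x. x \<in> carrier M \<Longrightarrow> (c + d) \<odot> x = c \<odot> x \<oplus> d \<odot> x"
  and "\<And>c x y. x \<in> carrier M \<Longrightarrow> y \<in> carrier M \<Longrightarrow>
      c \<odot> (x \<oplus> y) = c \<odot> x \<oplus> c \<odot> y"
  and "\<And>c d x. x \<in> carrier M \<Longrightarrow> (c * d) \<odot> x = c \<odot> (d \<odot> x)"
  and "\<And>x. x \<in> carrier M \<Longrightarrow> 1 \<odot> x = x"
 shows "vspace M"
 using assms by (intro moduleI cring_base_ring) auto

lemma
 fixes M (structure)
 assumes "vspace M"
 shows vs_smult: "x \<in> carrier M \<Longrightarrow> c \<odot> x \<in> carrier M"
  and vs_add: "x \<in> carrier M \<Longrightarrow> y \<in> carrier M \<Longrightarrow> x \<oplus> y \<in> carrier M"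
  and vs_zero: "\<zero> \<in> carrier M"
  and vs_smult_l_distr: "x \<in> carrier M \<Longrightarrow> (c + d) \<odot> x = c \<odot> x \<oplus> d \<odot> x"
  and vs_smult_r_distr: "x \<in> carrier M \<Longrightarrow> y \<in> carrier M \<Longrightarrow>
      c \<odot> (x \<oplus> y) = c \<odot> x \<oplus> c \<odot> y"
  and vs_smult_assoc: "x \<in> carrier M \<Longrightarrow> (c * d) \<odot> x = c \<odot> (d \<odot> x)"
  and vs_smult_one: "x \<in> carrier M \<Longrightarrow> 1 \<odot> x = x"
  and vs_smult_zero: "x \<in> carrier M \<Longrightarrow> 0 \<odot> x = \<zero>"
  and vs_smult_minus: "x \<in> carrier M \<Longrightarrow> (-1) \<odot> x = \<ominus> x"
  and vs_smult_r_null: "c \<odot> \<zero> = \<zero>"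
  and vs_l_zero: "x \<in> carrier M \<Longrightarrow> \<zero> \<oplus> x = x"
  and vs_r_zero: "x \<in> carrier M \<Longrightarrow> x \<oplus> \<zero> = x"
  and vs_finsum: "f \<in> A \<rightarrow> carrier M \<Longrightarrow> finsum M f A \<in> carrier M"
proof -
 interpret module base_ring M by fact
 show "x \<in> carrier M \<Longrightarrow> c \<odot> x \<in> carrier M"
  "x \<in> carrier M \<Longrightarrow> y \<in> carrier M \<Longrightarrow> x \<oplus> y \<in> carrier M"
  "\<zero> \<in> carrier M"
  "x \<in> carrier M \<Longrightarrow> \<zero> \<oplus> x = x"
  "x \<in> carrier M \<Longrightarrow> x \<oplus> \<zero> = x"
  "f \<in> A \<rightarrow> carrier M \<Longrightarrow> finsum M f A \<in> carrier M"
  by auto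
 show D: "x \<in> carrier M \<Longrightarrow> (c + d) \<odot> x = c \<odot> x \<oplus> d \<odot> x" for c d
  using smult_l_distr[of c d x] by simp
 show "x \<in> carrier M \<Longrightarrow> y \<in> carrier M \<Longrightarrow>
      c \<odot> (x \<oplus> y) = c \<odot> x \<oplus> c \<odot> y"
  using smult_r_distr[of c x y] by simp
 show "x \<in> carrier M \<Longrightarrow> (c * d) \<odot> x = c \<odot> (d \<odot> x)"
  using smult_assoc1[of c d x] by simp
 show one: "x \<in> carrier M \<Longrightarrow> 1 \<odot> x = x"
  using smult_one[of x] by simp
 show zero: "x \<in> carrier M \<Longrightarrow> 0 \<odot> x = \<zero>"
  using smult_l_null[of x] by simp
 show "c \<odot> \<zero> = \<zero>"
  using smult_r_null[of c] by simp
 assume x: "x \<in> carrier M"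
 have "(-1) \<odot> x \<oplus> x = \<zero>"
  using D[OF x, of "-1" 1] zero one x by simp
 then show "(-1) \<odot> x = \<ominus> x"
  using x by (intro M.minus_equality[symmetric]) auto
qed

lemma submoduleI':
 fixes M (structure)
 assumes "vspace M" "H \<subseteq> carrier M" "\<zero> \<in> H"
  "\<And>a b. a \<in> H \<Longrightarrow> b \<in> H \<Longrightarrow> a \<oplus> b \<in> H"
  "\<And>c x. x \<in> H \<Longrightarrow> c \<odot> x \<in> H"
 shows "submodule H base_ring M"
proof -
 interpret module base_ring M by fact
 show ?thesis
 proof (rule submoduleI)
  fix a assume "a \<in> H"
  then have "(-1) \<odot> a \<in> H" "a \<in> carrier M" using assms by auto
  then show "\<ominus> a \<in> H" by (simp add: vs_smult_minus[OF assms(1)])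
 qed (use assms in auto)
qed

lemma
 fixes M (structure)
 assumes "submodule N base_ring M"
 shows sub_subset: "N \<subseteq> carrier M"
  and sub_zero: "\<zero> \<in> N"
  and sub_add: "x \<in> N \<Longrightarrow> y \<in> N \<Longrightarrow> x \<oplus> y \<in> N"
  and sub_smult: "x \<in> N \<Longrightarrow> c \<odot> x \<in> N"
proof -
 interpret submodule N base_ring M by fact
 show "N \<subseteq> carrier M" "\<zero> \<in> N" "x \<in> N \<Longrightarrow> y \<in> N \<Longrightarrow> x \<oplus> y \<in> N"
  using subset one_closed m_closed by auto
 show "x \<in> N \<Longrightarrow> c \<odot> x \<in> N"
  using smult_closed[of c x] by simp
qed

lemma sub_minus:
 assumes "vspace M" "submodule N base_ring M" "x \<in> N" "y \<in> N"
 shows "x \<ominus>\<^bsub>M\<^esub> y \<in> N"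
proof -
 have "y \<in> carrier M" using assms sub_subset by auto
 then have "\<ominus>\<^bsub>M\<^esub> y \<in> N" using sub_smult[OF assms(2,4), of "-1"] vs_smult_minus[OF assms(1)] by simp
 then show ?thesis using sub_add[OF assms(2,3)] by (simp add: a_minus_def)
qed

lemma sub_finsum:
 assumes "vspace M" "submodule N base_ring M" "\<And>i. i \<in> A \<Longrightarrow> f i \<in> N"
 shows "finsum M f A \<in> N"
proof -
 interpret module base_ring M by fact
 show ?thesis
 proof (cases "finite A")
  case True
  then show ?thesis using assms(3)
  proof (induct A)
   case (insert a A)
   have "f \<in> insert a A \<rightarrow> carrier M" using insert sub_subset[OF assms(2)] by auto
   then have "finsum M f (insert a A) = f a \<oplus>\<^bsub>M\<^esub> finsum M f A"
    using insert by (intro M.finsum_insert) auto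
   then show ?case using insert sub_add[OF assms(2)] by auto
  qed (simp add: sub_zero[OF assms(2)])
 qed (simp add: sub_zero[OF assms(2)] M.finsum_infinite)
qed

lemma lin_span_least: "submodule N base_ring M \<Longrightarrow> S \<subseteq> N \<Longrightarrow> lin_span M S \<subseteq> N"
 unfolding lin_span_def by blast

lemma lin_span_superset: "S \<subseteq> lin_span M S"
 unfolding lin_span_def by blast

lemma submodule_lin_span:
 assumes "vspace M" "S \<subseteq> carrier M"
 shows "submodule (lin_span M S) base_ring M"
proof -
 have c: "submodule (carrier M) base_ring M" by (rule module.carrier_is_submodule[OF assms(1)])
 show ?thesis
 proof (rule submoduleI'[OF assms(1)])
  show "lin_span M S \<subseteq> carrier M" using lin_span_least[OF c assms(2)] .
 qed (auto simp: lin_span_def intro: sub_zero sub_add sub_smult)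
qed

lemma linear_mapD:
 assumes "linear_map M N f"
 shows "x \<in> carrier M \<Longrightarrow> f x \<in> carrier N"
  "x \<in> carrier M \<Longrightarrow> y \<in> carrier M \<Longrightarrow> f (x \<oplus>\<^bsub>M\<^esub> y) = f x \<oplus>\<^bsub>N\<^esub> f y"
  "x \<in> carrier M \<Longrightarrow> f (c \<odot>\<^bsub>M\<^esub> x) = c \<odot>\<^bsub>N\<^esub> f x"
 using assms unfolding linear_map_def by auto

lemma linear_mapI:
 assumes "\<And>x. x \<in> carrier M \<Longrightarrow> f x \<in> carrier N"
  "\<And>x y. x \<in> carrier M \<Longrightarrow> y \<in> carrier M \<Longrightarrow> f (x \<oplus>\<^bsub>M\<^esub> y) = f x \<oplus>\<^bsub>N\<^esub> f y"
  "\<And>c x. x \<in> carrier M \<Longrightarrow> f (c \<odot>\<^bsub>M\<^esub> x) = c \<odot>\<^bsub>N\<^esub> f x"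
 shows "linear_map M N f"
 using assms unfolding linear_map_def by auto

lemma linear_map_zero:
 assumes "vspace M" "vspace N" "linear_map M N f"
 shows "f \<zero>\<^bsub>M\<^esub> = \<zero>\<^bsub>N\<^esub>"
 using linear_mapD(3)[OF assms(3) vs_zero[OF assms(1)], of 0]
 by (simp add: vs_smult_zero assms vs_zero linear_mapD(1)[OF assms(3)])

lemma linear_map_finsum:
 assumes "vspace M" "vspace N" "linear_map M N f" "g \<in> A \<rightarrow> carrier M"
 shows "f (finsum M g A) = finsum N (\<lambda>i. f (g i)) A"
proof -
 interpret M: module base_ring M by fact
 interpret N: module base_ring N by fact
 show ?thesis
 proof (cases "finite A")
  case True
  then show ?thesis using assms(4)
  proof (induct A)
   case (insert a A)
   then have g: "g \<in> A \<rightarrow> carrier M" "g a \<in> carrier M" by auto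
   moreover have "(\<lambda>i. f (g i)) \<in> A \<rightarrow> carrier N" "f (g a) \<in> carrier N"
    using g linear_mapD(1)[OF assms(3)] by auto
   ultimately show ?case
    using insert by (simp add: M.M.finsum_insert N.M.finsum_insert linear_mapD[OF assms(3)])
  qed (simp add: linear_map_zero[OF assms(1-3)])
 qed (simp add: M.M.finsum_infinite N.M.finsum_infinite linear_map_zero[OF assms(1-3)])
qed

lemma linear_map_comp:
 assumes "linear_map M N f" "linear_map N W g"
 shows "linear_map M W (\<lambda>x. g (f x))"
 using assms unfolding linear_map_def by (auto simp: Pi_def)

lemma submodule_vimage:
 assumes "vspace M" "vspace N" "linear_map M N f" "submodule U base_ring N"
 shows "submodule {x \<in> carrier M. f x \<in> U} base_ring M"
 by (rule submoduleI'[OF assms(1)])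
  (auto simp: linear_mapD[OF assms(3)] vs_zero vs_add vs_smult assms(1)
   linear_map_zero[OF assms(1-3)] sub_zero[OF assms(4)] sub_add[OF assms(4)] sub_smult[OF assms(4)])

lemma coset_eq_iff:
 fixes M (structure)
 assumes "vspace M" "submodule N base_ring M" "x \<in> carrier M" "y \<in> carrier M"
 shows "N +> x = N +> y \<longleftrightarrow> x \<ominus> y \<in> N"
proof -
 interpret M: module base_ring M by fact
 interpret A: abelian_subgroup N M
  using assms(2) M.M.abelian_group_axioms
  by (intro abelian_subgroupI3 additive_subgroup.intro) (auto simp: submodule_def)
 show ?thesis
 proof
  assume "N +> x = N +> y"
  then have "x \<in> N +> y" using A.a_rcos_self[OF assms(3)] by simp
  then show "x \<ominus> y \<in> N" using A.a_rcos_module_minus M.M.abelian_group_axioms assms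
   by (metis A.a_rcos_module_imp a_minus_def)
 next
  assume "x \<ominus> y \<in> N"
  then have "x \<in> N +> y" using assms by (simp add: A.a_rcos_module_rev a_minus_def)
  then show "N +> x = N +> y" using A.a_repr_independence' assms by metis
 qed
qed

lemma mem_coset_iff:
 assumes "vspace M" "submodule N base_ring M" "x \<in> carrier M"
 shows "y \<in> N +>\<^bsub>M\<^esub> x \<longleftrightarrow> y \<in> carrier M \<and> y \<ominus>\<^bsub>M\<^esub> x \<in> N"
proof -
 interpret M: module base_ring M by fact
 interpret A: abelian_subgroup N M
  using assms(2) M.M.abelian_group_axioms
  by (intro abelian_subgroupI3 additive_subgroup.intro) (auto simp: submodule_def)
 show ?thesis
  using assms(3) A.a_rcos_module_imp A.a_rcos_module_rev A.a_elemrcos_carrier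
  by (metis a_minus_def)
qed

lemma quot_carrier:
 "carrier (quot M N) = {N +>\<^bsub>M\<^esub> x | x. x \<in> carrier M}"
 unfolding quot_def FactRing_def A_RCOSETS_defs a_r_coset_def r_coset_def by auto

lemma quot_carrierI: "x \<in> carrier M \<Longrightarrow> N +>\<^bsub>M\<^esub> x \<in> carrier (quot M N)"
 by (auto simp: quot_carrier)

lemma quot_carrierE:
 assumes "Z \<in> carrier (quot M N)"
 obtains x where "x \<in> carrier M" "Z = N +>\<^bsub>M\<^esub> x"
 using assms by (auto simp: quot_carrier)

lemma coset_self:
 assumes "vspace M" "submodule N base_ring M" "x \<in> carrier M"
 shows "x \<in> N +>\<^bsub>M\<^esub> x"
proof -
 interpret M: module base_ring M by fact
 show ?thesis using assms by (simp add: mem_coset_iff sub_zero M.M.minus_eq M.M.r_neg)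
qed

lemma quot_zero: "\<zero>\<^bsub>quot M N\<^esub> = N"
 by (simp add: quot_def FactRing_def)

lemma coset_zero:
 assumes "vspace M" "submodule N base_ring M"
 shows "N +>\<^bsub>M\<^esub> \<zero>\<^bsub>M\<^esub> = N"
proof -
 interpret M: module base_ring M by fact
 show ?thesis using sub_subset[OF assms(2)] by simp
qed

lemma quot_add:
 fixes M (structure)
 assumes "vspace M" "submodule N base_ring M" "x \<in> carrier M" "y \<in> carrier M"
 shows "(N +> x) \<oplus>\<^bsub>quot M N\<^esub> (N +> y) = N +> (x \<oplus> y)"
proof -
 interpret M: module base_ring M by fact
 interpret A: abelian_subgroup N M
  using assms(2) M.M.abelian_group_axioms
  by (intro abelian_subgroupI3 additive_subgroup.intro) (auto simp: submodule_def)
 show ?thesis using assms A.a_rcos_sum by (simp add: quot_def FactRing_def)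
qed

lemma quot_smult:
 fixes M (structure)
 assumes "vspace M" "submodule N base_ring M" "x \<in> carrier M"
 shows "c \<odot>\<^bsub>quot M N\<^esub> (N +> x) = N +> (c \<odot> x)"
proof -
 interpret M: module base_ring M by fact
 \<comment> \<open>Scalar multiplication in \<open>quot\<close> is a union over all representatives
   \<open>z\<close>; it is a coset because all members of the union coincide.\<close>
 have "N +> (c \<odot> z) = N +> (c \<odot> x)" if "z \<in> N +> x" for z
 proof -
  have z: "z \<in> carrier M" "z \<ominus> x \<in> N" using that assms by (auto simp: mem_coset_iff)
  have "c \<odot> z \<ominus> c \<odot> x = c \<odot> (z \<ominus> x)"
   using z assms M.smult_r_minus[of c x] M.smult_r_distr[of c z "\<ominus> x"]
   by (simp add: M.M.minus_eq)
  then show ?thesis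
   using z assms by (subst coset_eq_iff) (auto simp: sub_smult vs_smult)
 qed
 then have "(\<Union>z\<in>N +> x. N +> (c \<odot> z)) = N +> (c \<odot> x)"
  using coset_self[OF assms] by (intro SUP_eq_const) blast+
 then show ?thesis by (simp add: quot_def)
qed

lemma vspace_quot:
 fixes M (structure)
 assumes "vspace M" "submodule N base_ring M"
 shows "vspace (quot M N)"
proof -
 interpret M: module base_ring M by fact
 note [simp] = quot_add[OF assms] quot_smult[OF assms]
 have z: "\<zero>\<^bsub>quot M N\<^esub> = N +> \<zero>"
  by (simp add: quot_zero coset_zero[OF assms] del: M.a_coset_add_zero)
 have ag: "abelian_group (quot M N)"
 proof (rule abelian_groupI)
  fix Z assume "Z \<in> carrier (quot M N)"
  then obtain x where x: "x \<in> carrier M" "Z = N +> x" by (rule quot_carrierE)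
  have "(N +> (\<ominus> x)) \<oplus>\<^bsub>quot M N\<^esub> Z = \<zero>\<^bsub>quot M N\<^esub>"
   using x by (simp add: z M.M.l_neg del: M.a_coset_add_zero)
  moreover have "N +> (\<ominus> x) \<in> carrier (quot M N)"
   using x by (auto intro: quot_carrierI)
  ultimately show "\<exists>y\<in>carrier (quot M N). y \<oplus>\<^bsub>quot M N\<^esub> Z = \<zero>\<^bsub>quot M N\<^esub>" by blast
 qed (auto elim!: quot_carrierE simp: z M.M.a_ac quot_carrierI
    simp del: M.a_coset_add_zero)
 show ?thesis
  by (rule vspaceI[OF ag]) (auto elim!: quot_carrierE simp: quot_carrierI vs_smult[OF assms(1)]
    vs_smult_l_distr[OF assms(1)] vs_smult_r_distr[OF assms(1)] vs_smult_assoc[OF assms(1)] vs_smult_one[OF assms(1)])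
qed

lemma coset_linear:
 assumes "vspace M" "submodule N base_ring M"
 shows "linear_map M (quot M N) (\<lambda>x. N +>\<^bsub>M\<^esub> x)"
 by (rule linear_mapI) (auto simp: quot_carrierI quot_add[OF assms] quot_smult[OF assms])

section \<open>Formal linear combinations\<close>

text \<open>Linear extension of \<open>G\<close> to formal combinations. On a representative,
  \<open>tensor_lift\<close> is such a sum over pairs and \<open>free_lift\<close> one over words,
  so both inherit their linearity from here.\<close>

definition pm_sum :: "('k::field, 'c, 'l) module_scheme \<Rightarrow> ('z \<Rightarrow> 'c) \<Rightarrow> ('z \<Rightarrow>\<^sub>0 'k) \<Rightarrow> 'c" where
 "pm_sum W G p = (\<Oplus>\<^bsub>W\<^esub>z\<in>Poly_Mapping.keys p. Poly_Mapping.lookup p z \<odot>\<^bsub>W\<^esub> G z)"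

lemma pm_induct [consumes 1, case_names zero add]:
 fixes p :: "'z \<Rightarrow>\<^sub>0 'k::ab_group_add"
 assumes "Poly_Mapping.keys p \<subseteq> S" "P 0"
  and "\<And>x c q. x \<in> S \<Longrightarrow> Poly_Mapping.keys q \<subseteq> S \<Longrightarrow> P q \<Longrightarrow> P (Poly_Mapping.single x c + q)"
 shows "P p"
 using assms(1)
proof (induct p rule: update_induct)
 case const
 then show ?case using assms(2) by simp
next
 case (update f a b)
 have u: "Poly_Mapping.update a b f = Poly_Mapping.single a b + f"
  using update(1) by (intro poly_mapping_eqI)
   (auto simp: lookup_update lookup_add lookup_single when_def in_keys_iff)
 have k: "Poly_Mapping.keys (Poly_Mapping.update a b f) = insert a (Poly_Mapping.keys f)"
  using update(2) by (auto simp: keys_update)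
 show ?case unfolding u using update k by (intro assms(3)) auto
qed

lemma lookup_map_times [simp]:
 "Poly_Mapping.lookup (Poly_Mapping.map ((*) c) p) z = (c::'k::field) * Poly_Mapping.lookup p z"
 by (simp add: map.rep_eq when_def)

lemma keys_map_times: "Poly_Mapping.keys (Poly_Mapping.map ((*) (c::'k::field)) p) \<subseteq> Poly_Mapping.keys p"
 by (auto simp: in_keys_iff)

context
 fixes W :: "('k::field, 'c, 'l) module_scheme" (structure) and G :: "'z \<Rightarrow> 'c" and S :: "'z set"
 assumes W: "vspace W" and G: "\<And>z. z \<in> S \<Longrightarrow> G z \<in> carrier W"
begin

interpretation W: module base_ring W by (rule W)

text \<open>Keys may cancel in a sum of two mappings; over a common finite superset of the keys
  additivity becomes a termwise statement.\<close>

lemma pm_sum_superset: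
 assumes "finite A" "Poly_Mapping.keys p \<subseteq> A" "A \<subseteq> S"
 shows "pm_sum W G p = (\<Oplus>z\<in>A. Poly_Mapping.lookup p z \<odot> G z)"
 unfolding pm_sum_def using assms G
 by (intro W.M.add.finprod_mono_neutral_cong_left)
  (auto simp: in_keys_iff vs_smult_zero[OF W] vs_smult[OF W] Pi_def)

lemma pm_sum_closed:
 assumes "Poly_Mapping.keys p \<subseteq> S"
 shows "pm_sum W G p \<in> carrier W"
 unfolding pm_sum_def using assms G by (intro W.M.finsum_closed) (auto intro: vs_smult[OF W])

lemma pm_sum_add:
 assumes "Poly_Mapping.keys p \<subseteq> S" "Poly_Mapping.keys q \<subseteq> S"
 shows "pm_sum W G (p + q) = pm_sum W G p \<oplus> pm_sum W G q"
proof -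
 let ?A = "Poly_Mapping.keys p \<union> Poly_Mapping.keys q"
 have A: "finite ?A" "?A \<subseteq> S" using assms by auto
 have "pm_sum W G (p + q) = (\<Oplus>z\<in>?A. Poly_Mapping.lookup (p + q) z \<odot> G z)"
  using A Poly_Mapping.keys_add[of p q] by (intro pm_sum_superset) auto
 also have "\<dots> = (\<Oplus>z\<in>?A. Poly_Mapping.lookup p z \<odot> G z \<oplus> Poly_Mapping.lookup q z \<odot> G z)"
  using A G by (intro W.M.finsum_cong')
   (auto simp: lookup_add vs_smult_l_distr[OF W] vs_smult[OF W] Pi_def subset_iff)
 also have "\<dots> = (\<Oplus>z\<in>?A. Poly_Mapping.lookup p z \<odot> G z) \<oplus> (\<Oplus>z\<in>?A. Poly_Mapping.lookup q z \<odot> G z)"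
  using A G by (intro W.M.finsum_addf) (auto simp: vs_smult[OF W] Pi_def subset_iff)
 also have "\<dots> = pm_sum W G p \<oplus> pm_sum W G q"
  using A by (subst (1 2) pm_sum_superset[where A = ?A]) auto
 finally show ?thesis .
qed

lemma pm_sum_smult:
 assumes "Poly_Mapping.keys p \<subseteq> S"
 shows "pm_sum W G (Poly_Mapping.map ((*) c) p) = c \<odot> pm_sum W G p"
proof -
 let ?A = "Poly_Mapping.keys p"
 have "pm_sum W G (Poly_Mapping.map ((*) c) p) = (\<Oplus>z\<in>?A. c \<odot> (Poly_Mapping.lookup p z \<odot> G z))"
  using assms G keys_map_times[of c p]
  by (subst pm_sum_superset[where A = ?A])
   (auto intro!: W.M.finsum_cong' simp: vs_smult_assoc[OF W] vs_smult[OF W] Pi_def subset_iff)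
 also have "\<dots> = c \<odot> pm_sum W G p"
  unfolding pm_sum_def using assms G
  by (subst W.finsum_smult_ldistr) (auto simp: vs_smult[OF W] subset_iff)
 finally show ?thesis .
qed

lemma pm_sum_single:
 assumes "z \<in> S"
 shows "pm_sum W G (Poly_Mapping.single z c) = c \<odot> G z"
 using assms G by (subst pm_sum_superset[where A = "{z}"])
  (auto simp: vs_smult[OF W])

lemma pm_sum_zero: "pm_sum W G 0 = \<zero>"
 unfolding pm_sum_def by simp

end

lemma formal_pairs_simps:
 "carrier (formal_pairs M N) = {p. Poly_Mapping.keys p \<subseteq> carrier M \<times> carrier N}"
 "\<zero>\<^bsub>formal_pairs M N\<^esub> = 0"
 "p \<oplus>\<^bsub>formal_pairs M N\<^esub> q = p + q"
 "c \<odot>\<^bsub>formal_pairs M N\<^esub> p = Poly_Mapping.map ((*) c) p"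
 by (simp_all add: formal_pairs_def)

lemma vspace_formal_pairs: "vspace (formal_pairs M N)"
proof (rule vspaceI)
 show "abelian_group (formal_pairs M N)"
 proof (rule abelian_groupI)
  fix x assume "x \<in> carrier (formal_pairs M N)"
  then show "\<exists>y\<in>carrier (formal_pairs M N). y \<oplus>\<^bsub>formal_pairs M N\<^esub> x = \<zero>\<^bsub>formal_pairs M N\<^esub>"
   by (intro bexI[of _ "- x"]) (auto simp: formal_pairs_simps)
 qed (auto simp: formal_pairs_simps add.assoc add.commute dest: subsetD[OF Poly_Mapping.keys_add])
qed (auto simp: formal_pairs_simps subset_iff dest: subsetD[OF keys_map_times]
   intro!: poly_mapping_eqI simp: lookup_add algebra_simps)

lemma formal_pairs_minus:
 assumes "p \<in> carrier (formal_pairs M N)" "q \<in> carrier (formal_pairs M N)"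
 shows "p \<ominus>\<^bsub>formal_pairs M N\<^esub> q = p - q"
proof -
 interpret module base_ring "formal_pairs M N" by (rule vspace_formal_pairs)
 have "\<ominus>\<^bsub>formal_pairs M N\<^esub> q = - q"
  using assms by (intro M.minus_equality) (auto simp: formal_pairs_simps)
 then show ?thesis by (simp add: a_minus_def formal_pairs_simps)
qed

lemma vs_minus_eq_zero:
 fixes W (structure)
 assumes "vspace W" "x \<in> carrier W" "y \<in> carrier W"
 shows "x \<ominus> y = \<zero> \<longleftrightarrow> x = y"
proof -
 interpret W: module base_ring W by fact
 have "(x \<ominus> y) \<oplus> y = x"
  using assms by (simp add: a_minus_def W.M.a_assoc W.M.l_neg)
 moreover have "y \<ominus> y = \<zero>" using assms by (simp add: a_minus_def W.M.r_neg)
 ultimately show ?thesis using assms by (metis W.M.l_zero)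
qed

lemma linear_map_minus:
 assumes "vspace M" "vspace N" "linear_map M N f" "x \<in> carrier M" "y \<in> carrier M"
 shows "f (x \<ominus>\<^bsub>M\<^esub> y) = f x \<ominus>\<^bsub>N\<^esub> f y"
 using assms linear_mapD(3)[OF assms(3,5), of "-1"]
 by (simp add: a_minus_def vs_smult_minus[symmetric] linear_mapD[OF assms(3)] vs_smult)

lemma vspace_cong:
 fixes M (structure)
 assumes "vspace M" "carrier M' = carrier M" "\<zero>\<^bsub>M'\<^esub> = \<zero>"
  "\<And>x y. x \<in> carrier M \<Longrightarrow> y \<in> carrier M \<Longrightarrow> x \<oplus>\<^bsub>M'\<^esub> y = x \<oplus> y"
  "\<And>c x. x \<in> carrier M \<Longrightarrow> c \<odot>\<^bsub>M'\<^esub> x = c \<odot> x"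
 shows "vspace M'"
proof -
 interpret module base_ring M by fact
 have "abelian_group M'"
 proof (rule abelian_groupI)
  fix x assume "x \<in> carrier M'"
  then show "\<exists>y\<in>carrier M'. y \<oplus>\<^bsub>M'\<^esub> x = \<zero>\<^bsub>M'\<^esub>"
   using assms by (intro bexI[of _ "\<ominus> x"]) (auto simp: M.l_neg)
 qed (auto simp: assms M.a_assoc, simp add: M.a_comm)
 then show ?thesis
  by (rule vspaceI) (auto simp: assms vs_smult[OF assms(1)] vs_smult_l_distr[OF assms(1)]
    vs_smult_r_distr[OF assms(1)] vs_smult_assoc[OF assms(1)] vs_smult_one[OF assms(1)])
qed

lemma k_algebraI:
 fixes M :: "('k::field, 'a, 'm) module_scheme" (structure)
 assumes "vspace M" "\<one> \<in> carrier M"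
  "\<And>x y. x \<in> carrier M \<Longrightarrow> y \<in> carrier M \<Longrightarrow> x \<otimes> y \<in> carrier M"
  "\<And>x y z. x \<in> carrier M \<Longrightarrow> y \<in> carrier M \<Longrightarrow> z \<in> carrier M \<Longrightarrow>
    x \<otimes> y \<otimes> z = x \<otimes> (y \<otimes> z)"
  "\<And>x. x \<in> carrier M \<Longrightarrow> \<one> \<otimes> x = x"
  "\<And>x. x \<in> carrier M \<Longrightarrow> x \<otimes> \<one> = x"
  "\<And>x y z. x \<in> carrier M \<Longrightarrow> y \<in> carrier M \<Longrightarrow> z \<in> carrier M \<Longrightarrow>
    (x \<oplus> y) \<otimes> z = x \<otimes> z \<oplus> y \<otimes> z"
  "\<And>x y z. x \<in> carrier M \<Longrightarrow> y \<in> carrier M \<Longrightarrow> z \<in> carrier M \<Longrightarrow>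
    z \<otimes> (x \<oplus> y) = z \<otimes> x \<oplus> z \<otimes> y"
  "\<And>c x y. x \<in> carrier M \<Longrightarrow> y \<in> carrier M \<Longrightarrow> (c \<odot> x) \<otimes> y = c \<odot> (x \<otimes> y)"
  "\<And>c x y. x \<in> carrier M \<Longrightarrow> y \<in> carrier M \<Longrightarrow> x \<otimes> (c \<odot> y) = c \<odot> (x \<otimes> y)"
 shows "k_algebra M"
proof -
 have "ring M"
  using assms by (intro ringI monoidI) (auto simp: module_def)
 then show ?thesis
  using assms(1,9,10) by (intro k_algebra.intro k_algebra_axioms.intro)
qed

section \<open>Tensor products\<close>

definition bilin ::
  "('k::field, 'a, 'm) module_scheme \<Rightarrow> ('k, 'b, 'n) module_scheme \<Rightarrow> ('k, 'c, 'l) module_scheme \<Rightarrow>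
   ('a \<Rightarrow> 'b \<Rightarrow> 'c) \<Rightarrow> bool" where
 "bilin M N W \<beta> \<longleftrightarrow>
   (\<forall>x\<in>carrier M. linear_map N W (\<beta> x)) \<and> (\<forall>y\<in>carrier N. linear_map M W (\<lambda>x. \<beta> x y))"

lemma bilinI:
 assumes "\<And>x. x \<in> carrier M \<Longrightarrow> linear_map N W (\<beta> x)"
  "\<And>y. y \<in> carrier N \<Longrightarrow> linear_map M W (\<lambda>x. \<beta> x y)"
 shows "bilin M N W \<beta>"
 using assms unfolding bilin_def by auto

lemma bilinD:
 assumes "bilin M N W \<beta>"
 shows "x \<in> carrier M \<Longrightarrow> linear_map N W (\<beta> x)" "y \<in> carrier N \<Longrightarrow> linear_map M W (\<lambda>x. \<beta> x y)"
  "x \<in> carrier M \<Longrightarrow> y \<in> carrier N \<Longrightarrow> \<beta> x y \<in> carrier W"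
 using assms unfolding bilin_def by (auto intro: linear_mapD(1))

context
 fixes M :: "('k::field, 'a, 'm) module_scheme" and N :: "('k, 'b, 'n) module_scheme"
 assumes M: "vspace M" and N: "vspace N"
begin

lemma formal_single_closed:
 "x \<in> carrier M \<Longrightarrow> y \<in> carrier N \<Longrightarrow> Poly_Mapping.single (x, y) c \<in> carrier (formal_pairs M N)"
 by (auto simp: formal_pairs_simps)

lemma formal_pairs_diff_closed:
 "p \<in> carrier (formal_pairs M N) \<Longrightarrow> q \<in> carrier (formal_pairs M N) \<Longrightarrow> p - q \<in> carrier (formal_pairs M N)"
 unfolding formal_pairs_simps mem_Collect_eq by (rule order_trans[OF keys_diff]) blast

lemma bilinearity_relations_subset: "bilinearity_relations M N \<subseteq> carrier (formal_pairs M N)"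
 unfolding bilinearity_relations_def
 by (intro Un_least subsetI; elim CollectE exE conjE; hypsubst;
   intro formal_pairs_diff_closed formal_single_closed vs_add[OF M] vs_smult[OF M]
   vs_add[OF N] vs_smult[OF N]; assumption)

lemma submodule_tensor_relations: "submodule (tensor_relations M N) base_ring (formal_pairs M N)"
 unfolding tensor_relations_def
 by (rule submodule_lin_span[OF vspace_formal_pairs bilinearity_relations_subset])

lemma bilinearity_relation_mem: "r \<in> bilinearity_relations M N \<Longrightarrow> r \<in> tensor_relations M N"
 unfolding tensor_relations_def by (rule subsetD[OF lin_span_superset])

lemma vspace_tensor: "vspace (tensor_space M N)"
 unfolding tensor_space_def by (rule vspace_quot[OF vspace_formal_pairs submodule_tensor_relations])

lemma pure_closed: "x \<in> carrier M \<Longrightarrow> y \<in> carrier N \<Longrightarrow> pure_tensor M N x y \<in> carrier (tensor_space M N)"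
 unfolding pure_tensor_def tensor_space_def by (intro quot_carrierI formal_single_closed)

lemma formal_coset_eqI:
 assumes "p \<in> carrier (formal_pairs M N)" "q \<in> carrier (formal_pairs M N)"
  "p - q \<in> bilinearity_relations M N"
 shows "tensor_relations M N +>\<^bsub>formal_pairs M N\<^esub> p = tensor_relations M N +>\<^bsub>formal_pairs M N\<^esub> q"
 using assms by (simp add: coset_eq_iff[OF vspace_formal_pairs submodule_tensor_relations]
   formal_pairs_minus bilinearity_relation_mem)

lemma formal_coset_add:
 assumes "p \<in> carrier (formal_pairs M N)" "q \<in> carrier (formal_pairs M N)"
 shows "tensor_relations M N +>\<^bsub>formal_pairs M N\<^esub> (p + q) =
  (tensor_relations M N +>\<^bsub>formal_pairs M N\<^esub> p) \<oplus>\<^bsub>tensor_space M N\<^esub> (tensor_relations M N +>\<^bsub>formal_pairs M N\<^esub> q)"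
 using quot_add[OF vspace_formal_pairs submodule_tensor_relations assms]
 by (simp add: tensor_space_def formal_pairs_simps)

lemma formal_pairs_add_closed:
 "p \<in> carrier (formal_pairs M N) \<Longrightarrow> q \<in> carrier (formal_pairs M N) \<Longrightarrow> p + q \<in> carrier (formal_pairs M N)"
 using vs_add[OF vspace_formal_pairs, of p M N q] by (simp add: formal_pairs_simps)

lemma pure_add_left:
 assumes "x \<in> carrier M" "x' \<in> carrier M" "y \<in> carrier N"
 shows "pure_tensor M N (x \<oplus>\<^bsub>M\<^esub> x') y = pure_tensor M N x y \<oplus>\<^bsub>tensor_space M N\<^esub> pure_tensor M N x' y"
 unfolding pure_tensor_def
 using assms by (subst formal_coset_add[symmetric]; (intro formal_coset_eqI formal_pairs_add_closed
  formal_single_closed vs_add[OF M])?)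
  (auto simp: bilinearity_relations_def diff_diff_add[symmetric])

lemma pure_add_right:
 assumes "x \<in> carrier M" "y \<in> carrier N" "y' \<in> carrier N"
 shows "pure_tensor M N x (y \<oplus>\<^bsub>N\<^esub> y') = pure_tensor M N x y \<oplus>\<^bsub>tensor_space M N\<^esub> pure_tensor M N x y'"
 unfolding pure_tensor_def
 using assms by (subst formal_coset_add[symmetric]; (intro formal_coset_eqI formal_pairs_add_closed
  formal_single_closed vs_add[OF N])?)
  (auto simp: bilinearity_relations_def diff_diff_add[symmetric])

lemma pure_coset_scale_left:
 assumes "x \<in> carrier M" "y \<in> carrier N"
 shows "pure_tensor M N (c \<odot>\<^bsub>M\<^esub> x) y = tensor_relations M N +>\<^bsub>formal_pairs M N\<^esub> Poly_Mapping.single (x, y) c"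
 unfolding pure_tensor_def using assms
 by (intro formal_coset_eqI formal_single_closed vs_smult[OF M])
  (auto simp: bilinearity_relations_def)

lemma pure_coset_scale_right:
 assumes "x \<in> carrier M" "y \<in> carrier N"
 shows "pure_tensor M N x (c \<odot>\<^bsub>N\<^esub> y) = tensor_relations M N +>\<^bsub>formal_pairs M N\<^esub> Poly_Mapping.single (x, y) c"
 unfolding pure_tensor_def using assms
 by (intro formal_coset_eqI formal_single_closed vs_smult[OF N])
  (auto simp: bilinearity_relations_def)

lemma pure_coset_smult:
 assumes "x \<in> carrier M" "y \<in> carrier N"
 shows "c \<odot>\<^bsub>tensor_space M N\<^esub> pure_tensor M N x y = tensor_relations M N +>\<^bsub>formal_pairs M N\<^esub> Poly_Mapping.single (x, y) c"
proof -
 have "Poly_Mapping.map ((*) c) (Poly_Mapping.single (x, y) 1) = Poly_Mapping.single (x, y) c"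
  by (intro poly_mapping_eqI) (auto simp: lookup_single when_def)
 then show ?thesis
  using quot_smult[OF vspace_formal_pairs submodule_tensor_relations formal_single_closed[OF assms], of c 1]
  by (simp add: tensor_space_def pure_tensor_def formal_pairs_simps)
qed

lemma pure_smult_left:
 assumes "x \<in> carrier M" "y \<in> carrier N"
 shows "pure_tensor M N (c \<odot>\<^bsub>M\<^esub> x) y = c \<odot>\<^bsub>tensor_space M N\<^esub> pure_tensor M N x y"
 using assms by (simp add: pure_coset_scale_left pure_coset_smult)

lemma pure_smult_right:
 assumes "x \<in> carrier M" "y \<in> carrier N"
 shows "pure_tensor M N x (c \<odot>\<^bsub>N\<^esub> y) = c \<odot>\<^bsub>tensor_space M N\<^esub> pure_tensor M N x y"
 using assms by (simp add: pure_coset_scale_right pure_coset_smult)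

lemma bilin_pure: "bilin M N (tensor_space M N) (pure_tensor M N)"
 by (intro bilinI linear_mapI)
  (auto simp: pure_closed pure_add_left pure_add_right pure_smult_left pure_smult_right)

text \<open>Scalars are absorbed into the left factor of a pure tensor, so sums of pure tensors
  exhaust the space.\<close>

lemma tensor_induct [consumes 1, case_names zero pure add]:
 assumes "t \<in> carrier (tensor_space M N)" "P \<zero>\<^bsub>tensor_space M N\<^esub>"
  "\<And>x y. x \<in> carrier M \<Longrightarrow> y \<in> carrier N \<Longrightarrow> P (pure_tensor M N x y)"
  "\<And>s t. s \<in> carrier (tensor_space M N) \<Longrightarrow> t \<in> carrier (tensor_space M N) \<Longrightarrow> P s \<Longrightarrow> P t \<Longrightarrow>
    P (s \<oplus>\<^bsub>tensor_space M N\<^esub> t)"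
 shows "P t"
proof -
 obtain p where p: "p \<in> carrier (formal_pairs M N)" "t = tensor_relations M N +>\<^bsub>formal_pairs M N\<^esub> p"
  using assms(1) unfolding tensor_space_def by (rule quot_carrierE)
 have "Poly_Mapping.keys p \<subseteq> carrier M \<times> carrier N" using p by (simp add: formal_pairs_simps)
 then have "P (tensor_relations M N +>\<^bsub>formal_pairs M N\<^esub> p)"
 proof (induct p rule: pm_induct)
  case zero
  have "tensor_relations M N +>\<^bsub>formal_pairs M N\<^esub> 0 = \<zero>\<^bsub>tensor_space M N\<^esub>"
   using coset_zero[OF vspace_formal_pairs submodule_tensor_relations]
   by (simp add: tensor_space_def quot_zero formal_pairs_simps)
  then show ?case using assms(2) by simp
 next
  case (add z c q)
  obtain x y where z: "z = (x, y)" "x \<in> carrier M" "y \<in> carrier N" using add(1) by auto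
  have q: "q \<in> carrier (formal_pairs M N)" using add(2) by (simp add: formal_pairs_simps)
  have "P (tensor_relations M N +>\<^bsub>formal_pairs M N\<^esub> Poly_Mapping.single (x, y) c)"
   using assms(3) z vs_smult[OF M] by (simp add: pure_coset_scale_left[symmetric])
  moreover have "tensor_relations M N +>\<^bsub>formal_pairs M N\<^esub> r \<in> carrier (tensor_space M N)"
   if "r \<in> carrier (formal_pairs M N)" for r
   using that unfolding tensor_space_def by (rule quot_carrierI)
  ultimately show ?case
   using z q add(3) by (simp add: formal_coset_add formal_single_closed assms(4))
 qed
 then show ?thesis using p by simp
qed

context
 fixes W :: "('k, 'c, 'l) module_scheme"
 assumes W: "vspace W"
begin

lemma tensor_linear_eqI:
 assumes "linear_map (tensor_space M N) W f" "linear_map (tensor_space M N) W g"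
  "\<And>x y. x \<in> carrier M \<Longrightarrow> y \<in> carrier N \<Longrightarrow> f (pure_tensor M N x y) = g (pure_tensor M N x y)"
  "t \<in> carrier (tensor_space M N)"
 shows "f t = g t"
 using assms(4)
 by (induct rule: tensor_induct)
  (auto simp: assms(3) linear_mapD[OF assms(1)] linear_mapD[OF assms(2)]
   linear_map_zero[OF vspace_tensor W assms(1)] linear_map_zero[OF vspace_tensor W assms(2)])

context
 fixes \<beta> assumes \<beta>: "bilin M N W \<beta>"
begin

lemma pm_sum_linear: "linear_map (formal_pairs M N) W (pm_sum W (\<lambda>z. \<beta> (fst z) (snd z)))"
proof -
 have G: "z \<in> carrier M \<times> carrier N \<Longrightarrow> \<beta> (fst z) (snd z) \<in> carrier W" for z
  using bilinD(3)[OF \<beta>] by auto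
 show ?thesis
  by (intro linear_mapI) (auto simp: formal_pairs_simps pm_sum_closed[OF W G] pm_sum_add[OF W G] pm_sum_smult[OF W G])
qed

lemma pm_sum_pair_single:
 assumes "x \<in> carrier M" "y \<in> carrier N"
 shows "pm_sum W (\<lambda>z. \<beta> (fst z) (snd z)) (Poly_Mapping.single (x, y) c) = c \<odot>\<^bsub>W\<^esub> \<beta> x y"
 using assms pm_sum_single[OF W, of "carrier M \<times> carrier N" "\<lambda>z. \<beta> (fst z) (snd z)" "(x, y)" c] bilinD(3)[OF \<beta>]
 by auto

lemma pm_sum_bilinearity_relations:
 assumes "r \<in> bilinearity_relations M N"
 shows "pm_sum W (\<lambda>z. \<beta> (fst z) (snd z)) r = \<zero>\<^bsub>W\<^esub>"
proof -
 interpret W: module base_ring W by (rule W)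
 let ?f = "pm_sum W (\<lambda>z. \<beta> (fst z) (snd z))"
 \<comment> \<open>All four kinds of relations are brought to the form \<open>p - q\<close> with
   equal sums, the three-term ones by \<open>diff_diff_add\<close>.\<close>
 have diff: "?f (p - q) = \<zero>\<^bsub>W\<^esub>"
  if "p \<in> carrier (formal_pairs M N)" "q \<in> carrier (formal_pairs M N)" "?f p = ?f q" for p q
  using that linear_map_minus[OF vspace_formal_pairs W pm_sum_linear that(1,2)] linear_mapD(1)[OF pm_sum_linear]
  by (simp add: formal_pairs_minus W.M.minus_eq W.M.r_neg)
 have add: "?f (p + q) = ?f p \<oplus>\<^bsub>W\<^esub> ?f q"
  if "p \<in> carrier (formal_pairs M N)" "q \<in> carrier (formal_pairs M N)" for p q
  using linear_mapD(2)[OF pm_sum_linear that] by (simp add: formal_pairs_simps)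
 note [simp] = add pm_sum_pair_single formal_single_closed vs_add[OF M] vs_add[OF N]
  vs_smult[OF M] vs_smult[OF N] vs_smult_one[OF W] vs_smult_assoc[OF W] bilinD(3)[OF \<beta>]
  formal_pairs_add_closed linear_mapD(2,3)[OF bilinD(1)[OF \<beta>]] linear_mapD(2,3)[OF bilinD(2)[OF \<beta>]]
 show ?thesis
  using assms unfolding bilinearity_relations_def diff_diff_add
  by (elim UnE CollectE exE conjE; hypsubst; intro diff; simp)
qed

text \<open>The kernel of the linear extension is a subspace that contains the bilinearity
  relations, hence their span; so the representative picked by \<open>tensor_lift\<close> does not
  influence the value.\<close>

lemma tensor_lift_coset:
 assumes p: "p \<in> carrier (formal_pairs M N)"
 shows "tensor_lift W \<beta> (tensor_relations M N +>\<^bsub>formal_pairs M N\<^esub> p) = pm_sum W (\<lambda>z. \<beta> (fst z) (snd z)) p"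
proof -
 interpret W: module base_ring W by (rule W)
 interpret F: module base_ring "formal_pairs M N" by (rule vspace_formal_pairs)
 let ?f = "pm_sum W (\<lambda>z. \<beta> (fst z) (snd z))" and ?C = "tensor_relations M N +>\<^bsub>formal_pairs M N\<^esub> p"
 define q where "q = (SOME q. q \<in> ?C)"
 have "q \<in> ?C" unfolding q_def
  using coset_self[OF vspace_formal_pairs submodule_tensor_relations p] by (rule someI)
 then have q: "q \<in> carrier (formal_pairs M N)" "q \<ominus>\<^bsub>formal_pairs M N\<^esub> p \<in> tensor_relations M N"
  using p by (auto simp: mem_coset_iff[OF vspace_formal_pairs submodule_tensor_relations])
 have "submodule {\<zero>\<^bsub>W\<^esub>} base_ring W"
  by (rule submoduleI'[OF W]) (auto simp: vs_smult_r_null[OF W])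
 then have "submodule {p \<in> carrier (formal_pairs M N). ?f p \<in> {\<zero>\<^bsub>W\<^esub>}} base_ring (formal_pairs M N)"
  by (rule submodule_vimage[OF vspace_formal_pairs W pm_sum_linear])
 then have "tensor_relations M N \<subseteq> {p \<in> carrier (formal_pairs M N). ?f p \<in> {\<zero>\<^bsub>W\<^esub>}}"
  unfolding tensor_relations_def
  by (rule lin_span_least) (use bilinearity_relations_subset pm_sum_bilinearity_relations in auto)
 then have "?f (q \<ominus>\<^bsub>formal_pairs M N\<^esub> p) = \<zero>\<^bsub>W\<^esub>" using q by auto
 then have "?f q \<ominus>\<^bsub>W\<^esub> ?f p = \<zero>\<^bsub>W\<^esub>"
  using linear_map_minus[OF vspace_formal_pairs W pm_sum_linear q(1) p] by simp
 then have "?f q = ?f p"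
  using linear_mapD(1)[OF pm_sum_linear] p q by (simp add: vs_minus_eq_zero[OF W])
 then show ?thesis unfolding tensor_lift_def Let_def q_def[symmetric] by (simp add: pm_sum_def)
qed

lemma tensor_lift_pure:
 assumes "x \<in> carrier M" "y \<in> carrier N"
 shows "tensor_lift W \<beta> (pure_tensor M N x y) = \<beta> x y"
 using assms by (simp add: pure_tensor_def tensor_lift_coset formal_single_closed pm_sum_pair_single
   vs_smult_one[OF W] bilinD(3)[OF \<beta>])

lemma tensor_lift_linear: "linear_map (tensor_space M N) W (tensor_lift W \<beta>)"
proof (rule linear_mapI)
 fix s assume s: "s \<in> carrier (tensor_space M N)"
 then obtain p where p: "p \<in> carrier (formal_pairs M N)" "s = tensor_relations M N +>\<^bsub>formal_pairs M N\<^esub> p"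
  unfolding tensor_space_def by (rule quot_carrierE)
 show "tensor_lift W \<beta> s \<in> carrier W"
  using p linear_mapD(1)[OF pm_sum_linear] by (simp add: tensor_lift_coset)
 show "tensor_lift W \<beta> (c \<odot>\<^bsub>tensor_space M N\<^esub> s) = c \<odot>\<^bsub>W\<^esub> tensor_lift W \<beta> s" for c
  using p linear_mapD(3)[OF pm_sum_linear]
  by (simp add: tensor_lift_coset tensor_space_def quot_smult[OF vspace_formal_pairs submodule_tensor_relations]
   vs_smult[OF vspace_formal_pairs])
 fix t assume t: "t \<in> carrier (tensor_space M N)"
 then obtain q where q: "q \<in> carrier (formal_pairs M N)" "t = tensor_relations M N +>\<^bsub>formal_pairs M N\<^esub> q"
  unfolding tensor_space_def by (rule quot_carrierE)
 show "tensor_lift W \<beta> (s \<oplus>\<^bsub>tensor_space M N\<^esub> t) = tensor_lift W \<beta> s \<oplus>\<^bsub>W\<^esub> tensor_lift W \<beta> t"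
  using p q linear_mapD(2)[OF pm_sum_linear]
  by (simp add: tensor_lift_coset tensor_space_def quot_add[OF vspace_formal_pairs submodule_tensor_relations]
   vs_add[OF vspace_formal_pairs])
qed

end

end

end

text \<open>A lift that depends linearly on a parameter is bilinear in the tensor and the parameter.
  The nested lifts in \<open>tensor_alg\<close> and \<open>tensor_assoc\<close> are well behaved for
  this reason.\<close>

lemma tensor_lift_bilin:
 assumes M: "vspace M" and N: "vspace N" and P: "vspace P" and W: "vspace W"
  and b: "\<And>p. p \<in> carrier P \<Longrightarrow> bilin M N W (\<lambda>u v. L u v p)"
  and l: "\<And>u v. u \<in> carrier M \<Longrightarrow> v \<in> carrier N \<Longrightarrow> linear_map P W (L u v)"
 shows "bilin (tensor_space M N) P W (\<lambda>t p. tensor_lift W (\<lambda>u v. L u v p) t)"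
proof (rule bilinI)
 fix p assume "p \<in> carrier P"
 then show "linear_map (tensor_space M N) W (\<lambda>t. tensor_lift W (\<lambda>u v. L u v p) t)"
  using tensor_lift_linear[OF M N W b] by simp
next
 interpret W: module base_ring W by (rule W)
 fix t assume t: "t \<in> carrier (tensor_space M N)"
 note lin = linear_mapD[OF tensor_lift_linear[OF M N W b]]
 note [simp] = vs_add[OF P] vs_smult[OF P] vs_add[OF W] vs_smult[OF W]
  tensor_lift_pure[OF M N W b] linear_mapD[OF l] lin
  linear_map_zero[OF vspace_tensor[OF M N] W tensor_lift_linear[OF M N W b]]
 show "linear_map P W (\<lambda>p. tensor_lift W (\<lambda>u v. L u v p) t)"
 proof (rule linear_mapI)
  fix p q assume pq: "p \<in> carrier P" "q \<in> carrier P"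
  show "tensor_lift W (\<lambda>u v. L u v (p \<oplus>\<^bsub>P\<^esub> q)) t = tensor_lift W (\<lambda>u v. L u v p) t \<oplus>\<^bsub>W\<^esub> tensor_lift W (\<lambda>u v. L u v q) t"
   by (rule tensor_induct[OF M N t]) (use pq in \<open>auto simp: W.M.a_ac\<close>)
 next
  fix p c assume p: "p \<in> carrier P"
  show "tensor_lift W (\<lambda>u v. L u v (c \<odot>\<^bsub>P\<^esub> p)) t = c \<odot>\<^bsub>W\<^esub> tensor_lift W (\<lambda>u v. L u v p) t"
   by (rule tensor_induct[OF M N t])
    (use p in \<open>auto simp: vs_smult_r_distr[OF W] vs_smult_r_null[OF W]\<close>)
 qed (use t in simp)
qed

section \<open>Linear forms and dual systems\<close>

lemma base_alg_simps [simp]: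
 "carrier (base_alg :: ('k::field, 'k) module) = UNIV"
 "monoid.mult (base_alg :: ('k, 'k) module) = (*)"
 "one (base_alg :: ('k, 'k) module) = 1"
 "ring.zero (base_alg :: ('k, 'k) module) = 0"
 "add (base_alg :: ('k, 'k) module) = (+)"
 "Module.module.smult (base_alg :: ('k, 'k) module) = (*)"
 by (simp_all add: base_alg_def ring.defs ring_of_type_algebra_def)

lemma vspace_base_alg: "vspace (base_alg :: ('k::field, 'k) module)"
proof (rule vspaceI)
 show "abelian_group (base_alg :: ('k, 'k) module)"
  by (rule abelian_groupI) (auto simp: algebra_simps intro: exI[of _ "- x" for x])
qed (auto simp: algebra_simps)

lemma finsum_base_alg: "finsum (base_alg :: ('k::field, 'k) module) f A = sum f A"
proof -
 interpret module base_ring "base_alg :: ('k, 'k) module" by (rule vspace_base_alg)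
 show ?thesis
  by (induct A rule: infinite_finite_induct) (simp_all add: M.finsum_infinite M.finsum_insert)
qed

definition linform :: "('k::field, 'a, 'm) module_scheme \<Rightarrow> ('a \<Rightarrow> 'k) \<Rightarrow> bool" where
 "linform M \<phi> \<longleftrightarrow>
   (\<forall>x\<in>carrier M. \<forall>y\<in>carrier M. \<phi> (x \<oplus>\<^bsub>M\<^esub> y) = \<phi> x + \<phi> y) \<and>
   (\<forall>c. \<forall>x\<in>carrier M. \<phi> (c \<odot>\<^bsub>M\<^esub> x) = c * \<phi> x)"

lemma linform_iff: "linform M \<phi> \<longleftrightarrow> linear_map M base_alg \<phi>"
 by (simp add: linform_def linear_map_def)

lemma linformI:
 assumes "\<And>x y. x \<in> carrier M \<Longrightarrow> y \<in> carrier M \<Longrightarrow> \<phi> (x \<oplus>\<^bsub>M\<^esub> y) = \<phi> x + \<phi> y"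
  "\<And>c x. x \<in> carrier M \<Longrightarrow> \<phi> (c \<odot>\<^bsub>M\<^esub> x) = c * \<phi> x"
 shows "linform M \<phi>"
 using assms by (auto simp: linform_def)

lemma linformD:
 assumes "linform M \<phi>"
 shows "x \<in> carrier M \<Longrightarrow> y \<in> carrier M \<Longrightarrow> \<phi> (x \<oplus>\<^bsub>M\<^esub> y) = \<phi> x + \<phi> y"
  "x \<in> carrier M \<Longrightarrow> \<phi> (c \<odot>\<^bsub>M\<^esub> x) = c * \<phi> x"
 using assms by (auto simp: linform_def)

lemma linform_zero: "vspace M \<Longrightarrow> linform M \<phi> \<Longrightarrow> \<phi> \<zero>\<^bsub>M\<^esub> = 0"
 using linear_map_zero[OF _ vspace_base_alg] by (auto simp: linform_iff)

lemma linform_minus: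
 fixes M (structure)
 assumes "vspace M" "linform M \<phi>" "x \<in> carrier M" "y \<in> carrier M"
 shows "\<phi> (x \<ominus> y) = \<phi> x - \<phi> y"
proof -
 have "x \<ominus> y = x \<oplus> (-1) \<odot> y" using assms by (simp add: vs_smult_minus a_minus_def)
 then show ?thesis using assms by (simp add: linformD vs_smult)
qed

lemma linform_finsum:
 assumes "vspace M" "linform M \<phi>" "g \<in> A \<rightarrow> carrier M"
 shows "\<phi> (finsum M g A) = (\<Sum>i\<in>A. \<phi> (g i))"
 using linear_map_finsum[OF assms(1) vspace_base_alg _ assms(3)] assms(2)
 by (simp add: linform_iff finsum_base_alg)

lemma linform_add: "linform M \<phi> \<Longrightarrow> linform M \<psi> \<Longrightarrow> linform M (\<lambda>x. \<phi> x + \<psi> x)"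
 by (auto simp: linform_def algebra_simps)

lemma linform_diff: "linform M \<phi> \<Longrightarrow> linform M \<psi> \<Longrightarrow> linform M (\<lambda>x. \<phi> x - \<psi> x)"
 by (auto simp: linform_def algebra_simps)

lemma linform_scale: "linform M \<phi> \<Longrightarrow> linform M (\<lambda>x. c * \<phi> x)"
 by (auto simp: linform_def algebra_simps)

lemma linform_0: "linform M (\<lambda>x. 0)"
 by (auto simp: linform_def)

lemma linform_sum: "(\<And>i. i \<in> A \<Longrightarrow> linform M (\<phi> i)) \<Longrightarrow> linform M (\<lambda>x. \<Sum>i\<in>A. \<phi> i x)"
 by (auto simp: linform_def sum.distrib sum_distrib_left)

lemma linform_comp: "linear_map M N f \<Longrightarrow> linform N \<phi> \<Longrightarrow> linform M (\<lambda>x. \<phi> (f x))"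
 using linear_map_comp unfolding linform_iff by blast

lemma linear_map_finsum_smult:
 fixes W (structure)
 assumes M: "vspace M" and W: "vspace W"
  and l: "\<And>i. i \<in> A \<Longrightarrow> linform M (l i)" and b: "\<And>i. i \<in> A \<Longrightarrow> b i \<in> carrier W" and A: "finite A"
 shows "linear_map M W (\<lambda>x. \<Oplus>i\<in>A. l i x \<odot> b i)"
proof -
 interpret W: module base_ring W by (rule W)
 show ?thesis
 proof (rule linear_mapI)
  fix x y assume xy: "x \<in> carrier M" "y \<in> carrier M"
  have "(\<Oplus>i\<in>A. l i (x \<oplus>\<^bsub>M\<^esub> y) \<odot> b i) = (\<Oplus>i\<in>A. l i x \<odot> b i \<oplus> l i y \<odot> b i)"
   using xy b by (intro W.M.finsum_cong')
    (auto simp: linformD[OF l] vs_smult_l_distr[OF W] vs_smult[OF W] vs_add[OF W])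
  also have "\<dots> = (\<Oplus>i\<in>A. l i x \<odot> b i) \<oplus> (\<Oplus>i\<in>A. l i y \<odot> b i)"
   using b by (intro W.M.finsum_addf) (auto simp: vs_smult[OF W])
  finally show "(\<Oplus>i\<in>A. l i (x \<oplus>\<^bsub>M\<^esub> y) \<odot> b i) = \<dots>" .
 next
  fix c x assume x: "x \<in> carrier M"
  have "(\<Oplus>i\<in>A. l i (c \<odot>\<^bsub>M\<^esub> x) \<odot> b i) = (\<Oplus>i\<in>A. c \<odot> (l i x \<odot> b i))"
   using x b by (intro W.M.finsum_cong')
    (auto simp: linformD[OF l] vs_smult_assoc[OF W] vs_smult[OF W])
  also have "\<dots> = c \<odot> (\<Oplus>i\<in>A. l i x \<odot> b i)"
   using b A W.finsum_smult_ldistr[of A c "\<lambda>i. l i x \<odot> b i"] by (auto simp: vs_smult[OF W])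
  finally show "(\<Oplus>i\<in>A. l i (c \<odot>\<^bsub>M\<^esub> x) \<odot> b i) = \<dots>" .
 qed (use b in \<open>auto intro!: W.M.finsum_closed simp: vs_smult[OF W]\<close>)
qed

text \<open>A spanning family with coordinate forms; the family need not be linearly independent.\<close>

definition dual_system ::
  "('k::field, 'a, 'm) module_scheme \<Rightarrow> 'i set \<Rightarrow> ('i \<Rightarrow> 'a) \<Rightarrow> ('i \<Rightarrow> 'a \<Rightarrow> 'k) \<Rightarrow> bool" where
 "dual_system M I b l \<longleftrightarrow> finite I \<and> (\<forall>i\<in>I. b i \<in> carrier M \<and> linform M (l i)) \<and>
   (\<forall>x\<in>carrier M. x = (\<Oplus>\<^bsub>M\<^esub>i\<in>I. l i x \<odot>\<^bsub>M\<^esub> b i))"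

lemma dual_systemD:
 assumes "dual_system M I b l"
 shows "finite I" "i \<in> I \<Longrightarrow> b i \<in> carrier M" "i \<in> I \<Longrightarrow> linform M (l i)"
  "x \<in> carrier M \<Longrightarrow> (\<Oplus>\<^bsub>M\<^esub>i\<in>I. l i x \<odot>\<^bsub>M\<^esub> b i) = x"
 using assms by (auto simp: dual_system_def)

text \<open>The index set is taken in \<open>nat\<close> because an existential quantifier cannot
  range over types of indices; \<open>dual_system_reindex\<close> moves any other finite index set
  there.\<close>

definition fin_dim :: "('k::field, 'a, 'm) module_scheme \<Rightarrow> bool" where
 "fin_dim M \<longleftrightarrow> (\<exists>(I :: nat set) b l. dual_system M I b l)"

lemma dual_system_reindex:
 fixes M (structure)
 assumes M: "vspace M" and d: "dual_system M I b l" and h: "bij_betw h J I"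
 shows "dual_system M J (\<lambda>j. b (h j)) (\<lambda>j. l (h j))"
proof -
 interpret M: module base_ring M by (rule M)
 have hJ: "h ` J = I" "inj_on h J" using h by (auto simp: bij_betw_def)
 have "(\<Oplus>j\<in>J. l (h j) x \<odot> b (h j)) = x" if "x \<in> carrier M" for x
  using M.M.finsum_reindex[of "\<lambda>i. l i x \<odot> b i" h J] hJ dual_systemD[OF d] that
  by (auto simp: vs_smult[OF M])
 moreover have "finite J" using h dual_systemD(1)[OF d] bij_betw_finite by blast
 ultimately show ?thesis
  using hJ dual_systemD[OF d] unfolding dual_system_def by auto
qed

lemma dual_system_linear_eq:
 fixes M (structure)
 assumes M: "vspace M" and W: "vspace W" and d: "dual_system M I b l"
  and f: "linear_map M W f" and h: "linear_map M W h"
  and eq: "\<And>i. i \<in> I \<Longrightarrow> f (b i) = h (b i)" and z: "z \<in> carrier M"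
 shows "f z = h z"
proof -
 interpret W: module base_ring W by (rule W)
 have Pi: "(\<lambda>i. l i z \<odot> b i) \<in> I \<rightarrow> carrier M"
  using dual_systemD(2)[OF d] by (auto simp: vs_smult[OF M])
 have "f z = f (\<Oplus>i\<in>I. l i z \<odot> b i)" using dual_systemD(4)[OF d z] by simp
 also have "\<dots> = h (\<Oplus>i\<in>I. l i z \<odot> b i)"
  unfolding linear_map_finsum[OF M W f Pi] linear_map_finsum[OF M W h Pi]
  using dual_systemD(2)[OF d]
  by (intro W.M.finsum_cong')
   (auto simp: linear_mapD(3)[OF f] linear_mapD(3)[OF h] eq vs_smult[OF M] intro!: vs_smult[OF W] linear_mapD(1)[OF h])
 also have "\<dots> = h z" using dual_systemD(4)[OF d z] by simp
 finally show ?thesis .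
qed

lemma fin_dimI:
 assumes "vspace M" "dual_system M I b l"
 shows "fin_dim M"
proof -
 obtain h where "bij_betw h {0..<card I} I"
  using ex_bij_betw_nat_finite[OF dual_systemD(1)[OF assms(2)]] by blast
 then show ?thesis unfolding fin_dim_def using dual_system_reindex[OF assms] by blast
qed

lemma dual_system_eqI:
 fixes M (structure)
 assumes M: "vspace M" and d: "dual_system M I b l" and x: "x \<in> carrier M" "y \<in> carrier M"
  and eq: "\<And>i. i \<in> I \<Longrightarrow> l i x = l i y"
 shows "x = y"
proof -
 interpret M: module base_ring M by (rule M)
 have "(\<Oplus>i\<in>I. l i x \<odot> b i) = (\<Oplus>i\<in>I. l i y \<odot> b i)"
  using dual_systemD(2)[OF d] by (intro M.M.finsum_cong') (auto simp: eq vs_smult[OF M])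
 then show ?thesis using x by (simp add: dual_systemD(4)[OF d])
qed

lemma linform_eqI:
 assumes "vspace M" "fin_dim M" "x \<in> carrier M" "y \<in> carrier M"
  "\<And>\<phi>. linform M \<phi> \<Longrightarrow> \<phi> x = \<phi> y"
 shows "x = y"
proof -
 obtain I :: "nat set" and b l where d: "dual_system M I b l" using assms(2) by (auto simp: fin_dim_def)
 show ?thesis by (rule dual_system_eqI[OF assms(1) d assms(3,4)]) (simp add: assms(5) dual_systemD(3)[OF d])
qed

lemma linform_expand:
 fixes M (structure)
 assumes M: "vspace M" and d: "dual_system M I b l" and "linform M \<phi>" "x \<in> carrier M"
 shows "\<phi> x = (\<Sum>i\<in>I. l i x * \<phi> (b i))"
proof -
 have "\<phi> x = \<phi> (\<Oplus>i\<in>I. l i x \<odot> b i)" using assms by (simp add: dual_systemD(4)[OF d])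
 also have "\<dots> = (\<Sum>i\<in>I. \<phi> (l i x \<odot> b i))"
  using dual_systemD(2)[OF d] by (intro linform_finsum[OF M assms(3)]) (auto simp: vs_smult[OF M])
 also have "\<dots> = (\<Sum>i\<in>I. l i x * \<phi> (b i))"
  using dual_systemD(2)[OF d] by (intro sum.cong) (auto simp: linformD[OF assms(3)])
 finally show ?thesis .
qed

text \<open>The functional \<phi> \<otimes> \<psi> on the tensor product, through which tensors are
  observed from here on.\<close>

definition tev :: "('a \<Rightarrow> 'k::field) \<Rightarrow> ('b \<Rightarrow> 'k) \<Rightarrow> ('k, 'a, 'b) tensor \<Rightarrow> 'k" where
 "tev \<phi> \<psi> t = tensor_lift base_alg (\<lambda>u v. \<phi> u * \<psi> v) t"

context
 fixes M :: "('k::field, 'a, 'm) module_scheme" and N :: "('k, 'b, 'n) module_scheme"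
 assumes M: "vspace M" and N: "vspace N"
begin

interpretation T: module base_ring "tensor_space M N" by (rule vspace_tensor[OF M N])

lemma bilin_forms:
 assumes "linform M \<phi>" "linform N \<psi>"
 shows "bilin M N base_alg (\<lambda>u v. \<phi> u * \<psi> v)"
 by (intro bilinI linear_mapI) (auto simp: linformD[OF assms(1)] linformD[OF assms(2)] algebra_simps)

lemma tev_pure:
 assumes "linform M \<phi>" "linform N \<psi>" "x \<in> carrier M" "y \<in> carrier N"
 shows "tev \<phi> \<psi> (pure_tensor M N x y) = \<phi> x * \<psi> y"
 unfolding tev_def by (rule tensor_lift_pure[OF M N vspace_base_alg bilin_forms[OF assms(1,2)] assms(3,4)])

lemma linform_tev:
 assumes "linform M \<phi>" "linform N \<psi>"
 shows "linform (tensor_space M N) (tev \<phi> \<psi>)"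
 unfolding linform_iff tev_def by (rule tensor_lift_linear[OF M N vspace_base_alg bilin_forms[OF assms]])

text \<open>Linear forms on a tensor product are determined by pure tensors. The rules of
  calculation for \<open>tev\<close> are all instances of this.\<close>

lemma tev_eqI:
 assumes f: "linform (tensor_space M N) f" and \<phi>: "linform M \<phi>" "linform N \<psi>"
  and t: "t \<in> carrier (tensor_space M N)"
  and eq: "\<And>x y. x \<in> carrier M \<Longrightarrow> y \<in> carrier N \<Longrightarrow> \<phi> x * \<psi> y = f (pure_tensor M N x y)"
 shows "tev \<phi> \<psi> t = f t"
 by (rule tensor_linear_eqI[OF M N vspace_base_alg _ _ _ t])
  (use f linform_tev[OF \<phi>] in \<open>auto simp: linform_iff[symmetric] tev_pure[OF \<phi>] eq\<close>)

lemma tev_cong: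
 assumes "linform M \<phi>" "linform N \<psi>" "linform M \<phi>'" "linform N \<psi>'" "t \<in> carrier (tensor_space M N)"
  "\<And>x. x \<in> carrier M \<Longrightarrow> \<phi> x = \<phi>' x" "\<And>y. y \<in> carrier N \<Longrightarrow> \<psi> y = \<psi>' y"
 shows "tev \<phi> \<psi> t = tev \<phi>' \<psi>' t"
 by (rule tev_eqI) (use assms in \<open>auto simp: tev_pure intro: linform_tev\<close>)

lemma tev_sum_left:
 assumes "\<And>i. i \<in> A \<Longrightarrow> linform M (\<phi> i)" "linform N \<psi>" "t \<in> carrier (tensor_space M N)"
 shows "tev (\<lambda>x. \<Sum>i\<in>A. c i * \<phi> i x) \<psi> t = (\<Sum>i\<in>A. c i * tev (\<phi> i) \<psi> t)"
 by (rule tev_eqI) (use assms in \<open>auto simp: tev_pure sum_distrib_right mult.assoc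
   intro!: linform_tev linform_sum linform_scale\<close>)

lemma tev_sum_right:
 assumes "\<And>i. i \<in> A \<Longrightarrow> linform N (\<psi> i)" "linform M \<phi>" "t \<in> carrier (tensor_space M N)"
 shows "tev \<phi> (\<lambda>x. \<Sum>i\<in>A. c i * \<psi> i x) t = (\<Sum>i\<in>A. c i * tev \<phi> (\<psi> i) t)"
 by (rule tev_eqI) (use assms in \<open>auto simp: tev_pure sum_distrib_left mult.assoc mult.left_commute
   intro!: linform_tev linform_sum linform_scale sum.cong\<close>)

lemma tev_add_left:
 assumes "linform M \<phi>" "linform M \<phi>'" "linform N \<psi>" "t \<in> carrier (tensor_space M N)"
 shows "tev (\<lambda>x. \<phi> x + \<phi>' x) \<psi> t = tev \<phi> \<psi> t + tev \<phi>' \<psi> t"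
 by (rule tev_eqI) (use assms in \<open>auto simp: tev_pure algebra_simps intro!: linform_tev linform_add\<close>)

lemma tev_add_right:
 assumes "linform M \<phi>" "linform N \<psi>" "linform N \<psi>'" "t \<in> carrier (tensor_space M N)"
 shows "tev \<phi> (\<lambda>x. \<psi> x + \<psi>' x) t = tev \<phi> \<psi> t + tev \<phi> \<psi>' t"
 by (rule tev_eqI) (use assms in \<open>auto simp: tev_pure algebra_simps intro!: linform_tev linform_add\<close>)

lemma tev_diff_left:
 assumes "linform M \<phi>" "linform M \<phi>'" "linform N \<psi>" "t \<in> carrier (tensor_space M N)"
 shows "tev (\<lambda>x. \<phi> x - \<phi>' x) \<psi> t = tev \<phi> \<psi> t - tev \<phi>' \<psi> t"
 by (rule tev_eqI) (use assms in \<open>auto simp: tev_pure algebra_simps intro!: linform_tev linform_diff\<close>)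

lemma tev_diff_right:
 assumes "linform M \<phi>" "linform N \<psi>" "linform N \<psi>'" "t \<in> carrier (tensor_space M N)"
 shows "tev \<phi> (\<lambda>x. \<psi> x - \<psi>' x) t = tev \<phi> \<psi> t - tev \<phi> \<psi>' t"
 by (rule tev_eqI) (use assms in \<open>auto simp: tev_pure algebra_simps intro!: linform_tev linform_diff\<close>)

lemma tev_scale_left:
 assumes "linform M \<phi>" "linform N \<psi>" "t \<in> carrier (tensor_space M N)"
 shows "tev (\<lambda>x. c * \<phi> x) \<psi> t = c * tev \<phi> \<psi> t"
 by (rule tev_eqI) (use assms in \<open>auto simp: tev_pure algebra_simps intro!: linform_tev linform_scale\<close>)

lemma tev_scale_right:
 assumes "linform M \<phi>" "linform N \<psi>" "t \<in> carrier (tensor_space M N)"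
 shows "tev \<phi> (\<lambda>x. c * \<psi> x) t = c * tev \<phi> \<psi> t"
 by (rule tev_eqI) (use assms in \<open>auto simp: tev_pure algebra_simps intro!: linform_tev linform_scale\<close>)

lemma pure_finsum_left:
 assumes "f \<in> A \<rightarrow> carrier M" "y \<in> carrier N"
 shows "pure_tensor M N (finsum M f A) y = (\<Oplus>\<^bsub>tensor_space M N\<^esub>i\<in>A. pure_tensor M N (f i) y)"
 using linear_map_finsum[OF M vspace_tensor[OF M N] bilinD(2)[OF bilin_pure[OF M N] assms(2)] assms(1)] .

lemma pure_finsum_right:
 assumes "f \<in> A \<rightarrow> carrier N" "x \<in> carrier M"
 shows "pure_tensor M N x (finsum N f A) = (\<Oplus>\<^bsub>tensor_space M N\<^esub>i\<in>A. pure_tensor M N x (f i))"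
 using linear_map_finsum[OF N vspace_tensor[OF M N] bilinD(1)[OF bilin_pure[OF M N] assms(2)] assms(1)] .

end

lemma finsum_Times:
 fixes W (structure)
 assumes W: "vspace W" and "finite I" "finite J" "\<And>i j. i \<in> I \<Longrightarrow> j \<in> J \<Longrightarrow> f i j \<in> carrier W"
 shows "(\<Oplus>p\<in>I \<times> J. f (fst p) (snd p)) = (\<Oplus>i\<in>I. \<Oplus>j\<in>J. f i j)"
proof -
 interpret W: module base_ring W by (rule W)
 show ?thesis
  using assms(2,4)
 proof (induct I)
  case (insert a I)
  have "(\<Oplus>p\<in>insert a I \<times> J. f (fst p) (snd p)) =
    (\<Oplus>p\<in>(\<lambda>j. (a, j)) ` J \<union> I \<times> J. f (fst p) (snd p))"
   by (rule arg_cong[where f = "finsum W _"]) auto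
  also have "\<dots> = (\<Oplus>p\<in>(\<lambda>j. (a, j)) ` J. f (fst p) (snd p)) \<oplus> (\<Oplus>p\<in>I \<times> J. f (fst p) (snd p))"
   using insert assms(3) by (intro W.M.finsum_Un_disjoint) auto
  also have "(\<Oplus>p\<in>(\<lambda>j. (a, j)) ` J. f (fst p) (snd p)) = (\<Oplus>j\<in>J. f a j)"
   using insert by (subst W.M.finsum_reindex) (auto simp: inj_on_def)
  also have "(\<Oplus>p\<in>I \<times> J. f (fst p) (snd p)) = (\<Oplus>i\<in>I. \<Oplus>j\<in>J. f i j)"
   using insert by auto
  finally show ?case using insert by (subst W.M.finsum_insert) (auto intro!: W.M.finsum_closed)
 qed simp
qed

text \<open>Finite dimension passes from the factors to the tensor product, with coordinate forms
  that are again of the shape \<open>tev\<close>; functionals of this shape therefore separate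
  tensors.\<close>

lemma dual_system_tensor:
 fixes M (structure)
 assumes M: "vspace M" and N: "vspace N" and dM: "dual_system M I b l" and dN: "dual_system N J c m"
 shows "dual_system (tensor_space M N) (I \<times> J) (\<lambda>p. pure_tensor M N (b (fst p)) (c (snd p)))
  (\<lambda>p. tev (l (fst p)) (m (snd p)))"
proof -
 let ?T = "tensor_space M N"
 have T: "vspace ?T" by (rule vspace_tensor[OF M N])
 interpret T: module base_ring ?T by (rule T)
 note [simp] = dual_systemD(1-3)[OF dM] dual_systemD(1-3)[OF dN]
 have lin: "linear_map ?T ?T (\<lambda>t. \<Oplus>\<^bsub>?T\<^esub>p\<in>I \<times> J. tev (l (fst p)) (m (snd p)) t \<odot>\<^bsub>?T\<^esub> pure_tensor M N (b (fst p)) (c (snd p)))"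
  by (rule linear_map_finsum_smult[OF T T]) (auto intro!: linform_tev[OF M N] pure_closed[OF M N])
 have "(\<Oplus>\<^bsub>?T\<^esub>p\<in>I \<times> J. tev (l (fst p)) (m (snd p)) t \<odot>\<^bsub>?T\<^esub> pure_tensor M N (b (fst p)) (c (snd p))) = t"
  if t: "t \<in> carrier ?T" for t
 proof (rule tensor_linear_eqI[OF M N T lin _ _ t, of "\<lambda>t. t"])
  fix x y assume xy: "x \<in> carrier M" "y \<in> carrier N"
  have "pure_tensor M N x y = pure_tensor M N (\<Oplus>i\<in>I. l i x \<odot> b i) y"
   using xy by (simp add: dual_systemD(4)[OF dM])
  also have "\<dots> = (\<Oplus>\<^bsub>?T\<^esub>i\<in>I. pure_tensor M N (l i x \<odot> b i) y)"
   using xy by (intro pure_finsum_left[OF M N]) (auto simp: vs_smult[OF M])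
  also have "\<dots> = (\<Oplus>\<^bsub>?T\<^esub>i\<in>I. \<Oplus>\<^bsub>?T\<^esub>j\<in>J. (l i x * m j y) \<odot>\<^bsub>?T\<^esub> pure_tensor M N (b i) (c j))"
  proof (intro T.M.finsum_cong' refl)
   fix i assume i: "i \<in> I"
   have "pure_tensor M N (l i x \<odot> b i) y = pure_tensor M N (l i x \<odot> b i) (\<Oplus>\<^bsub>N\<^esub>j\<in>J. m j y \<odot>\<^bsub>N\<^esub> c j)"
    using xy by (simp add: dual_systemD(4)[OF dN])
   also have "\<dots> = (\<Oplus>\<^bsub>?T\<^esub>j\<in>J. pure_tensor M N (l i x \<odot> b i) (m j y \<odot>\<^bsub>N\<^esub> c j))"
    using i by (intro pure_finsum_right[OF M N]) (auto simp: vs_smult[OF N] vs_smult[OF M])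
   also have "\<dots> = (\<Oplus>\<^bsub>?T\<^esub>j\<in>J. (l i x * m j y) \<odot>\<^bsub>?T\<^esub> pure_tensor M N (b i) (c j))"
    using i by (intro T.M.finsum_cong' refl) (auto simp: vs_smult[OF N] vs_smult[OF M]
      vs_smult[OF T] pure_closed[OF M N] pure_smult_left[OF M N] pure_smult_right[OF M N] vs_smult_assoc[OF T] mult.commute[of "l i x"])
   finally show "pure_tensor M N (l i x \<odot> b i) y = \<dots>" .
  qed (auto intro!: T.M.finsum_closed simp: vs_smult[OF T] pure_closed[OF M N])
  also have "\<dots> = (\<Oplus>\<^bsub>?T\<^esub>p\<in>I \<times> J. (l (fst p) x * m (snd p) y) \<odot>\<^bsub>?T\<^esub> pure_tensor M N (b (fst p)) (c (snd p)))"
   by (rule finsum_Times[OF T, symmetric]) (auto simp: vs_smult[OF T] pure_closed[OF M N])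
  also have "\<dots> = (\<Oplus>\<^bsub>?T\<^esub>p\<in>I \<times> J. tev (l (fst p)) (m (snd p)) (pure_tensor M N x y) \<odot>\<^bsub>?T\<^esub> pure_tensor M N (b (fst p)) (c (snd p)))"
   using xy by (intro T.M.finsum_cong' refl) (auto simp: vs_smult[OF T] pure_closed[OF M N] tev_pure[OF M N])
  finally show "(\<Oplus>\<^bsub>?T\<^esub>p\<in>I \<times> J. tev (l (fst p)) (m (snd p)) (pure_tensor M N x y) \<odot>\<^bsub>?T\<^esub> pure_tensor M N (b (fst p)) (c (snd p))) = pure_tensor M N x y"
   by simp
 qed (auto intro: linear_mapI)
 then show ?thesis
  unfolding dual_system_def by (auto intro!: linform_tev[OF M N] pure_closed[OF M N])
qed

lemma tensor_eqI:
 assumes M: "vspace M" and N: "vspace N" and f: "fin_dim M" "fin_dim N"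
  and s: "s \<in> carrier (tensor_space M N)" "t \<in> carrier (tensor_space M N)"
  and eq: "\<And>\<phi> \<psi>. linform M \<phi> \<Longrightarrow> linform N \<psi> \<Longrightarrow> tev \<phi> \<psi> s = tev \<phi> \<psi> t"
 shows "s = t"
proof -
 obtain I J :: "nat set" and b c l m where d: "dual_system M I b l" "dual_system N J c m"
  using f by (auto simp: fin_dim_def)
 show ?thesis
  by (rule dual_system_eqI[OF vspace_tensor[OF M N] dual_system_tensor[OF M N d] s])
   (auto intro!: eq dual_systemD(3)[OF d(1)] dual_systemD(3)[OF d(2)])
qed

text \<open>Coassociativity is an identity in a triple tensor product; the dual system of the inner
  tensor product serves as that of the second factor.\<close>

lemma tensor_eqI3:
 assumes M: "vspace M" and N: "vspace N" and P: "vspace P" and f: "fin_dim M" "fin_dim N" "fin_dim P"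
  and s: "s \<in> carrier (tensor_space M (tensor_space N P))" "t \<in> carrier (tensor_space M (tensor_space N P))"
  and eq: "\<And>\<phi> \<psi> \<chi>. linform M \<phi> \<Longrightarrow> linform N \<psi> \<Longrightarrow> linform P \<chi> \<Longrightarrow>
   tev \<phi> (tev \<psi> \<chi>) s = tev \<phi> (tev \<psi> \<chi>) t"
 shows "s = t"
proof -
 obtain I J K :: "nat set" and b c d l m n where
  d: "dual_system M I b l" "dual_system N J c m" "dual_system P K d n"
  using f by (auto simp: fin_dim_def)
 show ?thesis
  by (rule dual_system_eqI[OF vspace_tensor[OF M vspace_tensor[OF N P]]
     dual_system_tensor[OF M vspace_tensor[OF N P] d(1) dual_system_tensor[OF N P d(2,3)]] s])
   (auto intro!: eq dual_systemD(3)[OF d(1)] dual_systemD(3)[OF d(2)] dual_systemD(3)[OF d(3)])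
qed

section \<open>Maps of tensor products and the tensor product algebra\<close>

context
 fixes M :: "('k::field, 'a, 'm) module_scheme" and N :: "('k, 'b, 'n) module_scheme"
  and M' :: "('k, 'c, 'o) module_scheme" and N' :: "('k, 'd, 'p) module_scheme" and f g
 assumes M: "vspace M" and N: "vspace N" and M': "vspace M'" and N': "vspace N'"
  and f: "linear_map M M' f" and g: "linear_map N N' g"
begin

lemma bilin_tensor_map: "bilin M N (tensor_space M' N') (\<lambda>u v. pure_tensor M' N' (f u) (g v))"
 by (intro bilinI linear_mapI)
  (auto simp: linear_mapD[OF f] linear_mapD[OF g] pure_closed[OF M' N'] pure_add_left[OF M' N']
   pure_add_right[OF M' N'] pure_smult_left[OF M' N'] pure_smult_right[OF M' N'])

lemma tensor_map_linear: "linear_map (tensor_space M N) (tensor_space M' N') (tensor_map M' N' f g)"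
 unfolding tensor_map_def by (rule tensor_lift_linear[OF M N vspace_tensor[OF M' N'] bilin_tensor_map])

lemma tensor_map_pure:
 "x \<in> carrier M \<Longrightarrow> y \<in> carrier N \<Longrightarrow>
  tensor_map M' N' f g (pure_tensor M N x y) = pure_tensor M' N' (f x) (g y)"
 unfolding tensor_map_def by (rule tensor_lift_pure[OF M N vspace_tensor[OF M' N'] bilin_tensor_map])

lemma tev_tensor_map:
 assumes "linform M' \<phi>" "linform N' \<psi>" "t \<in> carrier (tensor_space M N)"
 shows "tev \<phi> \<psi> (tensor_map M' N' f g t) = tev (\<lambda>x. \<phi> (f x)) (\<lambda>y. \<psi> (g y)) t"
 using assms
 by (intro tev_eqI[OF M N, symmetric] linform_comp[OF tensor_map_linear] linform_tev[OF M' N']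
   linform_comp[OF f] linform_comp[OF g])
  (auto simp: tensor_map_pure tev_pure[OF M' N'] linear_mapD[OF f] linear_mapD[OF g])

end

context
 fixes M :: "('k::field, 'a, 'm) module_scheme"
 assumes M: "vspace M"
begin

lemma
 defines "MM \<equiv> tensor_space M M"
 defines "T \<equiv> tensor_space M MM"
 shows bilin_assoc: "bilin MM M T (\<lambda>t w. tensor_lift T (\<lambda>u v. pure_tensor M MM u (pure_tensor M M v w)) t)"
  and assoc_inner_pure: "u \<in> carrier M \<Longrightarrow> v \<in> carrier M \<Longrightarrow> w \<in> carrier M \<Longrightarrow>
   tensor_lift T (\<lambda>u v. pure_tensor M MM u (pure_tensor M M v w)) (pure_tensor M M u v) =
   pure_tensor M MM u (pure_tensor M M v w)"
proof -
 have MM: "vspace MM" unfolding MM_def by (rule vspace_tensor[OF M M])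
 have T: "vspace T" unfolding T_def by (rule vspace_tensor[OF M MM])
 note [simp] = pure_closed[OF M M, folded MM_def] pure_closed[OF M MM, folded T_def]
  pure_add_left[OF M M, folded MM_def] pure_add_right[OF M M, folded MM_def]
  pure_smult_left[OF M M, folded MM_def] pure_smult_right[OF M M, folded MM_def]
  pure_add_left[OF M MM, folded T_def] pure_add_right[OF M MM, folded T_def]
  pure_smult_left[OF M MM, folded T_def] pure_smult_right[OF M MM, folded T_def]
 have b: "bilin M M T (\<lambda>u v. pure_tensor M MM u (pure_tensor M M v w))" if "w \<in> carrier M" for w
  using that by (intro bilinI linear_mapI) auto
 show "bilin MM M T (\<lambda>t w. tensor_lift T (\<lambda>u v. pure_tensor M MM u (pure_tensor M M v w)) t)"
  by (rule tensor_lift_bilin[OF M M M T b, folded MM_def]) (auto intro!: linear_mapI)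
 show "tensor_lift T (\<lambda>u v. pure_tensor M MM u (pure_tensor M M v w)) (pure_tensor M M u v) =
   pure_tensor M MM u (pure_tensor M M v w)" if "u \<in> carrier M" "v \<in> carrier M" "w \<in> carrier M"
  by (rule tensor_lift_pure[OF M M T b]) (use that in auto)
qed

lemma tensor_assoc_linear:
 "linear_map (tensor_space (tensor_space M M) M) (tensor_space M (tensor_space M M)) (tensor_assoc M)"
 unfolding tensor_assoc_def Let_def
 by (rule tensor_lift_linear[OF vspace_tensor[OF M M] M vspace_tensor[OF M vspace_tensor[OF M M]] bilin_assoc])

lemma tensor_assoc_pure:
 "t \<in> carrier (tensor_space M M) \<Longrightarrow> w \<in> carrier M \<Longrightarrow>
  tensor_assoc M (pure_tensor (tensor_space M M) M t w) =
   tensor_lift (tensor_space M (tensor_space M M))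
    (\<lambda>u v. pure_tensor M (tensor_space M M) u (pure_tensor M M v w)) t"
 unfolding tensor_assoc_def Let_def
 by (rule tensor_lift_pure[OF vspace_tensor[OF M M] M vspace_tensor[OF M vspace_tensor[OF M M]] bilin_assoc])

text \<open>Through functionals the change of brackets becomes invisible, which is what turns
  coassociativity into associativity of a product of functionals.\<close>

lemma tev_tensor_assoc:
 assumes l: "linform M \<phi>" "linform M \<psi>" "linform M \<chi>"
  and s: "s \<in> carrier (tensor_space (tensor_space M M) M)"
 shows "tev \<phi> (tev \<psi> \<chi>) (tensor_assoc M s) = tev (tev \<phi> \<psi>) \<chi> s"
proof -
 let ?MM = "tensor_space M M"
 have MM: "vspace ?MM" by (rule vspace_tensor[OF M M])
 have T: "vspace (tensor_space M ?MM)" by (rule vspace_tensor[OF M MM])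
 have lt: "linform ?MM (tev \<phi> \<psi>)" "linform ?MM (tev \<psi> \<chi>)" using linform_tev[OF M M] l by auto
 have lf: "linform (tensor_space M ?MM) (tev \<phi> (tev \<psi> \<chi>))" by (rule linform_tev[OF M MM l(1) lt(2)])
 show ?thesis
 proof (rule tev_eqI[OF MM M linform_comp[OF tensor_assoc_linear lf] lt(1) l(3) s, symmetric])
  fix t w assume t: "t \<in> carrier ?MM" and w: "w \<in> carrier M"
  have lin: "linear_map ?MM (tensor_space M ?MM) (tensor_lift (tensor_space M ?MM) (\<lambda>u v. pure_tensor M ?MM u (pure_tensor M M v w)))"
   using bilinD(2)[OF bilin_assoc w] by simp
  \<comment> \<open>The tensor \<open>t\<close> need not be pure. For fixed \<open>w\<close> the
    inner lift is linear in \<open>t\<close>, and the scalar \<open>\<chi> w\<close> is absorbed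
    into the second functional.\<close>
  have "tev \<phi> (\<lambda>v. \<psi> v * \<chi> w) t = tev \<phi> (tev \<psi> \<chi>) (tensor_lift (tensor_space M ?MM) (\<lambda>u v. pure_tensor M ?MM u (pure_tensor M M v w)) t)"
   by (rule tev_eqI[OF M M linform_comp[OF lin lf] l(1) _ t])
    (use w l linform_scale[OF l(2), of "\<chi> w"] in \<open>auto simp: assoc_inner_pure tev_pure[OF M MM] tev_pure[OF M M] lt pure_closed[OF M M] mult.commute\<close>)
  moreover have "tev \<phi> (\<lambda>v. \<psi> v * \<chi> w) t = tev \<phi> \<psi> t * \<chi> w"
   using tev_scale_right[OF M M l(1,2) t, of "\<chi> w"] by (simp add: mult.commute)
  ultimately show "tev \<phi> \<psi> t * \<chi> w = tev \<phi> (tev \<psi> \<chi>) (tensor_assoc M (pure_tensor ?MM M t w))"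
   using t w by (simp add: tensor_assoc_pure)
 qed
qed

end

lemma
 fixes M (structure)
 assumes "k_algebra M"
 shows alg_vspace: "vspace M" and alg_ring: "ring M"
  and alg_one: "\<one> \<in> carrier M"
  and alg_mult: "x \<in> carrier M \<Longrightarrow> y \<in> carrier M \<Longrightarrow> x \<otimes> y \<in> carrier M"
  and alg_assoc: "x \<in> carrier M \<Longrightarrow> y \<in> carrier M \<Longrightarrow> z \<in> carrier M \<Longrightarrow>
    x \<otimes> y \<otimes> z = x \<otimes> (y \<otimes> z)"
  and alg_l_one: "x \<in> carrier M \<Longrightarrow> \<one> \<otimes> x = x"
  and alg_r_one: "x \<in> carrier M \<Longrightarrow> x \<otimes> \<one> = x"
  and alg_l_distr: "x \<in> carrier M \<Longrightarrow> y \<in> carrier M \<Longrightarrow> z \<in> carrier M \<Longrightarrow>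
    (x \<oplus> y) \<otimes> z = x \<otimes> z \<oplus> y \<otimes> z"
  and alg_r_distr: "x \<in> carrier M \<Longrightarrow> y \<in> carrier M \<Longrightarrow> z \<in> carrier M \<Longrightarrow>
    z \<otimes> (x \<oplus> y) = z \<otimes> x \<oplus> z \<otimes> y"
  and alg_smult_left: "x \<in> carrier M \<Longrightarrow> y \<in> carrier M \<Longrightarrow> (c \<odot> x) \<otimes> y = c \<odot> (x \<otimes> y)"
  and alg_smult_right: "x \<in> carrier M \<Longrightarrow> y \<in> carrier M \<Longrightarrow> x \<otimes> (c \<odot> y) = c \<odot> (x \<otimes> y)"
  and alg_l_null: "x \<in> carrier M \<Longrightarrow> \<zero> \<otimes> x = \<zero>"
  and alg_r_null: "x \<in> carrier M \<Longrightarrow> x \<otimes> \<zero> = \<zero>"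
proof -
 show "vspace M" "ring M" using assms by (auto simp: k_algebra_def)
 interpret ring M by fact
 show "\<one> \<in> carrier M" "x \<in> carrier M \<Longrightarrow> y \<in> carrier M \<Longrightarrow> x \<otimes> y \<in> carrier M"
  "x \<in> carrier M \<Longrightarrow> y \<in> carrier M \<Longrightarrow> z \<in> carrier M \<Longrightarrow>
    x \<otimes> y \<otimes> z = x \<otimes> (y \<otimes> z)"
  "x \<in> carrier M \<Longrightarrow> \<one> \<otimes> x = x" "x \<in> carrier M \<Longrightarrow> x \<otimes> \<one> = x"
  "x \<in> carrier M \<Longrightarrow> y \<in> carrier M \<Longrightarrow> z \<in> carrier M \<Longrightarrow>
    (x \<oplus> y) \<otimes> z = x \<otimes> z \<oplus> y \<otimes> z"
  "x \<in> carrier M \<Longrightarrow> y \<in> carrier M \<Longrightarrow> z \<in> carrier M \<Longrightarrow>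
    z \<otimes> (x \<oplus> y) = z \<otimes> x \<oplus> z \<otimes> y"
  "x \<in> carrier M \<Longrightarrow> \<zero> \<otimes> x = \<zero>" "x \<in> carrier M \<Longrightarrow> x \<otimes> \<zero> = \<zero>"
  by (auto simp: m_assoc l_distr r_distr)
 show "x \<in> carrier M \<Longrightarrow> y \<in> carrier M \<Longrightarrow> (c \<odot> x) \<otimes> y = c \<odot> (x \<otimes> y)"
  "x \<in> carrier M \<Longrightarrow> y \<in> carrier M \<Longrightarrow> x \<otimes> (c \<odot> y) = c \<odot> (x \<otimes> y)"
  using assms unfolding k_algebra_def k_algebra_axioms_def by auto
qed

lemma bilin_add:
 assumes "vspace M" "vspace N" "vspace W" "bilin M N W \<beta>" "bilin M N W \<gamma>"
 shows "bilin M N W (\<lambda>u v. \<beta> u v \<oplus>\<^bsub>W\<^esub> \<gamma> u v)"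
proof -
 interpret W: module base_ring W by fact
 note b = bilinD(1)[OF assms(4)] bilinD(1)[OF assms(5)] bilinD(2)[OF assms(4)] bilinD(2)[OF assms(5)]
 show ?thesis
  by (intro bilinI linear_mapI)
   (auto simp: linear_mapD(2,3)[OF b(1)] linear_mapD(2,3)[OF b(2)] linear_mapD(2,3)[OF b(3)] linear_mapD(2,3)[OF b(4)]
    bilinD(3)[OF assms(4)] bilinD(3)[OF assms(5)] vs_smult_r_distr[OF assms(3)] W.M.a_ac)
qed

lemma bilin_zero: "vspace W \<Longrightarrow> bilin M N W (\<lambda>u v. \<zero>\<^bsub>W\<^esub>)"
 by (intro bilinI linear_mapI) (auto simp: vs_zero vs_l_zero vs_smult_r_null)

lemma bilin_cong:
 assumes "vspace M" "vspace N" "bilin M N W \<beta>"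
  "\<And>u v. u \<in> carrier M \<Longrightarrow> v \<in> carrier N \<Longrightarrow> \<beta>' u v = \<beta> u v"
 shows "bilin M N W \<beta>'"
proof -
 note b = bilinD(1)[OF assms(3)] bilinD(2)[OF assms(3)]
 show ?thesis
  by (intro bilinI linear_mapI)
   (auto simp: assms(4) linear_mapD(2,3)[OF b(1)] linear_mapD(2,3)[OF b(2)] bilinD(3)[OF assms(3)]
    vs_add[OF assms(1)] vs_smult[OF assms(1)] vs_add[OF assms(2)] vs_smult[OF assms(2)])
qed

context
 fixes M :: "('k::field, 'a, 'm) module_scheme" (structure) and N :: "('k, 'b, 'n) module_scheme"
 assumes M: "k_algebra M" and N: "k_algebra N"
begin

lemmas vM = alg_vspace[OF M]
lemmas vN = alg_vspace[OF N]

lemmas alg_simps_tensor [simp] = pure_closed[OF vM vN] pure_add_left[OF vM vN] pure_add_right[OF vM vN]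
 pure_smult_left[OF vM vN] pure_smult_right[OF vM vN] alg_l_distr[OF M] alg_r_distr[OF M] alg_l_distr[OF N] alg_r_distr[OF N]
 alg_smult_left[OF M] alg_smult_right[OF M] alg_smult_left[OF N] alg_smult_right[OF N]
 alg_mult[OF M] alg_mult[OF N] alg_one[OF M] alg_one[OF N]
 alg_l_one[OF M] alg_l_one[OF N] alg_r_one[OF M] alg_r_one[OF N]
 vs_smult[OF vM] vs_smult[OF vN] vs_add[OF vM] vs_add[OF vN]

lemma bilin_mult_inner:
 assumes "u \<in> carrier M" "v \<in> carrier N"
 shows "bilin M N (tensor_space M N) (\<lambda>u' v'. pure_tensor M N (u \<otimes> u') (v \<otimes>\<^bsub>N\<^esub> v'))"
 using assms by (intro bilinI linear_mapI) auto

lemma bilin_mult_inner':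
 assumes "u' \<in> carrier M" "v' \<in> carrier N"
 shows "bilin M N (tensor_space M N) (\<lambda>u v. pure_tensor M N (u \<otimes> u') (v \<otimes>\<^bsub>N\<^esub> v'))"
 using assms by (intro bilinI linear_mapI) auto

lemma tensor_alg_simps:
 "carrier (tensor_alg M N) = carrier (tensor_space M N)"
 "\<zero>\<^bsub>tensor_alg M N\<^esub> = \<zero>\<^bsub>tensor_space M N\<^esub>"
 "add (tensor_alg M N) = add (tensor_space M N)"
 "Module.module.smult (tensor_alg M N) = Module.module.smult (tensor_space M N)"
 "\<one>\<^bsub>tensor_alg M N\<^esub> = pure_tensor M N \<one> \<one>\<^bsub>N\<^esub>"
 by (simp_all add: tensor_alg_def)

lemma vspace_tensor_alg: "vspace (tensor_alg M N)"
 by (rule vspace_cong[OF vspace_tensor[OF vM vN]]) (simp_all add: tensor_alg_simps)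

interpretation T: module base_ring "tensor_space M N" by (rule vspace_tensor[OF vM vN])

text \<open>The inner lift is linear in its tensor by the universal property, but its bilinearity in
  \<open>u\<close> and \<open>v\<close> for a fixed tensor is a separate matter, settled by
  induction on that tensor.\<close>

lemma bilin_tensor_mult:
 "bilin (tensor_space M N) (tensor_space M N) (tensor_space M N) (monoid.mult (tensor_alg M N))"
proof -
 let ?T = "tensor_space M N"
 have T: "vspace ?T" by (rule vspace_tensor[OF vM vN])
 let ?L = "\<lambda>u v t. tensor_lift ?T (\<lambda>u' v'. pure_tensor M N (u \<otimes> u') (v \<otimes>\<^bsub>N\<^esub> v')) t"
 have lin: "linear_map ?T ?T (?L u v)" if "u \<in> carrier M" "v \<in> carrier N" for u v
  using that by (intro tensor_lift_linear[OF vM vN T bilin_mult_inner])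
 have pure: "?L u v (pure_tensor M N x y) = pure_tensor M N (u \<otimes> x) (v \<otimes>\<^bsub>N\<^esub> y)"
  if "u \<in> carrier M" "v \<in> carrier N" "x \<in> carrier M" "y \<in> carrier N" for u v x y
  using that by (intro tensor_lift_pure[OF vM vN T bilin_mult_inner])
 have z: "?L u v \<zero>\<^bsub>?T\<^esub> = \<zero>\<^bsub>?T\<^esub>" if "u \<in> carrier M" "v \<in> carrier N" for u v
  using linear_map_zero[OF T T lin[OF that]] .
 have "bilin M N ?T (\<lambda>u v. ?L u v t)" if t: "t \<in> carrier ?T" for t
 proof (rule tensor_induct[OF vM vN t])
  show "bilin M N ?T (\<lambda>u v. ?L u v \<zero>\<^bsub>?T\<^esub>)"
   by (rule bilin_cong[OF vM vN bilin_zero[OF T]]) (simp add: z)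
  show "bilin M N ?T (\<lambda>u v. ?L u v (pure_tensor M N x y))" if "x \<in> carrier M" "y \<in> carrier N" for x y
   by (rule bilin_cong[OF vM vN bilin_mult_inner'[OF that]]) (simp add: pure that)
  show "bilin M N ?T (\<lambda>u v. ?L u v (s \<oplus>\<^bsub>?T\<^esub> t))" if "s \<in> carrier ?T" "t \<in> carrier ?T"
   "bilin M N ?T (\<lambda>u v. ?L u v s)" "bilin M N ?T (\<lambda>u v. ?L u v t)" for s t
   by (rule bilin_cong[OF vM vN bilin_add[OF vM vN T that(3,4)]]) (simp add: linear_mapD[OF lin] that)
 qed
 from tensor_lift_bilin[OF vM vN T T this lin]
 show ?thesis unfolding tensor_alg_def by simp
qed

lemma tensor_mult_pure:
 assumes "x \<in> carrier M" "y \<in> carrier N" "x' \<in> carrier M" "y' \<in> carrier N"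
 shows "pure_tensor M N x y \<otimes>\<^bsub>tensor_alg M N\<^esub> pure_tensor M N x' y' =
  pure_tensor M N (x \<otimes> x') (y \<otimes>\<^bsub>N\<^esub> y')"
proof -
 let ?T = "tensor_space M N"
 have T: "vspace ?T" by (rule vspace_tensor[OF vM vN])
 let ?L = "\<lambda>u v. tensor_lift ?T (\<lambda>u' v'. pure_tensor M N (u \<otimes> u') (v \<otimes>\<^bsub>N\<^esub> v')) (pure_tensor M N x' y')"
 have pure: "?L u v = pure_tensor M N (u \<otimes> x') (v \<otimes>\<^bsub>N\<^esub> y')"
  if "u \<in> carrier M" "v \<in> carrier N" for u v
  using that assms by (intro tensor_lift_pure[OF vM vN T bilin_mult_inner])
 have "bilin M N ?T ?L" using assms by (intro bilinI linear_mapI) (auto simp: pure)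
 from tensor_lift_pure[OF vM vN T this assms(1,2)] pure[OF assms(1,2)]
 show ?thesis by (simp add: tensor_alg_def)
qed

lemma k_algebra_tensor: "k_algebra (tensor_alg M N)"
proof -
 let ?T = "tensor_space M N" and ?A = "tensor_alg M N"
 have T: "vspace ?T" by (rule vspace_tensor[OF vM vN])
 note b = bilin_tensor_mult
 note m [simp] = bilinD(3)[OF b] linear_mapD(2,3)[OF bilinD(1)[OF b]] linear_mapD(2,3)[OF bilinD(2)[OF b]] tensor_mult_pure
 have z [simp]: "s \<otimes>\<^bsub>?A\<^esub> \<zero>\<^bsub>?T\<^esub> = \<zero>\<^bsub>?T\<^esub>" "\<zero>\<^bsub>?T\<^esub> \<otimes>\<^bsub>?A\<^esub> s = \<zero>\<^bsub>?T\<^esub>" if "s \<in> carrier ?T" for s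
  using linear_map_zero[OF T T bilinD(1)[OF b that]] linear_map_zero[OF T T bilinD(2)[OF b that]] by auto
 \<comment> \<open>Associativity by three inductions on tensors: the third factor becomes arbitrary
   here, then the second, then the first.\<close>
 have a1: "pure_tensor M N x y \<otimes>\<^bsub>?A\<^esub> pure_tensor M N x' y' \<otimes>\<^bsub>?A\<^esub> t = pure_tensor M N x y \<otimes>\<^bsub>?A\<^esub> (pure_tensor M N x' y' \<otimes>\<^bsub>?A\<^esub> t)"
  if "x \<in> carrier M" "y \<in> carrier N" "x' \<in> carrier M" "y' \<in> carrier N" "t \<in> carrier ?T" for x y x' y' t
  by (rule tensor_induct[OF vM vN that(5)]) (use that in \<open>auto simp: alg_assoc[OF M] alg_assoc[OF N]\<close>)
 have a2: "pure_tensor M N x y \<otimes>\<^bsub>?A\<^esub> s \<otimes>\<^bsub>?A\<^esub> t = pure_tensor M N x y \<otimes>\<^bsub>?A\<^esub> (s \<otimes>\<^bsub>?A\<^esub> t)"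
  if "x \<in> carrier M" "y \<in> carrier N" "s \<in> carrier ?T" "t \<in> carrier ?T" for x y s t
  by (rule tensor_induct[OF vM vN that(3)]) (use that a1 in \<open>auto simp del: tensor_mult_pure\<close>)
 have a3: "r \<otimes>\<^bsub>?A\<^esub> s \<otimes>\<^bsub>?A\<^esub> t = r \<otimes>\<^bsub>?A\<^esub> (s \<otimes>\<^bsub>?A\<^esub> t)"
  if "r \<in> carrier ?T" "s \<in> carrier ?T" "t \<in> carrier ?T" for r s t
  by (rule tensor_induct[OF vM vN that(1)]) (use that a2 in auto)
 have l: "pure_tensor M N \<one> \<one>\<^bsub>N\<^esub> \<otimes>\<^bsub>?A\<^esub> t = t" if "t \<in> carrier ?T" for t
  by (rule tensor_induct[OF vM vN that]) auto
 have r: "t \<otimes>\<^bsub>?A\<^esub> pure_tensor M N \<one> \<one>\<^bsub>N\<^esub> = t" if "t \<in> carrier ?T" for t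
  by (rule tensor_induct[OF vM vN that]) auto
 show ?thesis
  by (rule k_algebraI[OF vspace_tensor_alg]) (auto simp: tensor_alg_simps a3 l r)
qed

text \<open>Left multiplication by a pure tensor is moved onto the functionals. Products of explicit
  tensors are thereby computed inside the two factors, without touching cosets.\<close>

lemma tev_mult:
 assumes l: "linform M \<phi>" "linform N \<psi>" and uv: "u \<in> carrier M" "v \<in> carrier N" and t: "t \<in> carrier (tensor_space M N)"
 shows "tev \<phi> \<psi> (pure_tensor M N u v \<otimes>\<^bsub>tensor_alg M N\<^esub> t) = tev (\<lambda>x. \<phi> (u \<otimes> x)) (\<lambda>y. \<psi> (v \<otimes>\<^bsub>N\<^esub> y)) t"
proof -
 have L: "linform M (\<lambda>x. \<phi> (u \<otimes> x))" "linform N (\<lambda>y. \<psi> (v \<otimes>\<^bsub>N\<^esub> y))"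
  using uv by (auto intro!: linformI simp: linformD[OF l(1)] linformD[OF l(2)])
 have "linear_map (tensor_space M N) (tensor_space M N) (\<lambda>t. pure_tensor M N u v \<otimes>\<^bsub>tensor_alg M N\<^esub> t)"
  using bilinD(1)[OF bilin_tensor_mult] uv by simp
 from tev_eqI[OF vM vN linform_comp[OF this linform_tev[OF vM vN l]] L t]
 show ?thesis using uv by (simp add: tensor_mult_pure tev_pure[OF vM vN l])
qed

declare alg_simps_tensor [simp del]

end

section \<open>Convolution of linear forms on a coalgebra\<close>

text \<open>The product of the dual algebra of \<open>H\<close>.\<close>

definition conv :: "('k::field, 'a, 'm) bialg_scheme \<Rightarrow> ('a \<Rightarrow> 'k) \<Rightarrow> ('a \<Rightarrow> 'k) \<Rightarrow> 'a \<Rightarrow> 'k" where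
 "conv H \<phi> \<psi> x = tev \<phi> \<psi> (comul H x)"

lemma tev_list_sum:
 assumes M: "vspace M" and N: "vspace N" and l: "linform M \<phi>" "linform N \<psi>"
  and ts: "\<And>u v. (u, v) \<in> set ts \<Longrightarrow> u \<in> carrier M \<and> v \<in> carrier N"
 shows "list_sum (tensor_space M N) (map (\<lambda>(u, v). pure_tensor M N u v) ts) \<in> carrier (tensor_space M N)"
  and "tev \<phi> \<psi> (list_sum (tensor_space M N) (map (\<lambda>(u, v). pure_tensor M N u v) ts)) =
   (\<Sum>(u, v)\<leftarrow>ts. \<phi> u * \<psi> v)"
proof -
 let ?s = "\<lambda>ts. list_sum (tensor_space M N) (map (\<lambda>(u, v). pure_tensor M N u v) ts)"
 have T: "vspace (tensor_space M N)" by (rule vspace_tensor[OF M N])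
 have "?s ts \<in> carrier (tensor_space M N) \<and> tev \<phi> \<psi> (?s ts) = (\<Sum>(u, v)\<leftarrow>ts. \<phi> u * \<psi> v)"
  using ts
 proof (induct ts)
  case Nil
  show ?case using vs_zero[OF T] linform_zero[OF T linform_tev[OF M N l]]
   by (simp add: list_sum_def)
 next
  case (Cons p ts)
  obtain u v where p: "p = (u, v)" by (cases p)
  have uv: "u \<in> carrier M" "v \<in> carrier N" using Cons(2) by (auto simp: p)
  have "?s ts \<in> carrier (tensor_space M N) \<and> tev \<phi> \<psi> (?s ts) = (\<Sum>(u, v)\<leftarrow>ts. \<phi> u * \<psi> v)"
   using Cons(2) by (intro Cons(1)) auto
  then show ?case using uv
   by (simp add: list_sum_def p pure_closed[OF M N] vs_add[OF T] linformD[OF linform_tev[OF M N l]]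
     tev_pure[OF M N l])
 qed
 then show "?s ts \<in> carrier (tensor_space M N)" "tev \<phi> \<psi> (?s ts) = (\<Sum>(u, v)\<leftarrow>ts. \<phi> u * \<psi> v)"
  by auto
qed

text \<open>In finite dimension a coalgebra structure is the same as a unital associative product on
  the dual; \<open>conv_assoc\<close> and \<open>conv_counit\<close> below are the opposite
  direction.\<close>

lemma k_coalgebraI:
 fixes H :: "('k::field, 'a, 'm) bialg_scheme" (structure)
 assumes V: "vspace H" and fd: "fin_dim H"
  and c: "linear_map H (tensor_space H H) (comul H)" and e: "linform H (counit H)"
  and a: "\<And>\<phi> \<psi> \<chi> x. linform H \<phi> \<Longrightarrow> linform H \<psi> \<Longrightarrow> linform H \<chi> \<Longrightarrow> x \<in> carrier H \<Longrightarrow>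
    conv H (conv H \<phi> \<psi>) \<chi> x = conv H \<phi> (conv H \<psi> \<chi>) x"
  and l: "\<And>\<phi> x. linform H \<phi> \<Longrightarrow> x \<in> carrier H \<Longrightarrow> conv H (counit H) \<phi> x = \<phi> x"
  and r: "\<And>\<phi> x. linform H \<phi> \<Longrightarrow> x \<in> carrier H \<Longrightarrow> conv H \<phi> (counit H) x = \<phi> x"
 shows "k_coalgebra H"
proof (intro k_coalgebra.intro V k_coalgebra_axioms.intro c)
 fix x assume x: "x \<in> carrier H"
 let ?T = "tensor_space H H"
 have T: "vspace ?T" by (rule vspace_tensor[OF V V])
 have cx: "comul H x \<in> carrier ?T" using linear_mapD(1)[OF c x] .
 have id: "linear_map H H (\<lambda>v. v)" by (intro linear_mapI) auto
 have cl: "tensor_map ?T H (comul H) (\<lambda>v. v) (comul H x) \<in> carrier (tensor_space ?T H)"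
  by (rule linear_mapD(1)[OF tensor_map_linear[OF V V T V c id] cx])
 have cr: "tensor_map H ?T (\<lambda>v. v) (comul H) (comul H x) \<in> carrier (tensor_space H ?T)"
  by (rule linear_mapD(1)[OF tensor_map_linear[OF V V V T id c] cx])
 show "tensor_assoc H (tensor_map ?T H (comul H) (\<lambda>v. v) (comul H x)) =
   tensor_map H ?T (\<lambda>u. u) (comul H) (comul H x)"
 proof (rule tensor_eqI3[OF V V V fd fd fd linear_mapD(1)[OF tensor_assoc_linear[OF V] cl] cr])
  fix \<phi> \<psi> \<chi> assume f: "linform H \<phi>" "linform H \<psi>" "linform H \<chi>"
  show "tev \<phi> (tev \<psi> \<chi>) (tensor_assoc H (tensor_map ?T H (comul H) (\<lambda>v. v) (comul H x))) =
   tev \<phi> (tev \<psi> \<chi>) (tensor_map H ?T (\<lambda>v. v) (comul H) (comul H x))"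
   using a[OF f x]
   by (simp add: tev_tensor_assoc[OF V f cl] tev_tensor_map[OF V V T V c id linform_tev[OF V V f(1,2)] f(3) cx]
     tev_tensor_map[OF V V V T id c f(1) linform_tev[OF V V f(2,3)] cx] conv_def[abs_def])
 qed
 have bl: "bilin H H H (\<lambda>u v. counit H u \<odot> v)" "bilin H H H (\<lambda>u v. counit H v \<odot> u)"
  by (intro bilinI linear_mapI; simp add: linformD[OF e] vs_smult[OF V] vs_smult_l_distr[OF V]
    vs_smult_r_distr[OF V] vs_smult_assoc[OF V, symmetric] mult.commute)+
 note tl = tensor_lift_linear[OF V V V bl(1)] tensor_lift_linear[OF V V V bl(2)]
 show "tensor_lift H (\<lambda>u v. counit H u \<odot> v) (comul H x) = x"
 proof (rule linform_eqI[OF V fd linear_mapD(1)[OF tl(1) cx] x])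
  fix \<phi> assume f: "linform H \<phi>"
  have "tev (counit H) \<phi> (comul H x) = \<phi> (tensor_lift H (\<lambda>u v. counit H u \<odot> v) (comul H x))"
   by (rule tev_eqI[OF V V linform_comp[OF tl(1) f] e f cx])
    (simp add: tensor_lift_pure[OF V V V bl(1)] linformD[OF f])
  then show "\<phi> (tensor_lift H (\<lambda>u v. counit H u \<odot> v) (comul H x)) = \<phi> x"
   using l[OF f x] by (simp add: conv_def)
 qed
 show "tensor_lift H (\<lambda>u v. counit H v \<odot> u) (comul H x) = x"
 proof (rule linform_eqI[OF V fd linear_mapD(1)[OF tl(2) cx] x])
  fix \<phi> assume f: "linform H \<phi>"
  have "tev \<phi> (counit H) (comul H x) = \<phi> (tensor_lift H (\<lambda>u v. counit H v \<odot> u) (comul H x))"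
   by (rule tev_eqI[OF V V linform_comp[OF tl(2) f] f e cx])
    (simp add: tensor_lift_pure[OF V V V bl(2)] linformD[OF f])
  then show "\<phi> (tensor_lift H (\<lambda>u v. counit H v \<odot> u) (comul H x)) = \<phi> x"
   using r[OF f x] by (simp add: conv_def)
 qed
qed (use linformD[OF e] in auto)

context
 fixes H :: "('k::field, 'a, 'm) bialg_scheme" (structure)
 assumes H: "k_coalgebra H"
begin

lemma coalg_vspace: "vspace H"
 using H by (simp add: k_coalgebra_def)

lemma coalg_comul_linear: "linear_map H (tensor_space H H) (comul H)"
 by (rule k_coalgebra.comul_linear[OF H])

lemma coalg_comul: "x \<in> carrier H \<Longrightarrow> comul H x \<in> carrier (tensor_space H H)"
 by (rule linear_mapD(1)[OF coalg_comul_linear])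

lemma coalg_counit: "linform H (counit H)"
 by (rule linformI) (auto simp: k_coalgebra.counit_add[OF H] k_coalgebra.counit_smult[OF H])

lemma linform_conv: "linform H \<phi> \<Longrightarrow> linform H \<psi> \<Longrightarrow> linform H (conv H \<phi> \<psi>)"
 unfolding conv_def[abs_def]
 by (rule linform_comp[OF coalg_comul_linear linform_tev[OF coalg_vspace coalg_vspace]])

lemma conv_assoc:
 assumes f: "linform H \<phi>" "linform H \<psi>" "linform H \<chi>" and x: "x \<in> carrier H"
 shows "conv H (conv H \<phi> \<psi>) \<chi> x = conv H \<phi> (conv H \<psi> \<chi>) x"
proof -
 let ?T = "tensor_space H H"
 note V = coalg_vspace and c = coalg_comul_linear and cx = coalg_comul[OF x]
 have T: "vspace ?T" by (rule vspace_tensor[OF V V])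
 have id: "linear_map H H (\<lambda>v. v)" by (intro linear_mapI) auto
 have cl: "tensor_map ?T H (comul H) (\<lambda>v. v) (comul H x) \<in> carrier (tensor_space ?T H)"
  by (rule linear_mapD(1)[OF tensor_map_linear[OF V V T V c id] cx])
 from k_coalgebra.coassoc[OF H x]
 have "tev \<phi> (tev \<psi> \<chi>) (tensor_assoc H (tensor_map ?T H (comul H) (\<lambda>v. v) (comul H x))) =
   tev \<phi> (tev \<psi> \<chi>) (tensor_map H ?T (\<lambda>v. v) (comul H) (comul H x))" by simp
 then show ?thesis
   by (simp add: tev_tensor_assoc[OF V f cl] tev_tensor_map[OF V V T V c id linform_tev[OF V V f(1,2)] f(3) cx]
     tev_tensor_map[OF V V V T id c f(1) linform_tev[OF V V f(2,3)] cx] conv_def[abs_def])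
qed

lemma conv_counit:
 assumes f: "linform H \<phi>" and x: "x \<in> carrier H"
 shows "conv H (counit H) \<phi> x = \<phi> x" "conv H \<phi> (counit H) x = \<phi> x"
proof -
 note V = coalg_vspace and e = coalg_counit and cx = coalg_comul[OF x]
 have bl: "bilin H H H (\<lambda>u v. counit H u \<odot> v)" "bilin H H H (\<lambda>u v. counit H v \<odot> u)"
  by (intro bilinI linear_mapI; simp add: linformD[OF e] vs_smult[OF V] vs_smult_l_distr[OF V]
    vs_smult_r_distr[OF V] vs_smult_assoc[OF V, symmetric] mult.commute)+
 note tl = tensor_lift_linear[OF V V V bl(1)] tensor_lift_linear[OF V V V bl(2)]
 have "tev (counit H) \<phi> (comul H x) = \<phi> (tensor_lift H (\<lambda>u v. counit H u \<odot> v) (comul H x))"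
  by (rule tev_eqI[OF V V linform_comp[OF tl(1) f] e f cx])
   (simp add: tensor_lift_pure[OF V V V bl(1)] linformD[OF f])
 then show "conv H (counit H) \<phi> x = \<phi> x" by (simp add: conv_def k_coalgebra.counit_left[OF H x])
 have "tev \<phi> (counit H) (comul H x) = \<phi> (tensor_lift H (\<lambda>u v. counit H v \<odot> u) (comul H x))"
  by (rule tev_eqI[OF V V linform_comp[OF tl(2) f] f e cx])
   (simp add: tensor_lift_pure[OF V V V bl(2)] linformD[OF f])
 then show "conv H \<phi> (counit H) x = \<phi> x" by (simp add: conv_def k_coalgebra.counit_right[OF H x])
qed

lemma conv_cong:
 assumes "linform H \<phi>" "linform H \<psi>" "linform H \<phi>'" "linform H \<psi>'" "x \<in> carrier H"
  "\<And>x. x \<in> carrier H \<Longrightarrow> \<phi> x = \<phi>' x" "\<And>y. y \<in> carrier H \<Longrightarrow> \<psi> y = \<psi>' y"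
 shows "conv H \<phi> \<psi> x = conv H \<phi>' \<psi>' x"
 unfolding conv_def
 using assms by (intro tev_cong[OF coalg_vspace coalg_vspace] coalg_comul) auto

lemma conv_linear_left:
 assumes "linform H \<phi>" "linform H \<phi>'" "linform H \<psi>" "x \<in> carrier H"
 shows "conv H (\<lambda>x. \<phi> x + \<phi>' x) \<psi> x = conv H \<phi> \<psi> x + conv H \<phi>' \<psi> x"
  "conv H (\<lambda>x. \<phi> x - \<phi>' x) \<psi> x = conv H \<phi> \<psi> x - conv H \<phi>' \<psi> x"
  "conv H (\<lambda>x. c * \<phi> x) \<psi> x = c * conv H \<phi> \<psi> x"
 unfolding conv_def using assms coalg_comul
 by (simp_all add: tev_add_left[OF coalg_vspace coalg_vspace] tev_diff_left[OF coalg_vspace coalg_vspace]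
   tev_scale_left[OF coalg_vspace coalg_vspace])

lemma conv_linear_right:
 assumes "linform H \<phi>" "linform H \<psi>" "linform H \<psi>'" "x \<in> carrier H"
 shows "conv H \<phi> (\<lambda>x. \<psi> x + \<psi>' x) x = conv H \<phi> \<psi> x + conv H \<phi> \<psi>' x"
  "conv H \<phi> (\<lambda>x. \<psi> x - \<psi>' x) x = conv H \<phi> \<psi> x - conv H \<phi> \<psi>' x"
  "conv H \<phi> (\<lambda>x. c * \<psi> x) x = c * conv H \<phi> \<psi> x"
 unfolding conv_def using assms coalg_comul
 by (simp_all add: tev_add_right[OF coalg_vspace coalg_vspace] tev_diff_right[OF coalg_vspace coalg_vspace]
   tev_scale_right[OF coalg_vspace coalg_vspace])

lemma conv_grouplike:
 assumes "g \<in> grouplikes H" "linform H \<phi>" "linform H \<psi>"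
 shows "conv H \<phi> \<psi> g = \<phi> g * \<psi> g"
 using assms by (simp add: conv_def grouplikes_def tev_pure[OF coalg_vspace coalg_vspace])

lemma comul_eqI:
 assumes "fin_dim H" "x \<in> carrier H" "t \<in> carrier (tensor_space H H)"
  "\<And>\<phi> \<psi>. linform H \<phi> \<Longrightarrow> linform H \<psi> \<Longrightarrow> conv H \<phi> \<psi> x = tev \<phi> \<psi> t"
 shows "comul H x = t"
 using assms by (intro tensor_eqI[OF coalg_vspace coalg_vspace] coalg_comul) (auto simp: conv_def)

end

section \<open>Annihilators\<close>

definition ann :: "('k::field, 'a, 'm) module_scheme \<Rightarrow> 'a set \<Rightarrow> ('a \<Rightarrow> 'k) set" where
 "ann M U = {\<phi>. linform M \<phi> \<and> (\<forall>u\<in>U. \<phi> u = 0)}"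

lemma annD: "\<phi> \<in> ann M U \<Longrightarrow> linform M \<phi>" "\<phi> \<in> ann M U \<Longrightarrow> u \<in> U \<Longrightarrow> \<phi> u = 0"
 by (auto simp: ann_def)

lemma annI: "linform M \<phi> \<Longrightarrow> (\<And>u. u \<in> U \<Longrightarrow> \<phi> u = 0) \<Longrightarrow> \<phi> \<in> ann M U"
 by (auto simp: ann_def)

lemma ann_antimono: "U \<subseteq> V \<Longrightarrow> \<phi> \<in> ann M V \<Longrightarrow> \<phi> \<in> ann M U"
 by (auto simp: ann_def)

lemma submodule_kernel:
 assumes M: "vspace M" and f: "linform M \<phi>"
 shows "submodule {x \<in> carrier M. \<phi> x = 0} base_ring M"
 by (rule submoduleI'[OF M])
  (auto simp: linformD[OF f] vs_add[OF M] vs_smult[OF M] vs_zero[OF M] linform_zero[OF M f])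

lemma ann_lin_span:
 assumes "vspace M" "S \<subseteq> carrier M" "linform M \<phi>" "\<And>s. s \<in> S \<Longrightarrow> \<phi> s = 0"
 shows "\<phi> \<in> ann M (lin_span M S)"
 using lin_span_least[OF submodule_kernel[OF assms(1,3)], of S] assms(2-4) by (intro annI) auto

section \<open>Projections onto subspaces and separation by linear forms\<close>

lemma vector_space_poly_mapping:
 "vector_space (\<lambda>c. Poly_Mapping.map ((*) c) :: ('i \<Rightarrow>\<^sub>0 'k::field) \<Rightarrow> ('i \<Rightarrow>\<^sub>0 'k))"
 by standard (auto intro!: poly_mapping_eqI simp: lookup_add algebra_simps)

text \<open>Left inverses on a subspace are found in vector spaces that fill a type, while
  \<open>M\<close> lives on a carrier. The coordinate map \<open>e\<close> embeds \<open>M\<close>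
  into finitely supported sequences, \<open>r\<close> retracts them onto \<open>M\<close>, and the
  projection found between is carried back.\<close>

lemma exists_projection:
 fixes M :: "('k::field, 'a, 'm) module_scheme" (structure)
 assumes M: "vspace M" and fd: "fin_dim M" and U: "submodule U base_ring M"
 obtains \<pi> where "linear_map M M \<pi>" "\<And>x. x \<in> carrier M \<Longrightarrow> \<pi> x \<in> U" "\<And>x. x \<in> U \<Longrightarrow> \<pi> x = x"
proof -
 interpret M: module base_ring M by (rule M)
 obtain I :: "nat set" and b l where d: "dual_system M I b l" using fd by (auto simp: fin_dim_def)
 note I = dual_systemD(1)[OF d]
 define sc where "sc = (\<lambda>c. Poly_Mapping.map ((*) c) :: (nat \<Rightarrow>\<^sub>0 'k) \<Rightarrow> _)"
 interpret V: vector_space sc unfolding sc_def by (rule vector_space_poly_mapping)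
 interpret VV: vector_space_pair sc sc by unfold_locales
 define e where "e x = (\<Sum>i\<in>I. Poly_Mapping.single i (l i x))" for x
 have e_lookup: "Poly_Mapping.lookup (e x) i = (if i \<in> I then l i x else 0)" for x i
  unfolding e_def lookup_sum using I by (auto simp: lookup_single when_def sum.delta)
 define r where "r p = (\<Oplus>i\<in>I. Poly_Mapping.lookup p i \<odot> b i)" for p
 have re: "r (e x) = x" if "x \<in> carrier M" for x
  unfolding r_def using that dual_systemD(2)[OF d]
  by (subst dual_systemD(4)[OF d that, symmetric]) (auto simp: e_lookup vs_smult[OF M] intro!: M.M.finsum_cong')
 have r_closed: "r p \<in> carrier M" for p
  unfolding r_def using dual_systemD(2)[OF d] by (intro M.M.finsum_closed) (auto simp: vs_smult[OF M])
 have r_add: "r (p + q) = r p \<oplus> r q" for p q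
 proof -
  have "r (p + q) = (\<Oplus>i\<in>I. Poly_Mapping.lookup p i \<odot> b i \<oplus> Poly_Mapping.lookup q i \<odot> b i)"
   unfolding r_def using dual_systemD(2)[OF d]
   by (intro M.M.finsum_cong') (auto simp: lookup_add vs_smult_l_distr[OF M] vs_smult[OF M] vs_add[OF M])
  then show ?thesis unfolding r_def using dual_systemD(2)[OF d]
   by (subst (asm) M.M.finsum_addf) (auto simp: vs_smult[OF M])
 qed
 have r_smult: "r (sc c p) = c \<odot> r p" for c p
 proof -
  have "r (sc c p) = (\<Oplus>i\<in>I. c \<odot> (Poly_Mapping.lookup p i \<odot> b i))"
   unfolding r_def sc_def using dual_systemD(2)[OF d]
   by (intro M.M.finsum_cong') (auto simp: vs_smult_assoc[OF M] vs_smult[OF M])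
  then show ?thesis unfolding r_def using dual_systemD(2)[OF d] I
    M.finsum_smult_ldistr[of I c "\<lambda>i. Poly_Mapping.lookup p i \<odot> b i"] by (auto simp: vs_smult[OF M])
 qed
 have e_add: "e (x \<oplus> y) = e x + e y" if "x \<in> carrier M" "y \<in> carrier M" for x y
  using that by (intro poly_mapping_eqI) (auto simp: e_lookup lookup_add linformD[OF dual_systemD(3)[OF d]])
 have e_smult: "e (c \<odot> x) = sc c (e x)" if "x \<in> carrier M" for x c
  using that by (intro poly_mapping_eqI) (auto simp: e_lookup sc_def linformD[OF dual_systemD(3)[OF d]])
 have Uc: "u \<in> carrier M" if "u \<in> U" for u using that sub_subset[OF U] by auto
 have e0: "e \<zero> = 0"
  by (intro poly_mapping_eqI) (auto simp: e_lookup linform_zero[OF M dual_systemD(3)[OF d]])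
 have S: "V.subspace (e ` U)"
 proof (rule V.subspaceI)
  show "0 \<in> e ` U" using sub_zero[OF U] e0 by (metis imageI)
  show "x + y \<in> e ` U" if "x \<in> e ` U" "y \<in> e ` U" for x y
  proof -
   obtain u v where "u \<in> U" "v \<in> U" "x = e u" "y = e v" using \<open>x \<in> e ` U\<close> \<open>y \<in> e ` U\<close> by auto
   then have "x + y = e (u \<oplus> v)" "u \<oplus> v \<in> U" using e_add Uc sub_add[OF U] by auto
   then show ?thesis by simp
  qed
  show "sc c x \<in> e ` U" if h: "x \<in> e ` U" for c x
  proof -
   obtain u where "u \<in> U" "x = e u" using h by auto
   then have "sc c x = e (c \<odot> u)" "c \<odot> u \<in> U" using e_smult Uc sub_smult[OF U] by auto
   then show ?thesis by simp
  qed
 qed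
 have "Vector_Spaces.linear sc sc (\<lambda>x. x)" by unfold_locales auto
 from VV.linear_exists_left_inverse_on[OF this S]
 obtain g where g: "range g \<subseteq> e ` U" "Vector_Spaces.linear sc sc g" "\<And>v. v \<in> e ` U \<Longrightarrow> g v = v" by auto
 show thesis
 proof (rule that[of "\<lambda>x. r (g (e x))"])
  show "linear_map M M (\<lambda>x. r (g (e x)))"
   by (intro linear_mapI)
    (auto simp: r_closed e_add e_smult VV.linear_add[OF g(2)] VV.linear_scale[OF g(2)] r_add r_smult)
  show "r (g (e x)) \<in> U" if "x \<in> carrier M" for x
  proof -
   obtain u where "u \<in> U" "g (e x) = e u" using g(1) by blast
   then show ?thesis using re Uc by simp
  qed
  show "r (g (e x)) = x" if "x \<in> U" for x
   using that g(3)[of "e x"] re Uc by auto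
 qed
qed

lemma linear_map_id_minus:
 fixes M (structure)
 assumes M: "vspace M" and f: "linear_map M M f" and g: "linear_map M M g"
 shows "linear_map M M (\<lambda>x. f x \<ominus> g x)"
proof -
 interpret M: module base_ring M by (rule M)
 have m: "x \<ominus> y = x \<oplus> (-1) \<odot> y" if "x \<in> carrier M" "y \<in> carrier M" for x y
  using that by (simp add: vs_smult_minus[OF M] a_minus_def)
 show ?thesis
  by (intro linear_mapI) (auto simp: m linear_mapD[OF f] linear_mapD[OF g] vs_add[OF M] vs_smult[OF M]
   vs_smult_r_distr[OF M] vs_smult_assoc[OF M, symmetric] M.M.a_ac)
qed

lemma linear_map_id: "linear_map M M (\<lambda>x. x)"
 by (intro linear_mapI) auto

text \<open>For a projection \<pi> onto \<open>U\<close> and any form \<phi>, the form \<phi> -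
  \<phi> \<pi> annihilates \<open>U\<close>. Hence all forms agree on \<open>x\<close> and
  \<open>\<pi> x\<close>.\<close>

lemma ann_sep:
 assumes M: "vspace M" and fd: "fin_dim M" and U: "submodule U base_ring M" and x: "x \<in> carrier M"
  and 0: "\<And>\<phi>. \<phi> \<in> ann M U \<Longrightarrow> \<phi> x = 0"
 shows "x \<in> U"
proof -
 obtain \<pi> where p: "linear_map M M \<pi>" "\<And>x. x \<in> carrier M \<Longrightarrow> \<pi> x \<in> U" "\<And>x. x \<in> U \<Longrightarrow> \<pi> x = x"
  using exists_projection[OF M fd U] by metis
 have Uc: "u \<in> carrier M" if "u \<in> U" for u using that sub_subset[OF U] by auto
 have "x = \<pi> x"
 proof (rule linform_eqI[OF M fd x])
  show "\<pi> x \<in> carrier M" using p(2) x Uc by auto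
  fix \<phi> assume f: "linform M \<phi>"
  have "(\<lambda>x. \<phi> x - \<phi> (\<pi> x)) \<in> ann M U"
   using p(3) by (intro annI linform_diff f linform_comp[OF p(1) f]) auto
  from 0[OF this] show "\<phi> x = \<phi> (\<pi> x)" by simp
 qed
 then show ?thesis using p(2)[OF x] by simp
qed

lemma ann_separates:
 assumes M: "vspace M" and fd: "fin_dim M" and U: "submodule U base_ring M" and x: "x \<in> carrier M" "x \<notin> U"
 obtains \<phi> where "\<phi> \<in> ann M U" "\<phi> x = 1"
proof -
 obtain \<psi> where p: "\<psi> \<in> ann M U" "\<psi> x \<noteq> 0" using ann_sep[OF M fd U x(1)] x(2) by blast
 have "(\<lambda>y. inverse (\<psi> x) * \<psi> y) \<in> ann M U"
  using p by (intro annI linform_scale) (auto dest: annD)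
 then show thesis by (rule that) (simp add: p(2))
qed

section \<open>The wedge of two subspaces as a common kernel\<close>

lemma tensor_sub_mono_pure:
 assumes M: "vspace M" and f: "linear_map M M f" and g: "linear_map M M g"
  and fU: "\<And>x. x \<in> carrier M \<Longrightarrow> f x \<in> U" and gV: "\<And>x. x \<in> carrier M \<Longrightarrow> g x \<in> V"
  and UV: "U \<subseteq> carrier M" "V \<subseteq> carrier M" and t: "t \<in> carrier (tensor_space M M)"
 shows "tensor_map M M f g t \<in> tensor_sub M U V"
proof -
 let ?S = "tensor_sub M U V"
 have T: "vspace (tensor_space M M)" by (rule vspace_tensor[OF M M])
 have S: "submodule ?S base_ring (tensor_space M M)"
  unfolding tensor_sub_def by (rule submodule_lin_span[OF T]) (use UV in \<open>auto intro!: pure_closed[OF M M]\<close>)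
 note L = tensor_map_linear[OF M M M M f g]
 show ?thesis
 proof (rule tensor_induct[OF M M t])
  show "tensor_map M M f g \<zero>\<^bsub>tensor_space M M\<^esub> \<in> ?S"
   using linear_map_zero[OF T T L] sub_zero[OF S] by simp
  show "tensor_map M M f g (pure_tensor M M x y) \<in> ?S" if "x \<in> carrier M" "y \<in> carrier M" for x y
   unfolding tensor_sub_def using that fU gV
   by (intro subsetD[OF lin_span_superset]) (auto simp: tensor_map_pure[OF M M M M f g])
 qed (simp add: linear_mapD[OF L] sub_add[OF S])
qed

lemma tev_tensor_sub_zero:
 assumes M: "vspace M" and UV: "U \<subseteq> carrier M" "V \<subseteq> carrier M" and f: "linform M \<phi>" "linform M \<psi>"
  and 0: "\<And>u v. u \<in> U \<Longrightarrow> v \<in> V \<Longrightarrow> \<phi> u * \<psi> v = 0" and t: "t \<in> tensor_sub M U V"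
 shows "t \<in> carrier (tensor_space M M)" "tev \<phi> \<psi> t = 0"
proof -
 have "tensor_sub M U V \<subseteq> {t \<in> carrier (tensor_space M M). tev \<phi> \<psi> t = 0}"
  unfolding tensor_sub_def
  by (rule lin_span_least[OF submodule_kernel[OF vspace_tensor[OF M M] linform_tev[OF M M f]]])
   (use UV 0 in \<open>auto simp: subset_iff tev_pure[OF M M f] pure_closed[OF M M]\<close>)
 then show "t \<in> carrier (tensor_space M M)" "tev \<phi> \<psi> t = 0" using t by auto
qed

text \<open>With projections p and q onto \<open>U\<close> and \<open>V\<close>, the identity of the
  tensor square is the sum of (1 - p) \<otimes> (1 - q), (1 - p) \<otimes> q and p \<otimes> 1. The
  first summand kills \<open>t\<close>, because its forms lie in the two annihilators; the other two
  land in the two subspaces.\<close>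

lemma tensor_sub_wedge_iff:
 assumes M: "vspace M" and fd: "fin_dim M" and U: "submodule U base_ring M" and V: "submodule V base_ring M"
  and t: "t \<in> carrier (tensor_space M M)"
 shows "t \<in> tensor_sub M (carrier M) V <+>\<^bsub>tensor_space M M\<^esub> tensor_sub M U (carrier M) \<longleftrightarrow>
  (\<forall>\<phi>\<in>ann M U. \<forall>\<psi>\<in>ann M V. tev \<phi> \<psi> t = 0)"
proof
 have T: "vspace (tensor_space M M)" by (rule vspace_tensor[OF M M])
 note Uc = sub_subset[OF U] and Vc = sub_subset[OF V]
 assume "t \<in> tensor_sub M (carrier M) V <+>\<^bsub>tensor_space M M\<^esub> tensor_sub M U (carrier M)"
 then obtain r s where rs: "r \<in> tensor_sub M (carrier M) V" "s \<in> tensor_sub M U (carrier M)"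
  "t = r \<oplus>\<^bsub>tensor_space M M\<^esub> s" by (auto simp: set_add_def' )
 show "\<forall>\<phi>\<in>ann M U. \<forall>\<psi>\<in>ann M V. tev \<phi> \<psi> t = 0"
 proof (intro ballI)
  fix \<phi> \<psi> assume f: "\<phi> \<in> ann M U" "\<psi> \<in> ann M V"
  note l = annD(1)[OF f(1)] annD(1)[OF f(2)]
  have "r \<in> carrier (tensor_space M M)" "tev \<phi> \<psi> r = 0"
   using tev_tensor_sub_zero[OF M order.refl Vc l _ rs(1)] annD(2)[OF f(2)] by auto
  moreover have "s \<in> carrier (tensor_space M M)" "tev \<phi> \<psi> s = 0"
   using tev_tensor_sub_zero[OF M Uc order.refl l _ rs(2)] annD(2)[OF f(1)] by auto
  ultimately show "tev \<phi> \<psi> t = 0" using rs(3) linformD(1)[OF linform_tev[OF M M l]] by simp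
 qed
next
 have T: "vspace (tensor_space M M)" by (rule vspace_tensor[OF M M])
 note Uc = sub_subset[OF U] and Vc = sub_subset[OF V]
 assume 0: "\<forall>\<phi>\<in>ann M U. \<forall>\<psi>\<in>ann M V. tev \<phi> \<psi> t = 0"
 obtain p where p: "linear_map M M p" "\<And>x. x \<in> carrier M \<Longrightarrow> p x \<in> U" "\<And>x. x \<in> U \<Longrightarrow> p x = x"
  using exists_projection[OF M fd U] by metis
 obtain q where q: "linear_map M M q" "\<And>x. x \<in> carrier M \<Longrightarrow> q x \<in> V" "\<And>x. x \<in> V \<Longrightarrow> q x = x"
  using exists_projection[OF M fd V] by metis
 let ?p' = "\<lambda>x. x \<ominus>\<^bsub>M\<^esub> p x"
 have p': "linear_map M M ?p'" by (rule linear_map_id_minus[OF M linear_map_id p(1)])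
 let ?r = "tensor_map M M ?p' q t" and ?s = "tensor_map M M p (\<lambda>x. x) t"
 have r: "?r \<in> tensor_sub M (carrier M) V"
  by (rule tensor_sub_mono_pure[OF M p' q(1) _ q(2) _ Vc t]) (auto intro: linear_mapD(1)[OF p'])
 have s: "?s \<in> tensor_sub M U (carrier M)"
  by (rule tensor_sub_mono_pure[OF M p(1) linear_map_id p(2) _ Uc _ t]) auto
 note rc = linear_mapD(1)[OF tensor_map_linear[OF M M M M p' q(1)] t]
 note sc = linear_mapD(1)[OF tensor_map_linear[OF M M M M p(1) linear_map_id] t]
 have "t = ?r \<oplus>\<^bsub>tensor_space M M\<^esub> ?s"
 proof (rule tensor_eqI[OF M M fd fd t vs_add[OF T rc sc]])
  fix \<phi> \<psi> assume f: "linform M \<phi>" "linform M \<psi>"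
  note fp = linform_comp[OF p(1) f(1)] and fp' = linform_comp[OF p' f(1)] and fq = linform_comp[OF q(1) f(2)]
  have e: "\<phi> (x \<ominus>\<^bsub>M\<^esub> p x) = \<phi> x - \<phi> (p x)" if "x \<in> carrier M" for x
   using that p(2) Uc by (intro linform_minus[OF M f(1)]) auto
  have "(\<lambda>x. \<phi> x - \<phi> (p x)) \<in> ann M U" "(\<lambda>x. \<psi> x - \<psi> (q x)) \<in> ann M V"
   using p(3) q(3) by (auto intro!: annI linform_diff f fp fq)
  with 0 have "tev (\<lambda>x. \<phi> x - \<phi> (p x)) (\<lambda>x. \<psi> x - \<psi> (q x)) t = 0" by auto
  then have "tev (\<lambda>x. \<phi> x - \<phi> (p x)) (\<lambda>x. \<psi> (q x)) t = tev (\<lambda>x. \<phi> x - \<phi> (p x)) \<psi> t"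
   by (simp add: tev_diff_right[OF M M linform_diff[OF f(1) fp] f(2) fq t])
  moreover have "tev (\<lambda>x. \<phi> (?p' x)) (\<lambda>x. \<psi> (q x)) t = tev (\<lambda>x. \<phi> x - \<phi> (p x)) (\<lambda>x. \<psi> (q x)) t"
   by (rule tev_cong[OF M M fp' fq linform_diff[OF f(1) fp] fq t]) (auto simp: e)
  ultimately show "tev \<phi> \<psi> t = tev \<phi> \<psi> (?r \<oplus>\<^bsub>tensor_space M M\<^esub> ?s)"
   by (simp add: linformD(1)[OF linform_tev[OF M M f] rc sc] tev_tensor_map[OF M M M M p' q(1) f t]
     tev_tensor_map[OF M M M M p(1) linear_map_id f t] tev_diff_left[OF M M f(1) fp f(2) t])
 qed
 then show "t \<in> tensor_sub M (carrier M) V <+>\<^bsub>tensor_space M M\<^esub> tensor_sub M U (carrier M)"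
  using r s unfolding set_add_def' by blast
qed

section \<open>The coradical filtration of a finite-dimensional pointed coalgebra\<close>

lemma previous_filtration_simps [simp]:
 "previous_filtration H 0 = {\<zero>\<^bsub>H\<^esub>}" "previous_filtration H (Suc n) = coradical_filtration H n"
 by (simp_all add: previous_filtration_def)

lemma list_sum_append:
 assumes "vspace W" "set xs \<subseteq> carrier W" "set ys \<subseteq> carrier W"
 shows "list_sum W (xs @ ys) = list_sum W xs \<oplus>\<^bsub>W\<^esub> list_sum W ys" "list_sum W xs \<in> carrier W"
proof -
 interpret W: module base_ring W by fact
 have c: "list_sum W xs \<in> carrier W" if "set xs \<subseteq> carrier W" for xs
  using that by (induct xs) (auto simp: list_sum_def)
 show "list_sum W xs \<in> carrier W" by (rule c[OF assms(2)])
 show "list_sum W (xs @ ys) = list_sum W xs \<oplus>\<^bsub>W\<^esub> list_sum W ys"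
  using assms(2)
 proof (induct xs)
  case Nil
  then show ?case using c[OF assms(3)] by (simp add: list_sum_def)
 next
  case (Cons a xs)
  then show ?case using c[OF assms(3)] c[of xs] by (simp add: list_sum_def W.M.a_assoc)
 qed
qed

context
 fixes H :: "('k::field, 'a, 'm) bialg_scheme" (structure)
 assumes H: "k_coalgebra H" and fd: "fin_dim H" and pointed: "pointed H"
begin

interpretation HM: module base_ring H by (rule coalg_vspace[OF H])

lemma grouplikes_subset: "grouplikes H \<subseteq> carrier H"
 by (auto simp: grouplikes_def)

lemma submodule_coradical: "submodule (coradical H) base_ring H"
 using pointed submodule_lin_span[OF coalg_vspace[OF H] grouplikes_subset] by (simp add: pointed_def)

text \<open>Pointedness enters here: the coradical is spanned by group-like elements, at which
  convolution is the pointwise product.\<close>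

lemma conv_coradical:
 assumes x: "x \<in> coradical H" and f: "linform H \<phi>" "linform H \<psi>" and a: "\<phi> \<in> ann H (coradical H) \<or> \<psi> \<in> ann H (coradical H)"
 shows "conv H \<phi> \<psi> x = 0"
proof -
 have "conv H \<phi> \<psi> \<in> ann H (coradical H)"
  unfolding pointed[unfolded pointed_def]
 proof (rule ann_lin_span[OF coalg_vspace[OF H] grouplikes_subset linform_conv[OF H f]])
  fix g assume g: "g \<in> grouplikes H"
  then have "g \<in> coradical H" unfolding pointed[unfolded pointed_def] by (rule subsetD[OF lin_span_superset])
  then have "\<phi> g = 0 \<or> \<psi> g = 0" using a annD(2) by metis
  then show "conv H \<phi> \<psi> g = 0" by (auto simp: conv_grouplike[OF H g f])
 qed
 then show ?thesis using x by (rule annD(2))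
qed

lemma submodule_zero: "submodule {\<zero>} base_ring H"
 by (rule submoduleI'[OF coalg_vspace[OF H]]) (auto simp: vs_smult_r_null[OF coalg_vspace[OF H]])

text \<open>The description by annihilators requires the previous term to be a subspace, and in turn
  shows that the next one is; so both facts come from one induction.\<close>

lemma
 shows submodule_coradical_filtration: "submodule (coradical_filtration H n) base_ring H"
  and coradical_filtration_Suc_iff: "x \<in> coradical_filtration H (Suc n) \<longleftrightarrow> x \<in> carrier H \<and>
   (\<forall>\<phi>\<in>ann H (coradical H). \<forall>\<psi>\<in>ann H (coradical_filtration H n). conv H \<phi> \<psi> x = 0)"
proof -
 have iff: "x \<in> coradical_filtration H (Suc n) \<longleftrightarrow> x \<in> carrier H \<and>
   (\<forall>\<phi>\<in>ann H (coradical H). \<forall>\<psi>\<in>ann H (coradical_filtration H n). conv H \<phi> \<psi> x = 0)"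
  if "submodule (coradical_filtration H n) base_ring H" for n x
  using tensor_sub_wedge_iff[OF coalg_vspace[OF H] fd submodule_coradical that coalg_comul[OF H, of x]]
  by (auto simp: conv_def)
 show s: "submodule (coradical_filtration H n) base_ring H" for n
 proof (induct n)
  case 0
  show ?case using submodule_coradical by simp
 next
  case (Suc n)
  show ?case
  proof (rule submoduleI'[OF coalg_vspace[OF H]])
   show "\<zero> \<in> coradical_filtration H (Suc n)"
    unfolding iff[OF Suc] using linform_zero[OF coalg_vspace[OF H] linform_conv[OF H]] by (auto dest!: annD(1))
  qed (unfold iff[OF Suc], auto simp: linformD[OF linform_conv[OF H annD(1) annD(1)]])
 qed
 show "x \<in> coradical_filtration H (Suc n) \<longleftrightarrow> x \<in> carrier H \<and>
   (\<forall>\<phi>\<in>ann H (coradical H). \<forall>\<psi>\<in>ann H (coradical_filtration H n). conv H \<phi> \<psi> x = 0)"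
  by (rule iff[OF s])
qed

lemma submodule_previous_filtration: "submodule (previous_filtration H n) base_ring H"
 by (cases n) (simp_all add: submodule_zero submodule_coradical_filtration)

lemmas filtration_closed = subsetD[OF sub_subset[OF submodule_coradical_filtration]]
 subsetD[OF sub_subset[OF submodule_previous_filtration]]

lemma coradical_filtration_mono_Suc: "coradical_filtration H n \<subseteq> coradical_filtration H (Suc n)"
proof (induct n)
 case 0
 show ?case
 proof
  fix x assume x: "x \<in> coradical_filtration H 0"
  show "x \<in> coradical_filtration H (Suc 0)"
   unfolding coradical_filtration_Suc_iff
   using x filtration_closed(1)[OF x] conv_coradical by (auto dest: annD(1))
 qed
next
 case (Suc n)
 show ?case
 proof
  fix x assume x: "x \<in> coradical_filtration H (Suc n)"
  then show "x \<in> coradical_filtration H (Suc (Suc n))"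
   using ann_antimono[OF Suc] unfolding coradical_filtration_Suc_iff by blast
 qed
qed

lemma coradical_filtration_mono: "m \<le> n \<Longrightarrow> coradical_filtration H m \<subseteq> coradical_filtration H n"
 using lift_Suc_mono_le[of "coradical_filtration H", OF coradical_filtration_mono_Suc] .

lemma previous_filtration_mono: "m \<le> n \<Longrightarrow> previous_filtration H m \<subseteq> previous_filtration H n"
proof (cases m)
 case 0
 then show ?thesis using sub_zero[OF submodule_previous_filtration] by auto
next
 case (Suc m')
 assume "m \<le> n"
 then obtain n' where "n = Suc n'" "m' \<le> n'" using Suc by (cases n) auto
 then show ?thesis using Suc coradical_filtration_mono by simp
qed

text \<open>The element (\<phi> \<otimes> id)(\<Delta> x). Fixing one leg of the comultiplication
  produces an element of \<open>H\<close>, to which membership criteria can be applied.\<close>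

lemma slice_left:
 assumes f: "linform H \<phi>" and x: "x \<in> carrier H"
 obtains z where "z \<in> carrier H" "\<And>\<psi>. linform H \<psi> \<Longrightarrow> \<psi> z = conv H \<phi> \<psi> x"
proof -
 note V = coalg_vspace[OF H]
 have b: "bilin H H H (\<lambda>u v. \<phi> u \<odot> v)"
  by (intro bilinI linear_mapI; simp add: linformD[OF f] vs_smult[OF V] vs_smult_l_distr[OF V]
    vs_smult_r_distr[OF V] vs_smult_assoc[OF V, symmetric] mult.commute)
 note tl = tensor_lift_linear[OF V V V b]
 show thesis
 proof (rule that[OF linear_mapD(1)[OF tl coalg_comul[OF H x]]])
  fix \<psi> assume p: "linform H \<psi>"
  show "\<psi> (tensor_lift H (\<lambda>u v. \<phi> u \<odot> v) (comul H x)) = conv H \<phi> \<psi> x"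
   unfolding conv_def
   by (rule tev_eqI[OF V V linform_comp[OF tl p] f p coalg_comul[OF H x], symmetric])
    (simp add: tensor_lift_pure[OF V V V b] linformD[OF p])
 qed
qed

lemma slice_right:
 assumes f: "linform H \<psi>" and x: "x \<in> carrier H"
 obtains z where "z \<in> carrier H" "\<And>\<phi>. linform H \<phi> \<Longrightarrow> \<phi> z = conv H \<phi> \<psi> x"
proof -
 note V = coalg_vspace[OF H]
 have b: "bilin H H H (\<lambda>u v. \<psi> v \<odot> u)"
  by (intro bilinI linear_mapI; simp add: linformD[OF f] vs_smult[OF V] vs_smult_l_distr[OF V]
    vs_smult_r_distr[OF V] vs_smult_assoc[OF V, symmetric] mult.commute)
 note tl = tensor_lift_linear[OF V V V b]
 show thesis
 proof (rule that[OF linear_mapD(1)[OF tl coalg_comul[OF H x]]])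
  fix \<phi> assume p: "linform H \<phi>"
  show "\<phi> (tensor_lift H (\<lambda>u v. \<psi> v \<odot> u) (comul H x)) = conv H \<phi> \<psi> x"
   unfolding conv_def
   by (rule tev_eqI[OF V V linform_comp[OF tl p] p f coalg_comul[OF H x], symmetric])
    (simp add: tensor_lift_pure[OF V V V b] linformD[OF p])
 qed
qed

text \<open>Equivalently, \<Delta> maps each filtration term into \<open>H\<close> tensor that term.
  The slice of \<open>x\<close> by \<phi> satisfies the wedge condition again, because convolving
  \<phi> with a form that kills the coradical gives such a form, and coassociativity transfers the
  condition from \<open>x\<close>.\<close>

lemma conv_filtration_right:
 assumes "x \<in> previous_filtration H n" "linform H \<phi>" "\<psi> \<in> ann H (previous_filtration H n)"
 shows "conv H \<phi> \<psi> x = 0"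
proof -
 note V = coalg_vspace[OF H]
 consider "n = 0" | "n = 1" | m where "n = Suc (Suc m)" by (metis One_nat_def not0_implies_Suc)
 then show ?thesis
 proof cases
  case 1
  then show ?thesis using assms linform_zero[OF V linform_conv[OF H assms(2) annD(1)[OF assms(3)]]] by simp
 next
  case 2
  then show ?thesis using assms conv_coradical[OF _ assms(2) annD(1)[OF assms(3)]] by simp
 next
  case 3
  note x = filtration_closed(2)[OF assms(1)]
  obtain z where z: "z \<in> carrier H" "\<And>\<psi>. linform H \<psi> \<Longrightarrow> \<psi> z = conv H \<phi> \<psi> x"
   using slice_left[OF assms(2) x] by metis
  have "z \<in> coradical_filtration H (Suc m)"
   unfolding coradical_filtration_Suc_iff
  proof (intro conjI ballI z(1))
   fix \<xi> \<mu> assume l: "\<xi> \<in> ann H (coradical H)" "\<mu> \<in> ann H (coradical_filtration H m)"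
   note ll = annD(1)[OF l(1)] annD(1)[OF l(2)]
   have "conv H \<xi> \<mu> z = conv H (conv H \<phi> \<xi>) \<mu> x"
    by (simp add: z(2)[OF linform_conv[OF H ll]] conv_assoc[OF H assms(2) ll x])
   moreover have "conv H \<phi> \<xi> \<in> ann H (coradical H)"
    using conv_coradical l(1) assms(2) ll by (intro annI linform_conv[OF H]) auto
   ultimately show "conv H \<xi> \<mu> z = 0"
    using assms(1) l(2) 3 coradical_filtration_Suc_iff by auto
  qed
  then have "\<psi> z = 0" using assms(3) 3 by (auto dest: annD(2))
  then show ?thesis using z(2)[OF annD(1)[OF assms(3)]] by simp
 qed
qed

text \<open>The product of forms vanishing on the terms of index a and b vanishes on the term of index
 a + b (in the indexing shifted by one): applying one of the two factors first lands, by
 coassociativity, in a smaller term of the filtration.\<close>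

lemma conv_filtration:
 assumes "x \<in> previous_filtration H (a + b)" "\<phi> \<in> ann H (previous_filtration H a)" "\<psi> \<in> ann H (previous_filtration H b)"
 shows "conv H \<phi> \<psi> x = 0"
 using assms
proof (induct a arbitrary: b \<phi> \<psi> x)
 case 0
 then show ?case using conv_filtration_right[of x b, OF _ annD(1)] by simp
next
 case (Suc a)
 note l = annD(1)[OF Suc(3)] annD(1)[OF Suc(4)]
 show ?case
 proof (cases a)
  case 0
  show ?thesis
  proof (cases b)
   case 0
   then show ?thesis using Suc(2,3) \<open>a = 0\<close> l conv_coradical by simp
  next
   case (Suc b')
   then show ?thesis using Suc.prems \<open>a = 0\<close> coradical_filtration_Suc_iff by auto
  qed
 next
  case a: (Suc a')
  note x = filtration_closed(2)[OF Suc(2)]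
  obtain z where z: "z \<in> carrier H" "\<And>\<phi>. linform H \<phi> \<Longrightarrow> \<phi> z = conv H \<phi> \<psi> x"
   using slice_right[OF l(2) x] by metis
  have "z \<in> coradical_filtration H (Suc a')"
   unfolding coradical_filtration_Suc_iff
  proof (intro conjI ballI z(1))
   fix \<xi> \<mu> assume lm: "\<xi> \<in> ann H (coradical H)" "\<mu> \<in> ann H (coradical_filtration H a')"
   note ll = annD(1)[OF lm(1)] annD(1)[OF lm(2)]
   have "conv H \<xi> \<mu> z = conv H \<xi> (conv H \<mu> \<psi>) x"
    by (simp add: z(2)[OF linform_conv[OF H ll]] conv_assoc[OF H ll l(2) x])
   moreover have "conv H \<mu> \<psi> \<in> ann H (previous_filtration H (a + b))"
    using Suc(1)[of _ b \<mu> \<psi>] lm(2) Suc(4) a by (intro annI linform_conv[OF H] ll l) auto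
   ultimately show "conv H \<xi> \<mu> z = 0"
    using Suc(2) lm(1) a coradical_filtration_Suc_iff[of x "a' + b"] by auto
  qed
  then have "\<phi> z = 0" using Suc(3) a by (auto dest: annD(2))
  then show ?thesis using z(2)[OF l(1)] by simp
 qed
qed

section \<open>Splitting the comultiplication along the filtration\<close>

definition filtered_decomposition :: "nat \<Rightarrow> (nat \<times> 'a \<times> 'a) list \<Rightarrow> bool" where
 "filtered_decomposition n ts \<longleftrightarrow> (\<forall>(i, u, v) \<in> set ts. i \<le> n \<and> u \<in> coradical_filtration H i \<and>
    v \<in> coradical_filtration H (n - i))"

abbreviation "decomposition_sum ts \<equiv> list_sum (tensor_space H H) (map (\<lambda>(i, u, v). pure_tensor H H u v) ts)"

lemma decomposition_closed:
 assumes "filtered_decomposition n ts"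
 shows "set (map (\<lambda>(i, u, v). pure_tensor H H u v) ts) \<subseteq> carrier (tensor_space H H)"
proof
 fix t assume "t \<in> set (map (\<lambda>(i, u, v). pure_tensor H H u v) ts)"
 then obtain i u v where iuv: "(i, u, v) \<in> set ts" "t = pure_tensor H H u v" by auto
 then have "u \<in> coradical_filtration H i" "v \<in> coradical_filtration H (n - i)"
  using assms by (auto simp: filtered_decomposition_def)
 then show "t \<in> carrier (tensor_space H H)"
  using filtration_closed(1) iuv(2) by (auto intro!: pure_closed[OF coalg_vspace[OF H] coalg_vspace[OF H]])
qed

lemma tensor_map_decomposition:
 assumes i: "i \<le> n" and f: "linear_map H H f" and g: "linear_map H H g"
  and fU: "\<And>x. x \<in> carrier H \<Longrightarrow> f x \<in> coradical_filtration H i"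
  and gV: "\<And>x. x \<in> carrier H \<Longrightarrow> g x \<in> coradical_filtration H (n - i)"
  and t: "t \<in> carrier (tensor_space H H)"
 shows "\<exists>ts. filtered_decomposition n ts \<and> tensor_map H H f g t = decomposition_sum ts"
proof -
 note V = coalg_vspace[OF H]
 have T: "vspace (tensor_space H H)" by (rule vspace_tensor[OF V V])
 note L = tensor_map_linear[OF V V V V f g]
 show ?thesis
 proof (rule tensor_induct[OF V V t])
  show "\<exists>ts. filtered_decomposition n ts \<and> tensor_map H H f g \<zero>\<^bsub>tensor_space H H\<^esub> = decomposition_sum ts"
   by (rule exI[of _ "[]"]) (simp add: filtered_decomposition_def list_sum_def linear_map_zero[OF T T L])
  show "\<exists>ts. filtered_decomposition n ts \<and> tensor_map H H f g (pure_tensor H H x y) = decomposition_sum ts"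
   if "x \<in> carrier H" "y \<in> carrier H" for x y
   using that i fU gV by (intro exI[of _ "[(i, f x, g y)]"])
    (auto simp: filtered_decomposition_def list_sum_def tensor_map_pure[OF V V V V f g]
     vs_r_zero[OF T] pure_closed[OF V V] linear_mapD[OF f] linear_mapD[OF g])
  fix s t assume st: "s \<in> carrier (tensor_space H H)" "t \<in> carrier (tensor_space H H)"
   "\<exists>ts. filtered_decomposition n ts \<and> tensor_map H H f g s = decomposition_sum ts"
   "\<exists>ts. filtered_decomposition n ts \<and> tensor_map H H f g t = decomposition_sum ts"
  then obtain ts ts' where ts: "filtered_decomposition n ts" "tensor_map H H f g s = decomposition_sum ts"
   "filtered_decomposition n ts'" "tensor_map H H f g t = decomposition_sum ts'" by auto
  have "filtered_decomposition n (ts @ ts')" using ts by (auto simp: filtered_decomposition_def)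
  moreover have "tensor_map H H f g (s \<oplus>\<^bsub>tensor_space H H\<^esub> t) = decomposition_sum (ts @ ts')"
   using list_sum_append(1)[OF T decomposition_closed[OF ts(1)] decomposition_closed[OF ts(3)]] ts
   by (simp add: linear_mapD[OF L] st)
  ultimately show "\<exists>ts. filtered_decomposition n ts \<and> tensor_map H H f g (s \<oplus>\<^bsub>tensor_space H H\<^esub> t) = decomposition_sum ts"
   by blast
 qed
qed

text \<open>Let P a project onto the term of shifted index a and let E a = P (a + 1) - P a. Then
  \<Delta> x is the sum over a \<le> n of (E a \<otimes> P (n + 1 - a)) \<Delta> x: the second
  projection may be dropped by \<open>conv_filtration\<close>, after which the sum telescopes. The
  projections for different a need not be compatible with each other.\<close>

lemma comul_decomposition:
 assumes x: "x \<in> coradical_filtration H n"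
 shows "\<exists>ts. filtered_decomposition n ts \<and> comul H x = decomposition_sum ts"
proof -
 note V = coalg_vspace[OF H]
 let ?T = "tensor_space H H"
 have T: "vspace ?T" by (rule vspace_tensor[OF V V])
 interpret T: module base_ring ?T by (rule T)
 have xc: "x \<in> carrier H" by (rule filtration_closed(1)[OF x])
 note cx = coalg_comul[OF H xc]
 have "\<exists>\<pi>. linear_map H H \<pi> \<and> (\<forall>x\<in>carrier H. \<pi> x \<in> previous_filtration H a) \<and>
  (\<forall>x\<in>previous_filtration H a. \<pi> x = x)" for a
  using exists_projection[OF V fd submodule_previous_filtration[of a]] by metis
 then obtain P where P: "\<And>a. linear_map H H (P a)" "\<And>a x. x \<in> carrier H \<Longrightarrow> P a x \<in> previous_filtration H a"
  "\<And>a x. x \<in> previous_filtration H a \<Longrightarrow> P a x = x" by metis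
 define E where "E a x = P (Suc a) x \<ominus> P a x" for a x
 have E: "linear_map H H (E a)" for a unfolding E_def by (rule linear_map_id_minus[OF V P(1) P(1)])
 have EC: "E a x \<in> coradical_filtration H a" if "x \<in> carrier H" for a x
  using P(2)[OF that, of "Suc a"] P(2)[OF that, of a] previous_filtration_mono[of a "Suc a"]
   sub_minus[OF V submodule_previous_filtration[of "Suc a"]] by (auto simp: E_def)
 let ?S = "\<lambda>a. tensor_map H H (E a) (P (Suc n - a)) (comul H x)"
 have Sc: "?S a \<in> carrier ?T" for a
  by (rule linear_mapD(1)[OF tensor_map_linear[OF V V V V E P(1)] cx])
 have "comul H x = (\<Oplus>\<^bsub>?T\<^esub>a\<in>{..<Suc n}. ?S a)"
 proof (rule comul_eqI[OF H fd xc])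
  show "(\<Oplus>\<^bsub>?T\<^esub>a\<in>{..<Suc n}. ?S a) \<in> carrier ?T" using Sc by (intro T.M.finsum_closed) auto
  fix \<phi> \<psi> assume f: "linform H \<phi>" "linform H \<psi>"
  have fP: "linform H (\<lambda>x. \<phi> (P a x))" "linform H (\<lambda>x. \<psi> (P a x))" "linform H (\<lambda>x. \<phi> (E a x))" for a
   using linform_comp[OF P(1)] linform_comp[OF E] f by auto
  have "tev \<phi> \<psi> (?S a) = conv H (\<lambda>x. \<phi> (P (Suc a) x)) \<psi> x - conv H (\<lambda>x. \<phi> (P a x)) \<psi> x"
   if "a \<in> {..<Suc n}" for a
  proof -
   have e: "\<phi> (E a y) = \<phi> (P (Suc a) y) - \<phi> (P a y)" if "y \<in> carrier H" for y
    unfolding E_def using linear_mapD(1)[OF P(1) that] by (intro linform_minus[OF V f(1)])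
   \<comment> \<open>The two forms vanish on the terms of shifted index \<open>a\<close> and
     \<open>Suc n - a\<close>, which add up to \<open>Suc n\<close>, the shifted index of the term
     that contains \<open>x\<close>.\<close>
   have 0: "conv H (\<lambda>x. \<phi> (E a x)) (\<lambda>x. \<psi> x - \<psi> (P (Suc n - a) x)) x = 0"
   proof (rule conv_filtration)
    show "x \<in> previous_filtration H (a + (Suc n - a))" using x that by simp
    show "(\<lambda>x. \<phi> (E a x)) \<in> ann H (previous_filtration H a)"
    proof (rule annI[OF fP(3)])
     fix u assume u: "u \<in> previous_filtration H a"
     moreover have "u \<in> previous_filtration H (Suc a)" using u previous_filtration_mono[of a "Suc a"] by auto
     ultimately show "\<phi> (E a u) = 0" using e[OF filtration_closed(2)[OF u]] P(3) by simp
    qed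
    show "(\<lambda>x. \<psi> x - \<psi> (P (Suc n - a) x)) \<in> ann H (previous_filtration H (Suc n - a))"
     using P(3) by (intro annI linform_diff f fP) auto
   qed
   have "tev \<phi> \<psi> (?S a) = conv H (\<lambda>x. \<phi> (E a x)) (\<lambda>x. \<psi> (P (Suc n - a) x)) x"
    unfolding conv_def by (rule tev_tensor_map[OF V V V V E P(1) f cx])
   also have "\<dots> = conv H (\<lambda>x. \<phi> (E a x)) \<psi> x"
    using 0 conv_linear_right(2)[OF H fP(3) f(2) fP(2) xc] by simp
   also have "\<dots> = conv H (\<lambda>x. \<phi> (P (Suc a) x) - \<phi> (P a x)) \<psi> x"
    by (rule conv_cong[OF H fP(3) f(2) linform_diff[OF fP(1) fP(1)] f(2) xc]) (auto simp: e)
   also have "\<dots> = conv H (\<lambda>x. \<phi> (P (Suc a) x)) \<psi> x - conv H (\<lambda>x. \<phi> (P a x)) \<psi> x"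
    by (rule conv_linear_left(2)[OF H fP(1) fP(1) f(2) xc])
   finally show ?thesis .
  qed
  then have "tev \<phi> \<psi> (\<Oplus>\<^bsub>?T\<^esub>a\<in>{..<Suc n}. ?S a) =
    (\<Sum>a<Suc n. conv H (\<lambda>x. \<phi> (P (Suc a) x)) \<psi> x - conv H (\<lambda>x. \<phi> (P a x)) \<psi> x)"
   using linform_finsum[OF T linform_tev[OF V V f], of "\<lambda>a. ?S a" "{..<Suc n}"] Sc by auto
  also have "\<dots> = conv H (\<lambda>x. \<phi> (P (Suc n) x)) \<psi> x - conv H (\<lambda>x. \<phi> (P 0 x)) \<psi> x"
   by (rule sum_lessThan_telescope)
  also have "conv H (\<lambda>x. \<phi> (P 0 x)) \<psi> x = conv H (\<lambda>x. 0 * \<phi> x) \<psi> x"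
   using P(2)[of _ 0] linform_zero[OF V f(1)] by (intro conv_cong[OF H fP(1) f(2) linform_scale[OF f(1)] f(2) xc]) auto
  also have "\<dots> = 0" using conv_linear_left(3)[OF H f(1) f(1) f(2) xc, of 0] by simp
  finally have "tev \<phi> \<psi> (\<Oplus>\<^bsub>?T\<^esub>a\<in>{..<Suc n}. ?S a) = conv H (\<lambda>x. \<phi> (P (Suc n) x)) \<psi> x" by simp
  \<comment> \<open>After telescoping, the left leg is projected onto the term of \<open>x\<close>
    itself, which changes nothing; index 0 imposes no condition on \<psi> beyond linearity.\<close>
  moreover have "conv H (\<lambda>x. \<phi> x - \<phi> (P (Suc n) x)) \<psi> x = 0"
   by (rule conv_filtration[of _ "Suc n" 0])
    (use x P(3) f linform_zero[OF V f(2)] in \<open>auto intro!: annI linform_diff fP\<close>)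
  ultimately show "conv H \<phi> \<psi> x = tev \<phi> \<psi> (\<Oplus>\<^bsub>?T\<^esub>a\<in>{..<Suc n}. ?S a)"
   using conv_linear_left(2)[OF H f(1) fP(1) f(2) xc] by simp
 qed
 moreover have *: "\<exists>ts. filtered_decomposition n ts \<and> (\<Oplus>\<^bsub>?T\<^esub>a\<in>{..<m}. ?S a) = decomposition_sum ts" if "m \<le> Suc n" for m
  using that
 proof (induct m)
  case 0
  show ?case by (rule exI[of _ "[]"]) (simp add: filtered_decomposition_def list_sum_def)
 next
  case (Suc m)
  then obtain ts where ts: "filtered_decomposition n ts" "(\<Oplus>\<^bsub>?T\<^esub>a\<in>{..<m}. ?S a) = decomposition_sum ts" by auto
  have "\<exists>ts. filtered_decomposition n ts \<and> ?S m = decomposition_sum ts"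
   by (rule tensor_map_decomposition[OF _ E P(1) EC _ cx])
    (use Suc(2) P(2)[of _ "Suc n - m"] in \<open>auto simp: Suc_diff_le\<close>)
  then obtain ts' where ts': "filtered_decomposition n ts'" "?S m = decomposition_sum ts'" by auto
  have "filtered_decomposition n (ts' @ ts)" using ts ts' by (auto simp: filtered_decomposition_def)
  moreover have "(\<Oplus>\<^bsub>?T\<^esub>a\<in>insert m {..<m}. ?S a) = ?S m \<oplus>\<^bsub>?T\<^esub> (\<Oplus>\<^bsub>?T\<^esub>a\<in>{..<m}. ?S a)"
   using Sc by (intro T.M.finsum_insert) auto
  then have "(\<Oplus>\<^bsub>?T\<^esub>a\<in>{..<Suc m}. ?S a) = decomposition_sum (ts' @ ts)"
   using list_sum_append(1)[OF T decomposition_closed[OF ts'(1)] decomposition_closed[OF ts(1)]] ts ts'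
   by (simp add: lessThan_Suc)
  ultimately show ?case by blast
 qed
 ultimately show ?thesis using *[of "Suc n"] by simp
qed

end

lemma
 fixes M (structure)
 assumes "vspace M"
 shows vs_add_assoc: "x \<in> carrier M \<Longrightarrow> y \<in> carrier M \<Longrightarrow> z \<in> carrier M \<Longrightarrow>
   x \<oplus> y \<oplus> z = x \<oplus> (y \<oplus> z)"
  and vs_add_comm: "x \<in> carrier M \<Longrightarrow> y \<in> carrier M \<Longrightarrow> x \<oplus> y = y \<oplus> x"
  and vs_l_neg: "x \<in> carrier M \<Longrightarrow> (-1) \<odot> x \<oplus> x = \<zero>"
proof -
 interpret M: module base_ring M by fact
 show "x \<in> carrier M \<Longrightarrow> y \<in> carrier M \<Longrightarrow> z \<in> carrier M \<Longrightarrow>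
   x \<oplus> y \<oplus> z = x \<oplus> (y \<oplus> z)" by (rule M.M.a_assoc)
 show "x \<in> carrier M \<Longrightarrow> y \<in> carrier M \<Longrightarrow> x \<oplus> y = y \<oplus> x" by (rule M.M.a_comm)
 show "x \<in> carrier M \<Longrightarrow> (-1) \<odot> x \<oplus> x = \<zero>"
  using vs_smult_minus[OF assms] M.M.l_neg by simp
qed

section \<open>The associated graded coalgebra\<close>

lemma a_r_coset_carrier_update [simp]: "N +>\<^bsub>M\<lparr>carrier := U\<rparr>\<^esub> x = N +>\<^bsub>M\<^esub> x"
 by (simp add: a_r_coset_def r_coset_def)

lemma tensor_space_cong:
 assumes "carrier M' = carrier M" "add M' = add M" "Module.module.smult M' = Module.module.smult M"
  "carrier N' = carrier N" "add N' = add N" "Module.module.smult N' = Module.module.smult N"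
 shows "tensor_space M' N' = tensor_space M N" "pure_tensor M' N' = pure_tensor M N"
 using assms
 by (simp_all add: tensor_space_def tensor_relations_def pure_tensor_def[abs_def] formal_pairs_def bilinearity_relations_def)

text \<open>The form on the n-th piece induced by \<phi>. It is independent of the representative
  when \<phi> vanishes on \<open>previous_filtration H n\<close>, and it is used only for such
  \<phi>.\<close>

definition gr_form :: "nat \<Rightarrow> ('a \<Rightarrow> 'k) \<Rightarrow> (nat \<Rightarrow> 'a set) \<Rightarrow> 'k::field" where
 "gr_form n \<phi> u = \<phi> (SOME x. x \<in> u n)"

lemma gr_alg_simps:
 "carrier (gr_alg H) = {f. (\<forall>n. f n \<in> carrier (gr_piece H n)) \<and> finite {n. f n \<noteq> \<zero>\<^bsub>gr_piece H n\<^esub>}}"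
 "\<zero>\<^bsub>gr_alg H\<^esub> = (\<lambda>n. \<zero>\<^bsub>gr_piece H n\<^esub>)"
 "u \<oplus>\<^bsub>gr_alg H\<^esub> v = (\<lambda>n. u n \<oplus>\<^bsub>gr_piece H n\<^esub> v n)"
 "c \<odot>\<^bsub>gr_alg H\<^esub> u = (\<lambda>n. c \<odot>\<^bsub>gr_piece H n\<^esub> u n)"
 "\<one>\<^bsub>gr_alg H\<^esub> = gr_class H 0 \<one>\<^bsub>H\<^esub>"
 by (simp_all add: gr_alg_def)

lemma gr_simps:
 "carrier (gr H) = carrier (gr_alg H)" "\<zero>\<^bsub>gr H\<^esub> = \<zero>\<^bsub>gr_alg H\<^esub>" "\<one>\<^bsub>gr H\<^esub> = \<one>\<^bsub>gr_alg H\<^esub>"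
 "add (gr H) = add (gr_alg H)" "monoid.mult (gr H) = monoid.mult (gr_alg H)"
 "Module.module.smult (gr H) = Module.module.smult (gr_alg H)"
 "counit (gr H) = (\<lambda>f. counit H (SOME x. x \<in> f 0))"
 by (simp_all add: gr_def module.defs)

lemma gr_tensor_space: "tensor_space (gr H) (gr H) = tensor_space (gr_alg H) (gr_alg H)"
 "pure_tensor (gr H) (gr H) = pure_tensor (gr_alg H) (gr_alg H)"
 by (rule tensor_space_cong; simp add: gr_simps)+

context
 fixes H :: "('k::field, 'a, 'm) bialg_scheme" (structure)
 assumes H: "k_coalgebra H" and fd: "fin_dim H" and pointed: "pointed H"
begin

abbreviation (input) "prevf \<equiv> previous_filtration H"
abbreviation (input) "corf \<equiv> coradical_filtration H"

lemma subC: "submodule (corf n) base_ring H"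
 by (rule submodule_coradical_filtration[OF H fd pointed])

lemma subF: "submodule (prevf n) base_ring H"
 by (rule submodule_previous_filtration[OF H fd pointed])

lemma F_subset_C: "prevf n \<subseteq> corf n"
 using previous_filtration_mono[OF H fd pointed, of n "Suc n"] by simp

lemma C_subset_F: "m < n \<Longrightarrow> corf m \<subseteq> prevf n"
 using previous_filtration_mono[OF H fd pointed, of "Suc m" n] by simp

lemma C_closed: "x \<in> corf n \<Longrightarrow> x \<in> carrier H"
 using sub_subset[OF subC] by auto

lemma vspace_C: "vspace (H\<lparr>carrier := corf n\<rparr>)"
 by (rule submodule.submodule_is_module[OF subC coalg_vspace[OF H]])

lemma submodule_F_C: "submodule (prevf n) base_ring (H\<lparr>carrier := corf n\<rparr>)"
 by (rule submoduleI'[OF vspace_C])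
  (use F_subset_C sub_zero[OF subF] sub_add[OF subF] sub_smult[OF subF] in auto)

lemma vspace_gr_piece: "vspace (gr_piece H n)"
 unfolding gr_piece_def by (rule vspace_quot[OF vspace_C submodule_F_C])

lemma gr_piece_zero: "\<zero>\<^bsub>gr_piece H n\<^esub> = prevf n"
 by (simp add: gr_piece_def quot_zero)

lemma gr_piece_carrier: "carrier (gr_piece H n) = {prevf n +> x | x. x \<in> corf n}"
 by (simp add: gr_piece_def quot_carrier)

lemma gr_piece_carrierI: "x \<in> corf n \<Longrightarrow> prevf n +> x \<in> carrier (gr_piece H n)"
 by (auto simp: gr_piece_carrier)

lemma gr_piece_add:
 "x \<in> corf n \<Longrightarrow> y \<in> corf n \<Longrightarrow> (prevf n +> x) \<oplus>\<^bsub>gr_piece H n\<^esub> (prevf n +> y) = prevf n +> (x \<oplus> y)"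
 using quot_add[OF vspace_C submodule_F_C, of x n y] by (simp add: gr_piece_def)

lemma gr_piece_smult:
 "x \<in> corf n \<Longrightarrow> c \<odot>\<^bsub>gr_piece H n\<^esub> (prevf n +> x) = prevf n +> (c \<odot> x)"
 using quot_smult[OF vspace_C submodule_F_C, of x n c] by (simp add: gr_piece_def)

lemma gr_coset_eq_iff:
 "x \<in> carrier H \<Longrightarrow> y \<in> carrier H \<Longrightarrow> prevf n +> x = prevf n +> y \<longleftrightarrow> x \<ominus> y \<in> prevf n"
 by (rule coset_eq_iff[OF coalg_vspace[OF H] subF])

lemma gr_coset_zero: "x \<in> prevf n \<Longrightarrow> prevf n +> x = prevf n"
proof -
 interpret HM: module base_ring H by (rule coalg_vspace[OF H])
 assume x: "x \<in> prevf n"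
 have "prevf n +> x = prevf n +> \<zero>"
  using x sub_subset[OF subF, of n] sub_minus[OF coalg_vspace[OF H] subF x sub_zero[OF subF]]
  by (subst gr_coset_eq_iff) auto
 then show ?thesis by (simp add: coset_zero[OF coalg_vspace[OF H] subF])
qed

section \<open>The graded vector space and its homogeneous forms\<close>

lemma vspace_gr: "vspace (gr_alg H)"
proof -
 note V = vspace_gr_piece
 have fin_add: "finite {n. u n \<oplus>\<^bsub>gr_piece H n\<^esub> v n \<noteq> \<zero>\<^bsub>gr_piece H n\<^esub>}"
  if "finite {n. u n \<noteq> \<zero>\<^bsub>gr_piece H n\<^esub>}" "finite {n. v n \<noteq> \<zero>\<^bsub>gr_piece H n\<^esub>}" for u v
  by (rule finite_subset[OF _ finite_UnI[OF that]]) (auto simp: vs_r_zero[OF V] vs_zero[OF V])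
 have fin_smult: "finite {n. c \<odot>\<^bsub>gr_piece H n\<^esub> u n \<noteq> \<zero>\<^bsub>gr_piece H n\<^esub>}"
  if "finite {n. u n \<noteq> \<zero>\<^bsub>gr_piece H n\<^esub>}" for c u
 proof (rule finite_subset[OF _ that], rule Collect_mono, rule impI, erule contrapos_nn)
  fix n assume "u n = \<zero>\<^bsub>gr_piece H n\<^esub>"
  then show "c \<odot>\<^bsub>gr_piece H n\<^esub> u n = \<zero>\<^bsub>gr_piece H n\<^esub>" using vs_smult_r_null[OF V[of n], of c] by simp
 qed
 have ag: "abelian_group (gr_alg H)"
 proof (rule abelian_groupI)
  fix u assume u: "u \<in> carrier (gr_alg H)"
  show "\<exists>y\<in>carrier (gr_alg H). y \<oplus>\<^bsub>gr_alg H\<^esub> u = \<zero>\<^bsub>gr_alg H\<^esub>"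
   using u by (intro bexI[of _ "\<lambda>n. (-1) \<odot>\<^bsub>gr_piece H n\<^esub> u n"])
    (simp_all add: gr_alg_simps vs_l_neg[OF V] vs_smult[OF V] fin_smult)
 next
  fix u v assume "u \<in> carrier (gr_alg H)" "v \<in> carrier (gr_alg H)"
  then show "u \<oplus>\<^bsub>gr_alg H\<^esub> v \<in> carrier (gr_alg H)"
   by (simp add: gr_alg_simps fin_add vs_add[OF V])
 qed (simp_all add: gr_alg_simps vs_zero[OF V] vs_l_zero[OF V] vs_add_assoc[OF V], simp add: vs_add_comm[OF V])
 show ?thesis
  by (rule vspaceI[OF ag]) (simp_all add: gr_alg_simps fin_smult vs_smult[OF V] vs_smult_l_distr[OF V]
    vs_smult_r_distr[OF V] vs_smult_assoc[OF V] vs_smult_one[OF V])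
qed

lemma gr_class_closed: "x \<in> corf n \<Longrightarrow> gr_class H n x \<in> carrier (gr_alg H)"
 by (simp add: gr_alg_simps gr_class_def gr_piece_carrierI vs_zero[OF vspace_gr_piece])

lemma gr_class_linear: "linear_map (H\<lparr>carrier := corf n\<rparr>) (gr_alg H) (gr_class H n)"
proof (intro linear_mapI)
 fix x assume x: "x \<in> carrier (H\<lparr>carrier := corf n\<rparr>)"
 show "gr_class H n x \<in> carrier (gr_alg H)" using x by (simp add: gr_class_closed)
 show "gr_class H n (c \<odot>\<^bsub>H\<lparr>carrier := corf n\<rparr>\<^esub> x) = c \<odot>\<^bsub>gr_alg H\<^esub> gr_class H n x" for c
  using x by (simp add: gr_alg_simps gr_class_def fun_eq_iff gr_piece_smult vs_smult_r_null[OF vspace_gr_piece])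
 fix y assume y: "y \<in> carrier (H\<lparr>carrier := corf n\<rparr>)"
 show "gr_class H n (x \<oplus>\<^bsub>H\<lparr>carrier := corf n\<rparr>\<^esub> y) = gr_class H n x \<oplus>\<^bsub>gr_alg H\<^esub> gr_class H n y"
  using x y by (simp add: gr_alg_simps gr_class_def fun_eq_iff gr_piece_add
   vs_l_zero[OF vspace_gr_piece] vs_zero[OF vspace_gr_piece])
qed

lemma gr_class_add: "x \<in> corf n \<Longrightarrow> y \<in> corf n \<Longrightarrow> gr_class H n (x \<oplus> y) = gr_class H n x \<oplus>\<^bsub>gr_alg H\<^esub> gr_class H n y"
 and gr_class_smult: "x \<in> corf n \<Longrightarrow> gr_class H n (c \<odot> x) = c \<odot>\<^bsub>gr_alg H\<^esub> gr_class H n x"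
 using linear_mapD(2,3)[OF gr_class_linear, of x n] by auto

lemma gr_class_eq_iff:
 assumes "x \<in> corf n" "y \<in> corf n"
 shows "gr_class H n x = gr_class H n y \<longleftrightarrow> x \<ominus> y \<in> prevf n"
proof -
 have "gr_class H n x = gr_class H n y \<longleftrightarrow> prevf n +> x = prevf n +> y"
  by (auto simp: gr_class_def fun_eq_iff)
 then show ?thesis using gr_coset_eq_iff[OF C_closed C_closed] assms by simp
qed

text \<open>A coset modulo the previous term consists of elements of the n-th term, since the former
  is contained in the latter; any choice of representative is therefore admissible.\<close>

lemma gr_rep:
 assumes "u \<in> carrier (gr_alg H)"
 shows "(SOME x. x \<in> u n) \<in> corf n" "u n = prevf n +> (SOME x. x \<in> u n)" "(SOME x. x \<in> u n) \<in> u n"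
proof -
 note V = coalg_vspace[OF H]
 obtain x where x: "x \<in> corf n" "u n = prevf n +> x" using assms by (auto simp: gr_alg_simps gr_piece_carrier)
 have "x \<in> u n" using x coset_self[OF V subF C_closed[OF x(1)]] by simp
 then show *: "(SOME x. x \<in> u n) \<in> u n" by (rule someI)
 define y where "y = (SOME x. x \<in> u n)"
 have y: "y \<in> carrier H" "y \<ominus> x \<in> prevf n"
  using * x mem_coset_iff[OF V subF C_closed[OF x(1)], of y] by (auto simp: y_def)
 interpret HM: module base_ring H by (rule V)
 have "y = (y \<ominus> x) \<oplus> x"
  using y C_closed[OF x(1)] by (simp add: HM.M.minus_eq HM.M.a_assoc HM.M.l_neg)
 then have "y \<in> corf n" using y F_subset_C x(1) sub_add[OF subC] by (metis subsetD)
 then show "(SOME x. x \<in> u n) \<in> corf n" by (simp add: y_def)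
 have "prevf n +> y = u n" using gr_coset_eq_iff[OF y(1) C_closed[OF x(1)]] y x by simp
 then show "u n = prevf n +> (SOME x. x \<in> u n)" by (simp add: y_def)
qed

lemma gr_form_coset:
 assumes f: "\<phi> \<in> ann H (prevf n)" and u: "u n = prevf n +> x" and x: "x \<in> carrier H"
 shows "gr_form n \<phi> u = \<phi> x"
proof -
 note V = coalg_vspace[OF H]
 have "x \<in> u n" using u coset_self[OF V subF x] by simp
 then have "(SOME x. x \<in> u n) \<in> u n" by (rule someI)
 then have y: "(SOME x. x \<in> u n) \<in> carrier H" "(SOME x. x \<in> u n) \<ominus> x \<in> prevf n"
  using u mem_coset_iff[OF V subF x] by auto
 have "\<phi> (SOME x. x \<in> u n) - \<phi> x = 0"
  using annD(2)[OF f y(2)] linform_minus[OF V annD(1)[OF f] y(1) x] by simp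
 then show ?thesis by (simp add: gr_form_def)
qed

lemma gr_form_class:
 assumes f: "\<phi> \<in> ann H (prevf n)" and x: "x \<in> corf m"
 shows "gr_form n \<phi> (gr_class H m x) = (if n = m then \<phi> x else 0)"
proof (cases "n = m")
 case True
 then show ?thesis using gr_form_coset[OF f _ C_closed[OF x], of "gr_class H m x"] by (simp add: gr_class_def)
next
 case False
 then show ?thesis
  using gr_form_coset[OF f _ vs_zero[OF coalg_vspace[OF H]], of "gr_class H m x"]
   linform_zero[OF coalg_vspace[OF H] annD(1)[OF f]]
  by (simp add: gr_class_def gr_piece_zero coset_zero[OF coalg_vspace[OF H] subF])
qed

lemma linform_gr_form:
 assumes f: "\<phi> \<in> ann H (prevf n)"
 shows "linform (gr_alg H) (gr_form n \<phi>)"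
proof (rule linformI)
 fix u assume u: "u \<in> carrier (gr_alg H)"
 note ru = gr_rep[OF u, of n]
 have 1: "gr_form n \<phi> u = \<phi> (SOME x. x \<in> u n)" by (simp add: gr_form_def)
 show "gr_form n \<phi> (c \<odot>\<^bsub>gr_alg H\<^esub> u) = c * gr_form n \<phi> u" for c
  using gr_form_coset[OF f, of "c \<odot>\<^bsub>gr_alg H\<^esub> u" "c \<odot> (SOME x. x \<in> u n)"] gr_piece_smult[OF ru(1), of c]
   ru(2) C_closed[OF ru(1)] linformD(2)[OF annD(1)[OF f]] 1
  by (simp add: gr_alg_simps vs_smult[OF coalg_vspace[OF H]])
 fix v assume v: "v \<in> carrier (gr_alg H)"
 note rv = gr_rep[OF v, of n]
 have 2: "gr_form n \<phi> v = \<phi> (SOME x. x \<in> v n)" by (simp add: gr_form_def)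
 have "u n \<oplus>\<^bsub>gr_piece H n\<^esub> v n = prevf n +> ((SOME x. x \<in> u n) \<oplus> (SOME x. x \<in> v n))"
  using gr_piece_add[OF ru(1) rv(1)] ru(2) rv(2) by simp
 then show "gr_form n \<phi> (u \<oplus>\<^bsub>gr_alg H\<^esub> v) = gr_form n \<phi> u + gr_form n \<phi> v"
  using gr_form_coset[OF f, of "u \<oplus>\<^bsub>gr_alg H\<^esub> v" "(SOME x. x \<in> u n) \<oplus> (SOME x. x \<in> v n)"]
   C_closed[OF ru(1)] C_closed[OF rv(1)] linformD(1)[OF annD(1)[OF f]] 1 2
  by (simp add: gr_alg_simps vs_add[OF coalg_vspace[OF H]])
qed

lemma gr_eqI:
 assumes u: "u \<in> carrier (gr_alg H)" and v: "v \<in> carrier (gr_alg H)"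
  and eq: "\<And>n \<phi>. \<phi> \<in> ann H (prevf n) \<Longrightarrow> gr_form n \<phi> u = gr_form n \<phi> v"
 shows "u = v"
proof
 fix n
 note V = coalg_vspace[OF H]
 note ru = gr_rep[OF u, of n] and rv = gr_rep[OF v, of n]
 note c = C_closed[OF ru(1)] C_closed[OF rv(1)]
 interpret HM: module base_ring H by (rule V)
 have "(SOME x. x \<in> u n) \<ominus> (SOME x. x \<in> v n) \<in> prevf n"
 proof (rule ann_sep[OF V fd subF])
  fix \<phi> assume f: "\<phi> \<in> ann H (prevf n)"
  show "\<phi> ((SOME x. x \<in> u n) \<ominus> (SOME x. x \<in> v n)) = 0"
   using eq[OF f] linform_minus[OF V annD(1)[OF f] c] by (simp add: gr_form_def)
 qed (use c in simp)
 then have "prevf n +> (SOME x. x \<in> u n) = prevf n +> (SOME x. x \<in> v n)"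
  using gr_coset_eq_iff[OF c] by simp
 then show "u n = v n" using ru(2) rv(2) by simp
qed

text \<open>Elements of the direct sum have finite support, so a finite spanning family leaves every
  piece zero from some degree on.\<close>

lemma filtration_stabilizes:
 assumes "fin_dim (gr_alg H)"
 obtains N where "\<And>n. N \<le> n \<Longrightarrow> corf n \<subseteq> prevf n"
proof -
 obtain I :: "nat set" and b l where d: "dual_system (gr_alg H) I b l" using assms by (auto simp: fin_dim_def)
 have "finite (\<Union>i\<in>I. {n. b i n \<noteq> \<zero>\<^bsub>gr_piece H n\<^esub>})"
  using dual_systemD(1,2)[OF d] by (auto simp: gr_alg_simps)
 then obtain N where N: "\<And>n. n \<in> (\<Union>i\<in>I. {n. b i n \<noteq> \<zero>\<^bsub>gr_piece H n\<^esub>}) \<Longrightarrow> n < N"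
  using finite_nat_set_iff_bounded by (metis (no_types, lifting))
 show thesis
 proof (rule that[of N], rule subsetI)
  fix n x assume n: "N \<le> n" and x: "x \<in> corf n"
  have b: "gr_form n \<phi> (b i) = 0" if "i \<in> I" "\<phi> \<in> ann H (prevf n)" for i \<phi>
  proof -
   have "b i n = \<zero>\<^bsub>gr_piece H n\<^esub>" using N[of n] n that by auto
   then have "b i n = prevf n +> \<zero>" by (simp add: gr_piece_zero coset_zero[OF coalg_vspace[OF H] subF])
   then show ?thesis
    using gr_form_coset[OF that(2) _ vs_zero[OF coalg_vspace[OF H]]]
     linform_zero[OF coalg_vspace[OF H] annD(1)[OF that(2)]] by simp
  qed
  show "x \<in> prevf n"
  proof (rule ann_sep[OF coalg_vspace[OF H] fd subF C_closed[OF x]])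
   fix \<phi> assume f: "\<phi> \<in> ann H (prevf n)"
   have "\<phi> x = gr_form n \<phi> (gr_class H n x)" using gr_form_class[OF f x] by simp
   also have "\<dots> = (\<Sum>i\<in>I. l i (gr_class H n x) * gr_form n \<phi> (b i))"
    by (rule linform_expand[OF vspace_gr d linform_gr_form[OF f] gr_class_closed[OF x]])
   also have "\<dots> = 0" using b[OF _ f] by simp
   finally show "\<phi> x = 0" .
  qed
 qed
qed

text \<open>In degree a, the forms \<open>l i\<close> are corrected by the projection P a so as to
  vanish on the previous term, and the vectors are the classes of P (a + 1) applied to
  \<open>b i\<close>. Applying P (n + 1) to the expansion of x - P n x reproduces the class of x.
  The family is highly redundant, but its coordinates are homogeneous forms, so such forms
  separate.\<close>

lemma gr_dual_system:
 assumes N: "\<And>n. N \<le> n \<Longrightarrow> corf n \<subseteq> prevf n"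
 obtains I :: "nat set" and b l where
  "dual_system (gr_alg H) ({..<N} \<times> I) b (\<lambda>p. gr_form (fst p) (l p))"
  "\<And>p. p \<in> {..<N} \<times> I \<Longrightarrow> l p \<in> ann H (prevf (fst p))"
proof -
 note V = coalg_vspace[OF H]
 interpret HM: module base_ring H by (rule V)
 interpret G: module base_ring "gr_alg H" by (rule vspace_gr)
 obtain I :: "nat set" and b l where d: "dual_system H I b l" using fd by (auto simp: fin_dim_def)
 have "\<exists>\<pi>. linear_map H H \<pi> \<and> (\<forall>x\<in>carrier H. \<pi> x \<in> prevf a) \<and> (\<forall>x\<in>prevf a. \<pi> x = x)" for a
  using exists_projection[OF V fd subF[of a]] by metis
 then obtain P where P: "\<And>a. linear_map H H (P a)" "\<And>a x. x \<in> carrier H \<Longrightarrow> P a x \<in> prevf a"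
  "\<And>a x. x \<in> prevf a \<Longrightarrow> P a x = x" by metis
 define m where "m = (\<lambda>p x. l (snd p) x - l (snd p) (P (fst p) x))"
 define c where "c = (\<lambda>p. gr_class H (fst p) (P (Suc (fst p)) (b (snd p))))"
 have m: "m p \<in> ann H (prevf (fst p))" if "p \<in> {..<N} \<times> I" for p
  unfolding m_def using that P(3)
  by (intro annI linform_diff dual_systemD(3)[OF d] linform_comp[OF P(1)]) auto
 have PC: "P (Suc (fst p)) (b (snd p)) \<in> corf (fst p)" if "p \<in> {..<N} \<times> I" for p
  using P(2)[of "b (snd p)" "Suc (fst p)"] dual_systemD(2)[OF d] that by auto
 have cc: "c p \<in> carrier (gr_alg H)" if "p \<in> {..<N} \<times> I" for p
  unfolding c_def by (rule gr_class_closed[OF PC[OF that]])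
 have "(\<Oplus>\<^bsub>gr_alg H\<^esub>p\<in>{..<N} \<times> I. gr_form (fst p) (m p) u \<odot>\<^bsub>gr_alg H\<^esub> c p) = u"
  if u: "u \<in> carrier (gr_alg H)" for u
 proof (rule gr_eqI[OF _ u])
  have Pi: "(\<lambda>p. gr_form (fst p) (m p) u \<odot>\<^bsub>gr_alg H\<^esub> c p) \<in> {..<N} \<times> I \<rightarrow> carrier (gr_alg H)"
   using cc by (auto simp: vs_smult[OF vspace_gr])
  show "(\<Oplus>\<^bsub>gr_alg H\<^esub>p\<in>{..<N} \<times> I. gr_form (fst p) (m p) u \<odot>\<^bsub>gr_alg H\<^esub> c p) \<in> carrier (gr_alg H)"
   using Pi by (rule vs_finsum[OF vspace_gr])
  fix n \<phi> assume f: "\<phi> \<in> ann H (prevf n)"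
  define x where "x = (SOME x. x \<in> u n)"
  have x: "x \<in> corf n" using gr_rep(1)[OF u] by (simp add: x_def)
  note xc = C_closed[OF x]
  have Fc: "y \<in> prevf a \<Longrightarrow> y \<in> carrier H" for a y using sub_subset[OF subF] by auto
  have "gr_form n \<phi> (\<Oplus>\<^bsub>gr_alg H\<^esub>p\<in>{..<N} \<times> I. gr_form (fst p) (m p) u \<odot>\<^bsub>gr_alg H\<^esub> c p) =
    (\<Sum>p\<in>{..<N} \<times> I. gr_form (fst p) (m p) u * gr_form n \<phi> (c p))"
   using linform_finsum[OF vspace_gr linform_gr_form[OF f] Pi]
   by (simp add: linformD(2)[OF linform_gr_form[OF f] cc])
  also have "\<dots> = (\<Sum>p\<in>{..<N} \<times> I. if n = fst p then m (n, snd p) x * \<phi> (P (Suc n) (b (snd p))) else 0)"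
  proof (intro sum.cong refl)
   fix p assume p: "p \<in> {..<N} \<times> I"
   have "gr_form (fst p) (m p) u = m p (SOME x. x \<in> u (fst p))" by (simp add: gr_form_def)
   then show "gr_form (fst p) (m p) u * gr_form n \<phi> (c p) = (if n = fst p then m (n, snd p) x * \<phi> (P (Suc n) (b (snd p))) else 0)"
    by (simp add: c_def gr_form_class[OF f PC[OF p]] x_def)
  qed
  also have "\<dots> = (\<Sum>a<N. \<Sum>i\<in>I. if n = a then m (n, i) x * \<phi> (P (Suc n) (b i)) else 0)"
   by (simp add: sum.cartesian_product split_def)
  also have "\<dots> = (\<Sum>a<N. if n = a then (\<Sum>i\<in>I. m (n, i) x * \<phi> (P (Suc n) (b i))) else 0)"
   by (intro sum.cong) auto
  also have "\<dots> = (if n < N then (\<Sum>i\<in>I. m (n, i) x * \<phi> (P (Suc n) (b i))) else 0)"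
   by (simp add: sum.delta')
  also have "\<dots> = \<phi> x"
  proof (cases "n < N")
   case True
   have PF: "P n x \<in> prevf n" "P n x \<in> carrier H" using P(2)[OF xc] Fc by auto
   have "(\<Sum>i\<in>I. m (n, i) x * \<phi> (P (Suc n) (b i))) = (\<Sum>i\<in>I. l i (x \<ominus> P n x) * \<phi> (P (Suc n) (b i)))"
    by (intro sum.cong refl) (simp add: m_def linform_minus[OF V dual_systemD(3)[OF d] xc PF(2)])
   also have "\<dots> = \<phi> (P (Suc n) (x \<ominus> P n x))"
    using xc PF by (intro linform_expand[OF V d, symmetric] linform_comp[OF P(1)] annD(1)[OF f]) auto
   also have "P (Suc n) (x \<ominus> P n x) = x \<ominus> P n x"
    using sub_minus[OF V subC x] PF(1) F_subset_C by (intro P(3)) auto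
   also have "\<phi> (x \<ominus> P n x) = \<phi> x"
    using annD(2)[OF f PF(1)] by (simp add: linform_minus[OF V annD(1)[OF f] xc PF(2)])
   finally show ?thesis using True by simp
  next
   case False
   then show ?thesis using N[of n] x annD(2)[OF f] by auto
  qed
  finally show "gr_form n \<phi> (\<Oplus>\<^bsub>gr_alg H\<^esub>p\<in>{..<N} \<times> I. gr_form (fst p) (m p) u \<odot>\<^bsub>gr_alg H\<^esub> c p) = gr_form n \<phi> u"
   by (simp add: gr_form_def x_def)
 qed
 then have "dual_system (gr_alg H) ({..<N} \<times> I) c (\<lambda>p. gr_form (fst p) (m p))"
  unfolding dual_system_def using dual_systemD(1)[OF d] cc m linform_gr_form by auto
 then show thesis using m by (rule that)
qed

lemma gr_tensor_eqI:
 assumes N: "\<And>n. N \<le> n \<Longrightarrow> corf n \<subseteq> prevf n"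
  and s: "s \<in> carrier (tensor_space (gr_alg H) (gr_alg H))" "t \<in> carrier (tensor_space (gr_alg H) (gr_alg H))"
  and eq: "\<And>i j \<phi> \<psi>. \<phi> \<in> ann H (prevf i) \<Longrightarrow> \<psi> \<in> ann H (prevf j) \<Longrightarrow>
   tev (gr_form i \<phi>) (gr_form j \<psi>) s = tev (gr_form i \<phi>) (gr_form j \<psi>) t"
 shows "s = t"
proof (rule gr_dual_system[OF N])
 fix I :: "nat set" and b l
 assume d: "dual_system (gr_alg H) ({..<N} \<times> I) b (\<lambda>p. gr_form (fst p) (l p))"
  "\<And>p. p \<in> {..<N} \<times> I \<Longrightarrow> l p \<in> ann H (prevf (fst p))"
 show ?thesis
  by (rule dual_system_eqI[OF vspace_tensor[OF vspace_gr vspace_gr] dual_system_tensor[OF vspace_gr vspace_gr d(1) d(1)] s])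
   (rule eq; rule d(2); auto)
qed

section \<open>Comultiplication of the associated graded coalgebra\<close>

abbreviation "gr_decomposition n ts \<equiv> list_sum (tensor_space (gr_alg H) (gr_alg H))
 (map (\<lambda>(i, u, v). pure_tensor (gr_alg H) (gr_alg H) (gr_class H i u) (gr_class H (n - i) v)) ts)"

lemma tev_decomposition:
 assumes ts: "filtered_decomposition H n ts" and f: "linform H \<phi>" "linform H \<psi>"
 shows "tev \<phi> \<psi> (decomposition_sum H ts) = (\<Sum>(i, u, v)\<leftarrow>ts. \<phi> u * \<psi> v)"
proof -
 have ps: "(u, v) \<in> set (map snd ts) \<Longrightarrow> u \<in> carrier H \<and> v \<in> carrier H" for u v
  using ts C_closed by (fastforce simp: filtered_decomposition_def[OF H fd pointed])
 from tev_list_sum(2)[OF coalg_vspace[OF H] coalg_vspace[OF H] f, of "map snd ts", OF ps]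
 show ?thesis by (simp add: comp_def split_def)
qed

text \<open>Let the degrees of the two forms add up to \<open>n\<close>. A term whose left degree
  differs from \<open>i\<close> has either its left factor below degree \<open>i\<close> or its
  right factor below degree \<open>j\<close>, so one of the forms kills it in \<open>H\<close> as
  well. Passing to classes therefore does not change the value.\<close>

lemma gr_decomposition:
 assumes ts: "filtered_decomposition H n ts"
 shows gr_decomposition_closed: "gr_decomposition n ts \<in> carrier (tensor_space (gr_alg H) (gr_alg H))"
  and tev_gr_decomposition: "\<phi> \<in> ann H (prevf i) \<Longrightarrow> \<psi> \<in> ann H (prevf j) \<Longrightarrow>
   tev (gr_form i \<phi>) (gr_form j \<psi>) (gr_decomposition n ts) =
    (if i + j = n then tev \<phi> \<psi> (decomposition_sum H ts) else 0)"
proof -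
 let ?ps = "map (\<lambda>(i, u, v). (gr_class H i u, gr_class H (n - i) v)) ts"
 have ps: "(u, v) \<in> set ?ps \<Longrightarrow> u \<in> carrier (gr_alg H) \<and> v \<in> carrier (gr_alg H)" for u v
  using ts gr_class_closed by (fastforce simp: filtered_decomposition_def[OF H fd pointed])
 have eq: "gr_decomposition n ts = list_sum (tensor_space (gr_alg H) (gr_alg H)) (map (\<lambda>(u, v). pure_tensor (gr_alg H) (gr_alg H) u v) ?ps)"
  by (simp add: comp_def split_def)
 show "gr_decomposition n ts \<in> carrier (tensor_space (gr_alg H) (gr_alg H))"
  unfolding eq by (rule tev_list_sum(1)[OF vspace_gr vspace_gr linform_0 linform_0 ps])
 assume f: "\<phi> \<in> ann H (prevf i)" "\<psi> \<in> ann H (prevf j)"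
 have "tev (gr_form i \<phi>) (gr_form j \<psi>) (gr_decomposition n ts) = (\<Sum>(u, v)\<leftarrow>?ps. gr_form i \<phi> u * gr_form j \<psi> v)"
  unfolding eq by (rule tev_list_sum(2)[OF vspace_gr vspace_gr linform_gr_form[OF f(1)] linform_gr_form[OF f(2)] ps])
 also have "\<dots> = (\<Sum>(i', u, v)\<leftarrow>ts. gr_form i \<phi> (gr_class H i' u) * gr_form j \<psi> (gr_class H (n - i') v))"
  by (simp add: comp_def split_def)
 also have "\<dots> = (\<Sum>(i', u, v)\<leftarrow>ts. if i + j = n then \<phi> u * \<psi> v else 0)"
 proof (intro arg_cong[where f = sum_list] map_cong refl)
  fix p assume p: "p \<in> set ts"
  obtain i' u v where iuv: "p = (i', u, v)" by (cases p)
  have c: "i' \<le> n" "u \<in> corf i'" "v \<in> corf (n - i')"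
   using ts p by (auto simp: filtered_decomposition_def[OF H fd pointed] iuv)
  have "\<phi> u = 0" if "i' < i" using C_subset_F[OF that] c annD(2)[OF f(1)] by auto
  moreover have "\<psi> v = 0" if "n - i' < j" using C_subset_F[OF that] c annD(2)[OF f(2)] by auto
  moreover have "i' < i \<or> i' = i \<or> n - i' < j" if "i + j = n" using that c(1) by auto
  ultimately show "(case p of (i', u, v) \<Rightarrow> gr_form i \<phi> (gr_class H i' u) * gr_form j \<psi> (gr_class H (n - i') v)) =
   (case p of (i', u, v) \<Rightarrow> if i + j = n then \<phi> u * \<psi> v else 0)"
   using c by (auto simp: iuv gr_form_class[OF f(1)] gr_form_class[OF f(2)])
 qed
 also have "\<dots> = (if i + j = n then tev \<phi> \<psi> (decomposition_sum H ts) else 0)"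
  by (cases "i + j = n") (simp_all add: tev_decomposition[OF ts annD(1)[OF f(1)] annD(1)[OF f(2)]], simp add: split_def)
 finally show "tev (gr_form i \<phi>) (gr_form j \<psi>) (gr_decomposition n ts) =
    (if i + j = n then tev \<phi> \<psi> (decomposition_sum H ts) else 0)" .
qed

context
 fixes N assumes N: "\<And>n. N \<le> n \<Longrightarrow> corf n \<subseteq> prevf n"
begin

text \<open>Uniqueness for the definite description in \<open>gr_comul\<close>: by the preceding
  lemma two decompositions of the same tensor agree under all pairs of homogeneous forms, and these
  separate.\<close>

lemma gr_comul_eq:
 assumes ts: "filtered_decomposition H n ts" "comul H x = decomposition_sum H ts"
 shows "gr_comul H n x = gr_decomposition n ts"
 unfolding gr_comul_def
proof (rule the_equality)
 show "\<exists>ts'. (\<forall>(i, u, v)\<in>set ts'. i \<le> n \<and> u \<in> corf i \<and> v \<in> corf (n - i)) \<and>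
   comul H x = decomposition_sum H ts' \<and> gr_decomposition n ts = gr_decomposition n ts'"
  using ts unfolding filtered_decomposition_def[OF H fd pointed] by blast
 fix t assume "\<exists>ts'. (\<forall>(i, u, v)\<in>set ts'. i \<le> n \<and> u \<in> corf i \<and> v \<in> corf (n - i)) \<and>
   comul H x = decomposition_sum H ts' \<and> t = gr_decomposition n ts'"
 then obtain ts' where ts': "filtered_decomposition H n ts'" "comul H x = decomposition_sum H ts'"
  "t = gr_decomposition n ts'" unfolding filtered_decomposition_def[OF H fd pointed] by blast
 show "t = gr_decomposition n ts"
  unfolding ts'(3)
  by (rule gr_tensor_eqI[OF N gr_decomposition_closed[OF ts'(1)] gr_decomposition_closed[OF ts(1)]])
   (simp_all add: tev_gr_decomposition[OF ts'(1)] tev_gr_decomposition[OF ts(1)] ts(2)[symmetric] ts'(2)[symmetric])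
qed

lemma
 assumes x: "x \<in> corf n"
 shows gr_comul_closed: "gr_comul H n x \<in> carrier (tensor_space (gr_alg H) (gr_alg H))"
  and tev_gr_comul: "\<phi> \<in> ann H (prevf i) \<Longrightarrow> \<psi> \<in> ann H (prevf j) \<Longrightarrow>
   tev (gr_form i \<phi>) (gr_form j \<psi>) (gr_comul H n x) = (if i + j = n then conv H \<phi> \<psi> x else 0)"
proof -
 obtain ts where ts: "filtered_decomposition H n ts" "comul H x = decomposition_sum H ts"
  using comul_decomposition[OF H fd pointed x] by auto
 show "gr_comul H n x \<in> carrier (tensor_space (gr_alg H) (gr_alg H))"
  using gr_comul_eq[OF ts] gr_decomposition_closed[OF ts(1)] by simp
 assume f: "\<phi> \<in> ann H (prevf i)" "\<psi> \<in> ann H (prevf j)"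
 show "tev (gr_form i \<phi>) (gr_form j \<psi>) (gr_comul H n x) = (if i + j = n then conv H \<phi> \<psi> x else 0)"
  using gr_comul_eq[OF ts] tev_gr_decomposition[OF ts(1) f] ts(2) by (simp add: conv_def)
qed

text \<open>In the dual algebra of the graded coalgebra, homogeneous forms multiply as in the dual
  of \<open>H\<close> and their degrees add.\<close>

lemma
 assumes u: "u \<in> carrier (gr_alg H)"
 shows comul_gr_closed: "comul (gr H) u \<in> carrier (tensor_space (gr_alg H) (gr_alg H))"
  and conv_gr: "\<phi> \<in> ann H (prevf i) \<Longrightarrow> \<psi> \<in> ann H (prevf j) \<Longrightarrow>
   conv (gr H) (gr_form i \<phi>) (gr_form j \<psi>) u = conv H \<phi> \<psi> (SOME x. x \<in> u (i + j))"
proof -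
 let ?T = "tensor_space (gr_alg H) (gr_alg H)" and ?S = "{n. u n \<noteq> \<zero>\<^bsub>gr_piece H n\<^esub>}"
 have T: "vspace ?T" by (rule vspace_tensor[OF vspace_gr vspace_gr])
 have def: "comul (gr H) u = (\<Oplus>\<^bsub>?T\<^esub>n\<in>?S. gr_comul H n (SOME x. x \<in> u n))"
  by (simp add: gr_def module.defs)
 have Pi: "(\<lambda>n. gr_comul H n (SOME x. x \<in> u n)) \<in> ?S \<rightarrow> carrier ?T"
  using gr_comul_closed[OF gr_rep(1)[OF u]] by auto
 show "comul (gr H) u \<in> carrier ?T" unfolding def by (rule vs_finsum[OF T Pi])
 assume f: "\<phi> \<in> ann H (prevf i)" "\<psi> \<in> ann H (prevf j)"
 have S: "finite ?S" using u by (simp add: gr_alg_simps)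
 have "conv (gr H) (gr_form i \<phi>) (gr_form j \<psi>) u =
   (\<Sum>n\<in>?S. if i + j = n then conv H \<phi> \<psi> (SOME x. x \<in> u n) else 0)"
  unfolding conv_def def
  using linform_finsum[OF T linform_tev[OF vspace_gr vspace_gr linform_gr_form[OF f(1)] linform_gr_form[OF f(2)]] Pi]
  by (simp add: tev_gr_comul[OF gr_rep(1)[OF u] f] conv_def cong: if_cong)
 also have "\<dots> = (if i + j \<in> ?S then conv H \<phi> \<psi> (SOME x. x \<in> u (i + j)) else 0)"
  using S by (simp add: sum.delta')
 also have "\<dots> = conv H \<phi> \<psi> (SOME x. x \<in> u (i + j))"
 proof (cases "i + j \<in> ?S")
  case False
  then have "u (i + j) = prevf (i + j)" by (simp add: gr_piece_zero)
  then have "(SOME x. x \<in> u (i + j)) \<in> prevf (i + j)" using gr_rep(3)[OF u, of "i + j"] by simp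
  then show ?thesis using conv_filtration[OF H fd pointed _ f] False by simp
 qed simp
 finally show "conv (gr H) (gr_form i \<phi>) (gr_form j \<psi>) u = conv H \<phi> \<psi> (SOME x. x \<in> u (i + j))" .
qed

lemma comul_gr_class:
 assumes x: "x \<in> corf n" and ts: "filtered_decomposition H n ts" "comul H x = decomposition_sum H ts"
 shows "comul (gr H) (gr_class H n x) = gr_decomposition n ts"
proof (rule gr_tensor_eqI[OF N comul_gr_closed[OF gr_class_closed[OF x]] gr_decomposition_closed[OF ts(1)]])
 note V = coalg_vspace[OF H]
 interpret HM: module base_ring H by (rule V)
 let ?u = "gr_class H n x"
 fix i j \<phi> \<psi> assume f: "\<phi> \<in> ann H (prevf i)" "\<psi> \<in> ann H (prevf j)"
 note l = annD(1)[OF f(1)] annD(1)[OF f(2)]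
 define y where "y = (SOME x. x \<in> ?u (i + j))"
 have y: "y \<in> ?u (i + j)" using gr_rep(3)[OF gr_class_closed[OF x]] by (simp add: y_def)
 have "conv H \<phi> \<psi> y = (if i + j = n then conv H \<phi> \<psi> x else 0)"
 proof (cases "i + j = n")
  case True
  then have "y \<in> carrier H" "y \<ominus> x \<in> prevf (i + j)"
   using y mem_coset_iff[OF V subF C_closed[OF x]] by (auto simp: gr_class_def)
  moreover from this conv_filtration[OF H fd pointed _ f] have "conv H \<phi> \<psi> (y \<ominus> x) = 0" by simp
  ultimately show ?thesis
   using True linform_minus[OF V linform_conv[OF H l] _ C_closed[OF x], of y] by simp
 next
  case False
  then have "y \<in> prevf (i + j)" using y by (simp add: gr_class_def gr_piece_zero)
  then show ?thesis using conv_filtration[OF H fd pointed _ f] False by simp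
 qed
 then show "tev (gr_form i \<phi>) (gr_form j \<psi>) (comul (gr H) (gr_class H n x)) =
   tev (gr_form i \<phi>) (gr_form j \<psi>) (gr_decomposition n ts)"
  using conv_gr[OF gr_class_closed[OF x] f] tev_gr_decomposition[OF ts(1) f] ts(2)
  by (simp add: conv_def y_def)
qed

end

end

section \<open>Presented algebras\<close>

lemma free_alg_simps [simp]:
 "carrier (free_alg :: ('k::field, ('k, 'i) free_algebra) module) = UNIV"
 "monoid.mult (free_alg :: ('k, ('k, 'i) free_algebra) module) = (*)"
 "one (free_alg :: ('k, ('k, 'i) free_algebra) module) = 1"
 "ring.zero (free_alg :: ('k, ('k, 'i) free_algebra) module) = 0"
 "add (free_alg :: ('k, ('k, 'i) free_algebra) module) = (+)"
 "Module.module.smult (free_alg :: ('k, ('k, 'i) free_algebra) module) = (\<lambda>c p. scal c * p)"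
 by (simp_all add: free_alg_def ring.defs ring_of_type_algebra_def)

lemma scal_mult_single:
 fixes c :: "'k::field"
 shows "scal c * Poly_Mapping.single w d = Poly_Mapping.single w (c * d)"
 by (simp add: scal_def mult_single)

lemma scal_eq_map:
 fixes p :: "('k::field, 'i) free_algebra"
 shows "scal c * p = Poly_Mapping.map ((*) c) p"
 by (simp add: scal_def mult_map_scale_conv_mult)

lemma single_eq_scal:
 fixes c :: "'k::field"
 shows "Poly_Mapping.single w c = scal c * Poly_Mapping.single w 1"
 by (simp add: scal_mult_single)

lemma scal_comm:
 fixes p :: "('k::field, 'i) free_algebra"
 shows "p * scal c = scal c * p"
proof -
 have "Poly_Mapping.keys p \<subseteq> UNIV" by simp
 then show ?thesis
  by (induct p rule: pm_induct) (simp_all add: distrib_left distrib_right scal_def mult_single mult.commute)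
qed

lemma mult_scal_left_comm:
 fixes p q :: "('k::field, 'i) free_algebra"
 shows "p * (scal c * q) = scal c * (p * q)"
 using scal_comm[of p c] by (metis mult.assoc)

lemma k_algebra_free: "k_algebra (free_alg :: ('k::field, ('k, 'i) free_algebra) module)"
proof (rule k_algebraI)
 show "vspace (free_alg :: ('k::field, ('k, 'i) free_algebra) module)"
 proof (rule vspaceI)
  show "abelian_group (free_alg :: ('k::field, ('k, 'i) free_algebra) module)"
   by (rule abelian_groupI) (auto simp: algebra_simps intro: exI[of _ "- x" for x])
  show "(c + d) \<odot>\<^bsub>free_alg\<^esub> x = c \<odot>\<^bsub>free_alg\<^esub> x \<oplus>\<^bsub>free_alg\<^esub> d \<odot>\<^bsub>free_alg\<^esub> x" for c d :: 'k and x :: "('k, 'i) free_algebra"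
   by (simp add: scal_def single_add distrib_right)
  show "(c * d) \<odot>\<^bsub>free_alg\<^esub> x = c \<odot>\<^bsub>free_alg\<^esub> (d \<odot>\<^bsub>free_alg\<^esub> x)" for c d :: 'k and x :: "('k, 'i) free_algebra"
   by (simp add: scal_def mult_single mult.assoc[symmetric])
  show "1 \<odot>\<^bsub>free_alg\<^esub> x = x" for x :: "('k, 'i) free_algebra"
   by (simp add: scal_def)
 qed (auto simp: distrib_left)
 show "x \<otimes>\<^bsub>free_alg\<^esub> (c \<odot>\<^bsub>free_alg\<^esub> y) = c \<odot>\<^bsub>free_alg\<^esub> (x \<otimes>\<^bsub>free_alg\<^esub> y)" for c :: 'k and x y :: "('k, 'i) free_algebra"
  by (simp add: mult.assoc[symmetric] scal_comm)
qed (auto simp: algebra_simps)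

lemma letters_simps [simp]: "letters 0 = []" "letters (v + w) = letters v @ letters w"
 by (simp_all add: zero_fword_def plus_fword_def)

lemma one_free_algebra: "(1 :: ('k::field, 'i) free_algebra) = Poly_Mapping.single 0 1"
 by simp

context
 fixes B :: "('k::field, 'b, 'n) module_scheme" (structure) and f :: "'i \<Rightarrow> 'b"
 assumes B: "k_algebra B" and f: "\<And>i. f i \<in> carrier B"
begin

lemma word_value_closed: "foldr (\<lambda>i b. f i \<otimes> b) is \<one> \<in> carrier B"
 by (induct "is") (auto simp: alg_one[OF B] alg_mult[OF B] f)

lemma word_value_append:
 "foldr (\<lambda>i b. f i \<otimes> b) (is @ js) \<one> =
  foldr (\<lambda>i b. f i \<otimes> b) is \<one> \<otimes> foldr (\<lambda>i b. f i \<otimes> b) js \<one>"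
 by (induct "is") (simp_all add: alg_l_one[OF B] word_value_closed alg_assoc[OF B] f del: foldr_append)

lemma free_lift_pm_sum: "free_lift B f = pm_sum B (\<lambda>w. foldr (\<lambda>i b. f i \<otimes> b) (letters w) \<one>)"
 by (simp add: free_lift_def[abs_def] pm_sum_def[abs_def])

lemma
 shows free_lift_closed: "free_lift B f p \<in> carrier B"
  and free_lift_add: "free_lift B f (p + q) = free_lift B f p \<oplus> free_lift B f q"
  and free_lift_scal: "free_lift B f (scal c * p) = c \<odot> free_lift B f p"
  and free_lift_zero: "free_lift B f 0 = \<zero>"
  and free_lift_single: "free_lift B f (Poly_Mapping.single w c) =
   c \<odot> foldr (\<lambda>i b. f i \<otimes> b) (letters w) \<one>"
  and free_lift_one: "free_lift B f 1 = \<one>"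
  and free_lift_gen: "free_lift B f (gen i) = f i"
proof -
 note V = alg_vspace[OF B]
 note s = pm_sum_closed[OF V, of UNIV] pm_sum_add[OF V, of UNIV] pm_sum_smult[OF V, of UNIV] pm_sum_single[OF V, of UNIV]
 show "free_lift B f p \<in> carrier B" "free_lift B f (p + q) = free_lift B f p \<oplus> free_lift B f q"
  "free_lift B f (scal c * p) = c \<odot> free_lift B f p" "free_lift B f 0 = \<zero>"
  unfolding free_lift_pm_sum scal_eq_map by (simp_all add: s word_value_closed pm_sum_zero[OF V, of UNIV])
 have sg: "\<And>w c. free_lift B f (Poly_Mapping.single w c) =
   c \<odot> foldr (\<lambda>i b. f i \<otimes> b) (letters w) \<one>"
  unfolding free_lift_pm_sum scal_eq_map by (simp_all add: s word_value_closed pm_sum_zero[OF V, of UNIV])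
 show "free_lift B f (Poly_Mapping.single w c) =
   c \<odot> foldr (\<lambda>i b. f i \<otimes> b) (letters w) \<one>" by (rule sg)
 show "free_lift B f 1 = \<one>"
  unfolding one_free_algebra sg by (simp add: vs_smult_one[OF V] alg_one[OF B])
 show "free_lift B f (gen i) = f i"
  unfolding gen_def sg by (simp add: vs_smult_one[OF V] alg_one[OF B] f alg_r_one[OF B])
qed

lemma free_lift_mult: "free_lift B f (p * q) = free_lift B f p \<otimes> free_lift B f q"
proof -
 note V = alg_vspace[OF B]
 note [simp] = free_lift_closed free_lift_add free_lift_zero free_lift_single alg_l_null[OF B] alg_r_null[OF B]
  alg_l_distr[OF B] alg_r_distr[OF B] word_value_closed vs_smult[OF V] alg_mult[OF B]
 have "Poly_Mapping.keys p \<subseteq> UNIV" by simp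
 then show ?thesis
 proof (induct p rule: pm_induct)
  case (add v c p)
  have "Poly_Mapping.keys q \<subseteq> UNIV" by simp
  then have "free_lift B f (Poly_Mapping.single v c * q) = free_lift B f (Poly_Mapping.single v c) \<otimes> free_lift B f q"
  proof (induct q rule: pm_induct)
   case (add w d q)
   then show ?case
    by (simp add: distrib_left mult_single word_value_append alg_smult_left[OF B] alg_smult_right[OF B] vs_smult_assoc[OF V, symmetric] mult.commute[of d c] del: foldr_append)
  qed simp
  then show ?case using add by (simp add: distrib_right)
 qed simp
qed

lemma ideal_free_lift_kernel: "ideal {p. free_lift B f p = \<zero>} (free_alg :: ('k, ('k, 'i) free_algebra) module)"
proof (rule idealI)
 note V = alg_vspace[OF B]
 show "ring (free_alg :: ('k, ('k, 'i) free_algebra) module)" by (rule alg_ring[OF k_algebra_free])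
 have "submodule {p. free_lift B f p = \<zero>} base_ring (free_alg :: ('k, ('k, 'i) free_algebra) module)"
  by (rule submoduleI'[OF alg_vspace[OF k_algebra_free]])
   (auto simp: free_lift_zero free_lift_add free_lift_scal vs_l_zero[OF V] vs_zero[OF V] vs_smult_r_null[OF V])
 then show "subgroup {p. free_lift B f p = \<zero>} (add_monoid (free_alg :: ('k, ('k, 'i) free_algebra) module))"
  by (simp add: submodule_def)
qed (auto simp: free_lift_mult alg_l_null[OF B] alg_r_null[OF B] free_lift_closed)

lemma free_lift_genideal:
 assumes "\<And>r. r \<in> R \<Longrightarrow> free_lift B f r = \<zero>" "p \<in> Idl\<^bsub>free_alg\<^esub> R"
 shows "free_lift B f p = \<zero>"
proof -
 interpret ring "free_alg :: ('k, ('k, 'i) free_algebra) module" by (rule alg_ring[OF k_algebra_free])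
 have "Idl\<^bsub>free_alg\<^esub> R \<subseteq> {p. free_lift B f p = \<zero>}"
  by (rule genideal_minimal[OF ideal_free_lift_kernel]) (use assms(1) in auto)
 then show ?thesis using assms(2) by auto
qed

end

section \<open>The quotient of the free algebra by relations\<close>

context
 fixes R :: "('k::field, 'i) free_algebra set"
begin

lemma ideal_genideal: "ideal (Idl\<^bsub>free_alg\<^esub> R) (free_alg :: ('k, ('k, 'i) free_algebra) module)"
proof -
 interpret ring "free_alg :: ('k, ('k, 'i) free_algebra) module" by (rule alg_ring[OF k_algebra_free])
 show ?thesis by (rule genideal_ideal) simp
qed

lemma submodule_genideal: "submodule (Idl\<^bsub>free_alg\<^esub> R) base_ring (free_alg :: ('k, ('k, 'i) free_algebra) module)"
proof -
 interpret I: ideal "Idl\<^bsub>free_alg\<^esub> R" "free_alg :: ('k, ('k, 'i) free_algebra) module" by (rule ideal_genideal)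
 show ?thesis
 proof (rule submoduleI'[OF alg_vspace[OF k_algebra_free]])
  show "c \<odot>\<^bsub>free_alg\<^esub> x \<in> Idl\<^bsub>free_alg\<^esub> R" if "x \<in> Idl\<^bsub>free_alg\<^esub> R" for c x
   using I.I_l_closed[OF that, of "scal c"] by simp
  show "a \<oplus>\<^bsub>free_alg\<^esub> b \<in> Idl\<^bsub>free_alg\<^esub> R" if "a \<in> Idl\<^bsub>free_alg\<^esub> R" "b \<in> Idl\<^bsub>free_alg\<^esub> R" for a b
   using that by (rule additive_subgroup.a_closed[OF ideal.axioms(1)[OF ideal_genideal]])
  show "\<zero>\<^bsub>free_alg\<^esub> \<in> Idl\<^bsub>free_alg\<^esub> R"
   by (rule additive_subgroup.zero_closed[OF ideal.axioms(1)[OF ideal_genideal]])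
 qed simp
qed

lemma free_minus [simp]: "p \<ominus>\<^bsub>free_alg :: ('k, ('k, 'i) free_algebra) module\<^esub> q = p - q"
proof -
 interpret ring "free_alg :: ('k, ('k, 'i) free_algebra) module" by (rule alg_ring[OF k_algebra_free])
 have "\<ominus>\<^bsub>free_alg\<^esub> q = - q" by (rule minus_equality) auto
 then show ?thesis by (simp add: a_minus_def)
qed

lemma presented_class_eq_iff: "presented_class R p = presented_class R q \<longleftrightarrow> p - q \<in> Idl\<^bsub>free_alg\<^esub> R"
 unfolding presented_class_def
 using coset_eq_iff[OF alg_vspace[OF k_algebra_free] submodule_genideal, of p q] by simp

lemma presented_carrier: "carrier (presented_alg R) = range (presented_class R)"
 by (auto simp: presented_alg_def quot_carrier presented_class_def)

lemma presented_class_closed [simp]: "presented_class R p \<in> carrier (presented_alg R)"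
 by (simp add: presented_carrier)

lemma presented_class_add: "presented_class R (p + q) = presented_class R p \<oplus>\<^bsub>presented_alg R\<^esub> presented_class R q"
 using quot_add[OF alg_vspace[OF k_algebra_free] submodule_genideal, of p q]
 by (simp add: presented_alg_def presented_class_def)

lemma presented_class_scal: "presented_class R (scal c * p) = c \<odot>\<^bsub>presented_alg R\<^esub> presented_class R p"
 using quot_smult[OF alg_vspace[OF k_algebra_free] submodule_genideal, of p c]
 by (simp add: presented_alg_def presented_class_def)

lemma presented_class_mult: "presented_class R (p * q) = presented_class R p \<otimes>\<^bsub>presented_alg R\<^esub> presented_class R q"
 using ideal.rcoset_mult_add[OF ideal_genideal, of p q]
 by (simp add: presented_alg_def presented_class_def quot_def FactRing_def)

lemma presented_class_one: "presented_class R 1 = \<one>\<^bsub>presented_alg R\<^esub>"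
 by (simp add: presented_alg_def presented_class_def quot_def FactRing_def)

lemma k_algebra_presented: "k_algebra (presented_alg R)"
 by (rule k_algebraI)
  (auto simp: presented_carrier presented_class_one[symmetric] presented_class_mult[symmetric]
   presented_class_add[symmetric] presented_class_scal[symmetric] algebra_simps mult_scal_left_comm
   intro!: vspace_quot[OF alg_vspace[OF k_algebra_free] submodule_genideal, folded presented_alg_def]
   simp del: presented_class_closed)

lemma presented_class_rep: "presented_class R (SOME p. p \<in> presented_class R q) = presented_class R q"
proof -
 have q: "q \<in> presented_class R q"
  unfolding presented_class_def by (rule coset_self[OF alg_vspace[OF k_algebra_free] submodule_genideal]) simp
 then have "(SOME p. p \<in> presented_class R q) \<in> presented_class R q" by (rule someI)
 then show ?thesis
  using mem_coset_iff[OF alg_vspace[OF k_algebra_free] submodule_genideal, of q]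
  by (simp add: presented_class_eq_iff) (simp add: presented_class_def)
qed

text \<open>Words are built by prefixing generators, so a subspace that contains 1 and is stable
  under left multiplication by generators is everything.\<close>

lemma presented_induct [consumes 1, case_names one mult add smult]:
 assumes "z \<in> carrier (presented_alg R)" "Q \<one>\<^bsub>presented_alg R\<^esub>"
  "\<And>i z. z \<in> carrier (presented_alg R) \<Longrightarrow> Q z \<Longrightarrow> Q (presented_class R (gen i) \<otimes>\<^bsub>presented_alg R\<^esub> z)"
  "\<And>y z. y \<in> carrier (presented_alg R) \<Longrightarrow> z \<in> carrier (presented_alg R) \<Longrightarrow> Q y \<Longrightarrow> Q z \<Longrightarrow> Q (y \<oplus>\<^bsub>presented_alg R\<^esub> z)"
  "\<And>c z. z \<in> carrier (presented_alg R) \<Longrightarrow> Q z \<Longrightarrow> Q (c \<odot>\<^bsub>presented_alg R\<^esub> z)"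
 shows "Q z"
proof -
 obtain p where p: "z = presented_class R p" using assms(1) by (auto simp: presented_carrier)
 have word: "Q (presented_class R (Poly_Mapping.single (FWord is) 1))" for "is"
 proof (induct "is")
  case Nil
  have "Poly_Mapping.single (FWord []) 1 = (1 :: ('k, 'i) free_algebra)"
   by (simp add: one_free_algebra zero_fword_def del: single_one)
  then show ?case using assms(2) by (simp add: presented_class_one)
 next
  case (Cons i "is")
  have "Poly_Mapping.single (FWord (i # is)) 1 = gen i * (Poly_Mapping.single (FWord is) 1 :: ('k, 'i) free_algebra)"
   by (simp add: gen_def mult_single plus_fword_def)
  then show ?case using assms(3) Cons by (simp add: presented_class_mult)
 qed
 have "Poly_Mapping.keys p \<subseteq> UNIV" by simp
 then have "Q (presented_class R p)"
 proof (induct p rule: pm_induct)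
  case zero
  have "presented_class R 0 = 0 \<odot>\<^bsub>presented_alg R\<^esub> \<one>\<^bsub>presented_alg R\<^esub>"
   by (simp add: presented_class_one[symmetric] presented_class_scal[symmetric] scal_def)
  then show ?case using assms(2,5) by (simp add: presented_class_one[symmetric])
 next
  case (add w c p)
  have "Q (presented_class R (Poly_Mapping.single w c))"
   using word[of "letters w"] assms(5) by (subst single_eq_scal) (simp add: presented_class_scal)
  then show ?case using add assms(4) by (simp add: presented_class_add)
 qed
 then show ?thesis using p by simp
qed

end

text \<open>Evaluated on a representative, as in \<open>presented_bialg\<close>.\<close>

definition presented_lift :: "('k::field, 'b, 'n) module_scheme \<Rightarrow> ('i \<Rightarrow> 'b) \<Rightarrow> ('k, 'i) free_algebra set \<Rightarrow> 'b" where
 "presented_lift B f Z = free_lift B f (SOME p. p \<in> Z)"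

context
 fixes B :: "('k::field, 'b, 'n) module_scheme" (structure) and f :: "'i \<Rightarrow> 'b" and R
 assumes B: "k_algebra B" and f: "\<And>i. f i \<in> carrier B" and R: "\<And>r. r \<in> R \<Longrightarrow> free_lift B f r = \<zero>"
begin

lemma presented_lift_class: "presented_lift B f (presented_class R p) = free_lift B f p"
proof -
 let ?q = "SOME q. q \<in> presented_class R p"
 note V = alg_vspace[OF B]
 have i: "?q - p \<in> Idl\<^bsub>free_alg\<^esub> R" using presented_class_rep[of R p] by (simp add: presented_class_eq_iff)
 have "free_lift B f (?q - p) = \<zero>" by (rule free_lift_genideal[OF B f _ i]) (rule R)
 moreover have "free_lift B f ((?q - p) + p) = free_lift B f (?q - p) \<oplus> free_lift B f p"
  by (rule free_lift_add[OF B f])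
 ultimately show ?thesis by (simp add: presented_lift_def vs_l_zero[OF V] free_lift_closed[OF B f])
qed

lemma presented_lift_gen: "presented_lift B f (presented_class R (gen i)) = f i"
 by (simp add: presented_lift_class free_lift_gen[OF B f])

lemma presented_lift_linear: "linear_map (presented_alg R) B (presented_lift B f)"
 by (rule linear_mapI) (auto simp: presented_carrier presented_class_add[symmetric] presented_class_scal[symmetric]
  presented_lift_class free_lift_closed[OF B f] free_lift_add[OF B f] free_lift_scal[OF B f])

lemma presented_lift_mult:
 "y \<in> carrier (presented_alg R) \<Longrightarrow> z \<in> carrier (presented_alg R) \<Longrightarrow>
  presented_lift B f (y \<otimes>\<^bsub>presented_alg R\<^esub> z) = presented_lift B f y \<otimes> presented_lift B f z"
 by (auto simp: presented_carrier presented_class_mult[symmetric] presented_lift_class free_lift_mult[OF B f])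

lemma presented_lift_one: "presented_lift B f \<one>\<^bsub>presented_alg R\<^esub> = \<one>"
 by (simp add: presented_class_one[symmetric] presented_lift_class free_lift_one[OF B f])

lemma presented_lift_hom: "presented_lift B f \<in> ring_hom (presented_alg R) B"
 using linear_mapD[OF presented_lift_linear]
 by (intro ring_hom_memI) (auto simp: presented_lift_mult presented_lift_one)

end

lemma presented_bialg_simps:
 "carrier (presented_bialg R \<delta> e) = carrier (presented_alg R)"
 "\<zero>\<^bsub>presented_bialg R \<delta> e\<^esub> = \<zero>\<^bsub>presented_alg R\<^esub>"
 "\<one>\<^bsub>presented_bialg R \<delta> e\<^esub> = \<one>\<^bsub>presented_alg R\<^esub>"
 "add (presented_bialg R \<delta> e) = add (presented_alg R)"
 "monoid.mult (presented_bialg R \<delta> e) = monoid.mult (presented_alg R)"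
 "Module.module.smult (presented_bialg R \<delta> e) = Module.module.smult (presented_alg R)"
 "counit (presented_bialg R \<delta> e) = presented_lift base_alg e"
 "comul (presented_bialg R \<delta> e) = presented_lift (tensor_alg (presented_alg R) (presented_alg R))
   (\<lambda>i. list_sum (tensor_alg (presented_alg R) (presented_alg R)) (map (\<lambda>(p, q).
    pure_tensor (presented_alg R) (presented_alg R) (presented_class R p) (presented_class R q)) (\<delta> i)))"
 by (simp_all add: presented_bialg_def Let_def module.defs presented_lift_def[abs_def])

lemma k_algebra_base_alg: "k_algebra (base_alg :: ('k::field, 'k) module)"
 by (rule k_algebraI[OF vspace_base_alg]) (auto simp: algebra_simps)

section \<open>The relations of the family Q in characteristic two\<close>

lemma char2_field:
 assumes "(1::'k::field) + 1 = 0"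
 shows "(a::'k) + a = 0" "a + (a + b) = b" "- a = a" "a - b = a + b" "(2::'k) = 0"
proof -
 show "(2::'k) = 0" using assms by simp
 show aa: "a + a = 0" for a :: 'k
  using assms by (metis distrib_left mult.right_neutral mult_zero_right)
 show "a + (a + b) = b" by (simp add: aa add.assoc[symmetric])
 show m: "- a = a" for a :: 'k using aa[of a] by (simp add: eq_neg_iff_add_eq_0[symmetric])
 show "a - b = a + b" using m[of b] by (metis diff_conv_add_uminus)
qed

lemma
 fixes M (structure)
 assumes c2: "(1::'k::field) + 1 = 0" and M: "vspace (M :: ('k, 'a, 'm) module_scheme)"
 shows vs2_add_self: "x \<in> carrier M \<Longrightarrow> x \<oplus> x = \<zero>"
  and vs2_add_self_left: "x \<in> carrier M \<Longrightarrow> y \<in> carrier M \<Longrightarrow> x \<oplus> (x \<oplus> y) = y"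
  and vs2_add_left_comm: "x \<in> carrier M \<Longrightarrow> y \<in> carrier M \<Longrightarrow> z \<in> carrier M \<Longrightarrow>
   x \<oplus> (y \<oplus> z) = y \<oplus> (x \<oplus> z)"
  and vs2_eq_iff: "x \<in> carrier M \<Longrightarrow> y \<in> carrier M \<Longrightarrow> x \<oplus> y = \<zero> \<longleftrightarrow> x = y"
  and vs2_minus: "x \<in> carrier M \<Longrightarrow> y \<in> carrier M \<Longrightarrow> x \<ominus> y = x \<oplus> y"
proof -
 have m1: "(-1 :: 'k) = 1" by (rule char2_field(3)[OF c2])
 show s: "x \<in> carrier M \<Longrightarrow> x \<oplus> x = \<zero>" for x
  using vs_l_neg[OF M, of x] by (simp add: m1 vs_smult_one[OF M])
 show sl: "x \<in> carrier M \<Longrightarrow> y \<in> carrier M \<Longrightarrow> x \<oplus> (x \<oplus> y) = y" for x y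
  by (simp add: vs_add_assoc[OF M, symmetric] s vs_l_zero[OF M])
 show "x \<in> carrier M \<Longrightarrow> y \<in> carrier M \<Longrightarrow> z \<in> carrier M \<Longrightarrow>
   x \<oplus> (y \<oplus> z) = y \<oplus> (x \<oplus> z)"
  by (metis vs_add_assoc[OF M] vs_add_comm[OF M])
 show "x \<in> carrier M \<Longrightarrow> y \<in> carrier M \<Longrightarrow> x \<oplus> y = \<zero> \<longleftrightarrow> x = y"
  by (metis s sl vs_r_zero[OF M])
 show "x \<in> carrier M \<Longrightarrow> y \<in> carrier M \<Longrightarrow> x \<ominus> y = x \<oplus> y"
  using vs_smult_minus[OF M, of y] by (simp add: m1 vs_smult_one[OF M] a_minus_def)
qed

text \<open>The relations as rewriting rules towards g^i x^j y^k, with signs dropped in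
  characteristic two. In \<open>rel_yg\<close> the two contributions \<epsilon> (1 + g) have
  cancelled because \<epsilon> is idempotent; in \<open>rel_yy\<close> the bracket is the normal
  form of x + x g.\<close>

locale q_algebra =
 fixes B :: "('k::field, 'b, 'n) module_scheme" (structure) and g x y :: 'b and \<epsilon> \<tau> :: 'k
 assumes B: "k_algebra B" and char2: "(1::'k) + 1 = 0" and idem: "\<epsilon> * \<epsilon> = \<epsilon>"
  and gen_closed [simp]: "g \<in> carrier B" "x \<in> carrier B" "y \<in> carrier B"
  and rel_gg: "g \<otimes> g = \<one>"
  and rel_xg: "x \<otimes> g = g \<otimes> x \<oplus> \<epsilon> \<odot> (\<one> \<oplus> g)"
  and rel_yg: "y \<otimes> g = g \<otimes> y \<oplus> \<epsilon> \<odot> (x \<oplus> g \<otimes> x)"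
  and rel_yx: "y \<otimes> x = x \<otimes> y \<oplus> \<tau> \<odot> (\<one> \<oplus> g)"
  and rel_xx: "x \<otimes> x = \<epsilon> \<odot> x"
  and rel_yy: "y \<otimes> y = \<epsilon> \<odot> y \<oplus> \<tau> \<odot> (x \<oplus> g \<otimes> x \<oplus> \<epsilon> \<odot> (\<one> \<oplus> g))"
begin

lemmas V = alg_vspace[OF B]

lemmas closed = vs_add[OF V] vs_smult[OF V] alg_mult[OF B] alg_one[OF B] vs_zero[OF V]

lemmas alg = alg_assoc[OF B] alg_l_one[OF B] alg_r_one[OF B] alg_l_distr[OF B] alg_r_distr[OF B]
 alg_smult_left[OF B] alg_smult_right[OF B]

text \<open>The same rules in front of a tail \<open>z\<close>. With products bracketed to the
  right, each occurrence inside a word is then in reach of a rule.\<close>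

lemma words:
 assumes z [simp]: "z \<in> carrier B"
 shows "g \<otimes> (g \<otimes> z) = z"
  "x \<otimes> (g \<otimes> z) = g \<otimes> (x \<otimes> z) \<oplus> \<epsilon> \<odot> (z \<oplus> g \<otimes> z)"
  "y \<otimes> (g \<otimes> z) = g \<otimes> (y \<otimes> z) \<oplus> \<epsilon> \<odot> (x \<otimes> z \<oplus> g \<otimes> (x \<otimes> z))"
  "y \<otimes> (x \<otimes> z) = x \<otimes> (y \<otimes> z) \<oplus> \<tau> \<odot> (z \<oplus> g \<otimes> z)"
  "x \<otimes> (x \<otimes> z) = \<epsilon> \<odot> (x \<otimes> z)"
  "y \<otimes> (y \<otimes> z) = \<epsilon> \<odot> (y \<otimes> z) \<oplus> \<tau> \<odot> (x \<otimes> z \<oplus> g \<otimes> (x \<otimes> z) \<oplus> \<epsilon> \<odot> (z \<oplus> g \<otimes> z))"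
proof -
 note [simp] = closed alg
 show "g \<otimes> (g \<otimes> z) = z" using arg_cong[OF rel_gg, of "\<lambda>w. w \<otimes> z"] by simp
 show "x \<otimes> (g \<otimes> z) = g \<otimes> (x \<otimes> z) \<oplus> \<epsilon> \<odot> (z \<oplus> g \<otimes> z)"
  using arg_cong[OF rel_xg, of "\<lambda>w. w \<otimes> z"] by simp
 show "y \<otimes> (g \<otimes> z) = g \<otimes> (y \<otimes> z) \<oplus> \<epsilon> \<odot> (x \<otimes> z \<oplus> g \<otimes> (x \<otimes> z))"
  using arg_cong[OF rel_yg, of "\<lambda>w. w \<otimes> z"] by simp
 show "y \<otimes> (x \<otimes> z) = x \<otimes> (y \<otimes> z) \<oplus> \<tau> \<odot> (z \<oplus> g \<otimes> z)"
  using arg_cong[OF rel_yx, of "\<lambda>w. w \<otimes> z"] by simp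
 show "x \<otimes> (x \<otimes> z) = \<epsilon> \<odot> (x \<otimes> z)" using arg_cong[OF rel_xx, of "\<lambda>w. w \<otimes> z"] by simp
 show "y \<otimes> (y \<otimes> z) = \<epsilon> \<odot> (y \<otimes> z) \<oplus> \<tau> \<odot> (x \<otimes> z \<oplus> g \<otimes> (x \<otimes> z) \<oplus> \<epsilon> \<odot> (z \<oplus> g \<otimes> z))"
  using arg_cong[OF rel_yy, of "\<lambda>w. w \<otimes> z"] by simp
qed

lemmas word_simps = closed alg rel_gg rel_xg rel_yg rel_yx rel_xx rel_yy words

lemmas vs_norm = vs_add_assoc[OF V] vs_add_comm[OF V] vs2_add_left_comm[OF char2 V] vs2_add_self[OF char2 V]
 vs2_add_self_left[OF char2 V] vs_smult_r_distr[OF V] vs_smult_assoc[OF V, symmetric] vs_r_zero[OF V] vs_l_zero[OF V]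

lemma idem_left: "\<epsilon> * (\<epsilon> * c) = \<epsilon> * c"
 by (simp add: mult.assoc[symmetric] idem)

lemmas scalar_norm = distrib_left distrib_right mult.assoc mult.commute mult.left_commute add.assoc add.commute
 add.left_commute char2_field[OF char2] idem idem_left

text \<open>The monomial g^i x^j y^k has index i + 2 j + 4 k. Hence half the index, rounded down, is
  j + 2 k, its degree with x in degree 1 and y in degree 2.\<close>

definition monomial :: "nat \<Rightarrow> 'b" where
 "monomial n = [\<one>, g, x, g \<otimes> x, y, g \<otimes> y, x \<otimes> y, g \<otimes> (x \<otimes> y)] ! n"

lemma less8: "n < 8 \<longleftrightarrow> n = 0 \<or> n = 1 \<or> n = 2 \<or> n = 3 \<or> n = 4 \<or> n = 5 \<or> n = 6 \<or> n = (7::nat)"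
 by auto

lemma monomial_simps:
 "monomial 0 = \<one>" "monomial 1 = g" "monomial (Suc 0) = g" "monomial 2 = x" "monomial 3 = g \<otimes> x" "monomial 4 = y" "monomial 5 = g \<otimes> y"
 "monomial 6 = x \<otimes> y" "monomial 7 = g \<otimes> (x \<otimes> y)"
 by (simp_all add: monomial_def)

lemma monomial_closed: "n < 8 \<Longrightarrow> monomial n \<in> carrier B"
 by (auto simp: less8 monomial_simps closed)

lemma monomial_span:
 assumes S: "submodule S base_ring B" and m: "\<And>n. n < 8 \<Longrightarrow> monomial n \<in> S" and n: "n < 8"
 shows "g \<otimes> monomial n \<in> S" "x \<otimes> monomial n \<in> S" "y \<otimes> monomial n \<in> S"
proof -
 note [simp] = m[of 0, unfolded monomial_simps] m[of 1, unfolded monomial_simps] m[of 2, unfolded monomial_simps]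
  m[of 3, unfolded monomial_simps] m[of 4, unfolded monomial_simps] m[of 5, unfolded monomial_simps]
  m[of 6, unfolded monomial_simps] m[of 7, unfolded monomial_simps] sub_add[OF S] sub_smult[OF S]
 show "g \<otimes> monomial n \<in> S"
  using n unfolding less8 by (elim disjE; hypsubst) (simp_all add: monomial_simps word_simps)
 show "x \<otimes> monomial n \<in> S"
  using n unfolding less8 by (elim disjE; hypsubst) (simp_all add: monomial_simps word_simps)
 show "y \<otimes> monomial n \<in> S"
  using n unfolding less8 by (elim disjE; hypsubst) (simp_all add: monomial_simps word_simps)
qed

end

definition q_relations :: "'i \<Rightarrow> 'i \<Rightarrow> 'i \<Rightarrow> 'k::field \<Rightarrow> 'k \<Rightarrow> ('k, 'i) free_algebra set" where
 "q_relations gg gx gy \<epsilon> \<tau> =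
   (let g = gen gg; x = gen gx; y = gen gy in
   {g\<^sup>2 - 1,
    (g * x - x * g) - scal \<epsilon> * (g - 1),
    (g * y - y * g) - scal \<epsilon> * (1 + g + x + x * g),
    (x * y - y * x) - scal \<tau> * (1 - g),
    x\<^sup>2 - scal \<epsilon> * x,
    y\<^sup>2 - (scal \<epsilon> * y + scal \<tau> * (x + x * g))})"

text \<open>The bases of \<open>Q_alg\<close> and \<open>A_alg\<close> are found simultaneously, \<open>A_alg\<close> having the relations
 with both parameters 0 under another naming of the generators.\<close>

locale q_presentation =
 fixes gg gx gy :: 'i and \<epsilon> \<tau> :: "'k::field"
 assumes char2: "(1::'k) + 1 = 0" and idem: "\<epsilon> * \<epsilon> = \<epsilon>"
  and gens: "UNIV = {gg, gx, gy}" and gens_distinct: "gg \<noteq> gx" "gg \<noteq> gy" "gx \<noteq> gy"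
begin

definition R where "R = q_relations gg gx gy \<epsilon> \<tau>"

abbreviation P where "P \<equiv> presented_alg R"

abbreviation cls where "cls \<equiv> presented_class R"

lemma free_char2: "p + p = (0 :: ('k, 'i) free_algebra)" "p + (p + q) = q" "- p = p" "p - q = p + q"
proof -
 have s: "p + p = 0" for p :: "('k, 'i) free_algebra"
  by (intro poly_mapping_eqI) (simp add: lookup_add char2_field[OF char2])
 show "p + p = 0" "p + (p + q) = q" by (simp_all add: s add.assoc[symmetric])
 show m: "- p = p" for p :: "('k, 'i) free_algebra" using s[of p] by (simp add: eq_neg_iff_add_eq_0[symmetric])
 show "p - q = p + q" using m[of q] by (metis diff_conv_add_uminus)
qed

lemma q_algebra_presented: "q_algebra P (cls (gen gg)) (cls (gen gx)) (cls (gen gy)) \<epsilon> \<tau>"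
proof -
 let ?g = "gen gg :: ('k, 'i) free_algebra" and ?x = "gen gx :: ('k, 'i) free_algebra" and ?y = "gen gy :: ('k, 'i) free_algebra"
 note A = k_algebra_presented[of R]
 note V = alg_vspace[OF A]
 have eqI: "cls p = cls q" if "p + q \<in> R" for p q
 proof -
  interpret ring "free_alg :: ('k, ('k, 'i) free_algebra) module" by (rule alg_ring[OF k_algebra_free])
  have "p + q \<in> Idl\<^bsub>free_alg\<^esub> R" using genideal_self[of R] that by auto
  then show ?thesis by (simp add: presented_class_eq_iff free_char2)
 qed
 have E: "cls (?g * ?g) = cls 1" "cls (?x * ?g) = cls (?g * ?x + scal \<epsilon> * (1 + ?g))"
  "cls (?y * ?g) = cls (?g * ?y + scal \<epsilon> * (1 + ?g + ?x + ?x * ?g))"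
  "cls (?y * ?x) = cls (?x * ?y + scal \<tau> * (1 + ?g))"
  "cls (?x * ?x) = cls (scal \<epsilon> * ?x)" "cls (?y * ?y) = cls (scal \<epsilon> * ?y + scal \<tau> * (?x + ?x * ?g))"
  by (rule eqI; simp add: R_def q_relations_def Let_def free_char2 power2_eq_square add.assoc add.commute add.left_commute)+
 have scal: "cls (scal c) = c \<odot>\<^bsub>P\<^esub> \<one>\<^bsub>P\<^esub>" for c
  using presented_class_scal[of R c 1] by (simp add: presented_class_one)
 note E' = E[unfolded presented_class_mult presented_class_add presented_class_scal presented_class_one scal]
 note cl = vs_add[OF V] vs_smult[OF V] alg_mult[OF A] alg_one[OF A]
 note norm = vs_add_assoc[OF V] vs_add_comm[OF V] vs2_add_left_comm[OF char2 V] vs2_add_self[OF char2 V]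
  vs2_add_self_left[OF char2 V] vs_smult_r_distr[OF V] vs_smult_assoc[OF V, symmetric] vs_r_zero[OF V] vs_l_zero[OF V]
 show ?thesis
  by (intro q_algebra.intro; (rule A char2 idem E'(1) E'(2) E'(4) E'(5) presented_class_closed)?)
   (simp_all add: E' cl norm idem alg_smult_left[OF A] alg_l_one[OF A])
qed

sublocale P: q_algebra P "cls (gen gg)" "cls (gen gx)" "cls (gen gy)" \<epsilon> \<tau>
 by (rule q_algebra_presented)

text \<open>The rewriting rules imply the defining relations, so every \<open>q_algebra\<close>
  receives a homomorphism from the presented algebra. It is applied to the tensor square, to the
  base field and finally to \<open>H\<close>.\<close>

lemma relations_vanish:
 assumes "q_algebra B (f gg) (f gx) (f gy) \<epsilon> \<tau>" and f: "\<And>i. f i \<in> carrier B" and r: "r \<in> R"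
 shows "free_lift B f r = \<zero>\<^bsub>B\<^esub>"
proof -
 interpret B: q_algebra B "f gg" "f gx" "f gy" \<epsilon> \<tau> by fact
 have scal: "free_lift B f (scal c) = c \<odot>\<^bsub>B\<^esub> \<one>\<^bsub>B\<^esub>" for c
  using free_lift_scal[OF B.B f, where c = c and p = 1] by (simp add: free_lift_one[OF B.B f])
 note simps = free_lift_add[OF B.B f] scal free_lift_mult[OF B.B f] free_lift_gen[OF B.B f] free_lift_one[OF B.B f]
 show ?thesis
  using r unfolding R_def q_relations_def Let_def free_char2 power2_eq_square
  by (elim insertE emptyE; simp only: simps B.gen_closed;
    simp add: B.word_simps;
    simp add: B.vs_norm B.word_simps idem mult.commute)
qed

lemma gens_cases: "i = gg \<or> i = gx \<or> i = gy"
 using gens by auto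

text \<open>The left regular representation in coordinates with respect to the monomials 1, g, x, gx, y,
 gy, xy, gxy; the coordinates beyond these carry the trivial representation.\<close>

definition T_g :: "(nat \<Rightarrow> 'k) \<Rightarrow> nat \<Rightarrow> 'k" where
 "T_g v n = (if n < 8 then [v 1, v 0, v 3, v 2, v 5, v 4, v 7, v 6] ! n else v n)"

definition T_x :: "(nat \<Rightarrow> 'k) \<Rightarrow> nat \<Rightarrow> 'k" where
 "T_x v n = (if n < 8 then [\<epsilon> * v 1, \<epsilon> * v 1, v 0 + \<epsilon> * v 2 + \<epsilon> * v 3, v 1, \<epsilon> * v 5, \<epsilon> * v 5,
   v 4 + \<epsilon> * v 6 + \<epsilon> * v 7, v 5] ! n else 0)"

definition T_y :: "(nat \<Rightarrow> 'k) \<Rightarrow> nat \<Rightarrow> 'k" where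
 "T_y v n = (if n < 8 then
   [\<tau> * (v 2 + v 3) + \<tau> * \<epsilon> * (v 4 + v 5 + v 6 + v 7),
   \<tau> * (v 2 + v 3) + \<tau> * \<epsilon> * (v 4 + v 5 + v 6 + v 7),
   \<epsilon> * (v 1 + v 3) + \<tau> * (v 4 + v 5) + \<tau> * \<epsilon> * (v 6 + v 7),
   \<epsilon> * (v 1 + v 3) + \<tau> * (v 4 + v 5) + \<tau> * \<epsilon> * (v 6 + v 7),
   v 0 + \<epsilon> * v 4 + \<tau> * (v 6 + v 7),
   v 1 + \<epsilon> * v 5 + \<tau> * (v 6 + v 7),
   v 2 + \<epsilon> * (v 5 + v 6 + v 7),
   v 3 + \<epsilon> * v 5] ! n else 0)"

definition T :: "'i \<Rightarrow> (nat \<Rightarrow> 'k) \<Rightarrow> nat \<Rightarrow> 'k" where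
 "T i = (if i = gg then T_g else if i = gx then T_x else T_y)"

lemma T_simps: "T gg = T_g" "T gx = T_x" "T gy = T_y"
 using gens_distinct by (auto simp: T_def)

lemmas less8 = P.less8

lemma eight_cases:
 assumes "Q 0" "Q 1" "Q 2" "Q 3" "Q 4" "Q 5" "Q 6" "Q 7" "\<And>n. \<not> n < 8 \<Longrightarrow> Q (n::nat)"
 shows "Q n"
proof (cases "n < 8")
 case True
 then show ?thesis unfolding less8 by (elim disjE; hypsubst) (rule assms)+
qed (rule assms)

lemma T_linear: "T i (\<lambda>n. c * u n + v n) = (\<lambda>n. c * T i u n + T i v n)"
proof (rule ext)
 fix n
 show "T i (\<lambda>n. c * u n + v n) n = c * T i u n + T i v n"
  using gens_cases[of i]
 proof (elim disjE; hypsubst)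
  show "T gg (\<lambda>n. c * u n + v n) n = c * T gg u n + T gg v n"
   unfolding T_simps by (induct n rule: eight_cases) (simp_all add: T_g_def)
  show "T gx (\<lambda>n. c * u n + v n) n = c * T gx u n + T gx v n"
   unfolding T_simps by (induct n rule: eight_cases) (simp_all add: T_x_def algebra_simps)
  show "T gy (\<lambda>n. c * u n + v n) n = c * T gy u n + T gy v n"
   unfolding T_simps by (induct n rule: eight_cases) (simp_all add: T_y_def algebra_simps)
 qed
qed

lemma foldr_T_linear: "foldr T is (\<lambda>n. c * u n + v n) = (\<lambda>n. c * foldr T is u n + foldr T is v n)"
 by (induct "is") (simp_all add: T_linear)

lemma foldr_T_zero: "foldr T is (\<lambda>n. 0) = (\<lambda>n. 0)"
 using foldr_T_linear[of "is" 0 "\<lambda>n. 0" "\<lambda>n. 0"] foldr_T_linear[of "is" "-1" "\<lambda>n. 0" "\<lambda>n. 0"]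
 by (simp add: fun_eq_iff)

definition act :: "('k, 'i) free_algebra \<Rightarrow> (nat \<Rightarrow> 'k) \<Rightarrow> nat \<Rightarrow> 'k" where
 "act p v n = pm_sum base_alg (\<lambda>w. foldr T (letters w) v n) p"

lemma act_simps:
 "act (p + q) v = (\<lambda>n. act p v n + act q v n)" "act (scal c * p) v = (\<lambda>n. c * act p v n)"
 "act 0 v = (\<lambda>n. 0)" "act (Poly_Mapping.single w c) v = (\<lambda>n. c * foldr T (letters w) v n)"
 unfolding act_def[abs_def] scal_eq_map
 by (simp_all add: pm_sum_add[OF vspace_base_alg, of UNIV] pm_sum_smult[OF vspace_base_alg, of UNIV]
  pm_sum_single[OF vspace_base_alg, of UNIV] pm_sum_zero[OF vspace_base_alg, of UNIV])

lemma act_gen: "act (gen i) v = T i v"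
 by (simp add: gen_def act_simps)

lemma act_one: "act 1 v = v"
 unfolding one_free_algebra act_simps by simp

lemma act_mult: "act (p * q) v = act p (act q v)"
proof -
 have "Poly_Mapping.keys q \<subseteq> UNIV" by simp
 then have w: "act (Poly_Mapping.single u c * q) v = act (Poly_Mapping.single u c) (act q v)" for u c
 proof (induct q rule: pm_induct)
  case zero
  then show ?case by (simp add: act_simps foldr_T_zero)
 next
  case (add w d q)
  have "foldr T (letters u) (act (Poly_Mapping.single w d + q) v) =
   (\<lambda>n. d * foldr T (letters u) (foldr T (letters w) v) n + foldr T (letters u) (act q v) n)"
   by (simp add: act_simps foldr_T_linear)
  then show ?case using add(3) by (simp add: distrib_left mult_single act_simps algebra_simps)
 qed
 have "Poly_Mapping.keys p \<subseteq> UNIV" by simp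
 then show ?thesis
  by (induct p rule: pm_induct) (simp_all add: act_simps(1,3) distrib_right w)
qed

text \<open>The independence of the monomials rests on this check: an unresolvable ambiguity between
  the rewriting rules would make the explicit matrices violate a relation.\<close>

lemma act_relation:
 assumes "r \<in> R"
 shows "act r v = (\<lambda>n. 0)"
proof (rule ext)
 fix n
 have c: "act (scal c) v = (\<lambda>n. c * v n)" for c v
  using act_simps(2)[of c 1 v] by (simp add: act_one)
 show "act r v n = 0"
  using assms unfolding R_def q_relations_def Let_def free_char2 power2_eq_square
  by (elim insertE emptyE; simp only: act_simps(1,3) c act_mult act_gen act_one T_simps;
   induct n rule: eight_cases; simp add: T_g_def T_x_def T_y_def P.scalar_norm)
qed

lemma act_ideal:
 assumes "p \<in> Idl\<^bsub>free_alg\<^esub> R"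
 shows "act p v = (\<lambda>n. 0)"
proof -
 let ?K = "{p. \<forall>v. act p v = (\<lambda>n. 0)}"
 have zero: "act p (\<lambda>n. 0) = (\<lambda>n. 0)" for p
 proof -
  have "Poly_Mapping.keys p \<subseteq> UNIV" by simp
  then show ?thesis by (induct p rule: pm_induct) (simp_all add: act_simps foldr_T_zero)
 qed
 have "ideal ?K (free_alg :: ('k, ('k, 'i) free_algebra) module)"
 proof (rule idealI)
  show "ring (free_alg :: ('k, ('k, 'i) free_algebra) module)" by (rule alg_ring[OF k_algebra_free])
  have "submodule ?K base_ring (free_alg :: ('k, ('k, 'i) free_algebra) module)"
   by (rule submoduleI'[OF alg_vspace[OF k_algebra_free]]) (auto simp: act_simps)
  then show "subgroup ?K (add_monoid (free_alg :: ('k, ('k, 'i) free_algebra) module))"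
   by (simp add: submodule_def)
 qed (auto simp: act_mult zero)
 moreover interpret ring "free_alg :: ('k, ('k, 'i) free_algebra) module" by (rule alg_ring[OF k_algebra_free])
 have "R \<subseteq> ?K" using act_relation by auto
 ultimately have "Idl\<^bsub>free_alg\<^esub> R \<subseteq> ?K" by (intro genideal_minimal)
 then show ?thesis using assms by auto
qed

text \<open>The vector acted upon consists of the coordinates of 1, so letting an element act on it
  recovers the coordinates of the element.\<close>

definition coord :: "nat \<Rightarrow> ('k, 'i) free_algebra set \<Rightarrow> 'k" where
 "coord n Z = act (SOME p. p \<in> Z) (\<lambda>m. if m = 0 then 1 else 0) n"

lemma coord_class: "coord n (cls p) = act p (\<lambda>m. if m = 0 then 1 else 0) n"
proof -
 let ?q = "SOME q. q \<in> cls p"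
 have "?q - p \<in> Idl\<^bsub>free_alg\<^esub> R" using presented_class_rep[of R p] by (simp add: presented_class_eq_iff)
 from act_ideal[OF this] have "act ((?q - p) + p) (\<lambda>m. if m = 0 then 1 else 0) = act p (\<lambda>m. if m = 0 then 1 else 0)"
  unfolding act_simps by simp
 then show ?thesis by (simp add: coord_def)
qed

lemma linform_coord: "linform P (coord n)"
 by (rule linformI) (auto simp: presented_carrier presented_class_add[symmetric] presented_class_scal[symmetric] coord_class act_simps)

lemma coord_gen_mult: "z \<in> carrier P \<Longrightarrow> coord n (cls (gen i) \<otimes>\<^bsub>P\<^esub> z) = T i (\<lambda>n. coord n z) n"
 by (auto simp: presented_carrier presented_class_mult[symmetric] coord_class[abs_def] act_mult act_gen)

lemma coord_mult:
 assumes "z \<in> carrier P"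
 shows "coord n (cls (gen gg) \<otimes>\<^bsub>P\<^esub> z) = T_g (\<lambda>n. coord n z) n" "coord n (cls (gen gx) \<otimes>\<^bsub>P\<^esub> z) = T_x (\<lambda>n. coord n z) n"
  "coord n (cls (gen gy) \<otimes>\<^bsub>P\<^esub> z) = T_y (\<lambda>n. coord n z) n"
 using coord_gen_mult[OF assms] by (simp_all add: T_simps)

lemma coord_one: "coord n \<one>\<^bsub>P\<^esub> = (if n = 0 then 1 else 0)"
 by (simp add: presented_class_one[symmetric] coord_class act_one)

abbreviation b where "b \<equiv> P.monomial"

lemma coord_monomial: "n < 8 \<Longrightarrow> m < 8 \<Longrightarrow> coord n (b m) = (if n = m then 1 else 0)"
proof -
 have m: "b 1 = cls (gen gg) \<otimes>\<^bsub>P\<^esub> \<one>\<^bsub>P\<^esub>" "b 2 = cls (gen gx) \<otimes>\<^bsub>P\<^esub> \<one>\<^bsub>P\<^esub>" "b 4 = cls (gen gy) \<otimes>\<^bsub>P\<^esub> \<one>\<^bsub>P\<^esub>"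
  "b 3 = cls (gen gg) \<otimes>\<^bsub>P\<^esub> b 2" "b 5 = cls (gen gg) \<otimes>\<^bsub>P\<^esub> b 4" "b 6 = cls (gen gx) \<otimes>\<^bsub>P\<^esub> b 4" "b 7 = cls (gen gg) \<otimes>\<^bsub>P\<^esub> b 6" "b 0 = \<one>\<^bsub>P\<^esub>"
  by (simp_all add: P.monomial_simps P.alg P.closed del: One_nat_def)
 note c = P.monomial_closed P.closed
 have c1: "coord n (b 0) = (if n = 0 then 1 else 0)" for n using m coord_one by simp
 have c2: "coord n (b 1) = T_g (\<lambda>n. coord n (b 0)) n" "coord n (b 2) = T_x (\<lambda>n. coord n (b 0)) n" "coord n (b 4) = T_y (\<lambda>n. coord n (b 0)) n"
  "coord n (b 3) = T_g (\<lambda>n. coord n (b 2)) n" "coord n (b 5) = T_g (\<lambda>n. coord n (b 4)) n" "coord n (b 6) = T_x (\<lambda>n. coord n (b 4)) n"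
  "coord n (b 7) = T_g (\<lambda>n. coord n (b 6)) n" for n
  unfolding m using c by (simp_all add: coord_mult m[symmetric])
 assume "n < 8" "m < 8"
 then show ?thesis
  unfolding less8 by (elim disjE; hypsubst) (simp_all add: c1 c2 T_g_def T_x_def T_y_def del: One_nat_def)
qed

text \<open>The span of the monomials contains 1 and is stable under left multiplication by the
  generators.\<close>

lemma spans: "z \<in> carrier P \<Longrightarrow> z \<in> lin_span P (b ` {..<8})"
proof -
 let ?S = "lin_span P (b ` {..<8})"
 have S: "submodule ?S base_ring P"
  by (rule submodule_lin_span[OF P.V]) (auto intro: P.monomial_closed)
 have m: "b n \<in> ?S" if "n < 8" for n using that lin_span_superset[of "b ` {..<8}" P] by auto
 have gen: "cls (gen i) \<otimes>\<^bsub>P\<^esub> z \<in> ?S" if z: "z \<in> ?S" for i z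
 proof -
  have lin: "linear_map P P (\<lambda>z. cls (gen i) \<otimes>\<^bsub>P\<^esub> z)"
   by (rule linear_mapI) (simp_all add: P.closed P.alg)
  have "cls (gen i) \<otimes>\<^bsub>P\<^esub> b n \<in> ?S" if "n < 8" for n
   using P.monomial_span[OF S m that] gens_cases[of i] by auto
  then have "?S \<subseteq> {z \<in> carrier P. cls (gen i) \<otimes>\<^bsub>P\<^esub> z \<in> ?S}"
   by (intro lin_span_least submodule_vimage[OF P.V P.V lin S]) (auto intro: P.monomial_closed)
  then show ?thesis using z by auto
 qed
 assume "z \<in> carrier P"
 then show ?thesis
  by (induct rule: presented_induct) (use m[of 0] sub_add[OF S] sub_smult[OF S] gen in \<open>auto simp: P.monomial_simps\<close>)
qed

lemma dual_monomials: "dual_system P {..<8} b coord"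
proof -
 let ?E = "\<lambda>z. \<Oplus>\<^bsub>P\<^esub>n\<in>{..<8}. coord n z \<odot>\<^bsub>P\<^esub> b n"
 interpret M: module base_ring P by (rule P.V)
 have lin: "linear_map P P ?E"
  by (rule linear_map_finsum_smult[OF P.V P.V linform_coord]) (auto intro: P.monomial_closed)
 have "?E (b m) = b m" if "m < 8" for m
 proof -
  have "?E (b m) = (\<Oplus>\<^bsub>P\<^esub>n\<in>{..<8}. if m = n then b n else \<zero>\<^bsub>P\<^esub>)"
   using that by (intro M.M.finsum_cong') (auto simp: coord_monomial vs_smult_one[OF P.V] vs_smult_zero[OF P.V] P.monomial_closed)
  also have "\<dots> = b m"
   by (rule M.M.finsum_singleton) (use that in \<open>auto intro: P.monomial_closed\<close>)
  finally show ?thesis .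
 qed
 moreover have "submodule {z \<in> carrier P. ?E z = z} base_ring P"
  by (rule submoduleI'[OF P.V]) (auto simp: linear_mapD[OF lin] P.closed linear_map_zero[OF P.V P.V lin] simp del: M.M.finsum_closed)
 ultimately have "lin_span P (b ` {..<8}) \<subseteq> {z \<in> carrier P. ?E z = z}"
  by (intro lin_span_least) (auto intro: P.monomial_closed)
 then have "?E z = z" if "z \<in> carrier P" for z using spans[OF that] by auto
 then show ?thesis unfolding dual_system_def using P.monomial_closed linform_coord by auto
qed

lemma fin_dim_P: "fin_dim P"
 by (rule fin_dimI[OF P.V dual_monomials])

end

section \<open>The Hopf algebra structure\<close>

lemma linform_mult_left:
 assumes "k_algebra B" "linform B \<phi>" "u \<in> carrier B"
 shows "linform B (\<lambda>w. \<phi> (u \<otimes>\<^bsub>B\<^esub> w))"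
 using assms by (intro linformI)
  (simp_all add: alg_r_distr alg_smult_right alg_mult linformD)

lemma linform_mult_left2:
 assumes "k_algebra B" "linform B \<phi>" "u \<in> carrier B" "v \<in> carrier B"
 shows "linform B (\<lambda>w. \<phi> (u \<otimes>\<^bsub>B\<^esub> (v \<otimes>\<^bsub>B\<^esub> w)))"
 using linform_mult_left[OF assms(1) linform_mult_left[OF assms(1-3)] assms(4)] .

lemma finsum_transfer:
 assumes "vspace M" "vspace N" "carrier N = carrier M" "add N = add M" "Module.module.smult N = Module.module.smult M"
  "f \<in> A \<rightarrow> carrier M"
 shows "finsum N f A = finsum M f A"
proof -
 have "linear_map M N (\<lambda>x. x)" using assms by (simp add: linear_map_def)
 from linear_map_finsum[OF assms(1,2) this assms(6)] show ?thesis by simp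
qed

section \<open>Convolution at a product with explicit left factor\<close>

context
 fixes H :: "('k::field, 'a, 'm) bialg_scheme" (structure)
 assumes A: "k_algebra H" and cl: "linear_map H (tensor_space H H) (comul H)"
  and cm: "\<And>u z. u \<in> carrier H \<Longrightarrow> z \<in> carrier H \<Longrightarrow>
   comul H (u \<otimes> z) = comul H u \<otimes>\<^bsub>tensor_alg H H\<^esub> comul H z"
begin

context
 fixes \<phi> \<psi> z assumes f: "linform H \<phi>" "linform H \<psi>" and z: "z \<in> carrier H"
begin

lemma tev_mult_comul:
 assumes "u \<in> carrier H" "v \<in> carrier H"
 shows "tev \<phi> \<psi> (pure_tensor H H u v \<otimes>\<^bsub>tensor_alg H H\<^esub> comul H z) =
  conv H (\<lambda>w. \<phi> (u \<otimes> w)) (\<lambda>w. \<psi> (v \<otimes> w)) z"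
 unfolding conv_def by (rule tev_mult[OF A A f assms linear_mapD(1)[OF cl z]])

lemma conv_one_mult:
 assumes "u \<in> carrier H"
 shows "conv H \<phi> (\<lambda>w. \<psi> (\<one> \<otimes> w)) z = conv H \<phi> \<psi> z"
  "conv H (\<lambda>w. \<phi> (u \<otimes> w)) (\<lambda>w. \<psi> (\<one> \<otimes> w)) z = conv H (\<lambda>w. \<phi> (u \<otimes> w)) \<psi> z"
  "conv H (\<lambda>w. \<phi> (\<one> \<otimes> w)) (\<lambda>w. \<psi> (u \<otimes> w)) z = conv H \<phi> (\<lambda>w. \<psi> (u \<otimes> w)) z"
 unfolding conv_def
 by (rule tev_cong[OF alg_vspace[OF A] alg_vspace[OF A] _ _ _ _ linear_mapD(1)[OF cl z]];
   simp add: linform_mult_left[OF A] f assms alg_one[OF A] alg_l_one[OF A])+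

lemma tev_mult_comul_add:
 assumes "s \<in> carrier (tensor_space H H)" "t \<in> carrier (tensor_space H H)"
 shows "tev \<phi> \<psi> ((s \<oplus>\<^bsub>tensor_space H H\<^esub> t) \<otimes>\<^bsub>tensor_alg H H\<^esub> comul H z) =
  tev \<phi> \<psi> (s \<otimes>\<^bsub>tensor_alg H H\<^esub> comul H z) + tev \<phi> \<psi> (t \<otimes>\<^bsub>tensor_alg H H\<^esub> comul H z)"
 using alg_l_distr[OF k_algebra_tensor[OF A A], of s t "comul H z"] assms linear_mapD(1)[OF cl z]
  alg_mult[OF k_algebra_tensor[OF A A]]
  linformD(1)[OF linform_tev[OF alg_vspace[OF A] alg_vspace[OF A] f]]
 by (simp add: tensor_alg_simps[OF A A])

text \<open>A left factor is traded for translated functionals; here it is group-like, in the two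
  lemmas that follow it has the comultiplication of x or of y. Iteration computes
  \<open>conv\<close> at all monomials from its values at the generators.\<close>

lemma conv_mult_grouplike:
 assumes "u \<in> carrier H" "comul H u = pure_tensor H H u u"
 shows "conv H \<phi> \<psi> (u \<otimes> z) = conv H (\<lambda>w. \<phi> (u \<otimes> w)) (\<lambda>w. \<psi> (u \<otimes> w)) z"
 using assms z tev_mult_comul[OF assms(1,1)] by (simp add: conv_def[of H \<phi> \<psi>] cm)

lemma conv_mult_skew_primitive:
 assumes c: "u \<in> carrier H" "g \<in> carrier H"
  and u: "comul H u = pure_tensor H H u \<one> \<oplus>\<^bsub>tensor_space H H\<^esub> pure_tensor H H g u"
 shows "conv H \<phi> \<psi> (u \<otimes> z) =
  conv H (\<lambda>w. \<phi> (u \<otimes> w)) \<psi> z + conv H (\<lambda>w. \<phi> (g \<otimes> w)) (\<lambda>w. \<psi> (u \<otimes> w)) z"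
 using c z u
 by (simp add: conv_def[of H \<phi> \<psi>] cm tev_mult_comul_add tev_mult_comul alg_one[OF A] conv_one_mult
   pure_closed[OF alg_vspace[OF A] alg_vspace[OF A]])

lemma conv_mult_second_order:
 assumes c: "u \<in> carrier H" "p \<in> carrier H" "q \<in> carrier H"
  and u: "comul H u = pure_tensor H H u \<one> \<oplus>\<^bsub>tensor_space H H\<^esub>
   (pure_tensor H H \<one> u \<oplus>\<^bsub>tensor_space H H\<^esub> pure_tensor H H p q)"
 shows "conv H \<phi> \<psi> (u \<otimes> z) =
  conv H (\<lambda>w. \<phi> (u \<otimes> w)) \<psi> z + (conv H \<phi> (\<lambda>w. \<psi> (u \<otimes> w)) z +
  conv H (\<lambda>w. \<phi> (p \<otimes> w)) (\<lambda>w. \<psi> (q \<otimes> w)) z)"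
 using c z u
 by (simp add: conv_def[of H \<phi> \<psi>] cm tev_mult_comul_add tev_mult_comul alg_one[OF A] conv_one_mult
   pure_closed[OF alg_vspace[OF A] alg_vspace[OF A]] vs_add[OF vspace_tensor[OF alg_vspace[OF A] alg_vspace[OF A]]])

end

end

context q_presentation
begin

definition \<delta> :: "'i \<Rightarrow> (('k, 'i) free_algebra \<times> ('k, 'i) free_algebra) list" where
 "\<delta> i = (if i = gg then [(gen gg, gen gg)] else if i = gx then [(gen gx, 1), (gen gg, gen gx)]
  else [(gen gy, 1), (1, gen gy), (gen gx * gen gg, gen gx)])"

definition e :: "'i \<Rightarrow> 'k" where
 "e i = (if i = gg then 1 else 0)"

definition D :: "('k, ('k, 'i) free_algebra set) bialg" where
 "D = presented_bialg R \<delta> e"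

abbreviation cg where "cg \<equiv> cls (gen gg)"
abbreviation cx where "cx \<equiv> cls (gen gx)"
abbreviation cy where "cy \<equiv> cls (gen gy)"

abbreviation PP where "PP \<equiv> tensor_alg P P"
abbreviation TT where "TT \<equiv> tensor_space P P"
abbreviation pure (infixl "\<boxtimes>" 70) where "u \<boxtimes> v \<equiv> pure_tensor P P u v"

definition comul_gen where
 "comul_gen i = list_sum PP (map (\<lambda>(p, q). cls p \<boxtimes> cls q) (\<delta> i))"

lemma TT_vspace: "vspace TT"
 by (rule vspace_tensor[OF P.V P.V])

lemmas TT_closed = vs_add[OF TT_vspace] vs_smult[OF TT_vspace] pure_closed[OF P.V P.V] vs_zero[OF TT_vspace]

lemmas PP_simps = tensor_alg_simps[OF P.B P.B]

lemmas PP_alg = alg_l_distr[OF k_algebra_tensor[OF P.B P.B], unfolded PP_simps]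
 alg_mult[OF k_algebra_tensor[OF P.B P.B], unfolded PP_simps]

lemma comul_gen_simps: "comul_gen gg = cg \<boxtimes> cg" "comul_gen gx = cx \<boxtimes> \<one>\<^bsub>P\<^esub> \<oplus>\<^bsub>TT\<^esub> cg \<boxtimes> cx"
 "comul_gen gy = cy \<boxtimes> \<one>\<^bsub>P\<^esub> \<oplus>\<^bsub>TT\<^esub> (\<one>\<^bsub>P\<^esub> \<boxtimes> cy \<oplus>\<^bsub>TT\<^esub> (cx \<otimes>\<^bsub>P\<^esub> cg) \<boxtimes> cx)"
 using gens_distinct
 by (auto simp: comul_gen_def \<delta>_def list_sum_def PP_simps vs_r_zero[OF TT_vspace] TT_closed P.closed
   presented_class_one presented_class_mult)

lemma comul_gen_closed: "comul_gen i \<in> carrier PP"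
 using gens_cases[of i] by (auto simp: comul_gen_simps PP_simps TT_closed P.closed)

text \<open>The prescribed comultiplication descends to the quotient because the images of the
  generators satisfy the relations in the tensor square. Evaluated at two functionals, each relation
  becomes an identity between values on normal forms.\<close>

lemma q_algebra_tensor: "q_algebra PP (comul_gen gg) (comul_gen gx) (comul_gen gy) \<epsilon> \<tau>"
proof -
 have eqI: "s = t" if "s \<in> carrier TT" "t \<in> carrier TT"
  "\<And>\<phi> \<psi>. linform P \<phi> \<Longrightarrow> linform P \<psi> \<Longrightarrow> tev \<phi> \<psi> s = tev \<phi> \<psi> t" for s t
  using that by (rule tensor_eqI[OF P.V P.V fin_dim_P fin_dim_P])
 note lin = linform_tev[OF P.V P.V, THEN linformD(1)] linform_tev[OF P.V P.V, THEN linformD(2)]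
 note simps = tev_mult[OF P.B P.B] tev_pure[OF P.V P.V] linform_mult_left[OF P.B] PP_alg TT_closed lin
 show ?thesis
 proof (intro q_algebra.intro k_algebra_tensor P.B char2 idem comul_gen_closed; unfold PP_simps)
  show "comul_gen gg \<otimes>\<^bsub>PP\<^esub> comul_gen gg = \<one>\<^bsub>P\<^esub> \<boxtimes> \<one>\<^bsub>P\<^esub>"
   unfolding comul_gen_simps
   by (rule eqI; simp add: simps P.word_simps)
  show "comul_gen gx \<otimes>\<^bsub>PP\<^esub> comul_gen gg =
   comul_gen gg \<otimes>\<^bsub>PP\<^esub> comul_gen gx \<oplus>\<^bsub>TT\<^esub> \<epsilon> \<odot>\<^bsub>TT\<^esub> (\<one>\<^bsub>P\<^esub> \<boxtimes> \<one>\<^bsub>P\<^esub> \<oplus>\<^bsub>TT\<^esub> comul_gen gg)"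
   unfolding comul_gen_simps
   by (rule eqI; simp add: simps P.word_simps linformD; simp add: P.scalar_norm)
  show "comul_gen gy \<otimes>\<^bsub>PP\<^esub> comul_gen gg =
   comul_gen gg \<otimes>\<^bsub>PP\<^esub> comul_gen gy \<oplus>\<^bsub>TT\<^esub> \<epsilon> \<odot>\<^bsub>TT\<^esub> (comul_gen gx \<oplus>\<^bsub>TT\<^esub> comul_gen gg \<otimes>\<^bsub>PP\<^esub> comul_gen gx)"
   unfolding comul_gen_simps
   by (rule eqI; simp add: simps P.word_simps linformD; simp add: P.scalar_norm)
  show "comul_gen gy \<otimes>\<^bsub>PP\<^esub> comul_gen gx =
   comul_gen gx \<otimes>\<^bsub>PP\<^esub> comul_gen gy \<oplus>\<^bsub>TT\<^esub> \<tau> \<odot>\<^bsub>TT\<^esub> (\<one>\<^bsub>P\<^esub> \<boxtimes> \<one>\<^bsub>P\<^esub> \<oplus>\<^bsub>TT\<^esub> comul_gen gg)"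
   unfolding comul_gen_simps
   by (rule eqI; simp add: simps P.word_simps linformD; simp add: P.scalar_norm)
  show "comul_gen gx \<otimes>\<^bsub>PP\<^esub> comul_gen gx = \<epsilon> \<odot>\<^bsub>TT\<^esub> comul_gen gx"
   unfolding comul_gen_simps
   by (rule eqI; simp add: simps P.word_simps linformD; simp add: P.scalar_norm)
  show "comul_gen gy \<otimes>\<^bsub>PP\<^esub> comul_gen gy = \<epsilon> \<odot>\<^bsub>TT\<^esub> comul_gen gy \<oplus>\<^bsub>TT\<^esub>
   \<tau> \<odot>\<^bsub>TT\<^esub> (comul_gen gx \<oplus>\<^bsub>TT\<^esub> comul_gen gg \<otimes>\<^bsub>PP\<^esub> comul_gen gx \<oplus>\<^bsub>TT\<^esub> \<epsilon> \<odot>\<^bsub>TT\<^esub> (\<one>\<^bsub>P\<^esub> \<boxtimes> \<one>\<^bsub>P\<^esub> \<oplus>\<^bsub>TT\<^esub> comul_gen gg))"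
   unfolding comul_gen_simps
   by (rule eqI; simp add: simps P.word_simps linformD; simp add: P.scalar_norm)
 qed
qed

lemma q_algebra_counit: "q_algebra base_alg (e gg) (e gx) (e gy) \<epsilon> \<tau>"
 using gens_distinct
 by (intro q_algebra.intro k_algebra_base_alg char2 idem) (auto simp: e_def char2_field[OF char2])

lemmas D_simps = presented_bialg_simps[of R \<delta> e, folded D_def comul_gen_def[abs_def]]

lemma D_tensor: "tensor_space D D = TT" "pure_tensor D D = pure_tensor P P" "tensor_alg D D = PP"
proof -
 show s: "tensor_space D D = TT" "pure_tensor D D = pure_tensor P P"
  by (rule tensor_space_cong; simp add: D_simps)+
 show "tensor_alg D D = PP" unfolding tensor_alg_def s by (simp add: D_simps)
qed

lemma k_algebra_D: "k_algebra D"
 by (rule k_algebraI) (use vspace_cong[OF P.V, of D] in \<open>simp_all add: D_simps P.closed P.alg\<close>)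

lemma linform_D: "linform D = linform P"
 by (simp add: linform_def[abs_def] D_simps)

lemma vspace_D: "vspace D"
 by (rule alg_vspace[OF k_algebra_D])

lemma finsum_D: "f \<in> A \<rightarrow> carrier P \<Longrightarrow> finsum D f A = finsum P f A"
 by (rule finsum_transfer[OF P.V vspace_D]) (simp_all add: D_simps)

lemma dual_system_D: "dual_system D {..<8} b coord"
proof -
 have "(\<Oplus>\<^bsub>D\<^esub>i\<in>{..<8}. coord i z \<odot>\<^bsub>P\<^esub> b i) = z" if "z \<in> carrier P" for z
  using dual_systemD(4)[OF dual_monomials that] P.monomial_closed by (subst finsum_D) (auto simp: P.closed)
 then show ?thesis
  using dual_monomials by (simp add: dual_system_def linform_D D_simps)
qed

lemma fin_dim_D: "fin_dim D"
 by (rule fin_dimI[OF vspace_D dual_system_D])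

lemma comul_gen_vanish: "r \<in> R \<Longrightarrow> free_lift PP comul_gen r = \<zero>\<^bsub>PP\<^esub>"
 by (rule relations_vanish[OF q_algebra_tensor comul_gen_closed])

lemma e_vanish: "r \<in> R \<Longrightarrow> free_lift base_alg e r = \<zero>\<^bsub>base_alg\<^esub>"
 by (rule relations_vanish[OF q_algebra_counit]) auto

lemmas comul_lift = k_algebra_tensor[OF P.B P.B] comul_gen_closed comul_gen_vanish

lemma comul_D_hom: "comul D \<in> ring_hom D (tensor_alg D D)"
 using presented_lift_hom[OF comul_lift] by (simp add: D_tensor D_simps ring_hom_def)

lemma comul_D_linear: "linear_map D (tensor_space D D) (comul D)"
 using presented_lift_linear[OF comul_lift] by (simp add: D_tensor D_simps linear_map_def PP_simps)

lemma comul_D_gen: "comul D (cls (gen i)) = comul_gen i"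
 using presented_lift_gen[OF comul_lift] by (simp add: D_simps)

lemma comul_D_one: "comul D \<one>\<^bsub>P\<^esub> = \<one>\<^bsub>P\<^esub> \<boxtimes> \<one>\<^bsub>P\<^esub>"
 using presented_lift_one[OF comul_lift] by (simp add: D_simps PP_simps)

lemma comul_D_mult: "u \<in> carrier D \<Longrightarrow> z \<in> carrier D \<Longrightarrow> comul D (u \<otimes>\<^bsub>D\<^esub> z) = comul D u \<otimes>\<^bsub>tensor_alg D D\<^esub> comul D z"
 using comul_D_hom by (simp add: ring_hom_def)

lemmas e_lift = k_algebra_base_alg UNIV_I[of "e i" for i, folded base_alg_simps(1)] e_vanish

lemma counit_D_hom: "counit D \<in> ring_hom D base_ring"
 using presented_lift_hom[OF e_lift] by (simp add: D_simps ring_hom_def)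

lemma linform_counit_D: "linform D (counit D)"
 using presented_lift_linear[OF e_lift] by (simp add: D_simps linform_iff linear_map_def)

lemma counit_D_mult: "u \<in> carrier P \<Longrightarrow> z \<in> carrier P \<Longrightarrow> counit D (u \<otimes>\<^bsub>P\<^esub> z) = counit D u * counit D z"
 using counit_D_hom by (simp add: ring_hom_def D_simps)

lemma counit_D_gen: "counit D (cls (gen i)) = e i" "counit D \<one>\<^bsub>P\<^esub> = 1"
 using presented_lift_gen[OF e_lift] presented_lift_one[OF e_lift] by (simp_all add: D_simps)

lemma counit_monomial: "n < 8 \<Longrightarrow> counit D (b n) = (if n < 2 then 1 else 0)"
 unfolding less8 using gens_distinct
 by (elim disjE; hypsubst; simp add: P.monomial_simps counit_D_mult P.closed counit_D_gen e_def)

text \<open>The pairs \<open>(u, v)\<close> such that the sum of the \<open>u \<otimes> v\<close> is the comultiplication of the n-th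
 monomial.\<close>

definition comul_monomial :: "nat \<Rightarrow> (('k, 'i) free_algebra set \<times> ('k, 'i) free_algebra set) list" where
 "comul_monomial n = [
   [(b 0, b 0)],
   [(b 1, b 1)],
   [(b 2, b 0), (b 1, b 2)],
   [(b 3, b 1), (b 0, b 3)],
   [(b 4, b 0), (b 0, b 4), (b 3 \<oplus>\<^bsub>P\<^esub> \<epsilon> \<odot>\<^bsub>P\<^esub> (b 0 \<oplus>\<^bsub>P\<^esub> b 1), b 2)],
   [(b 5, b 1), (b 1, b 5), (b 2 \<oplus>\<^bsub>P\<^esub> \<epsilon> \<odot>\<^bsub>P\<^esub> (b 0 \<oplus>\<^bsub>P\<^esub> b 1), b 3)],
   [(b 6, b 0), (b 2, b 4), (b 5, b 2), (b 1, b 6), (\<epsilon> \<odot>\<^bsub>P\<^esub> (b 2 \<oplus>\<^bsub>P\<^esub> b 3), b 2)],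
   [(b 7, b 1), (b 3, b 5), (b 4, b 3), (b 0, b 7), (\<epsilon> \<odot>\<^bsub>P\<^esub> (b 2 \<oplus>\<^bsub>P\<^esub> b 3), b 3)]] ! n"

lemma comul_monomial_simps:
 "comul_monomial 0 = [(b 0, b 0)]"
 "comul_monomial 1 = [(b 1, b 1)]"
 "comul_monomial 2 = [(b 2, b 0), (b 1, b 2)]"
 "comul_monomial 3 = [(b 3, b 1), (b 0, b 3)]"
 "comul_monomial 4 = [(b 4, b 0), (b 0, b 4), (b 3 \<oplus>\<^bsub>P\<^esub> \<epsilon> \<odot>\<^bsub>P\<^esub> (b 0 \<oplus>\<^bsub>P\<^esub> b 1), b 2)]"
 "comul_monomial 5 = [(b 5, b 1), (b 1, b 5), (b 2 \<oplus>\<^bsub>P\<^esub> \<epsilon> \<odot>\<^bsub>P\<^esub> (b 0 \<oplus>\<^bsub>P\<^esub> b 1), b 3)]"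
 "comul_monomial 6 = [(b 6, b 0), (b 2, b 4), (b 5, b 2), (b 1, b 6), (\<epsilon> \<odot>\<^bsub>P\<^esub> (b 2 \<oplus>\<^bsub>P\<^esub> b 3), b 2)]"
 "comul_monomial 7 = [(b 7, b 1), (b 3, b 5), (b 4, b 3), (b 0, b 7), (\<epsilon> \<odot>\<^bsub>P\<^esub> (b 2 \<oplus>\<^bsub>P\<^esub> b 3), b 3)]"
 by (simp_all add: comul_monomial_def)

lemma comul_monomial_closed:
 "n < 8 \<Longrightarrow> (u, v) \<in> set (comul_monomial n) \<Longrightarrow> u \<in> carrier P \<and> v \<in> carrier P"
 unfolding less8 by (elim disjE; hypsubst; auto simp: comul_monomial_simps P.closed P.monomial_closed simp del: One_nat_def)

lemma conv_D_gen:
 assumes "linform P \<phi>" "linform P \<psi>"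
 shows "conv D \<phi> \<psi> \<one>\<^bsub>P\<^esub> = \<phi> \<one>\<^bsub>P\<^esub> * \<psi> \<one>\<^bsub>P\<^esub>" "conv D \<phi> \<psi> cg = \<phi> cg * \<psi> cg"
  "conv D \<phi> \<psi> cx = \<phi> cx * \<psi> \<one>\<^bsub>P\<^esub> + \<phi> cg * \<psi> cx"
  "conv D \<phi> \<psi> cy = \<phi> cy * \<psi> \<one>\<^bsub>P\<^esub> + (\<phi> \<one>\<^bsub>P\<^esub> * \<psi> cy + \<phi> (cx \<otimes>\<^bsub>P\<^esub> cg) * \<psi> cx)"
 using assms
 by (simp_all add: conv_def comul_D_gen comul_D_one comul_gen_simps tev_pure[OF P.V P.V] P.closed TT_closed
   linform_tev[OF P.V P.V, THEN linformD(1)])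

lemma conv_D_mult:
 assumes "linform P \<phi>" "linform P \<psi>" "z \<in> carrier P"
 shows "conv D \<phi> \<psi> (cg \<otimes>\<^bsub>P\<^esub> z) = conv D (\<lambda>w. \<phi> (cg \<otimes>\<^bsub>P\<^esub> w)) (\<lambda>w. \<psi> (cg \<otimes>\<^bsub>P\<^esub> w)) z"
  "conv D \<phi> \<psi> (cx \<otimes>\<^bsub>P\<^esub> z) = conv D (\<lambda>w. \<phi> (cx \<otimes>\<^bsub>P\<^esub> w)) \<psi> z +
    conv D (\<lambda>w. \<phi> (cg \<otimes>\<^bsub>P\<^esub> w)) (\<lambda>w. \<psi> (cx \<otimes>\<^bsub>P\<^esub> w)) z"
 using conv_mult_grouplike[OF k_algebra_D comul_D_linear comul_D_mult, of \<phi> \<psi> z cg]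
  conv_mult_skew_primitive[OF k_algebra_D comul_D_linear comul_D_mult, of \<phi> \<psi> z cx cg] assms
 by (simp_all add: linform_D D_simps(1,3-6) D_tensor comul_D_gen comul_gen_simps)

lemma conv_monomial_list:
 assumes f: "linform P \<phi>" "linform P \<psi>" and n: "n < 8"
 shows "conv D \<phi> \<psi> (b n) = (\<Sum>(u, v)\<leftarrow>comul_monomial n. \<phi> u * \<psi> v)"
 using n unfolding less8
 by (elim disjE; hypsubst; simp add: comul_monomial_simps comul_monomial_simps(2)[unfolded One_nat_def] P.monomial_simps
   conv_D_gen conv_D_mult f linform_mult_left[OF P.B] linform_mult_left2[OF P.B]
   P.word_simps linformD[OF f(1)] linformD[OF f(2)]; simp add: P.scalar_norm)

lemma comul_D_monomial:
 assumes n: "n < 8"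
 shows "comul D (b n) = list_sum TT (map (\<lambda>(u, v). u \<boxtimes> v) (comul_monomial n))"
proof -
 note cl = comul_monomial_closed[OF n]
 show ?thesis
 proof (rule tensor_eqI[OF P.V P.V fin_dim_P fin_dim_P])
  show "comul D (b n) \<in> carrier TT"
   using linear_mapD(1)[OF comul_D_linear, of "b n"] P.monomial_closed[OF n] by (simp add: D_simps D_tensor)
  show "list_sum TT (map (\<lambda>(u, v). u \<boxtimes> v) (comul_monomial n)) \<in> carrier TT"
   by (rule tev_list_sum(1)[OF P.V P.V linform_0 linform_0 cl])
  fix \<phi> \<psi> assume f: "linform P \<phi>" "linform P \<psi>"
  show "tev \<phi> \<psi> (comul D (b n)) = tev \<phi> \<psi> (list_sum TT (map (\<lambda>(u, v). u \<boxtimes> v) (comul_monomial n)))"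
   using conv_monomial_list[OF f n] by (simp add: tev_list_sum(2)[OF P.V P.V f cl] conv_def)
 qed
qed

lemma conv_monomial:
 assumes f: "linform P \<phi>" "linform P \<psi>"
 shows "conv D \<phi> \<psi> (b 0) = \<phi> (b 0) * \<psi> (b 0)"
  "conv D \<phi> \<psi> (b 1) = \<phi> (b 1) * \<psi> (b 1)"
  "conv D \<phi> \<psi> (b 2) = \<phi> (b 2) * \<psi> (b 0) + \<phi> (b 1) * \<psi> (b 2)"
  "conv D \<phi> \<psi> (b 3) = \<phi> (b 3) * \<psi> (b 1) + \<phi> (b 0) * \<psi> (b 3)"
  "conv D \<phi> \<psi> (b 4) = \<phi> (b 4) * \<psi> (b 0) + \<phi> (b 0) * \<psi> (b 4) + (\<phi> (b 3) + \<epsilon> * (\<phi> (b 0) + \<phi> (b 1))) * \<psi> (b 2)"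
  "conv D \<phi> \<psi> (b 5) = \<phi> (b 5) * \<psi> (b 1) + \<phi> (b 1) * \<psi> (b 5) + (\<phi> (b 2) + \<epsilon> * (\<phi> (b 0) + \<phi> (b 1))) * \<psi> (b 3)"
  "conv D \<phi> \<psi> (b 6) = \<phi> (b 6) * \<psi> (b 0) + \<phi> (b 2) * \<psi> (b 4) + \<phi> (b 5) * \<psi> (b 2) + \<phi> (b 1) * \<psi> (b 6)
    + \<epsilon> * (\<phi> (b 2) + \<phi> (b 3)) * \<psi> (b 2)"
  "conv D \<phi> \<psi> (b 7) = \<phi> (b 7) * \<psi> (b 1) + \<phi> (b 3) * \<psi> (b 5) + \<phi> (b 4) * \<psi> (b 3) + \<phi> (b 0) * \<psi> (b 7)
    + \<epsilon> * (\<phi> (b 2) + \<phi> (b 3)) * \<psi> (b 3)"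
 by (simp_all add: conv_monomial_list[OF f] comul_monomial_simps linformD[OF f(1)] P.monomial_closed P.closed del: One_nat_def)

lemma linear_eq_on_monomials:
 assumes W: "vspace W" and f: "linear_map P W f" and h: "linear_map P W h"
  and eq: "\<And>n. n < 8 \<Longrightarrow> f (b n) = h (b n)" and z: "z \<in> carrier P"
 shows "f z = h z"
 by (rule dual_system_linear_eq[OF P.V W dual_monomials f h _ z]) (simp add: eq)

lemma linform_eq_on_monomials:
 assumes "linform P f" "linform P h" "\<And>n. n < 8 \<Longrightarrow> f (b n) = h (b n)" "z \<in> carrier P"
 shows "f z = h z"
 using linear_eq_on_monomials[OF vspace_base_alg] assms by (simp add: linform_iff)

lemma linform_conv_D: "linform P \<phi> \<Longrightarrow> linform P \<psi> \<Longrightarrow> linform P (conv D \<phi> \<psi>)"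
 using linform_comp[OF comul_D_linear linform_tev[OF alg_vspace[OF k_algebra_D] alg_vspace[OF k_algebra_D]]]
 by (simp add: linform_D conv_def[abs_def])

text \<open>Both axioms are linear in the element, so the eight monomials suffice; there they are
  polynomial identities in the values of the forms on the monomials.\<close>

lemma k_coalgebra_D: "k_coalgebra D"
proof (rule k_coalgebraI[OF alg_vspace[OF k_algebra_D] fin_dim_D comul_D_linear linform_counit_D]; unfold linform_D D_simps(1))
 fix \<phi> \<psi> \<chi> z assume f: "linform P \<phi>" "linform P \<psi>" "linform P \<chi>" and z: "z \<in> carrier P"
 note l = linform_conv_D[OF f(1,2)] linform_conv_D[OF f(2,3)]
 show "conv D (conv D \<phi> \<psi>) \<chi> z = conv D \<phi> (conv D \<psi> \<chi>) z"
 proof (rule linform_eq_on_monomials[OF linform_conv_D[OF l(1) f(3)] linform_conv_D[OF f(1) l(2)] _ z])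
  show "conv D (conv D \<phi> \<psi>) \<chi> (b n) = conv D \<phi> (conv D \<psi> \<chi>) (b n)" if "n < 8" for n
   using that unfolding less8
   by (elim disjE; hypsubst; simp only: conv_monomial[OF l(1) f(3)] conv_monomial[OF f(1) l(2)] conv_monomial[OF f(1,2)] conv_monomial[OF f(2,3)];
    simp add: P.scalar_norm del: One_nat_def)
 qed
next
 fix \<phi> z assume f: "linform P \<phi>" and z: "z \<in> carrier P"
 note e = linform_counit_D[unfolded linform_D]
 note cm = counit_monomial[of 0] counit_monomial[of 1] counit_monomial[of 2] counit_monomial[of 3] counit_monomial[of 4]
  counit_monomial[of 5] counit_monomial[of 6] counit_monomial[of 7]
 show "conv D (counit D) \<phi> z = \<phi> z"
 proof (rule linform_eq_on_monomials[OF linform_conv_D[OF e f] f _ z])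
  show "conv D (counit D) \<phi> (b n) = \<phi> (b n)" if "n < 8" for n
   using that unfolding less8
   by (elim disjE; hypsubst; simp only: conv_monomial[OF e f]; simp add: cm char2_field[OF char2] del: One_nat_def)
 qed
 show "conv D \<phi> (counit D) z = \<phi> z"
 proof (rule linform_eq_on_monomials[OF linform_conv_D[OF f e] f _ z])
  show "conv D \<phi> (counit D) (b n) = \<phi> (b n)" if "n < 8" for n
   using that unfolding less8
   by (elim disjE; hypsubst; simp only: conv_monomial[OF f e]; simp add: cm del: One_nat_def)
 qed
qed

lemma k_bialgebra_D: "k_bialgebra D"
 by (intro k_bialgebra.intro k_bialgebra_axioms.intro k_algebra_D k_coalgebra_D comul_D_hom counit_D_hom)

text \<open>An antipode reverses products, so the values on generators determine all others. From
  the comultiplication of x one gets S(x) = g x. From S(y) + y + S(x g) x = 0 together with S(x g) =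
  x and x x = \<epsilon> x one gets S(y) = y + \<epsilon> x.\<close>

definition antipode_monomial :: "nat \<Rightarrow> ('k, 'i) free_algebra set" where
 "antipode_monomial n = (let S_y = cy \<oplus>\<^bsub>P\<^esub> \<epsilon> \<odot>\<^bsub>P\<^esub> cx; S_x = cg \<otimes>\<^bsub>P\<^esub> cx in
   [\<one>\<^bsub>P\<^esub>, cg, S_x, S_x \<otimes>\<^bsub>P\<^esub> cg, S_y, S_y \<otimes>\<^bsub>P\<^esub> cg, S_y \<otimes>\<^bsub>P\<^esub> S_x, S_y \<otimes>\<^bsub>P\<^esub> S_x \<otimes>\<^bsub>P\<^esub> cg] ! n)"

definition antipode :: "('k, 'i) free_algebra set \<Rightarrow> ('k, 'i) free_algebra set" where
 "antipode z = (\<Oplus>\<^bsub>P\<^esub>n\<in>{..<8}. coord n z \<odot>\<^bsub>P\<^esub> antipode_monomial n)"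

lemma antipode_monomial_closed: "n < 8 \<Longrightarrow> antipode_monomial n \<in> carrier P"
 unfolding less8 by (elim disjE; hypsubst; simp add: antipode_monomial_def Let_def P.closed)

lemma antipode_linear: "linear_map P P antipode"
 unfolding antipode_def[abs_def]
 by (rule linear_map_finsum_smult[OF P.V P.V linform_coord]) (auto intro: antipode_monomial_closed)

lemma antipode_b: "m < 8 \<Longrightarrow> antipode (b m) = antipode_monomial m"
proof -
 interpret M: module base_ring P by (rule P.V)
 assume m: "m < 8"
 have "antipode (b m) = (\<Oplus>\<^bsub>P\<^esub>n\<in>{..<8}. if m = n then antipode_monomial n else \<zero>\<^bsub>P\<^esub>)"
  unfolding antipode_def using m
  by (intro M.M.finsum_cong') (auto simp: coord_monomial vs_smult_one[OF P.V] vs_smult_zero[OF P.V] antipode_monomial_closed)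
 also have "\<dots> = antipode_monomial m"
  by (rule M.M.finsum_singleton) (use m in \<open>auto intro: antipode_monomial_closed\<close>)
 finally show ?thesis .
qed

lemma tensor_lift_list_sum:
 assumes W: "vspace W" and \<beta>: "bilin P P W \<beta>" and ts: "\<And>u v. (u, v) \<in> set ts \<Longrightarrow> u \<in> carrier P \<and> v \<in> carrier P"
 shows "tensor_lift W \<beta> (list_sum TT (map (\<lambda>(u, v). u \<boxtimes> v) ts)) = list_sum W (map (\<lambda>(u, v). \<beta> u v) ts)"
proof -
 note l = tensor_lift_linear[OF P.V P.V W \<beta>]
 have "list_sum TT (map (\<lambda>(u, v). u \<boxtimes> v) ts) \<in> carrier TT \<and>
  tensor_lift W \<beta> (list_sum TT (map (\<lambda>(u, v). u \<boxtimes> v) ts)) = list_sum W (map (\<lambda>(u, v). \<beta> u v) ts)"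
  using ts
 proof (induct ts)
  case Nil
  then show ?case using linear_map_zero[OF TT_vspace W l] TT_closed by (simp add: list_sum_def)
 next
  case (Cons p ts)
  obtain u v where p: "p = (u, v)" by (cases p)
  have uv: "u \<in> carrier P" "v \<in> carrier P" using Cons(2) by (auto simp: p)
  have "list_sum TT (map (\<lambda>(u, v). u \<boxtimes> v) ts) \<in> carrier TT \<and>
   tensor_lift W \<beta> (list_sum TT (map (\<lambda>(u, v). u \<boxtimes> v) ts)) = list_sum W (map (\<lambda>(u, v). \<beta> u v) ts)"
   using Cons(2) by (intro Cons(1)) auto
  then show ?case using uv
   by (simp add: list_sum_def p TT_closed linear_mapD(2)[OF l] tensor_lift_pure[OF P.V P.V W \<beta>])
 qed
 then show ?thesis by simp
qed

lemma is_antipode_D: "is_antipode D antipode"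
proof -
 note al = linear_mapD[OF antipode_linear]
 have bl: "bilin P P D (\<lambda>u v. antipode u \<otimes>\<^bsub>P\<^esub> v)" "bilin P P D (\<lambda>u v. u \<otimes>\<^bsub>P\<^esub> antipode v)"
  by (intro bilinI linear_mapI; simp add: al P.closed P.alg D_simps)+
 have cl: "linear_map P TT (comul D)"
  using comul_D_linear by (simp add: D_tensor linear_map_def D_simps)
 have ul: "linear_map P D (\<lambda>z. counit D z \<odot>\<^bsub>P\<^esub> \<one>\<^bsub>P\<^esub>)"
  using linformD[OF linform_counit_D] by (intro linear_mapI)
   (simp_all add: D_simps P.closed vs_smult_l_distr[OF P.V] vs_smult_assoc[OF P.V])
 have ls: "list_sum D = list_sum P" by (simp add: list_sum_def[abs_def] D_simps)
 note ab = antipode_b[of 0] antipode_b[of 1] antipode_b[of 2] antipode_b[of 3] antipode_b[of 4] antipode_b[of 5]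
  antipode_b[of 6] antipode_b[of 7]
 note sc = vs_smult_one[OF P.V] vs_smult_zero[OF P.V] vs_smult_r_null[OF P.V]
 have 1: "tensor_lift D (\<lambda>u v. antipode u \<otimes>\<^bsub>P\<^esub> v) (comul D z) = counit D z \<odot>\<^bsub>P\<^esub> \<one>\<^bsub>P\<^esub>" if z: "z \<in> carrier P" for z
 proof (rule linear_eq_on_monomials[OF vspace_D linear_map_comp[OF cl tensor_lift_linear[OF P.V P.V vspace_D bl(1)]] ul _ z])
  fix n :: nat assume n: "n < 8"
  have "list_sum P (map (\<lambda>(u, v). antipode u \<otimes>\<^bsub>P\<^esub> v) (comul_monomial n)) = counit D (b n) \<odot>\<^bsub>P\<^esub> \<one>\<^bsub>P\<^esub>"
   using n counit_monomial[OF n] unfolding less8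
   by (elim disjE; hypsubst; simp add: comul_monomial_simps list_sum_def al ab P.monomial_closed P.closed del: One_nat_def;
    simp add: antipode_monomial_def Let_def P.monomial_simps P.word_simps sc; simp add: P.vs_norm P.word_simps idem P.idem_left sc mult.commute mult.left_commute)
  then show "tensor_lift D (\<lambda>u v. antipode u \<otimes>\<^bsub>P\<^esub> v) (comul D (b n)) = counit D (b n) \<odot>\<^bsub>P\<^esub> \<one>\<^bsub>P\<^esub>"
   by (simp add: comul_D_monomial[OF n] tensor_lift_list_sum[OF vspace_D bl(1) comul_monomial_closed[OF n]] ls)
 qed
 have 2: "tensor_lift D (\<lambda>u v. u \<otimes>\<^bsub>P\<^esub> antipode v) (comul D z) = counit D z \<odot>\<^bsub>P\<^esub> \<one>\<^bsub>P\<^esub>" if z: "z \<in> carrier P" for z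
 proof (rule linear_eq_on_monomials[OF vspace_D linear_map_comp[OF cl tensor_lift_linear[OF P.V P.V vspace_D bl(2)]] ul _ z])
  fix n :: nat assume n: "n < 8"
  have "list_sum P (map (\<lambda>(u, v). u \<otimes>\<^bsub>P\<^esub> antipode v) (comul_monomial n)) = counit D (b n) \<odot>\<^bsub>P\<^esub> \<one>\<^bsub>P\<^esub>"
   using n counit_monomial[OF n] unfolding less8
   by (elim disjE; hypsubst; simp add: comul_monomial_simps list_sum_def al ab P.monomial_closed P.closed del: One_nat_def;
    simp add: antipode_monomial_def Let_def P.monomial_simps P.word_simps sc; simp add: P.vs_norm P.word_simps idem P.idem_left sc mult.commute mult.left_commute)
  then show "tensor_lift D (\<lambda>u v. u \<otimes>\<^bsub>P\<^esub> antipode v) (comul D (b n)) = counit D (b n) \<odot>\<^bsub>P\<^esub> \<one>\<^bsub>P\<^esub>"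
   by (simp add: comul_D_monomial[OF n] tensor_lift_list_sum[OF vspace_D bl(2) comul_monomial_closed[OF n]] ls)
 qed
 have "linear_map D D antipode" using antipode_linear by (simp add: linear_map_def D_simps)
 then show ?thesis using 1 2 by (simp add: is_antipode_def D_simps)
qed

lemma hopf_algebra_D: "hopf_algebra D"
 using is_antipode_D by (intro hopf_algebra.intro hopf_algebra_axioms.intro k_bialgebra_D) blast

lemma has_dimension_D: "has_dimension D 8"
proof -
 interpret M: module base_ring P by (rule P.V)
 have inj: "inj_on b {..<8}"
 proof (rule inj_onI)
  fix m n :: nat assume mn: "m \<in> {..<8}" "n \<in> {..<8}" and eq: "b m = b n"
  have "coord m (b m) = coord m (b n)" by (rule arg_cong[OF eq])
  then show "m = n" using mn by (simp add: coord_monomial split: if_splits)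
 qed
 let ?B = "b ` {..<8}"
 have fs: "(\<Oplus>\<^bsub>D\<^esub>v\<in>?B. c v \<odot>\<^bsub>P\<^esub> v) = (\<Oplus>\<^bsub>P\<^esub>v\<in>?B. c v \<odot>\<^bsub>P\<^esub> v)" for c
  using P.monomial_closed by (intro finsum_D) (auto simp: P.closed)
 have "is_basis D ?B"
  unfolding is_basis_def D_simps fs
 proof (intro conjI ballI ex1I)
  show "?B \<subseteq> carrier P" using P.monomial_closed by auto
  fix z assume z: "z \<in> carrier P"
  define c where "c = (\<lambda>v\<in>?B. coord (the_inv_into {..<8} b v) z)"
  have re: "(\<Oplus>\<^bsub>P\<^esub>v\<in>?B. d v \<odot>\<^bsub>P\<^esub> v) = (\<Oplus>\<^bsub>P\<^esub>n\<in>{..<8}. d (b n) \<odot>\<^bsub>P\<^esub> b n)" for d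
   using P.monomial_closed by (intro M.M.finsum_reindex inj) (auto simp: P.closed)
  show "c \<in> ?B \<rightarrow>\<^sub>E UNIV" by (auto simp: c_def)
  have "(\<Oplus>\<^bsub>P\<^esub>n\<in>{..<8}. c (b n) \<odot>\<^bsub>P\<^esub> b n) = (\<Oplus>\<^bsub>P\<^esub>n\<in>{..<8}. coord n z \<odot>\<^bsub>P\<^esub> b n)"
   using P.monomial_closed by (intro M.M.finsum_cong') (auto simp: c_def the_inv_into_f_f[OF inj] P.closed)
  then show "z = (\<Oplus>\<^bsub>P\<^esub>v\<in>?B. c v \<odot>\<^bsub>P\<^esub> v)"
   unfolding re using dual_systemD(4)[OF dual_monomials z] by simp
  fix d assume d: "d \<in> ?B \<rightarrow>\<^sub>E UNIV \<and> z = (\<Oplus>\<^bsub>P\<^esub>v\<in>?B. d v \<odot>\<^bsub>P\<^esub> v)"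
  show "d = c"
  proof (rule PiE_ext)
   show "d \<in> ?B \<rightarrow>\<^sub>E UNIV" "c \<in> ?B \<rightarrow>\<^sub>E UNIV" using d by (auto simp: c_def)
   fix v assume "v \<in> ?B"
   then obtain m where m: "m < 8" "v = b m" by auto
   have "coord m z = (\<Sum>n<8. coord m (d (b n) \<odot>\<^bsub>P\<^esub> b n))"
    using d unfolding re using P.monomial_closed
    by (subst linform_finsum[OF P.V linform_coord, symmetric]) (auto simp: P.closed)
   also have "\<dots> = (\<Sum>n<8. if m = n then d (b n) else 0)"
    using m by (intro sum.cong) (auto simp: linformD[OF linform_coord] P.monomial_closed coord_monomial)
   also have "\<dots> = d (b m)" using m by (simp add: sum.delta')
   finally show "d v = c v" using m by (simp add: c_def the_inv_into_f_f[OF inj])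
  qed
 qed simp
 moreover have "card ?B = 8" using inj by (simp add: card_image)
 ultimately show ?thesis unfolding has_dimension_def by blast
qed

end

section \<open>Subcoalgebras and multiplication of the associated graded algebra\<close>

lemma SUP_const': "a \<in> A \<Longrightarrow> (\<And>x. x \<in> A \<Longrightarrow> f x = c) \<Longrightarrow> (\<Union>x\<in>A. f x) = c"
 by auto

text \<open>A subcoalgebra is closed under the slices (\<phi> \<otimes> id) \<Delta>, which serve to
  extract elements from it.\<close>

lemma subcoalgebra_slice:
 fixes H (structure)
 assumes H: "k_coalgebra H" and C: "subcoalgebra H C" and z: "z \<in> C" and f: "linform H \<phi>"
 obtains w where "w \<in> C" "\<And>\<psi>. linform H \<psi> \<Longrightarrow> \<psi> w = conv H \<phi> \<psi> z"
proof -
 note V = coalg_vspace[OF H]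
 have S: "submodule C base_ring H" "comul H z \<in> tensor_sub H C C" using C z by (auto simp: subcoalgebra_def)
 note zc = subsetD[OF sub_subset[OF S(1)] z]
 have b: "bilin H H H (\<lambda>u v. \<phi> u \<odot> v)"
  by (intro bilinI linear_mapI; simp add: linformD[OF f] vs_smult[OF V] vs_smult_l_distr[OF V]
    vs_smult_r_distr[OF V] vs_smult_assoc[OF V, symmetric] mult.commute)
 note tl = tensor_lift_linear[OF V V V b]
 have "tensor_sub H C C \<subseteq> {t \<in> carrier (tensor_space H H). tensor_lift H (\<lambda>u v. \<phi> u \<odot> v) t \<in> C}"
  unfolding tensor_sub_def
  by (rule lin_span_least[OF submodule_vimage[OF vspace_tensor[OF V V] V tl S(1)]])
   (use sub_subset[OF S(1)] sub_smult[OF S(1)] in \<open>auto simp: subset_iff tensor_lift_pure[OF V V V b] pure_closed[OF V V]\<close>)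
 then have "tensor_lift H (\<lambda>u v. \<phi> u \<odot> v) (comul H z) \<in> C" using S(2) by auto
 then show thesis
 proof (rule that)
  fix \<psi> assume p: "linform H \<psi>"
  show "\<psi> (tensor_lift H (\<lambda>u v. \<phi> u \<odot> v) (comul H z)) = conv H \<phi> \<psi> z"
   unfolding conv_def
   by (rule tev_eqI[OF V V linform_comp[OF tl p] f p coalg_comul[OF H zc], symmetric])
    (simp add: tensor_lift_pure[OF V V V b] linformD[OF p])
 qed
qed

text \<open>The line through a group-like element has no proper nonzero subspace, and it is nonzero
  because the counit of \<open>g\<close> is 1.\<close>

lemma simple_subcoalgebra_grouplike:
 fixes H (structure)
 assumes H: "k_coalgebra H" and g: "g \<in> grouplikes H"
 shows "simple_subcoalgebra H {c \<odot> g | c. True}"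
proof -
 note V = coalg_vspace[OF H]
 let ?L = "{c \<odot> g | c. True}"
 have gc: "g \<in> carrier H" "comul H g = pure_tensor H H g g" "counit H g = 1" using g by (auto simp: grouplikes_def)
 have LI: "c \<odot> g \<in> ?L" for c by (rule CollectI, rule exI[of _ c]) simp
 have S: "submodule ?L base_ring H"
 proof (rule submoduleI'[OF V])
  show "\<zero> \<in> ?L" using LI[of 0] vs_smult_zero[OF V gc(1)] by simp
  show "a \<oplus> b \<in> ?L" if "a \<in> ?L" "b \<in> ?L" for a b
   using that LI by (auto simp: vs_smult_l_distr[OF V gc(1), symmetric])
  show "c \<odot> x \<in> ?L" if "x \<in> ?L" for c x
   using that LI by (auto simp: vs_smult_assoc[OF V gc(1), symmetric])
 qed (auto simp: vs_smult[OF V] gc)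
 have gL: "g \<in> ?L" using LI[of 1] vs_smult_one[OF V gc(1)] by simp
 note T = vspace_tensor[OF V V]
 have SS: "submodule (tensor_sub H ?L ?L) base_ring (tensor_space H H)"
  unfolding tensor_sub_def
  by (rule submodule_lin_span[OF T]) (auto simp: vs_smult[OF V] gc intro!: pure_closed[OF V V])
 have "pure_tensor H H g g \<in> tensor_sub H ?L ?L"
  unfolding tensor_sub_def by (rule subsetD[OF lin_span_superset]) (use gL in blast)
 then have "comul H ` ?L \<subseteq> tensor_sub H ?L ?L"
  using sub_smult[OF SS] by (auto simp: linear_mapD(3)[OF coalg_comul_linear[OF H]] gc)
 then have sc: "subcoalgebra H ?L" using S by (simp only: subcoalgebra_def simp_thms)
 have g0: "g \<noteq> \<zero>" using gc(3) linform_zero[OF V coalg_counit[OF H]] by auto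
 have dich: "E = {\<zero>} \<or> E = ?L" if E: "subcoalgebra H E" "E \<subseteq> ?L" for E
 proof (cases "E = {\<zero>}")
  case False
  have SE: "submodule E base_ring H" using E by (simp add: subcoalgebra_def)
  then obtain v where v: "v \<in> E" "v \<noteq> \<zero>" using False sub_zero[OF SE] by blast
  then obtain c where c: "v = c \<odot> g" using E(2) by auto
  then have "c \<noteq> 0" using v vs_smult_zero[OF V gc(1)] by auto
  then have "g = inverse c \<odot> v" by (simp add: c vs_smult_assoc[OF V gc(1), symmetric] vs_smult_one[OF V gc(1)])
  then have "g \<in> E" using sub_smult[OF SE v(1)] by simp
  then have "?L \<subseteq> E" using sub_smult[OF SE] by (auto simp: subset_iff)
  then show ?thesis using E(2) by simp
 qed simp
 have "?L \<noteq> {\<zero>}" using gL g0 by (metis singletonD)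
 with sc show ?thesis unfolding simple_subcoalgebra_def
  by (intro conjI allI impI dich) (simp_all only: simp_thms)
qed

lemma grouplike_in_coradical:
 assumes H: "k_coalgebra H" and g: "g \<in> grouplikes H"
 shows "g \<in> coradical H"
proof -
 have "g = 1 \<odot>\<^bsub>H\<^esub> g" using g vs_smult_one[OF coalg_vspace[OF H]] by (simp add: grouplikes_def)
 then have "g \<in> \<Union>{D. simple_subcoalgebra H D}" using simple_subcoalgebra_grouplike[OF H g] by blast
 then show ?thesis unfolding coradical_def by (rule subsetD[OF lin_span_superset])
qed

section \<open>The product of the associated graded algebra on representatives\<close>

context
 fixes H :: "('k::field, 'a, 'm) bialg_scheme" (structure) and N :: nat
 assumes A: "k_algebra H" and H: "k_coalgebra H" and fd: "fin_dim H" and pointed: "pointed H"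
  and M: "\<And>i j u v. u \<in> coradical_filtration H i \<Longrightarrow> v \<in> coradical_filtration H j \<Longrightarrow>
   u \<otimes> v \<in> coradical_filtration H (i + j)"
  and N: "\<And>n. N \<le> n \<Longrightarrow> coradical_filtration H n \<subseteq> previous_filtration H n"
begin

lemma filtration_mult_closed:
 "u \<in> prevf H i \<Longrightarrow> v \<in> corf H j \<Longrightarrow> u \<otimes> v \<in> prevf H (i + j)" "u \<in> corf H i \<Longrightarrow> v \<in> prevf H j \<Longrightarrow> u \<otimes> v \<in> prevf H (i + j)"
proof -
 note c = C_closed[OF H fd pointed] and z = sub_zero[OF subF[OF H fd pointed]]
 show "u \<in> prevf H i \<Longrightarrow> v \<in> corf H j \<Longrightarrow> u \<otimes> v \<in> prevf H (i + j)"
  using M z c by (cases i) (auto simp: alg_l_null[OF A])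
 show "u \<in> corf H i \<Longrightarrow> v \<in> prevf H j \<Longrightarrow> u \<otimes> v \<in> prevf H (i + j)"
  using M z c by (cases j) (auto simp: alg_r_null[OF A])
qed

text \<open>The product in \<open>gr_alg\<close> is a sum of unions over all representatives. Each
  union is a single coset, so any family of representatives \<open>x\<close>, \<open>y\<close>
  computes it.\<close>

lemma gr_mult_eq:
 assumes u: "u \<in> carrier (gr_alg H)" and v: "v \<in> carrier (gr_alg H)"
  and x: "\<And>i. x i \<in> u i" and y: "\<And>i. y i \<in> v i"
 shows "(\<And>i. x i \<in> corf H i)" "(\<And>i. y i \<in> corf H i)"
  "(u \<otimes>\<^bsub>gr_alg H\<^esub> v) n = prevf H n +> (\<Oplus>i\<in>{..n}. x i \<otimes> y (n - i))"
  "(\<Oplus>i\<in>{..n}. x i \<otimes> y (n - i)) \<in> corf H n"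
proof -
 note V = alg_vspace[OF A]
 interpret HM: module base_ring H by (rule V)
 interpret P: module base_ring "gr_piece H n" by (rule vspace_gr_piece[OF H fd pointed])
 note Cc = C_closed[OF H fd pointed] and sF = subF[OF H fd pointed] and sC = subC[OF H fd pointed]
 have Fc: "w \<in> prevf H i \<Longrightarrow> w \<in> carrier H" for w i using sub_subset[OF sF] by auto
 have mem: "w \<in> corf H i" "w' \<in> u i \<Longrightarrow> w' \<ominus> w \<in> prevf H i"
  if u: "u \<in> carrier (gr_alg H)" and w: "w \<in> u i" for u w w' i
 proof -
  define r where "r = (SOME x. x \<in> u i)"
  note r = gr_rep[OF H fd pointed u, of i, folded r_def]
  have *: "w \<in> carrier H \<and> w \<ominus> r \<in> prevf H i" if "w \<in> u i" for w
   using that r mem_coset_iff[OF V sF Cc[OF r(1)]] by simp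
  have dec: "w = (w \<ominus> r) \<oplus> r" if "w \<in> carrier H" for w
   using that Cc[OF r(1)] by (simp add: HM.M.minus_eq HM.M.a_assoc HM.M.l_neg)
  show "w \<in> corf H i" using *[OF w] dec[of w] sub_add[OF sC _ r(1)] F_subset_C[OF H fd pointed, of i] by (metis subsetD)
  assume w': "w' \<in> u i"
  have "w' \<ominus> w = (w' \<ominus> r) \<ominus> (w \<ominus> r)"
   using *[OF w] *[OF w'] Cc[OF r(1)]
   by (simp add: HM.M.minus_eq HM.M.minus_add HM.M.a_ac HM.M.r_neg1 HM.M.r_neg2)
  then show "w' \<ominus> w \<in> prevf H i" using sub_minus[OF V sF] * w w' by simp
 qed
 show xC: "x i \<in> corf H i" and yC: "y i \<in> corf H i" for i using mem(1) u v x y by auto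
 have xyC: "x i \<otimes> y (n - i) \<in> corf H n" if "i \<le> n" for i using M[OF xC[of i] yC[of "n - i"]] that by simp
 show "(\<Oplus>i\<in>{..n}. x i \<otimes> y (n - i)) \<in> corf H n" by (rule sub_finsum[OF V sC]) (use xyC in auto)
 have piece: "(\<Union>x'\<in>u i. \<Union>y'\<in>v (n - i). prevf H n +> (x' \<otimes> y')) = prevf H n +> (x i \<otimes> y (n - i))"
  if i: "i \<le> n" for i
 proof -
  have "prevf H n +> (x' \<otimes> y') = prevf H n +> (x i \<otimes> y (n - i))" if x': "x' \<in> u i" and y': "y' \<in> v (n - i)" for x' y'
  proof -
   note c = mem(1)[OF u x'] mem(1)[OF v y']
   have d: "x' \<ominus> x i \<in> prevf H i" "y' \<ominus> y (n - i) \<in> prevf H (n - i)"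
    using mem(2)[OF u x x'] mem(2)[OF v y y'] by auto
   note cc = Cc[OF c(1)] Cc[OF c(2)] Cc[OF xC[of i]] Cc[OF yC[of "n - i"]]
   have m: "a \<ominus> b = a \<oplus> (-1) \<odot> b" if "a \<in> carrier H" "b \<in> carrier H" for a b
    using that by (simp add: vs_smult_minus[OF V] a_minus_def)
   \<comment> \<open>Both differences lie in previous terms, and multiplicativity of the filtration
     puts the two products on the right into the previous term of degree \<open>n\<close>.\<close>
   have "x' \<otimes> y' \<ominus> x i \<otimes> y (n - i) = (x' \<ominus> x i) \<otimes> y' \<oplus> x i \<otimes> (y' \<ominus> y (n - i))"
    using cc vs_l_neg[OF V, of "x i \<otimes> y'"] vs_add_comm[OF V]
    by (simp add: m alg_l_distr[OF A] alg_r_distr[OF A] alg_smult_left[OF A] alg_smult_right[OF A]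
     alg_mult[OF A] vs_smult[OF V] vs_add_assoc[OF V] vs_add_assoc[OF V, symmetric, of "(-1) \<odot> (x i \<otimes> y')"] vs_l_zero[OF V])
   moreover have "(x' \<ominus> x i) \<otimes> y' \<in> prevf H n" "x i \<otimes> (y' \<ominus> y (n - i)) \<in> prevf H n"
    using filtration_mult_closed(1)[OF d(1) c(2)] filtration_mult_closed(2)[OF xC[of i] d(2)] i by auto
   ultimately show ?thesis
    using cc sub_add[OF sF] by (subst gr_coset_eq_iff[OF H fd pointed]) (auto simp: alg_mult[OF A])
  qed
  then show ?thesis by (intro SUP_const'[OF x[of i]] SUP_const'[OF y[of "n - i"]])
 qed
 have "(u \<otimes>\<^bsub>gr_alg H\<^esub> v) n =
  (\<Oplus>\<^bsub>gr_piece H n\<^esub>i\<in>{..n}. (\<Union>x'\<in>u i. \<Union>y'\<in>v (n - i). prevf H n +> (x' \<otimes> y')))"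
  by (simp only: gr_alg_def monoid.simps ring.simps module.simps)
 also have "\<dots> = (\<Oplus>\<^bsub>gr_piece H n\<^esub>i\<in>{..n}. prevf H n +> (x i \<otimes> y (n - i)))"
 proof (rule P.M.finsum_cong'[OF refl])
  show "(\<lambda>i. prevf H n +> (x i \<otimes> y (n - i))) \<in> {..n} \<rightarrow> carrier (gr_piece H n)"
   using xyC by (intro Pi_I gr_piece_carrierI[OF H fd pointed]) simp
 qed (use piece in simp)
 also have "\<dots> = prevf H n +> (\<Oplus>\<^bsub>H\<lparr>carrier := corf H n\<rparr>\<^esub>i\<in>{..n}. x i \<otimes> y (n - i))"
  using linear_map_finsum[OF vspace_C[OF H fd pointed] vspace_gr_piece[OF H fd pointed]
   coset_linear[OF vspace_C[OF H fd pointed] submodule_F_C[OF H fd pointed], folded gr_piece_def], of "\<lambda>i. x i \<otimes> y (n - i)" "{..n}" n] xyC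
  by simp
 also have "(\<Oplus>\<^bsub>H\<lparr>carrier := corf H n\<rparr>\<^esub>i\<in>{..n}. x i \<otimes> y (n - i)) = (\<Oplus>i\<in>{..n}. x i \<otimes> y (n - i))"
 proof -
  have inc: "linear_map (H\<lparr>carrier := corf H n\<rparr>) H (\<lambda>x. x)" using Cc by (auto simp: linear_map_def)
  show ?thesis
   using linear_map_finsum[OF vspace_C[OF H fd pointed] V inc, of "\<lambda>i. x i \<otimes> y (n - i)" "{..n}"] xyC by simp
 qed
 finally show "(u \<otimes>\<^bsub>gr_alg H\<^esub> v) n = prevf H n +> (\<Oplus>i\<in>{..n}. x i \<otimes> y (n - i))" .
qed

lemma gr_finite_support:
 assumes "\<And>n. u n \<in> carrier (gr_piece H n)"
 shows "u \<in> carrier (gr_alg H)"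
proof -
 have "u n = \<zero>\<^bsub>gr_piece H n\<^esub>" if n: "N \<le> n" for n
 proof -
  obtain x where x: "x \<in> corf H n" "u n = prevf H n +> x" using assms[of n] by (auto simp: gr_piece_carrier[OF H fd pointed])
  then have "x \<in> prevf H n" using N[OF n] by auto
  then show ?thesis using x gr_coset_zero[OF H fd pointed] by (simp add: gr_piece_zero[OF H fd pointed])
 qed
 then have "{n. u n \<noteq> \<zero>\<^bsub>gr_piece H n\<^esub>} \<subseteq> {..<N}" by (auto simp: not_le[symmetric])
 then have "finite {n. u n \<noteq> \<zero>\<^bsub>gr_piece H n\<^esub>}" by (rule finite_subset) simp
 then show ?thesis using assms by (simp add: gr_alg_simps)
qed

lemma gr_form_mult:
 assumes u: "u \<in> carrier (gr_alg H)" and v: "v \<in> carrier (gr_alg H)"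
  and x: "\<And>i. x i \<in> u i" and y: "\<And>i. y i \<in> v i"
 shows gr_mult_closed: "u \<otimes>\<^bsub>gr_alg H\<^esub> v \<in> carrier (gr_alg H)"
  and "\<phi> \<in> ann H (prevf H n) \<Longrightarrow> gr_form n \<phi> (u \<otimes>\<^bsub>gr_alg H\<^esub> v) = (\<Sum>i\<le>n. \<phi> (x i \<otimes> y (n - i)))"
proof -
 note g = gr_mult_eq[OF u v x y]
 note Cc = C_closed[OF H fd pointed]
 show "u \<otimes>\<^bsub>gr_alg H\<^esub> v \<in> carrier (gr_alg H)"
  by (rule gr_finite_support) (use g(3,4) in \<open>simp add: gr_piece_carrierI[OF H fd pointed]\<close>)
 assume f: "\<phi> \<in> ann H (prevf H n)"
 have "gr_form n \<phi> (u \<otimes>\<^bsub>gr_alg H\<^esub> v) = \<phi> (\<Oplus>i\<in>{..n}. x i \<otimes> y (n - i))"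
  by (rule gr_form_coset[where u="u \<otimes>\<^bsub>gr_alg H\<^esub> v" and x="\<Oplus>i\<in>{..n}. x i \<otimes> y (n - i)",
   OF H fd pointed f g(3)[of n] Cc[OF g(4)[of n]]])
 also have "\<dots> = (\<Sum>i\<le>n. \<phi> (x i \<otimes> y (n - i)))"
  using g(1,2) Cc by (intro linform_finsum[OF alg_vspace[OF A] annD(1)[OF f]]) (auto intro!: alg_mult[OF A])
 finally show "gr_form n \<phi> (u \<otimes>\<^bsub>gr_alg H\<^esub> v) = (\<Sum>i\<le>n. \<phi> (x i \<otimes> y (n - i)))" .
qed

end

section \<open>The coradical filtration of Q\<close>

context q_presentation
begin

lemma conv_expand:
 assumes f: "linform P \<phi>" "linform P \<psi>" and z: "z \<in> carrier P"
 shows "conv D \<phi> \<psi> z = (\<Sum>n<8. coord n z * conv D \<phi> \<psi> (b n))"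
 by (rule linform_expand[OF P.V dual_monomials linform_conv_D[OF f] z])

lemma lessThan_8: "(\<Sum>n<8. f n) = f 0 + f 1 + f 2 + f 3 + f 4 + f 5 + f 6 + f (7::nat)"
 by (simp add: lessThan_nat_numeral lessThan_Suc add_ac)

lemma coord_b: "n < 8 \<Longrightarrow> m < 8 \<Longrightarrow> coord n (b m) = (if n = m then 1 else 0)"
 by (rule coord_monomial)

text \<open>The span of the first \<open>k\<close> monomials, given by the vanishing of the other
  coordinates. The coradical filtration will consist of those with \<open>k\<close> even, each step
  adding the two monomials of one degree.\<close>

definition Z :: "nat \<Rightarrow> ('k, 'i) free_algebra set set" where
 "Z k = {z \<in> carrier P. \<forall>n. k \<le> n \<and> n < 8 \<longrightarrow> coord n z = 0}"

lemma submodule_Z: "submodule (Z k) base_ring D"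
 using linformD[OF linform_coord] linform_zero[OF P.V linform_coord]
 by (intro submoduleI'[OF vspace_D]) (auto simp: Z_def D_simps P.closed)

lemma Z_least:
 assumes S: "submodule S base_ring D" and b: "\<And>n. n < 8 \<Longrightarrow> coord n z \<noteq> 0 \<Longrightarrow> b n \<in> S" and z: "z \<in> carrier P"
 shows "z \<in> S"
proof -
 have "coord n z \<odot>\<^bsub>D\<^esub> b n \<in> S" if "n < 8" for n
  using that b sub_smult[OF S] sub_zero[OF S] vs_smult_zero[OF P.V P.monomial_closed[OF that]]
  by (cases "coord n z = 0") (auto simp: D_simps)
 then have "(\<Oplus>\<^bsub>D\<^esub>n\<in>{..<8}. coord n z \<odot>\<^bsub>D\<^esub> b n) \<in> S" by (intro sub_finsum[OF vspace_D S]) auto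
 then show ?thesis using dual_systemD(4)[OF dual_system_D, of z] z by (simp add: D_simps)
qed

lemma b_in_Z: "n < 8 \<Longrightarrow> b n \<in> Z k \<longleftrightarrow> n < k"
 by (auto simp: Z_def P.monomial_closed coord_b not_le)

lemma Z_subset_iff:
 assumes S: "submodule S base_ring D"
 shows "Z k \<subseteq> S \<longleftrightarrow> (\<forall>n<8. n < k \<longrightarrow> b n \<in> S)"
proof
 assume *: "\<forall>n<8. n < k \<longrightarrow> b n \<in> S"
 show "Z k \<subseteq> S"
 proof
  fix z assume z: "z \<in> Z k"
  show "z \<in> S"
  proof (rule Z_least[OF S])
   fix n :: nat assume n: "n < 8" "coord n z \<noteq> 0"
   then have "n < k" using z by (force simp: Z_def not_le[symmetric])
   then show "b n \<in> S" using * n by simp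
  qed (use z in \<open>simp add: Z_def\<close>)
 qed
qed (use b_in_Z in auto)

lemma Z_zero: "Z 0 = {\<zero>\<^bsub>P\<^esub>}"
proof -
 have "z = \<zero>\<^bsub>P\<^esub>" if "z \<in> Z 0" for z
 proof (rule dual_system_eqI[OF P.V dual_monomials _ P.closed(5)])
  show "coord i z = coord i \<zero>\<^bsub>P\<^esub>" if "i \<in> {..<8}" for i
   using that \<open>z \<in> Z 0\<close> by (simp add: Z_def linform_zero[OF P.V linform_coord])
 qed (use that in \<open>simp add: Z_def\<close>)
 moreover have "\<zero>\<^bsub>P\<^esub> \<in> Z 0" using sub_zero[OF submodule_Z, of 0] by (simp add: D_simps)
 ultimately show ?thesis by blast
qed

lemma Z_top: "8 \<le> k \<Longrightarrow> Z k = carrier P"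
 by (auto simp: Z_def)

text \<open>Take a monomial of greatest degree in \<open>z\<close>, with index \<open>m\<close>.
  Slicing by the coordinate form of \<open>m\<close> on the left leaves a multiple of 1 or of g
  according to the parity of \<open>m\<close>, because \<Delta> b_m contains b_m tensor that
  element, while b_m occurs on the left in no other monomial of at most the same degree.\<close>

lemma subcoalgebra_contains_grouplike:
 assumes C: "subcoalgebra D C" and z: "z \<in> C" "z \<noteq> \<zero>\<^bsub>P\<^esub>"
 shows "b 0 \<in> C \<or> b 1 \<in> C"
proof -
 have SC: "submodule C base_ring D" using C by (simp add: subcoalgebra_def)
 have zc: "z \<in> carrier P" using sub_subset[OF SC] z by (auto simp: D_simps)
 have key: "b i \<in> C" if m: "coord m z \<noteq> 0" and i: "i < 8"
  and eq: "\<And>\<psi>. linform P \<psi> \<Longrightarrow> conv D (coord m) \<psi> z = coord m z * \<psi> (b i)" for m i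
 proof (rule subcoalgebra_slice[OF k_coalgebra_D C z(1), of "coord m"])
  show "linform D (coord m)" by (simp add: linform_D linform_coord)
  fix w assume w: "w \<in> C" and weq: "\<And>\<psi>. linform D \<psi> \<Longrightarrow> \<psi> w = conv D (coord m) \<psi> z"
  have wc: "w \<in> carrier P" using sub_subset[OF SC] w by (auto simp: D_simps)
  note bc = P.monomial_closed[OF i]
  have "w = coord m z \<odot>\<^bsub>P\<^esub> b i"
   by (rule dual_system_eqI[OF P.V dual_monomials wc])
    (simp_all add: P.closed bc weq linform_D linform_coord eq linformD[OF linform_coord])
  then have "b i = inverse (coord m z) \<odot>\<^bsub>P\<^esub> w"
   using m bc by (simp add: vs_smult_assoc[OF P.V, symmetric] vs_smult_one[OF P.V])
  then show "b i \<in> C" using sub_smult[OF SC w, of "inverse (coord m z)"] by (simp add: D_simps)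
 qed
 note conv = conv_expand[OF linform_coord _ zc] conv_monomial[OF linform_coord] lessThan_8 coord_b
 have "\<exists>n<8. coord n z \<noteq> 0"
  using dual_system_eqI[OF P.V dual_monomials zc P.closed(5)] z(2)
  by (auto simp: linform_zero[OF P.V linform_coord])
 then show ?thesis
 proof -
  assume ex: "\<exists>n<8. coord n z \<noteq> 0"
  \<comment> \<open>Greatest refers to the degree, half the index; 4 bounds the degrees that
    occur.\<close>
  obtain m where "m < 8" and m: "coord m z \<noteq> 0" and d: "\<And>n. n < 8 \<Longrightarrow> coord n z \<noteq> 0 \<Longrightarrow> n div 2 \<le> m div 2"
   using ex ex_has_greatest_nat[of "\<lambda>n. n < 8 \<and> coord n z \<noteq> 0" _ "\<lambda>n. n div 2" 4] by fastforce
  have hi: "n < 8 \<Longrightarrow> m div 2 < n div 2 \<Longrightarrow> coord n z = 0" for n using d[of n] by force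
  from \<open>m < 8\<close> have "conv D (coord m) \<psi> z = coord m z * \<psi> (b (m mod 2))" if "linform P \<psi>" for \<psi>
   using hi[of 2] hi[of 3] hi[of 4] hi[of 5] hi[of 6] hi[of 7] that unfolding less8[of m]
   by (elim disjE; hypsubst; simp add: conv del: One_nat_def)
  then have "b (m mod 2) \<in> C" by (intro key[OF m]) auto
  then show ?thesis by (cases "even m") (auto simp: even_iff_mod_2_eq_zero odd_iff_mod_2_eq_one)
 qed
qed

lemma grouplikes_D: "b 0 \<in> grouplikes D" "b 1 \<in> grouplikes D"
proof -
 have "b 0 \<in> grouplikes D \<and> b 1 \<in> grouplikes D"
  using comul_D_one comul_D_gen[of gg] gens_distinct
  by (simp add: grouplikes_def P.monomial_simps D_simps(1) P.closed D_tensor comul_gen_simps counit_D_gen e_def del: One_nat_def)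
 then show "b 0 \<in> grouplikes D" "b 1 \<in> grouplikes D" by auto
qed

lemma submodule_coradical_D: "submodule (coradical D) base_ring D"
 unfolding coradical_def
 by (rule submodule_lin_span[OF vspace_D]) (auto simp: simple_subcoalgebra_def subcoalgebra_def dest: subsetD[OF sub_subset])

text \<open>A simple subcoalgebra contains the line through 1 or g; this line is itself a
  subcoalgebra, hence equal to it.\<close>

lemma coradical_D: "coradical D = Z 2"
proof
 have "C \<subseteq> Z 2" if C: "simple_subcoalgebra D C" for C
 proof -
  have sc: "subcoalgebra D C" "C \<noteq> {\<zero>\<^bsub>P\<^esub>}" using C by (simp_all add: simple_subcoalgebra_def D_simps)
  then have SC: "submodule C base_ring D" by (simp add: subcoalgebra_def)
  obtain z where "z \<in> C" "z \<noteq> \<zero>\<^bsub>P\<^esub>" using sc(2) sub_zero[OF SC] by (auto simp: D_simps)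
  from subcoalgebra_contains_grouplike[OF sc(1) this]
  obtain i :: nat where i: "i < 2" "b i \<in> C" "b i \<in> grouplikes D" using grouplikes_D by (metis one_less_numeral_iff pos2 semiring_norm(76))
  let ?L = "{c \<odot>\<^bsub>D\<^esub> b i | c. True}"
  have L: "simple_subcoalgebra D ?L" by (rule simple_subcoalgebra_grouplike[OF k_coalgebra_D i(3)])
  have "?L \<subseteq> C" using sub_smult[OF SC i(2)] by auto
  moreover have "subcoalgebra D ?L" "?L \<noteq> {\<zero>\<^bsub>D\<^esub>}" using L unfolding simple_subcoalgebra_def by (rule conjunct1, rule conjunct1[OF conjunct2])
  moreover have "\<forall>E. subcoalgebra D E \<and> E \<subseteq> C \<longrightarrow> E = {\<zero>\<^bsub>D\<^esub>} \<or> E = C"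
   using C unfolding simple_subcoalgebra_def by (elim conjE)
  ultimately have "?L = C" by (metis (no_types))
  moreover have "?L \<subseteq> Z 2" using sub_smult[OF submodule_Z, of "b i" 2] i(1) b_in_Z[of i 2] by auto
  ultimately show ?thesis by simp
 qed
 then show "coradical D \<subseteq> Z 2"
  unfolding coradical_def by (intro lin_span_least[OF submodule_Z]) auto
 show "Z 2 \<subseteq> coradical D"
  using grouplike_in_coradical[OF k_coalgebra_D] grouplikes_D
  by (subst Z_subset_iff[OF submodule_coradical_D]) (auto simp: less_2_cases_iff)
qed

lemma pointed_D: "pointed D"
 unfolding pointed_def
proof
 have "submodule (lin_span D (grouplikes D)) base_ring D"
  by (rule submodule_lin_span[OF vspace_D]) (auto simp: grouplikes_def)
 then show "coradical D \<subseteq> lin_span D (grouplikes D)"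
  unfolding coradical_D using grouplikes_D by (subst Z_subset_iff) (auto simp: less_2_cases_iff intro!: subsetD[OF lin_span_superset])
 show "lin_span D (grouplikes D) \<subseteq> coradical D"
  by (rule lin_span_least[OF submodule_coradical_D]) (auto intro: grouplike_in_coradical[OF k_coalgebra_D])
qed

lemma ann_Z: "\<phi> \<in> ann D (Z k) \<Longrightarrow> linform P \<phi> \<and> (\<forall>n<8. n < k \<longrightarrow> \<phi> (b n) = 0)"
 using annD[of \<phi> D "Z k"] b_in_Z by (auto simp: linform_D)

lemma coord_ann_Z: "n < 8 \<Longrightarrow> k \<le> n \<Longrightarrow> coord n \<in> ann D (Z k)"
 by (rule annI) (auto simp: linform_D linform_coord Z_def)

text \<open>Each step tests the wedge condition on coordinate forms for one inclusion and inserts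
  the comultiplications of the monomials for the other. From degree 3 on the term is the whole
  algebra.\<close>

lemma coradical_filtration_D: "coradical_filtration D n = Z (2 * n + 2)"
proof (induct n)
 case (Suc n)
 note iff = coradical_filtration_Suc_iff[OF k_coalgebra_D fin_dim_D pointed_D, of _ n, unfolded Suc coradical_D]
 have "n = 0 \<or> n = 1 \<or> n = 2 \<or> 3 \<le> n" by auto
 note n = this
 show ?case
 proof (intro Set.set_eqI iffI)
  fix x assume "x \<in> coradical_filtration D (Suc n)"
  then have x: "x \<in> carrier P"
   and t: "\<And>i j. i < 8 \<Longrightarrow> j < 8 \<Longrightarrow> 2 \<le> i \<Longrightarrow> 2 * n + 2 \<le> j \<Longrightarrow> conv D (coord i) (coord j) x = 0"
   unfolding iff using coord_ann_Z by (auto simp: D_simps)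
  note conv = conv_expand[OF linform_coord linform_coord x] conv_monomial[OF linform_coord linform_coord] lessThan_8 coord_b
  \<comment> \<open>The pairs (2, 4) and (3, 5) read off the coordinates 6 and 7. The pairs (3, 2)
    and (2, 3) read off 4 and 5, up to \<epsilon> times 6 and 7.\<close>
  have "n = 0 \<longrightarrow> coord 4 x = 0 \<and> coord 5 x = 0" "n \<le> 1 \<longrightarrow> coord 6 x = 0 \<and> coord 7 x = 0"
   using t[of 3 2] t[of 2 3] t[of 2 4] t[of 3 5] by (auto simp: conv simp del: One_nat_def)
  then show "x \<in> Z (2 * Suc n + 2)" using x n unfolding Z_def less8 by auto
 next
  fix x assume "x \<in> Z (2 * Suc n + 2)"
  then have x: "x \<in> carrier P" "\<And>m. 2 * n + 4 \<le> m \<Longrightarrow> m < 8 \<Longrightarrow> coord m x = 0" by (auto simp: Z_def)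
  have "conv D \<phi> \<psi> x = 0" if f: "\<phi> \<in> ann D (Z 2)" "\<psi> \<in> ann D (Z (2 * n + 2))" for \<phi> \<psi>
  proof -
   have F: "linform P \<phi>" "linform P \<psi>" "\<phi> (b 0) = 0" "\<phi> (b 1) = 0" "\<And>m. m < 8 \<Longrightarrow> m < 2 * n + 2 \<Longrightarrow> \<psi> (b m) = 0"
    using ann_Z[OF f(1)] ann_Z[OF f(2)] by auto
   note conv = conv_expand[OF F(1,2) x(1)] conv_monomial[OF F(1,2)] lessThan_8 F(3,4)
   from n show ?thesis
   proof (elim disjE)
    assume n: "n = 0" show ?thesis by (simp add: conv F(5) x(2) n del: One_nat_def)
   next assume n: "n = 1" show ?thesis by (simp add: conv F(5) x(2) n del: One_nat_def)
   next assume n: "n = 2" show ?thesis by (simp add: conv F(5) x(2) n del: One_nat_def)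
   next assume n: "3 \<le> n" show ?thesis using n by (simp add: conv F(5) del: One_nat_def)
   qed
  qed
  then show "x \<in> coradical_filtration D (Suc n)" unfolding iff using x by (auto simp: D_simps)
 qed
qed (simp only: coradical_D coradical_filtration.simps(1) mult_0_right add_0)

lemma previous_filtration_D: "previous_filtration D n = Z (2 * n)"
 by (cases n) (simp_all add: previous_filtration_simps coradical_filtration_D Z_zero D_simps)

lemma half_bounds: "2 * (n div 2) \<le> n" "n < 2 * (n div 2) + (2::nat)"
 by presburger+

section \<open>Structure constants in top degree\<close>

lemma T_values:
 "T_g v 0 = v 1"
  "T_g v 1 = v 0"
  "T_g v 2 = v 3"
  "T_g v 3 = v 2"
  "T_g v 4 = v 5"
  "T_g v 5 = v 4"
  "T_g v 6 = v 7"
  "T_g v 7 = v 6"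
 "T_x v 0 = \<epsilon> * v 1"
  "T_x v 1 = \<epsilon> * v 1"
  "T_x v 2 = v 0 + \<epsilon> * v 2 + \<epsilon> * v 3"
  "T_x v 3 = v 1"
  "T_x v 4 = \<epsilon> * v 5"
  "T_x v 5 = \<epsilon> * v 5"
  "T_x v 6 = v 4 + \<epsilon> * v 6 + \<epsilon> * v 7"
  "T_x v 7 = v 5"
 "T_y v 0 = \<tau> * (v 2 + v 3) + \<tau> * \<epsilon> * (v 4 + v 5 + v 6 + v 7)"
  "T_y v 1 = \<tau> * (v 2 + v 3) + \<tau> * \<epsilon> * (v 4 + v 5 + v 6 + v 7)"
  "T_y v 2 = \<epsilon> * (v 1 + v 3) + \<tau> * (v 4 + v 5) + \<tau> * \<epsilon> * (v 6 + v 7)"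
  "T_y v 3 = \<epsilon> * (v 1 + v 3) + \<tau> * (v 4 + v 5) + \<tau> * \<epsilon> * (v 6 + v 7)"
  "T_y v 4 = v 0 + \<epsilon> * v 4 + \<tau> * (v 6 + v 7)"
  "T_y v 5 = v 1 + \<epsilon> * v 5 + \<tau> * (v 6 + v 7)"
  "T_y v 6 = v 2 + \<epsilon> * (v 5 + v 6 + v 7)"
  "T_y v 7 = v 3 + \<epsilon> * v 5"
 by (simp_all add: T_g_def T_x_def T_y_def)

text \<open>The hypothesis on the degrees makes the terms with \<open>\<epsilon>\<close> or \<open>\<tau>\<close> disappear.\<close>

lemma mult_table:
 assumes mnk: "m < 8" "n < 8" "k < 8" and d: "m div 2 + n div 2 \<le> k div 2 \<or> \<epsilon> = 0 \<and> \<tau> = 0"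
 shows "coord k (b m \<otimes>\<^bsub>P\<^esub> b n) = (if m div 2 + n div 2 = k div 2 \<and> even (m + n + k) \<and>
  (m div 2 = 0 \<or> n div 2 = 0 \<or> m div 2 \<noteq> n div 2) then 1 else 0)"
proof -
 note c = P.monomial_closed[OF mnk(2)]
 have eq: "coord k (b m \<otimes>\<^bsub>P\<^esub> b n) =
  ([\<lambda>v. v, T_g, T_x, \<lambda>v. T_g (T_x v), T_y, \<lambda>v. T_g (T_y v), \<lambda>v. T_x (T_y v), \<lambda>v. T_g (T_x (T_y v))] ! m)
   (\<lambda>k. coord k (b n)) k"
  using mnk(1) unfolding less8
  by (elim disjE; hypsubst; simp add: P.monomial_simps P.alg c P.closed coord_mult del: One_nat_def)
 have "n + 2 * a < 2 * c + 2" if "a + n div 2 \<le> c" for a c using that half_bounds[of n] by auto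
 then consider "n + 2 * (m div 2) < 2 * (k div 2) + 2" | "\<And>t. \<epsilon> * t = 0" "\<And>t. \<tau> * t = 0" using d by auto
 then show ?thesis
 proof cases
  case 1
  then show ?thesis
   unfolding eq using mnk
   apply (induct m rule: eight_cases)
       apply (simp_all del: One_nat_def)
       apply (induct k rule: eight_cases; simp add: T_values coord_b del: One_nat_def; (induct n rule: eight_cases; simp add: coord_b del: One_nat_def)?)+
   done
 next
  case 2
  show ?thesis
   unfolding eq using mnk
   apply (induct m rule: eight_cases)
       apply (simp_all del: One_nat_def)
       apply (induct k rule: eight_cases; simp add: 2 T_values coord_b del: One_nat_def; (induct n rule: eight_cases; simp add: coord_b del: One_nat_def)?)+
   done
 qed
qed

text \<open>The index pairs that occur in \<Delta> b_n once the terms with \<epsilon> are dropped.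
  All of them have the full degree of the monomial, while the dropped terms have smaller total
  degree.\<close>

definition comul_support :: "nat \<Rightarrow> (nat \<times> nat) set" where
 "comul_support n = [{(0, 0)}, {(1, 1)}, {(2, 0), (1, 2)}, {(3, 1), (0, 3)}, {(4, 0), (0, 4), (3, 2)},
   {(5, 1), (1, 5), (2, 3)}, {(6, 0), (2, 4), (5, 2), (1, 6)}, {(7, 1), (3, 5), (4, 3), (0, 7)}] ! n"

lemma conv_table:
 assumes ijn: "i < 8" "j < 8" "n < 8" and d: "n div 2 \<le> i div 2 + j div 2 \<or> \<epsilon> = 0"
 shows "conv D (coord i) (coord j) (b n) = (if (i, j) \<in> comul_support n then 1 else 0)"
proof -
 note eq = conv_monomial[OF linform_coord linform_coord]
 have "2 * c \<le> j + 2 * a" if "c \<le> a + j div 2" for a c using that half_bounds[of j] by auto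
 then consider "2 * (n div 2) \<le> j + 2 * (i div 2)" | "\<And>t. \<epsilon> * t = 0" using d by auto
 then show ?thesis
 proof cases
  case 1
  then show ?thesis
   using ijn
   apply (induct n rule: eight_cases)
       apply (simp_all only: eq)
       apply (simp_all add: coord_b comul_support_def  del: One_nat_def)
       apply (induct i rule: eight_cases; simp del: One_nat_def; (induct j rule: eight_cases; simp del: One_nat_def)?)+
   done
 next
  case 2
  show ?thesis
   using ijn
   apply (induct n rule: eight_cases)
       apply (simp_all only: eq)
       apply (simp_all add: coord_b comul_support_def 2 del: One_nat_def)
   done
 qed
qed

lemma comul_support_degree: "n < 8 \<Longrightarrow> (i, j) \<in> comul_support n \<Longrightarrow> n div 2 = i div 2 + j div 2"
 unfolding less8 by (elim disjE; hypsubst) (auto simp: comul_support_def)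

end

section \<open>The associated graded algebra of Q\<close>

lemma dual_basis_map:
 fixes M :: "('k::field, 'a, 'm) module_scheme" and W :: "('k, 'b, 'n) module_scheme"
 assumes M: "vspace M" and W: "vspace W" and d: "dual_system M I b l" and e: "dual_system W I c m"
  and l: "\<And>i j. i \<in> I \<Longrightarrow> j \<in> I \<Longrightarrow> l i (b j) = (if i = j then 1 else 0)"
  and m: "\<And>i j. i \<in> I \<Longrightarrow> j \<in> I \<Longrightarrow> m i (c j) = (if i = j then 1 else 0)"
 defines "f \<equiv> \<lambda>x. \<Oplus>\<^bsub>W\<^esub>i\<in>I. l i x \<odot>\<^bsub>W\<^esub> c i"
 shows dual_basis_map_linear: "linear_map M W f" and dual_basis_map_coord: "x \<in> carrier M \<Longrightarrow> j \<in> I \<Longrightarrow> m j (f x) = l j x"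
  and dual_basis_map_bij: "bij_betw f (carrier M) (carrier W)"
proof -
 have coord: "m j (\<Oplus>\<^bsub>W\<^esub>i\<in>I. a i \<odot>\<^bsub>W\<^esub> c i) = a j" if j: "j \<in> I"
  and m: "\<And>i j. i \<in> I \<Longrightarrow> j \<in> I \<Longrightarrow> m i (c j) = (if i = j then 1 else 0)"
  and e: "dual_system W I c m" and W: "vspace W"
  for j a c and m :: "_ \<Rightarrow> _ \<Rightarrow> 'k" and W :: "('k, 'z, 'y) module_scheme"
 proof -
  have "m j (\<Oplus>\<^bsub>W\<^esub>i\<in>I. a i \<odot>\<^bsub>W\<^esub> c i) = (\<Sum>i\<in>I. m j (a i \<odot>\<^bsub>W\<^esub> c i))"
   using dual_systemD(2)[OF e] by (intro linform_finsum[OF W dual_systemD(3)[OF e j]]) (auto simp: vs_smult[OF W])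
  also have "\<dots> = (\<Sum>i\<in>I. if j = i then a i else 0)"
   using dual_systemD(2)[OF e] j by (intro sum.cong refl) (simp add: linformD[OF dual_systemD(3)[OF e j]] m)
  also have "\<dots> = a j" using j dual_systemD(1)[OF e] by simp
  finally show ?thesis .
 qed
 show lin: "linear_map M W f"
  unfolding f_def by (rule linear_map_finsum_smult[OF M W dual_systemD(3)[OF d] dual_systemD(2)[OF e] dual_systemD(1)[OF d]])
 show fc: "m j (f x) = l j x" if "j \<in> I" for x j
  unfolding f_def by (rule coord[OF that m e W])
 show "bij_betw f (carrier M) (carrier W)"
  unfolding bij_betw_def
 proof
  show "inj_on f (carrier M)"
  proof (rule inj_onI)
   fix x y assume xy: "x \<in> carrier M" "y \<in> carrier M" and eq: "f x = f y"
   show "x = y" by (rule dual_system_eqI[OF M d xy]) (metis fc eq)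
  qed
  show "f ` carrier M = carrier W"
  proof
   show "f ` carrier M \<subseteq> carrier W" using linear_mapD(1)[OF lin] by auto
   show "carrier W \<subseteq> f ` carrier M"
   proof
    fix y assume y: "y \<in> carrier W"
    let ?x = "\<Oplus>\<^bsub>M\<^esub>i\<in>I. m i y \<odot>\<^bsub>M\<^esub> b i"
    have x: "?x \<in> carrier M"
     by (rule vs_finsum[OF M]) (auto intro!: vs_smult[OF M] dual_systemD(2)[OF d])
    have "f ?x = y"
     by (rule dual_system_eqI[OF W e linear_mapD(1)[OF lin x] y]) (simp add: fc coord[OF _ l d M])
    then show "y \<in> f ` carrier M" using image_eqI[of y f ?x "carrier M"] x by simp
   qed
  qed
 qed
qed

lemma half_less_iff: "m div 2 < i + 1 \<longleftrightarrow> m < 2 * i + (2::nat)"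
 by (simp add: div_less_iff_less_mult mult.commute)

context q_presentation
begin

lemma coord_mult_expand:
 assumes u: "u \<in> carrier P" and v: "v \<in> carrier P"
 shows "coord k (u \<otimes>\<^bsub>P\<^esub> v) = (\<Sum>m<8. \<Sum>n<8. coord m u * coord n v * coord k (b m \<otimes>\<^bsub>P\<^esub> b n))"
proof -
 have l: "linform P (\<lambda>u. coord k (u \<otimes>\<^bsub>P\<^esub> v))"
  using v by (intro linformI) (simp_all add: P.alg P.closed linformD[OF linform_coord])
 have "coord k (u \<otimes>\<^bsub>P\<^esub> v) = (\<Sum>m<8. coord m u * coord k (b m \<otimes>\<^bsub>P\<^esub> v))"
  by (rule linform_expand[OF P.V dual_monomials l u])
 also have "\<dots> = (\<Sum>m<8. \<Sum>n<8. coord m u * coord n v * coord k (b m \<otimes>\<^bsub>P\<^esub> b n))"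
  using P.monomial_closed
  by (intro sum.cong refl, subst linform_expand[OF P.V dual_monomials linform_mult_left[OF P.B linform_coord] v])
   (auto simp: sum_distrib_left mult.assoc)
 finally show ?thesis .
qed

lemma Z_mult:
 assumes u: "u \<in> Z (2 * i + 2)" and v: "v \<in> Z (2 * j + 2)"
 shows "u \<otimes>\<^bsub>P\<^esub> v \<in> Z (2 * (i + j) + 2)"
proof -
 have c: "u \<in> carrier P" "v \<in> carrier P" using u v by (auto simp: Z_def)
 have "coord k (u \<otimes>\<^bsub>P\<^esub> v) = 0" if k: "2 * (i + j) + 2 \<le> k" "k < 8" for k
  unfolding coord_mult_expand[OF c]
 proof (intro sum.neutral ballI)
  fix m n :: nat assume mn: "m \<in> {..<8}" "n \<in> {..<8}"
  consider "2 * i + 2 \<le> m" | "2 * j + 2 \<le> n" | "m div 2 + n div 2 < k div 2"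
   using half_less_iff[of m i] half_less_iff[of n j] half_less_iff[of k "i + j"] k(1) by fastforce
  then show "coord m u * coord n v * coord k (b m \<otimes>\<^bsub>P\<^esub> b n) = 0"
   using u v mn k(2) by cases (auto simp: Z_def mult_table)
 qed
 then show ?thesis using c by (simp add: Z_def P.closed)
qed

lemmas D_graded = k_coalgebra_D fin_dim_D pointed_D

lemma filtration_mult_D:
 "u \<in> coradical_filtration D i \<Longrightarrow> v \<in> coradical_filtration D j \<Longrightarrow> u \<otimes>\<^bsub>D\<^esub> v \<in> coradical_filtration D (i + j)"
 using Z_mult by (simp add: coradical_filtration_D D_simps)

lemma filtration_stable_D: "4 \<le> n \<Longrightarrow> coradical_filtration D n \<subseteq> previous_filtration D n"
 by (simp add: coradical_filtration_D previous_filtration_D Z_top)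

definition gr_basis where "gr_basis m = gr_class D (m div 2) (b m)"

definition gr_coord where "gr_coord m = gr_form (m div 2) (coord m)"

lemma coord_ann: "m < 8 \<Longrightarrow> coord m \<in> ann D (previous_filtration D (m div 2))"
 unfolding previous_filtration_D by (rule coord_ann_Z) (simp_all add: half_bounds)

lemma b_filtration: "m < 8 \<Longrightarrow> b m \<in> coradical_filtration D (m div 2)"
 using half_bounds(2)[of m] by (simp add: coradical_filtration_D b_in_Z)

lemma gr_basis_closed: "m < 8 \<Longrightarrow> gr_basis m \<in> carrier (gr_alg D)"
 unfolding gr_basis_def by (rule gr_class_closed[OF D_graded b_filtration])

lemma linform_gr_coord: "m < 8 \<Longrightarrow> linform (gr_alg D) (gr_coord m)"
 unfolding gr_coord_def by (rule linform_gr_form[OF D_graded coord_ann])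

lemma gr_coord_basis: "m < 8 \<Longrightarrow> n < 8 \<Longrightarrow> gr_coord m (gr_basis n) = (if m = n then 1 else 0)"
 unfolding gr_coord_def gr_basis_def
 by (subst gr_form_class[OF D_graded coord_ann b_filtration]) (auto simp: coord_b)

lemma gr_rep_D:
 assumes u: "u \<in> carrier (gr_alg D)"
 defines "r \<equiv> \<lambda>i. SOME x. x \<in> u i"
 shows "r i \<in> u i" "r i \<in> carrier P" "m < 8 \<Longrightarrow> i < m div 2 \<Longrightarrow> coord m (r i) = 0" "gr_coord m u = coord m (r (m div 2))"
  "u i = previous_filtration D i +>\<^bsub>D\<^esub> r i"
proof -
 note r = gr_rep[OF D_graded u, folded r_def]
 show "r i \<in> u i" "r i \<in> carrier P" "u i = previous_filtration D i +>\<^bsub>D\<^esub> r i"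
  using r(1)[of i] r(2,3) unfolding r_def by (simp_all add: coradical_filtration_D Z_def)
 show "m < 8 \<Longrightarrow> i < m div 2 \<Longrightarrow> coord m (r i) = 0"
  using r(1)[of i] half_bounds(1)[of m] unfolding r_def by (simp add: coradical_filtration_D Z_def)
qed (simp add: gr_coord_def gr_form_def r_def)

text \<open>In contrast to \<open>gr_dual_system\<close> this family is a basis. A monomial of
  degree below \<open>n\<close> is killed by a form of degree \<open>n\<close>, and one of degree
  above \<open>n\<close> does not occur in a representative of degree \<open>n\<close>.\<close>

lemma gr_dual_system_D: "dual_system (gr_alg D) {..<8} gr_basis gr_coord"
proof -
 note G = vspace_gr[OF D_graded]
 have "(\<Oplus>\<^bsub>gr_alg D\<^esub>m\<in>{..<8}. gr_coord m u \<odot>\<^bsub>gr_alg D\<^esub> gr_basis m) = u" if u: "u \<in> carrier (gr_alg D)" for u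
 proof (rule gr_eqI[OF D_graded _ u])
  have Pi: "(\<lambda>m. gr_coord m u \<odot>\<^bsub>gr_alg D\<^esub> gr_basis m) \<in> {..<8} \<rightarrow> carrier (gr_alg D)"
   by (auto intro!: vs_smult[OF G] gr_basis_closed)
  then show "(\<Oplus>\<^bsub>gr_alg D\<^esub>m\<in>{..<8}. gr_coord m u \<odot>\<^bsub>gr_alg D\<^esub> gr_basis m) \<in> carrier (gr_alg D)"
   by (rule vs_finsum[OF G])
  fix n \<phi> assume f: "\<phi> \<in> ann D (previous_filtration D n)"
  note r = gr_rep_D[OF u] and l = linform_gr_form[OF D_graded f]
  have "gr_form n \<phi> (\<Oplus>\<^bsub>gr_alg D\<^esub>m\<in>{..<8}. gr_coord m u \<odot>\<^bsub>gr_alg D\<^esub> gr_basis m) =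
   (\<Sum>m<8. gr_form n \<phi> (gr_coord m u \<odot>\<^bsub>gr_alg D\<^esub> gr_basis m))"
   by (rule linform_finsum[OF G l Pi])
  also have "\<dots> = (\<Sum>m<8. coord m (SOME x. x \<in> u n) * \<phi> (b m))"
  proof (intro sum.cong refl)
   fix m :: nat assume m: "m \<in> {..<8}"
   have "gr_form n \<phi> (gr_coord m u \<odot>\<^bsub>gr_alg D\<^esub> gr_basis m) = gr_coord m u * (if n = m div 2 then \<phi> (b m) else 0)"
    using m gr_form_class[OF D_graded f b_filtration, of m] by (simp add: linformD(2)[OF l] gr_basis_closed gr_basis_def[of m, symmetric])
   moreover have "\<phi> (b m) = 0" if "m div 2 < n"
    using ann_Z[OF f[unfolded previous_filtration_D]] that half_bounds(2)[of m] m by auto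
   ultimately show "gr_form n \<phi> (gr_coord m u \<odot>\<^bsub>gr_alg D\<^esub> gr_basis m) = coord m (SOME x. x \<in> u n) * \<phi> (b m)"
    using r(3)[of m n] m by (cases "m div 2" n rule: linorder_cases) (auto simp: r(4))
  qed
  also have "\<dots> = gr_form n \<phi> u"
   unfolding gr_form_def using annD(1)[OF f]
   by (intro linform_expand[OF P.V dual_monomials _ r(2), symmetric]) (simp add: linform_D)
  finally show "gr_form n \<phi> (\<Oplus>\<^bsub>gr_alg D\<^esub>m\<in>{..<8}. gr_coord m u \<odot>\<^bsub>gr_alg D\<^esub> gr_basis m) = gr_form n \<phi> u" .
 qed
 then show ?thesis
  unfolding dual_system_def using gr_basis_closed linform_gr_coord by simp
qed

end

text \<open>Two presentations side by side: one with parameters \<epsilon>, \<tau> and one with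
  parameters 0 and its own names of generators. The isomorphism \<open>F\<close> sends the class of
  each monomial of the first to the same monomial of the second.\<close>

locale q_degeneration = Q: q_presentation gg gx gy \<epsilon> \<tau> + A: q_presentation gg' gx' gy' "0::'k" "0::'k"
 for gg gx gy :: 'i and \<epsilon> \<tau> :: "'k::field" and gg' gx' gy' :: 'j
begin

definition F where
 "F u = (\<Oplus>\<^bsub>A.D\<^esub>m\<in>{..<8}. Q.gr_coord m u \<odot>\<^bsub>A.D\<^esub> A.b m)"

lemmas gr_Q = vspace_gr[OF Q.D_graded]

lemmas F_dual = gr_Q A.vspace_D Q.gr_dual_system_D A.dual_system_D

lemma F_linear: "linear_map (gr_alg Q.D) A.D F"
 and F_coord: "u \<in> carrier (gr_alg Q.D) \<Longrightarrow> k < 8 \<Longrightarrow> A.coord k (F u) = Q.gr_coord k u"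
 and F_bij: "bij_betw F (carrier (gr_alg Q.D)) (carrier A.D)"
 unfolding F_def[abs_def]
 using dual_basis_map_linear[OF F_dual] dual_basis_map_coord[OF F_dual] dual_basis_map_bij[OF F_dual]
 by (simp_all add: Q.gr_coord_basis A.coord_b)

lemma F_eqI:
 assumes "u \<in> carrier (gr_alg Q.D)" "z \<in> carrier A.P" "\<And>k. k < 8 \<Longrightarrow> Q.gr_coord k u = A.coord k z"
 shows "F u = z"
 using assms linear_mapD(1)[OF F_linear assms(1)]
 by (intro dual_system_eqI[OF A.P.V A.dual_monomials]) (simp_all add: F_coord A.D_simps)

lemma F_closed: "u \<in> carrier (gr_alg Q.D) \<Longrightarrow> F u \<in> carrier A.P"
 using linear_mapD(1)[OF F_linear] by (simp add: A.D_simps)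

lemma F_mult:
 assumes u: "u \<in> carrier (gr_alg Q.D)" and v: "v \<in> carrier (gr_alg Q.D)"
 shows "u \<otimes>\<^bsub>gr_alg Q.D\<^esub> v \<in> carrier (gr_alg Q.D)" "F (u \<otimes>\<^bsub>gr_alg Q.D\<^esub> v) = F u \<otimes>\<^bsub>A.P\<^esub> F v"
proof -
 define r where "r i = (SOME x. x \<in> u i)" for i
 define s where "s i = (SOME x. x \<in> v i)" for i
 note r = Q.gr_rep_D[OF u, folded r_def] and s = Q.gr_rep_D[OF v, folded s_def]
 note gm = gr_form_mult[OF Q.k_algebra_D Q.D_graded Q.filtration_mult_D Q.filtration_stable_D u v r(1) s(1)]
 show c: "u \<otimes>\<^bsub>gr_alg Q.D\<^esub> v \<in> carrier (gr_alg Q.D)" by (rule gm)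
 show "F (u \<otimes>\<^bsub>gr_alg Q.D\<^esub> v) = F u \<otimes>\<^bsub>A.P\<^esub> F v"
 proof (rule F_eqI[OF c])
  fix k :: nat assume k: "k < 8"
  let ?K = "k div 2" and ?q = "\<lambda>m n. Q.coord k (Q.b m \<otimes>\<^bsub>Q.P\<^esub> Q.b n)" and ?a = "\<lambda>m n. A.coord k (A.b m \<otimes>\<^bsub>A.P\<^esub> A.b n)"
  have "Q.gr_coord k (u \<otimes>\<^bsub>gr_alg Q.D\<^esub> v) = (\<Sum>i\<le>?K. Q.coord k (r i \<otimes>\<^bsub>Q.D\<^esub> s (?K - i)))"
   unfolding Q.gr_coord_def by (rule gm(2)[OF _ _ _ Q.coord_ann[OF k]])
  also have "\<dots> = (\<Sum>i\<le>?K. \<Sum>m<8. \<Sum>n<8. Q.coord m (r i) * Q.coord n (s (?K - i)) * ?q m n)"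
   by (simp add: Q.D_simps Q.coord_mult_expand r(2) s(2))
  also have "\<dots> = (\<Sum>m<8. \<Sum>n<8. \<Sum>i\<le>?K. Q.coord m (r i) * Q.coord n (s (?K - i)) * ?q m n)"
   by (subst sum.swap) (intro sum.cong refl sum.swap)
  also have "\<dots> = (\<Sum>m<8. \<Sum>n<8. Q.gr_coord m u * Q.gr_coord n v * ?a m n)"
  proof (intro sum.cong refl)
   fix m n :: nat assume "m \<in> {..<8}" "n \<in> {..<8}"
   then have mn: "m < 8" "n < 8" by auto
   note t = Q.mult_table[OF mn k] A.mult_table[OF mn k]
   \<comment> \<open>Of the sum over \<open>i\<close> only \<open>i = m div 2\<close> survives: a
     representative has no coordinates above its degree, and products of total degree smaller than
     that of \<open>k\<close> have coordinate 0 at \<open>k\<close> on both sides.\<close>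
   have "Q.coord m (r i) * Q.coord n (s (?K - i)) * ?q m n =
    (if i = m div 2 then Q.gr_coord m u * Q.gr_coord n v * ?a m n else 0)" if i: "i \<le> ?K" for i
   proof (cases "m div 2 \<le> i \<and> n div 2 \<le> ?K - i")
    case False
    then have "Q.coord m (r i) * Q.coord n (s (?K - i)) = 0" using r(3)[OF mn(1)] s(3)[OF mn(2)] by auto
    moreover have "?a m n = 0" if "i = m div 2" using False i that t(2) by auto
    ultimately show ?thesis by auto
   next
    case True
    then have "m div 2 + n div 2 \<le> ?K" using i by linarith
    then have q: "?q m n = ?a m n" using t by simp
    show ?thesis
    proof (cases "m div 2 + n div 2 = ?K")
     case eq: True
     then have "i = m div 2" "?K - i = n div 2" using True i by linarith+
     then show ?thesis by (simp add: r(4) s(4) q)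
    qed (use q t(2) in simp)
   qed
   then have "(\<Sum>i\<le>?K. Q.coord m (r i) * Q.coord n (s (?K - i)) * ?q m n) =
    (\<Sum>i\<le>?K. if i = m div 2 then Q.gr_coord m u * Q.gr_coord n v * ?a m n else 0)" by (intro sum.cong refl) simp
   also have "\<dots> = Q.gr_coord m u * Q.gr_coord n v * ?a m n" using t(2) by (auto simp: sum.delta)
   finally show "(\<Sum>i\<le>?K. Q.coord m (r i) * Q.coord n (s (?K - i)) * ?q m n) = Q.gr_coord m u * Q.gr_coord n v * ?a m n" .
  qed
  also have "\<dots> = A.coord k (F u \<otimes>\<^bsub>A.P\<^esub> F v)"
   by (simp add: A.coord_mult_expand F_closed u v F_coord)
  finally show "Q.gr_coord k (u \<otimes>\<^bsub>gr_alg Q.D\<^esub> v) = A.coord k (F u \<otimes>\<^bsub>A.P\<^esub> F v)" .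
 qed (intro A.P.closed F_closed u v)
qed

lemma F_one: "F \<one>\<^bsub>gr_alg Q.D\<^esub> = \<one>\<^bsub>A.P\<^esub>"
proof -
 have one: "\<one>\<^bsub>gr_alg Q.D\<^esub> = Q.gr_basis 0"
  by (simp add: gr_alg_simps Q.gr_basis_def Q.P.monomial_simps Q.D_simps)
 show ?thesis unfolding one
  by (rule F_eqI[OF Q.gr_basis_closed]) (simp_all add: A.P.closed A.coord_one Q.gr_coord_basis)
qed

lemma F_counit:
 assumes u: "u \<in> carrier (gr_alg Q.D)"
 shows "counit A.D (F u) = counit (gr Q.D) u"
proof -
 note r = Q.gr_rep_D[OF u]
 have "counit A.D (F u) = (\<Sum>m<8. Q.gr_coord m u * counit A.D (A.b m))"
  using linform_expand[OF A.P.V A.dual_monomials A.linform_counit_D[unfolded A.linform_D] F_closed[OF u]] u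
  by (simp add: F_coord)
 also have "\<dots> = (\<Sum>m<8. Q.coord m (SOME x. x \<in> u 0) * counit Q.D (Q.b m))"
  by (intro sum.cong refl) (auto simp: A.counit_monomial Q.counit_monomial r(4))
 also have "\<dots> = counit (gr Q.D) u"
  using linform_expand[OF Q.P.V Q.dual_monomials Q.linform_counit_D[unfolded Q.linform_D] r(2)]
  by (simp add: gr_simps)
 finally show ?thesis .
qed

text \<open>Compared at pairs of coordinate forms, both sides are sums of top-degree
  comultiplication constants. These agree by \<open>conv_table\<close>, and the representative has
  no coordinates of higher degree.\<close>

lemma F_comul:
 assumes u: "u \<in> carrier (gr_alg Q.D)"
 shows "comul A.D (F u) = tensor_map A.D A.D F F (comul (gr Q.D) u)"
proof (rule dual_system_eqI[OF A.TT_vspace dual_system_tensor[OF A.P.V A.P.V A.dual_monomials A.dual_monomials]])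
 note cc = comul_gr_closed[OF Q.D_graded Q.filtration_stable_D u]
 show "comul A.D (F u) \<in> carrier A.TT"
  using linear_mapD(1)[OF A.comul_D_linear, of "F u"] F_closed[OF u] by (simp add: A.D_simps A.D_tensor)
 show "tensor_map A.D A.D F F (comul (gr Q.D) u) \<in> carrier A.TT"
  using linear_mapD(1)[OF tensor_map_linear[OF gr_Q gr_Q A.vspace_D A.vspace_D F_linear F_linear] cc] by (simp add: A.D_tensor)
 fix p :: "nat \<times> nat" assume p: "p \<in> {..<8} \<times> {..<8}"
 obtain i j where ij: "p = (i, j)" "i < 8" "j < 8" using p by auto
 let ?d = "i div 2 + j div 2"
 let ?x = "SOME x. x \<in> u ?d"
 note r = Q.gr_rep_D[OF u]
 have l: "linform A.D (A.coord k)" for k by (simp add: A.linform_D A.linform_coord)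
 have "tev (A.coord i) (A.coord j) (tensor_map A.D A.D F F (comul (gr Q.D) u)) =
  tev (\<lambda>z. A.coord i (F z)) (\<lambda>z. A.coord j (F z)) (comul (gr Q.D) u)"
  by (rule tev_tensor_map[OF gr_Q gr_Q A.vspace_D A.vspace_D F_linear F_linear l l cc])
 also have "\<dots> = tev (Q.gr_coord i) (Q.gr_coord j) (comul (gr Q.D) u)"
  by (rule tev_cong[OF gr_Q gr_Q linform_comp[OF F_linear l] linform_comp[OF F_linear l] _ _ cc]) (simp_all add: F_coord ij Q.linform_gr_coord)
 also have "\<dots> = conv Q.D (Q.coord i) (Q.coord j) ?x"
  using conv_gr[OF Q.D_graded Q.filtration_stable_D u Q.coord_ann[OF ij(2)] Q.coord_ann[OF ij(3)]]
  by (simp add: conv_def Q.gr_coord_def)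
 also have "\<dots> = (\<Sum>n<8. Q.coord n ?x * conv Q.D (Q.coord i) (Q.coord j) (Q.b n))"
  by (rule Q.conv_expand[OF Q.linform_coord Q.linform_coord r(2)])
 also have "\<dots> = (\<Sum>n<8. Q.gr_coord n u * conv A.D (A.coord i) (A.coord j) (A.b n))"
 proof (intro sum.cong refl)
  fix n :: nat assume "n \<in> {..<8}"
  then have n: "n < 8" by simp
  note t = Q.conv_table[OF ij(2,3) n] A.conv_table[OF ij(2,3) n] Q.comul_support_degree[OF n, of i j]
  show "Q.coord n ?x * conv Q.D (Q.coord i) (Q.coord j) (Q.b n) = Q.gr_coord n u * conv A.D (A.coord i) (A.coord j) (A.b n)"
  proof (cases "n div 2 \<le> ?d")
   case True
   then show ?thesis using t by (auto simp: r(4) Q.comul_support_def A.comul_support_def)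
  next
   case False
   then show ?thesis using t r(3)[OF n, of ?d] by (auto simp: Q.comul_support_def A.comul_support_def)
  qed
 qed
 also have "\<dots> = conv A.D (A.coord i) (A.coord j) (F u)"
  by (simp add: A.conv_expand[OF A.linform_coord A.linform_coord F_closed[OF u]] F_coord u)
 finally show "tev (A.coord (fst p)) (A.coord (snd p)) (comul A.D (F u)) =
   tev (A.coord (fst p)) (A.coord (snd p)) (tensor_map A.D A.D F F (comul (gr Q.D) u))"
  by (simp add: ij conv_def)
qed

lemma F_hopf_iso: "F \<in> hopf_iso (gr Q.D) A.D"
proof -
 have "F \<in> ring_iso (gr Q.D) A.D"
  using F_bij F_mult(2) F_one F_closed
  by (auto simp: ring_iso_def ring_hom_def gr_simps A.D_simps linear_mapD(2)[OF F_linear, unfolded A.D_simps])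
 moreover have "linear_map (gr Q.D) A.D F" using F_linear by (simp add: linear_map_def gr_simps)
 ultimately show ?thesis using F_comul F_counit by (simp add: hopf_iso_def gr_simps)
qed

text \<open>A component vanishes exactly when the coordinates of its degree do, so homogeneity is a
  condition on the same eight coordinates on both sides.\<close>

lemma F_component: "F ` gr_component Q.D n = {z \<in> carrier A.P. \<forall>k<8. k div 2 \<noteq> n \<longrightarrow> A.coord k z = 0}" (is "_ = ?Y")
proof -
 have iff: "u \<in> gr_component Q.D n \<longleftrightarrow> F u \<in> ?Y" if u: "u \<in> carrier (gr_alg Q.D)" for u
 proof -
  note r = Q.gr_rep_D[OF u]
  have "u m = \<zero>\<^bsub>gr_piece Q.D m\<^esub> \<longleftrightarrow> (\<forall>k<8. k div 2 = m \<longrightarrow> Q.gr_coord k u = 0)" for m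
  proof -
   let ?r = "SOME x. x \<in> u m"
   have "u m = \<zero>\<^bsub>gr_piece Q.D m\<^esub> \<longleftrightarrow> ?r \<in> previous_filtration Q.D m"
    using r(1)[of m] r(5)[of m] gr_coset_zero[OF Q.D_graded, of ?r m] by (auto simp: gr_piece_zero[OF Q.D_graded])
   also have "\<dots> \<longleftrightarrow> (\<forall>k<8. k div 2 = m \<longrightarrow> Q.coord k ?r = 0)"
   proof
    assume "?r \<in> previous_filtration Q.D m"
    then show "\<forall>k<8. k div 2 = m \<longrightarrow> Q.coord k ?r = 0" by (auto simp: Q.previous_filtration_D Q.Z_def)
   next
    assume *: "\<forall>k<8. k div 2 = m \<longrightarrow> Q.coord k ?r = 0"
    have "Q.coord k ?r = 0" if k: "2 * m \<le> k" "k < 8" for k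
    proof (cases "k div 2 = m")
     case False
     then have "m < k div 2" using k(1) half_less_iff[of k m] by linarith
     then show ?thesis using r(3)[of k m] k by simp
    qed (use * k in auto)
    then show "?r \<in> previous_filtration Q.D m" using r(2)[of m] by (simp add: Q.previous_filtration_D Q.Z_def)
   qed
   finally show ?thesis using r(4) by auto
  qed
  then show ?thesis using u by (auto simp: gr_component_def gr_simps F_closed F_coord)
 qed
 show ?thesis
 proof
  show "F ` gr_component Q.D n \<subseteq> ?Y" using iff by (auto simp: gr_component_def gr_simps)
  show "?Y \<subseteq> F ` gr_component Q.D n"
  proof
   fix z assume z: "z \<in> ?Y"
   then have "z \<in> F ` carrier (gr_alg Q.D)" using F_bij by (simp add: bij_betw_def A.D_simps)
   then obtain u where "u \<in> carrier (gr_alg Q.D)" "z = F u" by auto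
   then show "z \<in> F ` gr_component Q.D n" using iff z by blast
  qed
 qed
qed

end

section \<open>The grading by the degrees of words\<close>

context q_presentation
begin

definition gen_degree :: "'i \<Rightarrow> nat" where
 "gen_degree i = (if i = gg then 0 else if i = gx then 1 else 2)"

text \<open>With both parameters 0 the operators \<open>T\<close> are homogeneous, so a word moves
  the coordinate vector of 1 into the degree of the word.\<close>

lemma word_coord:
 assumes "\<epsilon> = 0" "\<tau> = 0" "k < 8" "k div 2 \<noteq> sum_list (map gen_degree is)"
 shows "foldr T is (\<lambda>m. if m = 0 then 1 else 0) k = 0"
 using assms(3,4)
proof (induct "is" arbitrary: k)
 case (Cons i "is")
 have e: "\<epsilon> * t = 0" "\<tau> * t = 0" for t using assms(1,2) by auto
 let ?v = "foldr T is (\<lambda>m. if m = 0 then 1 else 0)"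
 let ?d = "sum_list (map gen_degree is)"
 have v: "k div 2 \<noteq> ?d \<longrightarrow> ?v k = 0" if "k < 8" for k using Cons(1)[OF that] by simp
 note V = v[of 0] v[of 1] v[of 2] v[of 3] v[of 4] v[of 5] v[of 6] v[of 7]
 consider "i = gg" | "i = gx" | "i = gy" using gens_cases[of i] by auto
 then show ?case
 proof cases
  case 1
  then show ?thesis using Cons(2,3) V
   by (induct k rule: eight_cases) (simp_all add: gen_degree_def T_simps T_values del: One_nat_def)
 next
  case 2
  then show ?thesis using Cons(2,3) V gens_distinct
   by (induct k rule: eight_cases) (simp_all add: gen_degree_def T_simps T_values e del: One_nat_def)
 next
  case 3
  then show ?thesis using Cons(2,3) V gens_distinct
   by (induct k rule: eight_cases) (simp_all add: gen_degree_def T_simps T_values e del: One_nat_def)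
 qed
qed auto

text \<open>One inclusion is homogeneity of words; for the other, each monomial is itself the class
  of a word of its degree.\<close>

lemma component_eq:
 assumes "\<epsilon> = 0" "\<tau> = 0"
 shows "lin_span D {cls (Poly_Mapping.single w 1) | w. sum_list (map gen_degree (letters w)) = n} =
  {z \<in> carrier P. \<forall>k<8. k div 2 \<noteq> n \<longrightarrow> coord k z = 0}" (is "lin_span D ?W = ?Y")
proof
 have S: "submodule ?Y base_ring D"
  using linformD[OF linform_coord] linform_zero[OF P.V linform_coord]
  by (intro submoduleI'[OF vspace_D]) (auto simp: D_simps P.closed)
 have "?W \<subseteq> ?Y"
 proof
  fix z assume "z \<in> ?W"
  then obtain w where w: "z = cls (Poly_Mapping.single w 1)" "sum_list (map gen_degree (letters w)) = n" by blast
  then show "z \<in> ?Y" using word_coord[OF assms, of _ "letters w"] by (simp add: presented_class_closed coord_class act_simps)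
 qed
 then show "lin_span D ?W \<subseteq> ?Y" by (rule lin_span_least[OF S])
 have SW: "submodule (lin_span D ?W) base_ring D"
  by (rule submodule_lin_span[OF vspace_D]) (auto simp: D_simps presented_class_closed)
 have w: "cls (Poly_Mapping.single (FWord is) 1) \<in> lin_span D ?W" if "sum_list (map gen_degree is) = n" for "is"
  by (rule subsetD[OF lin_span_superset]) (use that in \<open>auto intro!: exI[of _ "FWord is"]\<close>)
 have m: "b 0 = cls (Poly_Mapping.single (FWord []) 1)" "b 1 = cls (Poly_Mapping.single (FWord [gg]) 1)" "b 2 = cls (Poly_Mapping.single (FWord [gx]) 1)"
  "b 3 = cls (Poly_Mapping.single (FWord [gg, gx]) 1)" "b 4 = cls (Poly_Mapping.single (FWord [gy]) 1)"
  "b 5 = cls (Poly_Mapping.single (FWord [gg, gy]) 1)" "b 6 = cls (Poly_Mapping.single (FWord [gx, gy]) 1)"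
  "b 7 = cls (Poly_Mapping.single (FWord [gg, gx, gy]) 1)"
  by (unfold P.monomial_simps) (simp_all add: presented_class_mult[symmetric] presented_class_one[symmetric] one_free_algebra zero_fword_def gen_def mult_single plus_fword_def del: One_nat_def)
 show "?Y \<subseteq> lin_span D ?W"
 proof
  fix z assume z: "z \<in> ?Y"
  show "z \<in> lin_span D ?W"
  proof (rule Z_least[OF SW])
   fix k :: nat assume k: "k < 8" "coord k z \<noteq> 0"
   then have "k div 2 = n" using z by auto
   then show "b k \<in> lin_span D ?W"
    using k(1) gens_distinct unfolding less8
    by (elim disjE; simp only: m; intro w; simp add: gen_degree_def)
  qed (use z in simp)
 qed
qed

end

section \<open>Commutativity as an invariant\<close>

context q_presentation
begin

lemma commutative:
 assumes "\<epsilon> = 0" "\<tau> = 0" and u: "u \<in> carrier P" and v: "v \<in> carrier P"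
 shows "u \<otimes>\<^bsub>P\<^esub> v = v \<otimes>\<^bsub>P\<^esub> u"
proof (rule dual_system_eqI[OF P.V dual_monomials])
 fix k :: nat assume "k \<in> {..<8}"
 then have k: "k < 8" by simp
 have "coord k (b m \<otimes>\<^bsub>P\<^esub> b n) = coord k (b n \<otimes>\<^bsub>P\<^esub> b m)" if "m < 8" "n < 8" for m n
  unfolding mult_table[OF that k disjI2[OF conjI[OF assms(1,2)]]] mult_table[OF that(2,1) k disjI2[OF conjI[OF assms(1,2)]]]
  by (auto simp: add.commute)
 then have "coord k (u \<otimes>\<^bsub>P\<^esub> v) = (\<Sum>m<8. \<Sum>n<8. coord n v * coord m u * coord k (b n \<otimes>\<^bsub>P\<^esub> b m))"
  unfolding coord_mult_expand[OF u v] by (intro sum.cong refl) (simp add: mult.commute)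
 also have "\<dots> = coord k (v \<otimes>\<^bsub>P\<^esub> u)"
  unfolding coord_mult_expand[OF v u] by (rule sum.swap)
 finally show "coord k (u \<otimes>\<^bsub>P\<^esub> v) = coord k (v \<otimes>\<^bsub>P\<^esub> u)" .
qed (intro P.closed u v)+

lemma not_commutative:
 assumes "\<tau> \<noteq> 0"
 shows "cy \<otimes>\<^bsub>P\<^esub> cx \<noteq> cx \<otimes>\<^bsub>P\<^esub> cy"
proof
 assume "cy \<otimes>\<^bsub>P\<^esub> cx = cx \<otimes>\<^bsub>P\<^esub> cy"
 then have "b 6 = b 6 \<oplus>\<^bsub>P\<^esub> \<tau> \<odot>\<^bsub>P\<^esub> (b 0 \<oplus>\<^bsub>P\<^esub> b 1)"
  by (simp add: P.rel_yx P.monomial_simps del: One_nat_def)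
 then have "coord 0 (b 6) = coord 0 (b 6 \<oplus>\<^bsub>P\<^esub> \<tau> \<odot>\<^bsub>P\<^esub> (b 0 \<oplus>\<^bsub>P\<^esub> b 1))" by (rule arg_cong)
 then show False using assms
  by (simp add: linformD[OF linform_coord] P.closed P.monomial_closed coord_b del: One_nat_def)
qed

end

lemma Q_gen_UNIV: "UNIV = {Q_g, Q_x, Q_y}"
 by (auto intro: Q_gen.exhaust)

lemma A_gen_UNIV: "UNIV = {A_g, A_a, A_b}"
 by (auto intro: A_gen.exhaust)

lemma q_presentation_Q:
 assumes "(1::'k::field) + 1 = 0" "\<epsilon> * \<epsilon> = (\<epsilon>::'k)"
 shows "q_presentation Q_g Q_x Q_y \<epsilon>"
 by (intro q_presentation.intro assms Q_gen_UNIV) auto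

lemma q_presentation_A:
 assumes "(1::'k::field) + 1 = 0"
 shows "q_presentation A_g A_a A_b (0::'k)"
 by (intro q_presentation.intro assms A_gen_UNIV) auto

lemma Q_alg_eq:
 assumes "q_presentation Q_g Q_x Q_y (\<epsilon>::'k::field)"
 shows "Q_alg \<epsilon> \<tau> = q_presentation.D Q_g Q_x Q_y \<epsilon> \<tau>"
proof -
 interpret q_presentation Q_g Q_x Q_y \<epsilon> \<tau> by fact
 have "Q_delta i = \<delta> i" "Q_counit i = e i" for i by (cases i; simp add: \<delta>_def e_def)+
 then have "Q_delta = \<delta>" "Q_counit = e" by (auto intro!: ext)
 then show ?thesis
  by (simp add: Q_alg_def D_def R_def Q_relations_def q_relations_def)
qed

lemma A_alg_eq:
 assumes "q_presentation A_g A_a A_b (0::'k::field)"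
 shows "(A_alg :: ('k, _) bialg) = q_presentation.D A_g A_a A_b 0 0"
  and "(A_relations :: ('k, _) free_algebra set) = q_presentation.R A_g A_a A_b 0 0"
  and "A_degree = q_presentation.gen_degree A_g A_a"
proof -
 interpret q_presentation A_g A_a A_b "0::'k" 0 by fact
 have "scal 0 = (0 :: ('k, A_gen) free_algebra)" by (simp add: scal_def)
 then show R: "A_relations = R"
  by (auto simp: A_relations_def R_def q_relations_def Let_def)
 have "A_delta i = \<delta> i" "A_counit i = e i" for i by (cases i; simp add: \<delta>_def e_def)+
 then have "A_delta = \<delta>" "A_counit = e" by (auto intro!: ext)
 then show "A_alg = D" unfolding A_alg_def D_def R by simp
 show "A_degree = gen_degree"
 proof
  show "A_degree i = gen_degree i" for i by (cases i) (simp_all add: gen_degree_def)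
 qed
qed

lemma Q_alg_properties:
 assumes c: "(1::'k::field) + 1 = 0" and i: "\<epsilon> * \<epsilon> = (\<epsilon>::'k)"
 shows "hopf_algebra (Q_alg \<epsilon> \<tau>)" "pointed (Q_alg \<epsilon> \<tau>)" "has_dimension (Q_alg \<epsilon> \<tau>) 8" "graded_iso_to_A (Q_alg \<epsilon> \<tau>)"
proof -
 note q = q_presentation_Q[OF c i] and a = q_presentation_A[OF c]
 interpret q_degeneration Q_g Q_x Q_y \<epsilon> \<tau> A_g A_a A_b by (intro q_degeneration.intro q a)
 show "hopf_algebra (Q_alg \<epsilon> \<tau>)" "pointed (Q_alg \<epsilon> \<tau>)" "has_dimension (Q_alg \<epsilon> \<tau>) 8"
  unfolding Q_alg_eq[OF q] by (rule Q.hopf_algebra_D Q.pointed_D Q.has_dimension_D)+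
 have "F ` gr_component Q.D n = A_component n" for n
  unfolding F_component A_component_def A_alg_eq[OF a] by (rule A.component_eq[symmetric]) auto
 then show "graded_iso_to_A (Q_alg \<epsilon> \<tau>)"
  unfolding graded_iso_to_A_def Q_alg_eq[OF q] A_alg_eq(1)[OF a] using F_hopf_iso by blast
qed

text \<open>With both parameters 0 the algebra is commutative, whereas x and y do not commute for
  nonzero \<tau>. The ring structure alone tells the two apart.\<close>

lemma Q_alg_not_isomorphic:
 assumes c: "(1::'k::field) + 1 = 0" and \<tau>: "\<tau> \<noteq> (0::'k)"
 shows "\<not> hopf_isomorphic (Q_alg 0 0) (Q_alg 0 \<tau>)"
proof
 have i: "(0::'k) * 0 = 0" by simp
 note q = q_presentation_Q[OF c i]
 interpret P0: q_presentation Q_g Q_x Q_y "0::'k" 0 by (rule q)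
 interpret P1: q_presentation Q_g Q_x Q_y "0::'k" \<tau> by (rule q)
 assume "hopf_isomorphic (Q_alg 0 0) (Q_alg 0 \<tau>)"
 then obtain f where "f \<in> ring_iso P0.D P1.D" by (auto simp: hopf_isomorphic_def hopf_iso_def Q_alg_eq[OF q])
 then have f: "f ` carrier P0.P = carrier P1.P"
  "\<And>u v. u \<in> carrier P0.P \<Longrightarrow> v \<in> carrier P0.P \<Longrightarrow> f (u \<otimes>\<^bsub>P0.P\<^esub> v) = f u \<otimes>\<^bsub>P1.P\<^esub> f v"
  by (auto simp: ring_iso_def ring_hom_def bij_betw_def P0.D_simps P1.D_simps)
 have "P1.cx \<in> f ` carrier P0.P" "P1.cy \<in> f ` carrier P0.P" unfolding f(1) by auto
 then obtain u v where uv: "u \<in> carrier P0.P" "v \<in> carrier P0.P" "P1.cx = f u" "P1.cy = f v" by auto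
 have "P1.cy \<otimes>\<^bsub>P1.P\<^esub> P1.cx = P1.cx \<otimes>\<^bsub>P1.P\<^esub> P1.cy"
  unfolding uv using P0.commutative[OF refl refl uv(1,2)] by (simp add: f(2)[symmetric] uv(1,2))
 then show False using P1.not_commutative[OF \<tau>] by simp
qed

section \<open>Lifting the generators of the associated graded Hopf algebra\<close>

lemma linear_map_inv_into:
 fixes M (structure)
 assumes M: "vspace M" and f: "linear_map M W f" and b: "bij_betw f (carrier M) (carrier W)"
 shows "linear_map W M (inv_into (carrier M) f)"
proof -
 have c: "inv_into (carrier M) f y \<in> carrier M" "f (inv_into (carrier M) f y) = y" if "y \<in> carrier W" for y
  using b that by (auto simp: bij_betw_def inv_into_into f_inv_into_f)
 have inj: "inv_into (carrier M) f (f x) = x" if "x \<in> carrier M" for x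
  using b that by (simp add: bij_betw_def)
 show ?thesis
 proof (rule linear_mapI)
  fix x assume x: "x \<in> carrier W"
  show "inv_into (carrier M) f x \<in> carrier M" by (rule c(1)[OF x])
  show "inv_into (carrier M) f (a \<odot>\<^bsub>W\<^esub> x) = a \<odot> inv_into (carrier M) f x" for a
   using inj[of "a \<odot> inv_into (carrier M) f x"] c[OF x] by (simp add: linear_mapD[OF f] vs_smult[OF M])
  fix y assume y: "y \<in> carrier W"
  show "inv_into (carrier M) f (x \<oplus>\<^bsub>W\<^esub> y) = inv_into (carrier M) f x \<oplus> inv_into (carrier M) f y"
   using inj[of "inv_into (carrier M) f x \<oplus> inv_into (carrier M) f y"] c[OF x] c[OF y]
   by (simp add: linear_mapD[OF f] vs_add[OF M])
 qed
qed

text \<open>The isomorphism \<open>f\<close> is only one of Hopf algebras and may mix degrees. The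
  elements \<open>t n\<close> below, preimages of the monomials, therefore need not be
  homogeneous.\<close>

locale graded_model = A: q_presentation gg gx gy "0::'k::field" "0::'k" for gg gx gy :: 'i +
 fixes H :: "('k::field, 'h, 'm) bialg_scheme" (structure) and f :: "(nat \<Rightarrow> 'h set) \<Rightarrow> ('k, 'i) free_algebra set"
 assumes hopf: "hopf_algebra H" and fd: "fin_dim H" and pt: "pointed H" and f: "f \<in> hopf_iso (gr H) A.D"
begin

lemma H_alg: "k_algebra H" and H_coalg: "k_coalgebra H" and H_bialg: "k_bialgebra H"
 using hopf by (simp_all add: hopf_algebra_def k_bialgebra_def)

lemmas H_graded = H_coalg fd pt

abbreviation G where "G \<equiv> gr_alg H"
abbreviation ch where "ch \<equiv> coradical_filtration H"
abbreviation ph where "ph \<equiv> previous_filtration H"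

lemmas G_V = vspace_gr[OF H_graded]
lemmas H_V = coalg_vspace[OF H_coalg]

lemma f_linear: "linear_map G A.P f" and f_bij: "bij_betw f (carrier G) (carrier A.P)"
 using f by (auto simp: hopf_iso_def ring_iso_def linear_map_def gr_simps A.D_simps)

definition h where "h = inv_into (carrier G) f"

lemma h_linear: "linear_map A.P G h"
 unfolding h_def by (rule linear_map_inv_into[OF G_V f_linear f_bij])

lemma h_f: "u \<in> carrier G \<Longrightarrow> h (f u) = u" and f_h: "z \<in> carrier A.P \<Longrightarrow> f (h z) = z"
 using f_bij by (auto simp: h_def bij_betw_def f_inv_into_f)

definition t where "t n = h (A.b n)"

lemma t_closed: "n < 8 \<Longrightarrow> t n \<in> carrier G"
 unfolding t_def by (rule linear_mapD(1)[OF h_linear A.P.monomial_closed])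

lemma f_t: "n < 8 \<Longrightarrow> f (t n) = A.b n"
 unfolding t_def by (rule f_h[OF A.P.monomial_closed])

lemma G_dual: "dual_system G {..<8} t (\<lambda>n u. A.coord n (f u))"
proof -
 interpret G: module base_ring G by (rule G_V)
 have "(\<Oplus>\<^bsub>G\<^esub>n\<in>{..<8}. A.coord n (f u) \<odot>\<^bsub>G\<^esub> t n) = u" if u: "u \<in> carrier G" for u
 proof -
  have "u = h (\<Oplus>\<^bsub>A.P\<^esub>n\<in>{..<8}. A.coord n (f u) \<odot>\<^bsub>A.P\<^esub> A.b n)"
   using dual_systemD(4)[OF A.dual_monomials linear_mapD(1)[OF f_linear u]] h_f[OF u] by simp
  also have "\<dots> = (\<Oplus>\<^bsub>G\<^esub>n\<in>{..<8}. h (A.coord n (f u) \<odot>\<^bsub>A.P\<^esub> A.b n))"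
   by (rule linear_map_finsum[OF A.P.V G_V h_linear]) (auto simp: A.P.closed A.P.monomial_closed)
  also have "\<dots> = (\<Oplus>\<^bsub>G\<^esub>n\<in>{..<8}. A.coord n (f u) \<odot>\<^bsub>G\<^esub> t n)"
   by (intro G.M.finsum_cong') (auto simp: linear_mapD(3)[OF h_linear] A.P.monomial_closed t_def[symmetric] t_closed vs_smult[OF G_V])
  finally show ?thesis by simp
 qed
 then show ?thesis
  using linform_comp[OF f_linear A.linform_coord] t_closed by (simp add: dual_system_def)
qed

lemma form_expand: "linform G \<Phi> \<Longrightarrow> u \<in> carrier G \<Longrightarrow> \<Phi> u = (\<Sum>n<8. A.coord n (f u) * \<Phi> (t n))"
 by (rule linform_expand[OF G_V G_dual])

lemma stable: "\<exists>N. \<forall>n\<ge>N. ch n \<subseteq> ph n"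
 by (rule filtration_stabilizes[OF H_graded fin_dimI[OF G_V G_dual]]) blast

definition N where "N = (SOME N. \<forall>n\<ge>N. ch n \<subseteq> ph n)"

lemma N: "N \<le> n \<Longrightarrow> ch n \<subseteq> ph n"
 using someI_ex[OF stable] unfolding N_def by simp

lemma comul_closed: "u \<in> carrier G \<Longrightarrow> comul (gr H) u \<in> carrier (tensor_space G G)"
 by (rule comul_gr_closed[OF H_graded N])

lemma conv_h:
 assumes l: "linform G \<Phi>" "linform G \<Psi>" and u: "u \<in> carrier G"
 shows "conv (gr H) \<Phi> \<Psi> u = conv A.D (\<lambda>z. \<Phi> (h z)) (\<lambda>z. \<Psi> (h z)) (f u)"
proof -
 have l': "linform A.D (\<lambda>z. \<Phi> (h z))" "linform A.D (\<lambda>z. \<Psi> (h z))"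
  using l linform_comp[OF h_linear] by (simp_all add: A.linform_D)
 have fl: "linear_map G A.D f" using f_linear by (simp add: linear_map_def A.D_simps)
 have "comul A.D (f u) = tensor_map A.D A.D f f (comul (gr H) u)" using f u by (simp add: hopf_iso_def gr_simps)
 then have "conv A.D (\<lambda>z. \<Phi> (h z)) (\<lambda>z. \<Psi> (h z)) (f u) = tev (\<lambda>v. \<Phi> (h (f v))) (\<lambda>v. \<Psi> (h (f v))) (comul (gr H) u)"
  by (simp add: conv_def tev_tensor_map[OF G_V G_V A.vspace_D A.vspace_D fl fl l' comul_closed[OF u]])
 also have "\<dots> = tev \<Phi> \<Psi> (comul (gr H) u)"
  by (rule tev_cong[OF G_V G_V linform_comp[OF fl l'(1)] linform_comp[OF fl l'(2)] l comul_closed[OF u]]) (simp_all add: h_f)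
 finally show ?thesis by (simp add: conv_def)
qed

lemma conv_t:
 assumes l: "linform G \<Phi>" "linform G \<Psi>"
 shows "conv (gr H) \<Phi> \<Psi> (t 0) = \<Phi> (t 0) * \<Psi> (t 0)"
  "conv (gr H) \<Phi> \<Psi> (t 1) = \<Phi> (t 1) * \<Psi> (t 1)"
  "conv (gr H) \<Phi> \<Psi> (t 2) = \<Phi> (t 2) * \<Psi> (t 0) + \<Phi> (t 1) * \<Psi> (t 2)"
  "conv (gr H) \<Phi> \<Psi> (t 3) = \<Phi> (t 3) * \<Psi> (t 1) + \<Phi> (t 0) * \<Psi> (t 3)"
  "conv (gr H) \<Phi> \<Psi> (t 4) = \<Phi> (t 4) * \<Psi> (t 0) + \<Phi> (t 0) * \<Psi> (t 4) + \<Phi> (t 3) * \<Psi> (t 2)"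
 using A.conv_monomial(1-5)[OF linform_comp[OF h_linear l(1)] linform_comp[OF h_linear l(2)], folded t_def]
 by (simp_all add: conv_h[OF l t_closed] f_t del: One_nat_def)

abbreviation rep where "rep u n \<equiv> SOME x. x \<in> u n"

lemma rep: "u \<in> carrier G \<Longrightarrow> rep u n \<in> ch n" "u \<in> carrier G \<Longrightarrow> rep u n \<in> carrier H"
 "u \<in> carrier G \<Longrightarrow> u n = ph n +> rep u n"
 using gr_rep[OF H_graded, of u n] C_closed[OF H_graded] by auto

text \<open>The element \<open>u\<close> has degree at most \<open>n\<close>: a component is zero
  exactly when its representative lies in the previous filtration term. Such bounds take the place
  of homogeneity.\<close>

definition E where "E n u \<longleftrightarrow> u \<in> carrier G \<and> (\<forall>m>n. rep u m \<in> ph m)"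

lemma E_form: "E n u \<Longrightarrow> n < m \<Longrightarrow> \<alpha> \<in> ann H (ph m) \<Longrightarrow> gr_form m \<alpha> u = 0"
 using annD(2)[of \<alpha> H "ph m"] by (auto simp: E_def gr_form_def)

lemma conv_rep:
 assumes "u \<in> carrier G" "\<alpha> \<in> ann H (ph i)" "\<mu> \<in> ann H (ph j)"
 shows "conv (gr H) (gr_form i \<alpha>) (gr_form j \<mu>) u = conv H \<alpha> \<mu> (rep u (i + j))"
 by (rule conv_gr[OF H_graded N assms])

lemmas gr_linform = linform_gr_form[OF H_graded]

text \<open>If all products of a form of degree 1 with one of degree m - 1 kill \<open>u\<close>,
  then the representative in degree m lies in the wedge of the coradical with the term of index m -
  2. This wedge is the term of index m - 1, so the component is zero.\<close>

lemma E_wedge: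
 assumes u: "u \<in> carrier G"
  and 0: "\<And>m \<alpha> \<mu>. n + 2 \<le> m \<Longrightarrow> \<alpha> \<in> ann H (ph 1) \<Longrightarrow> \<mu> \<in> ann H (ph (m - 1)) \<Longrightarrow>
   conv (gr H) (gr_form 1 \<alpha>) (gr_form (m - 1) \<mu>) u = 0"
 shows "E (Suc n) u"
 unfolding E_def
proof (intro conjI u allI impI)
 fix m assume m: "Suc n < m"
 define k where "k = m - 2"
 have mk: "m = Suc (Suc k)" using m by (simp add: k_def)
 have "rep u m \<in> ch (Suc k)"
  unfolding coradical_filtration_Suc_iff[OF H_graded]
 proof (intro conjI ballI rep(2)[OF u])
  fix \<alpha> \<mu> assume l: "\<alpha> \<in> ann H (coradical H)" "\<mu> \<in> ann H (ch k)"
  then have "conv (gr H) (gr_form 1 \<alpha>) (gr_form (m - 1) \<mu>) u = 0"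
   using m by (intro 0) (simp_all add: previous_filtration_simps mk)
  moreover have "conv (gr H) (gr_form 1 \<alpha>) (gr_form (m - 1) \<mu>) u = conv H \<alpha> \<mu> (rep u (1 + (m - 1)))"
   using l by (intro conv_rep[OF u]) (simp_all add: previous_filtration_simps mk)
  ultimately show "conv H \<alpha> \<mu> (rep u m) = 0" by (simp add: mk)
 qed
 then show "rep u m \<in> ph m" by (simp add: mk previous_filtration_simps)
qed

text \<open>Let m > 0 be the greatest degree of a nonzero component. The square of a form of degree
  m that is 1 on it is nonzero on the component of degree 2 m, a contradiction. Stability of the
  filtration bounds the degrees, so that a greatest one exists.\<close>

lemma grouplike_E:
 assumes u: "u \<in> carrier G"
  and gl: "\<And>\<Phi> \<Psi>. linform G \<Phi> \<Longrightarrow> linform G \<Psi> \<Longrightarrow> conv (gr H) \<Phi> \<Psi> u = \<Phi> u * \<Psi> u"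
 shows "E 0 u"
proof (rule ccontr)
 let ?S = "{m. 0 < m \<and> rep u m \<notin> ph m}"
 assume "\<not> E 0 u"
 then have ne: "?S \<noteq> {}" using u by (auto simp: E_def)
 have "m < N" if "m \<in> ?S" for m using that rep(1)[OF u, of m] N[of m] by (cases "m < N") (auto simp: not_less)
 then have "?S \<subseteq> {..<N}" by (simp add: subset_iff)
 then have fin: "finite ?S" by (rule finite_subset) simp
 define m where "m = Max ?S"
 have m: "m \<in> ?S" and max: "\<And>k. k \<in> ?S \<Longrightarrow> k \<le> m"
  unfolding m_def by (rule Max_in[OF fin ne], rule Max_ge[OF fin])
 obtain \<alpha> where l: "\<alpha> \<in> ann H (ph m)" "\<alpha> (rep u m) = 1"
  using m ann_separates[OF H_V fd subF[OF H_graded] rep(2)[OF u]] by blast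
 have "m + m \<notin> ?S" using max[of "m + m"] m by auto
 then have "rep u (m + m) \<in> ph (m + m)" using m by auto
 then have "conv H \<alpha> \<alpha> (rep u (m + m)) = 0" by (rule conv_filtration[OF H_graded _ l(1) l(1)])
 moreover have "conv H \<alpha> \<alpha> (rep u (m + m)) = 1"
  using conv_rep[OF u l(1) l(1)] gl[OF gr_linform[OF l(1)] gr_linform[OF l(1)]] by (simp add: gr_form_def l(2))
 ultimately show False by simp
qed

text \<open>The elements for 1 and g are group-like. In the comultiplications of the others each
  summand has a factor whose degree is already bounded too low for one of the two test
  forms.\<close>

lemma t_E: "E 0 (t 0)" "E 0 (t 1)" "E 1 (t 2)" "E 1 (t 3)" "E 2 (t 4)"
proof -
 note c = t_closed[of 0, simplified] t_closed[of 1, simplified] t_closed[of 2, simplified] t_closed[of 3, simplified] t_closed[of 4, simplified]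
 show e0: "E 0 (t 0)" by (rule grouplike_E[OF c(1) conv_t(1)])
 show e1: "E 0 (t 1)" by (rule grouplike_E[OF t_closed conv_t(2)]) simp
 have "E (Suc 0) (t 2)"
  by (rule E_wedge[OF c(3)]) (simp add: conv_t(3)[OF gr_linform gr_linform] E_form[OF e0] E_form[OF e1] del: One_nat_def)
 then show e2: "E 1 (t 2)" by simp
 have "E (Suc 0) (t 3)"
  by (rule E_wedge[OF c(4)]) (simp add: conv_t(4)[OF gr_linform gr_linform] E_form[OF e0] E_form[OF e1] del: One_nat_def)
 then show e3: "E 1 (t 3)" by simp
 have "E (Suc 1) (t 4)"
  by (rule E_wedge[OF c(5)]) (simp add: conv_t(5)[OF gr_linform gr_linform] E_form[OF e0] E_form[OF e1] E_form[OF e2] del: One_nat_def)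
 then show "E 2 (t 4)" by (simp add: numeral_2_eq_2)
qed

lemma E0_class: "E 0 u \<Longrightarrow> u = gr_class H 0 (rep u 0)"
proof
 fix n assume e: "E 0 u"
 then have u: "u \<in> carrier G" by (simp add: E_def)
 show "u n = gr_class H 0 (rep u 0) n"
 proof (cases "n = 0")
  case False
  then have "ph n +> rep u n = ph n" using e by (intro gr_coset_zero[OF H_graded]) (simp add: E_def)
  then show ?thesis using False rep(3)[OF u, of n] by (simp add: gr_class_def gr_piece_zero[OF H_graded])
 qed (use rep(3)[OF u, of 0] in \<open>simp add: gr_class_def\<close>)
qed

definition g where "g = rep (t 1) 0"

lemma t1: "t 1 = gr_class H 0 g"
 unfolding g_def by (rule E0_class[OF t_E(2)])

lemma one_ch: "\<one> \<in> ch 0"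
proof -
 interpret k_bialgebra H by (rule H_bialg)
 have "\<one> \<in> grouplikes H"
  using comul_hom counit_hom by (simp add: grouplikes_def ring_hom_def tensor_alg_def base_alg_simps alg_one[OF H_alg])
 then show ?thesis using grouplike_in_coradical[OF H_coalg] by simp
qed

lemma t0: "t 0 = gr_class H 0 \<one>"
proof -
 have "f (gr_class H 0 \<one>) = A.b 0"
  using f by (simp add: hopf_iso_def ring_iso_def ring_hom_def gr_simps gr_alg_simps A.D_simps A.P.monomial_simps)
 then show ?thesis unfolding t_def using h_f[OF gr_class_closed[OF H_graded one_ch]] by simp
qed

lemma g_ch: "g \<in> ch 0" "g \<in> carrier H"
 unfolding g_def using rep(1)[of "t 1" 0] rep(2)[of "t 1" 0] t_closed[of 1] by simp_all

lemma ann_ph0: "linform H \<alpha> \<Longrightarrow> \<alpha> \<in> ann H (ph 0)"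
 by (auto intro: annI simp: previous_filtration_simps linform_zero[OF H_V])

text \<open>In degree 0 every form of \<open>H\<close> induces a form of the graded object, so the
  comultiplication of \<open>t 1\<close> determines that of \<open>g\<close> completely and not only
  modulo lower terms.\<close>

lemma g_grouplike: "g \<in> grouplikes H" "g \<noteq> \<one>"
proof -
 have "comul H g = pure_tensor H H g g"
 proof (rule comul_eqI[OF H_coalg fd g_ch(2) pure_closed[OF H_V H_V g_ch(2) g_ch(2)]])
  fix \<alpha> \<mu> assume l: "linform H \<alpha>" "linform H \<mu>"
  have "conv H \<alpha> \<mu> g = conv (gr H) (gr_form 0 \<alpha>) (gr_form 0 \<mu>) (t 1)"
   using conv_rep[OF t_closed ann_ph0[OF l(1)] ann_ph0[OF l(2)], of 1] by (simp add: g_def)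
  also have "\<dots> = \<alpha> g * \<mu> g"
   using conv_t(2)[OF gr_linform[OF ann_ph0[OF l(1)]] gr_linform[OF ann_ph0[OF l(2)]]] by (simp add: gr_form_def g_def)
  finally show "conv H \<alpha> \<mu> g = tev \<alpha> \<mu> (pure_tensor H H g g)" by (simp add: tev_pure[OF H_V H_V l g_ch(2) g_ch(2)])
 qed
 moreover have "counit (gr H) (t 1) = counit A.D (f (t 1))"
  using f t_closed[of 1] by (simp add: hopf_iso_def gr_simps(1))
 then have "counit H g = 1" using A.counit_monomial[of 1] by (simp add: gr_simps(7) g_def f_t del: One_nat_def)
 ultimately show "g \<in> grouplikes H" using g_ch by (simp add: grouplikes_def)
 show "g \<noteq> \<one>"
 proof
  assume "g = \<one>"
  then have "A.b 1 = A.b 0" using t0 t1 f_t[of 0] f_t[of 1] by simp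
  then show False using A.coord_b[of 0 1] A.coord_b[of 0 0] by simp
 qed
qed

text \<open>In contrast to \<open>conv_rep\<close> this holds for arbitrary forms on the graded
  object, in particular for the coordinates of A carried over by \<open>f\<close>, which need not be
  homogeneous.\<close>

lemma conv_class:
 assumes x: "x \<in> ch n" and ts: "filtered_decomposition H n ts" "comul H x = decomposition_sum H ts"
  and l: "linform G \<Phi>" "linform G \<Psi>"
 shows "conv (gr H) \<Phi> \<Psi> (gr_class H n x) = (\<Sum>(i, u, v)\<leftarrow>ts. \<Phi> (gr_class H i u) * \<Psi> (gr_class H (n - i) v))"
proof -
 let ?ps = "map (\<lambda>(i, u, v). (gr_class H i u, gr_class H (n - i) v)) ts"
 have ps: "u \<in> carrier G \<and> v \<in> carrier G" if "(u, v) \<in> set ?ps" for u v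
  using that ts(1) gr_class_closed[OF H_graded] by (fastforce simp: filtered_decomposition_def[OF H_graded])
 have "comul (gr H) (gr_class H n x) = list_sum (tensor_space G G) (map (\<lambda>(u, v). pure_tensor G G u v) ?ps)"
  using comul_gr_class[OF H_graded N x ts] by (simp add: comp_def split_def)
 then show ?thesis
  using tev_list_sum(2)[OF G_V G_V l, of ?ps, OF ps] by (simp add: conv_def comp_def split_def)
qed

lemma conv_f:
 assumes u: "u \<in> carrier G"
 shows "conv (gr H) (\<lambda>v. A.coord i (f v)) (\<lambda>v. A.coord j (f v)) u = conv A.D (A.coord i) (A.coord j) (f u)"
proof -
 note l = linform_comp[OF f_linear A.linform_coord]
 have "conv A.D (\<lambda>z. A.coord i (f (h z))) (\<lambda>z. A.coord j (f (h z))) (f u) = conv A.D (A.coord i) (A.coord j) (f u)"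
  using A.linform_coord linform_comp[OF h_linear linform_comp[OF f_linear A.linform_coord]] linear_mapD(1)[OF f_linear u] f_h
  by (intro conv_cong[OF A.k_coalgebra_D]) (simp_all add: A.linform_D A.D_simps)
 then show ?thesis using conv_h[OF l l u, of i j] by simp
qed

text \<open>The class of a group-like element is sent by \<open>f\<close> to an element whose
  coordinates c_n satisfy that the convolution of coordinate forms i and j takes the value c_i c_j.
  As no diagonal pair with n \<ge> 2 occurs in a comultiplication, c_n squared is 0 there; moreover
  c_0 c_1 = 0, and c_0 + c_1 = 1 by the counit.\<close>

lemma grouplikes_eq: "grouplikes H = {\<one>, g}"
proof -
 interpret k_bialgebra H by (rule H_bialg)
 have "\<one> \<in> grouplikes H"
  using comul_hom counit_hom by (simp add: grouplikes_def ring_hom_def tensor_alg_def base_alg_simps alg_one[OF H_alg])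
 moreover have "k = \<one> \<or> k = g" if k: "k \<in> grouplikes H" for k
 proof -
  have kc: "k \<in> ch 0" "k \<in> carrier H" "comul H k = pure_tensor H H k k" "counit H k = 1"
   using k grouplike_in_coradical[OF H_coalg k] by (simp_all add: grouplikes_def)
  let ?u = "gr_class H 0 k"
  have u: "?u \<in> carrier G" by (rule gr_class_closed[OF H_graded kc(1)])
  have z: "f ?u \<in> carrier A.P" by (rule linear_mapD(1)[OF f_linear u])
  have ts: "filtered_decomposition H 0 [(0, k, k)]" "comul H k = decomposition_sum H [(0, k, k)]"
   using kc pure_closed[OF H_V H_V kc(2) kc(2)]
   by (simp_all add: filtered_decomposition_def[OF H_graded] list_sum_def vs_r_zero[OF vspace_tensor[OF H_V H_V]])
  have *: "conv A.D (A.coord i) (A.coord j) (f ?u) = A.coord i (f ?u) * A.coord j (f ?u)" for i j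
   using conv_class[OF kc(1) ts linform_comp[OF f_linear A.linform_coord] linform_comp[OF f_linear A.linform_coord], of i j] conv_f[OF u, of i j] by simp
  note conv = A.conv_expand[OF A.linform_coord A.linform_coord z] A.conv_monomial[OF A.linform_coord A.linform_coord] A.lessThan_8 A.coord_b
  have 0: "A.coord n (f ?u) = 0" if "n < 8" "2 \<le> n" for n
   using *[of n n] that unfolding A.less8 by (elim disjE) (simp_all add: conv del: One_nat_def)
  have 01: "A.coord 0 (f ?u) * A.coord 1 (f ?u) = 0"
   using *[of 0 1] by (simp add: conv 0 del: One_nat_def)
  have "counit (gr H) ?u = counit A.D (f ?u)" using f u by (simp add: hopf_iso_def gr_simps(1))
  moreover have "counit (gr H) ?u = 1"
   using gr_form_class[OF H_graded ann_ph0 kc(1), of "counit H"] coalg_counit[OF H_coalg] kc(4) by (simp add: gr_simps(7) gr_form_def)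
  moreover have "counit A.D (f ?u) = A.coord 0 (f ?u) + A.coord 1 (f ?u)"
   using linform_expand[OF A.P.V A.dual_monomials A.linform_counit_D[unfolded A.linform_D] z]
   by (simp add: A.lessThan_8 A.counit_monomial 0 del: One_nat_def)
  ultimately have 1: "A.coord 0 (f ?u) + A.coord 1 (f ?u) = 1" by simp
  have eq: "f ?u = A.b i" if i: "i < 2" and c: "A.coord 0 (f ?u) = (if i = 0 then 1 else 0)" "A.coord 1 (f ?u) = (if i = 1 then 1 else 0)" for i
  proof (rule dual_system_eqI[OF A.P.V A.dual_monomials z A.P.monomial_closed])
   fix k :: nat assume "k \<in> {..<8}"
   moreover have "k = 0 \<or> k = 1 \<or> 2 \<le> k" by linarith
   ultimately show "A.coord k (f ?u) = A.coord k (A.b i)" using i 0[of k] c by (elim disjE) (simp_all add: A.coord_b)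
  qed (use i in simp)
  have "f ?u = A.b 0 \<or> f ?u = A.b 1"
  proof (cases "A.coord 0 (f ?u) = 0")
   case True
   then show ?thesis using eq[of 1] 1 by simp
  next
   case False
   then show ?thesis using eq[of 0] 1 01 by simp
  qed
  then have "?u = t 0 \<or> ?u = t 1" using h_f[OF u] unfolding t_def by metis
  then show ?thesis
   unfolding t0 t1 gr_class_eq_iff[OF H_graded kc(1) one_ch] gr_class_eq_iff[OF H_graded kc(1) g_ch(1)]
   using vs_minus_eq_zero[OF H_V] kc(2) g_ch(2) alg_one[OF H_alg] by (simp add: previous_filtration_simps)
 qed
 ultimately show ?thesis using g_grouplike(1) by auto
qed

end

section \<open>The first filtration term of the lifting\<close>

context graded_model
begin

lemma coradical_span: "coradical H = lin_span H {\<one>, g}"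
 using pt by (simp add: pointed_def grouplikes_eq)

lemma coord_class_0:
 assumes "u \<in> ch 0" and n: "2 \<le> n" "n < 8"
 shows "A.coord n (f (gr_class H 0 u)) = 0"
proof -
 let ?S = "{u \<in> ch 0. A.coord n (f (gr_class H 0 u)) = 0}"
 note c = gr_class_closed[OF H_graded]
 have "submodule ?S base_ring H"
 proof (rule submoduleI'[OF H_V])
  have z: "\<zero> = 0 \<odot> \<one>" by (rule vs_smult_zero[OF H_V alg_one[OF H_alg], symmetric])
  show "\<zero> \<in> ?S"
   using sub_zero[OF subC[OF H_graded], of 0]
    linformD(2)[OF linform_comp[OF f_linear A.linform_coord] c[OF one_ch], of n 0] gr_class_smult[OF H_graded one_ch, of 0]
   by (simp add: z)
 qed (use linformD[OF linform_comp[OF f_linear A.linform_coord]] c C_closed[OF H_graded]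
   sub_add[OF subC[OF H_graded]] sub_smult[OF subC[OF H_graded]] in
   \<open>auto simp: gr_class_add[OF H_graded] gr_class_smult[OF H_graded] simp del: coradical_filtration.simps\<close>)
 moreover have "\<one> \<in> ?S" "g \<in> ?S"
  using n one_ch g_ch f_t[of 0] f_t[of 1] unfolding t0 t1 by (simp_all add: A.coord_b)
 ultimately have "lin_span H {\<one>, g} \<subseteq> ?S" by (intro lin_span_least) auto
 then show ?thesis using assms(1) by (auto simp: coradical_span)
qed

text \<open>Since \<open>f\<close> may mix degrees, the bound comes from the comultiplication: in
  each term of a filtered decomposition one factor is in the coradical and has no coordinates from 2
  on. The pairs (3, 2), (2, 3), (2, 4) and (3, 5) of coordinate forms then give the vanishing of the
  coordinates 4 to 7.\<close>

lemma coord_class_1: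
 assumes x: "x \<in> ch 1" and n: "4 \<le> n" "n < 8"
 shows "A.coord n (f (gr_class H 1 x)) = 0"
proof -
 let ?u = "gr_class H 1 x"
 have u: "?u \<in> carrier G" by (rule gr_class_closed[OF H_graded x])
 note z = linear_mapD(1)[OF f_linear u]
 obtain ts where ts: "filtered_decomposition H 1 ts" "comul H x = decomposition_sum H ts"
  using comul_decomposition[OF H_graded x] by blast
 have 0: "conv A.D (A.coord i) (A.coord j) (f ?u) = 0" if ij: "2 \<le> i" "i < 8" "2 \<le> j" "j < 8" for i j
 proof -
  note l = linform_comp[OF f_linear A.linform_coord]
  have *: "A.coord i (f (gr_class H k v)) * A.coord j (f (gr_class H (1 - k) w)) = 0" if "(k, v, w) \<in> set ts" for k v w
  proof -
   have "k \<le> 1" "v \<in> ch k" "w \<in> ch (1 - k)" using that ts(1) by (auto simp: filtered_decomposition_def[OF H_graded])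
   then show ?thesis using coord_class_0[of v i] coord_class_0[of w j] ij by (cases "k = 0") auto
  qed
  have "(\<Sum>(k, v, w)\<leftarrow>ts. A.coord i (f (gr_class H k v)) * A.coord j (f (gr_class H (1 - k) w))) = (\<Sum>p\<leftarrow>ts. 0)"
   by (intro arg_cong[of _ _ sum_list] map_cong refl) (use * in \<open>auto simp del: One_nat_def\<close>)
  then show ?thesis
   using conv_f[OF u, of i j] conv_class[OF x ts l l, of i j] by (simp only: sum_list_0)
 qed
 note conv = A.conv_expand[OF A.linform_coord A.linform_coord z] A.conv_monomial[OF A.linform_coord A.linform_coord] A.lessThan_8 A.coord_b
 show ?thesis
  using n 0[of 3 2] 0[of 2 3] 0[of 2 4] 0[of 3 5] unfolding A.less8
  by (elim disjE; hypsubst; simp add: conv del: One_nat_def)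
qed

text \<open>Representatives of the components of the preimages of x, g x and y in degrees 1, 1 and
  2: first approximations to x, g x and y, each known only modulo the previous filtration
  term.\<close>

definition X0 where "X0 = rep (t 2) 1"
definition Y0 where "Y0 = rep (t 3) 1"
definition y0 where "y0 = rep (t 4) 2"

lemma lift_closed: "X0 \<in> ch 1" "Y0 \<in> ch 1" "y0 \<in> carrier H" "X0 \<in> carrier H" "Y0 \<in> carrier H"
 unfolding X0_def Y0_def y0_def by (rule rep[OF t_closed]; simp)+

lemma ph_simps: "ph 1 = coradical H" "ph (1 + 1) = ch 1" "ph 2 = ch 1"
 by (simp_all add: previous_filtration_simps numeral_2_eq_2)

lemma form_t: "linform H \<mu> \<Longrightarrow> gr_form 0 \<mu> (t 0) = \<mu> \<one>" "linform H \<mu> \<Longrightarrow> gr_form 0 \<mu> (t 1) = \<mu> g"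
 "gr_form 1 \<mu> (t 2) = \<mu> X0" "gr_form 1 \<mu> (t 3) = \<mu> Y0" "gr_form 2 \<mu> (t 4) = \<mu> y0"
 using gr_form_class[OF H_graded ann_ph0 one_ch, of \<mu>] gr_form_class[OF H_graded ann_ph0 g_ch(1), of \<mu>]
 by (simp_all add: t0 t1 gr_form_def X0_def Y0_def y0_def del: One_nat_def)

text \<open>A form that kills the coradical induces one of degree 1, and any form induces one of
  degree 0, so the product is read off in degree 1. At two arbitrary forms the value is not yet
  known; this is the defect to be removed later.\<close>

lemma conv_X0: "\<alpha> \<in> ann H (coradical H) \<Longrightarrow> linform H \<mu> \<Longrightarrow> conv H \<alpha> \<mu> X0 = \<alpha> X0 * \<mu> \<one>"
 "linform H \<mu> \<Longrightarrow> \<alpha> \<in> ann H (coradical H) \<Longrightarrow> conv H \<mu> \<alpha> X0 = \<mu> g * \<alpha> X0"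
 and conv_Y0: "\<alpha> \<in> ann H (coradical H) \<Longrightarrow> linform H \<mu> \<Longrightarrow> conv H \<alpha> \<mu> Y0 = \<alpha> Y0 * \<mu> g"
proof -
 assume a: "\<alpha> \<in> ann H (coradical H)" and m: "linform H \<mu>"
 have a': "\<alpha> \<in> ann H (ph 1)" using a by (simp add: ph_simps del: One_nat_def)
 note m' = ann_ph0[OF m] and l = gr_linform[OF a'] gr_linform[OF ann_ph0[OF m]]
 note e = E_form[OF t_E(1) _ a'] E_form[OF t_E(2) _ a']
 show "conv H \<alpha> \<mu> X0 = \<alpha> X0 * \<mu> \<one>"
  using conv_rep[OF t_closed a' m', of 2] conv_t(3)[OF l] by (simp add: e form_t m X0_def[symmetric] del: One_nat_def)
 show "conv H \<mu> \<alpha> X0 = \<mu> g * \<alpha> X0"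
  using conv_rep[OF t_closed m' a', of 2] conv_t(3)[OF l(2,1)] by (simp add: e form_t m X0_def[symmetric] del: One_nat_def)
 show "conv H \<alpha> \<mu> Y0 = \<alpha> Y0 * \<mu> g"
  using conv_rep[OF t_closed a' m', of 3] conv_t(4)[OF l] by (simp add: e form_t m Y0_def[symmetric] del: One_nat_def)
qed

lemma conv_y0:
 "\<alpha> \<in> ann H (ch 1) \<Longrightarrow> linform H \<mu> \<Longrightarrow> conv H \<alpha> \<mu> y0 = \<alpha> y0 * \<mu> \<one>"
 "linform H \<mu> \<Longrightarrow> \<alpha> \<in> ann H (ch 1) \<Longrightarrow> conv H \<mu> \<alpha> y0 = \<mu> \<one> * \<alpha> y0"
 "\<beta> \<in> ann H (coradical H) \<Longrightarrow> \<gamma> \<in> ann H (coradical H) \<Longrightarrow> conv H \<beta> \<gamma> y0 = \<beta> Y0 * \<gamma> X0"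
proof -
 { assume a: "\<alpha> \<in> ann H (ch 1)" and m: "linform H \<mu>"
  have a': "\<alpha> \<in> ann H (ph 2)" using a by (simp only: ph_simps)
  note m' = ann_ph0[OF m] and l = gr_linform[OF a'] gr_linform[OF ann_ph0[OF m]]
  note e = E_form[OF t_E(1) _ a'] E_form[OF t_E(3) _ a'] E_form[OF t_E(4) _ a']
  show "conv H \<alpha> \<mu> y0 = \<alpha> y0 * \<mu> \<one>"
   using conv_rep[OF t_closed a' m', of 4] conv_t(5)[OF l] by (simp add: e form_t m y0_def[symmetric] del: One_nat_def)
  show "conv H \<mu> \<alpha> y0 = \<mu> \<one> * \<alpha> y0"
   using conv_rep[OF t_closed m' a', of 4, unfolded add_0, folded y0_def] conv_t(5)[OF l(2,1)] by (simp add: e form_t m y0_def[symmetric] del: One_nat_def) }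
 assume a: "\<beta> \<in> ann H (coradical H)" "\<gamma> \<in> ann H (coradical H)"
 have a': "\<beta> \<in> ann H (ph 1)" "\<gamma> \<in> ann H (ph 1)" using a by (simp_all only: ph_simps)
 note l = gr_linform[OF a'(1)] gr_linform[OF a'(2)]
 have "1 + 1 = (2::nat)" by simp
 then show "conv H \<beta> \<gamma> y0 = \<beta> Y0 * \<gamma> X0"
  using conv_rep[OF t_closed a', of 4] conv_t(5)[OF l] E_form[OF t_E(1) _ a'(1)] E_form[OF t_E(1) _ a'(2)]
  by (simp add: form_t y0_def[symmetric] del: One_nat_def)
qed

text \<open>Otherwise \<open>t 2\<close> would have degree at most 0, hence be the class of an
  element of the coradical, whose coordinate 2 in A vanishes.\<close>

lemma X0_notin: "X0 \<notin> coradical H"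
proof
 assume "X0 \<in> coradical H"
 then have "E 0 (t 2)"
  using t_E(3) unfolding E_def X0_def by (metis One_nat_def Suc_lessI ph_simps(1))
 then have "t 2 = gr_class H 0 (rep (t 2) 0)" by (rule E0_class)
 moreover have "A.coord 2 (f (gr_class H 0 (rep (t 2) 0))) = 0" by (rule coord_class_0[OF rep(1)[OF t_closed]]) simp_all
 ultimately show False using f_t[of 2] by (simp add: A.coord_b)
qed

text \<open>Modulo the coradical, a class of degree 1 has only the coordinates 2 and 3: higher ones
  vanish by \<open>coord_class_1\<close>, and the elements for 1 and g are invisible to forms of
  degree 1.\<close>

lemma H1_span:
 assumes x: "x \<in> ch 1"
 obtains a c where "x \<ominus> (a \<odot> X0 \<oplus> c \<odot> Y0) \<in> coradical H"
proof -
 let ?u = "gr_class H 1 x"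
 let ?a = "\<lambda>n. A.coord n (f ?u)"
 let ?w = "?a 2 \<odot> X0 \<oplus> ?a 3 \<odot> Y0"
 have xc: "x \<in> carrier H" by (rule C_closed[OF H_graded x])
 have wc: "?w \<in> carrier H" by (simp add: vs_add[OF H_V] vs_smult[OF H_V] lift_closed)
 have xw: "x \<ominus> ?w \<in> carrier H" using linear_mapD(1)[OF linear_map_id_minus[OF H_V linear_map_id linear_map_id]]
  using vs2_minus[OF A.char2 H_V xc wc] vs_add[OF H_V xc wc] by simp
 have "x \<ominus> ?w \<in> coradical H"
 proof (rule ann_sep[OF H_V fd submodule_coradical[OF H_graded] xw])
  fix \<alpha> assume a: "\<alpha> \<in> ann H (coradical H)"
  then have a': "\<alpha> \<in> ann H (ph 1)" by (simp only: ph_simps)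
  have "\<alpha> x = gr_form 1 \<alpha> ?u" by (simp add: gr_form_class[OF H_graded a' x] del: One_nat_def)
  also have "\<dots> = (\<Sum>n<8. ?a n * gr_form 1 \<alpha> (t n))" by (rule form_expand[OF gr_linform[OF a'] gr_class_closed[OF H_graded x]])
  also have "\<dots> = ?a 2 * \<alpha> X0 + ?a 3 * \<alpha> Y0"
   by (simp add: A.lessThan_8 coord_class_1[OF x] E_form[OF t_E(1) _ a'] E_form[OF t_E(2) _ a'] form_t del: One_nat_def)
  finally show "\<alpha> (x \<ominus> ?w) = 0"
   by (simp add: vs2_minus[OF A.char2 H_V xc wc] linformD[OF annD(1)[OF a]] xc wc vs_smult[OF H_V] vs_add[OF H_V] lift_closed
    char2_field[OF A.char2] del: One_nat_def)
 qed
 then show thesis by (rule that)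
qed

end

section \<open>The relations of a lifting\<close>

text \<open>A tensor killed in either leg by all forms that vanish on \<open>U\<close> lies in the
  tensor square of \<open>U\<close>. It is then given by a matrix, namely its values at the forms
  \<xi> dual to the spanning elements \<open>e\<close>.\<close>

lemma tev_factor:
 fixes M :: "('k::field, 'a, 'm) module_scheme" and \<xi> :: "nat \<Rightarrow> 'a \<Rightarrow> 'k" and e :: "nat \<Rightarrow> 'a"
 assumes M: "vspace M" and T: "T \<in> carrier (tensor_space M M)" and \<xi>: "\<And>i. i < n \<Longrightarrow> linform M (\<xi> i)"
  and U: "\<And>\<alpha>. linform M \<alpha> \<Longrightarrow> (\<lambda>z. \<alpha> z - (\<Sum>i<n. \<alpha> (e i) * \<xi> i z)) \<in> ann M U"
  and v: "\<And>\<alpha> \<mu>. \<alpha> \<in> ann M U \<Longrightarrow> linform M \<mu> \<Longrightarrow> tev \<alpha> \<mu> T = 0 \<and> tev \<mu> \<alpha> T = 0"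
  and l: "linform M \<alpha>" "linform M \<mu>"
 shows "tev \<alpha> \<mu> T = (\<Sum>i<n. \<Sum>j<n. \<alpha> (e i) * \<mu> (e j) * tev (\<xi> i) (\<xi> j) T)"
proof -
 have p: "linform M (\<lambda>z. \<Sum>i<n. \<alpha> (e i) * \<xi> i z)" for \<alpha> :: "'a \<Rightarrow> 'k" using \<xi> by (intro linform_sum linform_scale) simp
 have "tev \<alpha> \<mu> T = tev (\<lambda>z. \<Sum>i<n. \<alpha> (e i) * \<xi> i z) \<mu> T"
  using v[OF U[OF l(1)] l(2)] tev_diff_left[OF M M l(1) p l(2) T] by simp
 also have "\<dots> = (\<Sum>i<n. \<alpha> (e i) * tev (\<xi> i) \<mu> T)"
  using \<xi> by (intro tev_sum_left[OF M M _ l(2) T]) simp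
 also have "\<dots> = (\<Sum>i<n. \<alpha> (e i) * tev (\<xi> i) (\<lambda>z. \<Sum>j<n. \<mu> (e j) * \<xi> j z) T)"
  using v[OF U[OF l(2)] \<xi>] tev_diff_right[OF M M \<xi> l(2) p T] by (intro sum.cong refl) simp
 also have "\<dots> = (\<Sum>i<n. \<alpha> (e i) * (\<Sum>j<n. \<mu> (e j) * tev (\<xi> i) (\<xi> j) T))"
  using \<xi> by (intro sum.cong refl arg_cong[of _ _ "\<lambda>z. _ * z"] tev_sum_right[OF M M _ _ T]) simp_all
 finally show ?thesis by (simp add: sum_distrib_left mult.assoc)
qed

text \<open>The elements 1, g, x and g x form a basis of the first filtration term, and \<xi>
  consists of dual forms defined on all of \<open>H\<close>. Primitive elements of all kinds lie in
  that term, so evaluating their convolutions at pairs from \<xi> determines them.\<close>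

locale skew_lifting =
 fixes H :: "('k::field, 'h, 'm) bialg_scheme" (structure) and g x :: 'h and \<xi> :: "nat \<Rightarrow> 'h \<Rightarrow> 'k"
 assumes hopf: "hopf_algebra H" and fd: "fin_dim H" and pt: "pointed H" and char2: "(1::'k) + 1 = 0"
  and grouplikes: "grouplikes H = {\<one>, g}" and gg: "g \<otimes> g = \<one>" and x [simp]: "x \<in> carrier H"
  and conv_x: "\<And>\<alpha> \<mu>. linform H \<alpha> \<Longrightarrow> linform H \<mu> \<Longrightarrow> conv H \<alpha> \<mu> x = \<alpha> x * \<mu> \<one> + \<alpha> g * \<mu> x"
  and \<xi>: "\<And>i. linform H (\<xi> i)"
  and dual: "\<And>i j. i < 4 \<Longrightarrow> j < 4 \<Longrightarrow> \<xi> i ([\<one>, g, x, g \<otimes> x] ! j) = (if i = j then 1 else 0)"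
  and span: "\<And>z. z \<in> coradical_filtration H 1 \<Longrightarrow>
   z = \<xi> 0 z \<odot> \<one> \<oplus> (\<xi> 1 z \<odot> g \<oplus> (\<xi> 2 z \<odot> x \<oplus> \<xi> 3 z \<odot> (g \<otimes> x)))"
begin

lemma H_alg: "k_algebra H" and H_coalg: "k_coalgebra H" and H_bialg: "k_bialgebra H"
 using hopf by (simp_all add: hopf_algebra_def k_bialgebra_def)

lemmas V = coalg_vspace[OF H_coalg]

lemma gl: "g \<in> grouplikes H" "\<one> \<in> grouplikes H"
 by (simp_all add: grouplikes)

lemma g [simp]: "g \<in> carrier H"
 using gl by (simp add: grouplikes_def)

lemmas closed [simp] = vs_add[OF V] vs_smult[OF V] alg_mult[OF H_alg] alg_one[OF H_alg] vs_zero[OF V]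

lemmas alg = alg_assoc[OF H_alg] alg_l_one[OF H_alg] alg_r_one[OF H_alg] alg_l_distr[OF H_alg] alg_r_distr[OF H_alg]
 alg_smult_left[OF H_alg] alg_smult_right[OF H_alg]

lemmas vs_norm = vs_add_assoc[OF V] vs_add_comm[OF V] vs2_add_left_comm[OF char2 V] vs2_add_self[OF char2 V]
 vs2_add_self_left[OF char2 V] vs_smult_r_distr[OF V] vs_smult_assoc[OF V, symmetric] vs_r_zero[OF V] vs_l_zero[OF V]

lemma lin: "linform H \<alpha> \<Longrightarrow> u \<in> carrier H \<Longrightarrow> v \<in> carrier H \<Longrightarrow> \<alpha> (u \<oplus> v) = \<alpha> u + \<alpha> v"
 "linform H \<alpha> \<Longrightarrow> u \<in> carrier H \<Longrightarrow> \<alpha> (c \<odot> u) = c * \<alpha> u"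
 by (rule linformD; assumption)+

lemmas ring_norm = distrib_left distrib_right mult.assoc mult.commute mult.left_commute add.assoc add.commute add.left_commute char2_field[OF char2]

lemma xi: "\<xi> 0 \<one> = 1" "\<xi> 0 g = 0" "\<xi> 0 x = 0" "\<xi> 0 (g \<otimes> x) = 0" "\<xi> 1 \<one> = 0" "\<xi> 1 g = 1" "\<xi> 1 x = 0" "\<xi> 1 (g \<otimes> x) = 0"
 "\<xi> 2 \<one> = 0" "\<xi> 2 g = 0" "\<xi> 2 x = 1" "\<xi> 2 (g \<otimes> x) = 0" "\<xi> 3 \<one> = 0" "\<xi> 3 g = 0" "\<xi> 3 x = 0" "\<xi> 3 (g \<otimes> x) = 1"
 using dual[of 0 0] dual[of 0 1] dual[of 0 2] dual[of 0 3] dual[of 1 0] dual[of 1 1] dual[of 1 2] dual[of 1 3]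
  dual[of 2 0] dual[of 2 1] dual[of 2 2] dual[of 2 3] dual[of 3 0] dual[of 3 1] dual[of 3 2] dual[of 3 3] by simp_all

lemma linform_mult: "u \<in> carrier H \<Longrightarrow> linform H \<alpha> \<Longrightarrow> linform H (\<lambda>w. \<alpha> (u \<otimes> w))"
 "u \<in> carrier H \<Longrightarrow> v \<in> carrier H \<Longrightarrow> linform H \<alpha> \<Longrightarrow> linform H (\<lambda>w. \<alpha> (u \<otimes> (v \<otimes> w)))"
 using linform_mult_left[OF H_alg] linform_mult_left2[OF H_alg] by auto

lemma comul_mult: "u \<in> carrier H \<Longrightarrow> z \<in> carrier H \<Longrightarrow> comul H (u \<otimes> z) = comul H u \<otimes>\<^bsub>tensor_alg H H\<^esub> comul H z"
 using k_bialgebra.comul_hom[OF H_bialg] by (simp add: ring_hom_def)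

lemmas conv_mults = H_alg coalg_comul_linear[OF H_coalg] comul_mult

lemma conv_one: "linform H \<alpha> \<Longrightarrow> linform H \<mu> \<Longrightarrow> conv H \<alpha> \<mu> \<one> = \<alpha> \<one> * \<mu> \<one>"
 and conv_g: "linform H \<alpha> \<Longrightarrow> linform H \<mu> \<Longrightarrow> conv H \<alpha> \<mu> g = \<alpha> g * \<mu> g"
 using conv_grouplike[OF H_coalg] gl by auto

lemma conv_gz: "linform H \<alpha> \<Longrightarrow> linform H \<mu> \<Longrightarrow> z \<in> carrier H \<Longrightarrow>
  conv H \<alpha> \<mu> (g \<otimes> z) = conv H (\<lambda>w. \<alpha> (g \<otimes> w)) (\<lambda>w. \<mu> (g \<otimes> w)) z"
 using gl by (intro conv_mult_grouplike[OF conv_mults]) (auto simp: grouplikes_def)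

lemma comul_x: "comul H x = pure_tensor H H x \<one> \<oplus>\<^bsub>tensor_space H H\<^esub> pure_tensor H H g x"
 by (rule comul_eqI[OF H_coalg fd])
  (simp_all add: conv_x tev_pure[OF V V] linformD(1)[OF linform_tev[OF V V]] vs_add[OF vspace_tensor[OF V V]] pure_closed[OF V V])

lemma conv_xz: "linform H \<alpha> \<Longrightarrow> linform H \<mu> \<Longrightarrow> z \<in> carrier H \<Longrightarrow>
  conv H \<alpha> \<mu> (x \<otimes> z) = conv H (\<lambda>w. \<alpha> (x \<otimes> w)) \<mu> z + conv H (\<lambda>w. \<alpha> (g \<otimes> w)) (\<lambda>w. \<mu> (x \<otimes> w)) z"
 by (rule conv_mult_skew_primitive[OF conv_mults _ _ _ _ _ comul_x]) simp_all

lemma conv_lin: "linform H \<alpha> \<Longrightarrow> linform H \<mu> \<Longrightarrow> u \<in> carrier H \<Longrightarrow> v \<in> carrier H \<Longrightarrow> conv H \<alpha> \<mu> (u \<oplus> v) = conv H \<alpha> \<mu> u + conv H \<alpha> \<mu> v"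
 "linform H \<alpha> \<Longrightarrow> linform H \<mu> \<Longrightarrow> u \<in> carrier H \<Longrightarrow> conv H \<alpha> \<mu> (c \<odot> u) = c * conv H \<alpha> \<mu> u"
 by (rule lin[OF linform_conv[OF H_coalg]]; assumption)+

lemma ggz: "z \<in> carrier H \<Longrightarrow> g \<otimes> (g \<otimes> z) = z"
 using alg(1)[of g g z] by (simp add: gg alg)

lemmas conv_simps = conv_one conv_g conv_x conv_gz conv_xz conv_lin linform_mult alg gg ggz

lemma cor_mem: "\<one> \<in> coradical H" "g \<in> coradical H"
 using grouplike_in_coradical[OF H_coalg] gl by auto

lemma cor_ann: "\<alpha> \<in> ann H (coradical H) \<Longrightarrow> linform H \<alpha> \<and> \<alpha> \<one> = 0 \<and> \<alpha> g = 0"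
 using annD[of \<alpha>] cor_mem by blast

lemma H1I:
 assumes "z \<in> carrier H" "\<And>\<alpha> \<mu>. \<alpha> \<in> ann H (coradical H) \<Longrightarrow> \<mu> \<in> ann H (coradical H) \<Longrightarrow> conv H \<alpha> \<mu> z = 0"
 shows "z \<in> coradical_filtration H 1"
 using assms coradical_filtration_Suc_iff[OF H_coalg fd pt, of z 0] by simp

lemma conv_H1:
 assumes "z \<in> coradical_filtration H 1" and l: "linform H \<alpha>" "linform H \<mu>"
 shows "conv H \<alpha> \<mu> z = \<xi> 0 z * (\<alpha> \<one> * \<mu> \<one>) + (\<xi> 1 z * (\<alpha> g * \<mu> g) + (\<xi> 2 z * (\<alpha> x * \<mu> \<one> + \<alpha> g * \<mu> x) +
  \<xi> 3 z * (\<alpha> (g \<otimes> x) * \<mu> g + \<alpha> \<one> * \<mu> (g \<otimes> x))))"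
 by (subst span[OF assms(1)]) (simp add: l conv_simps)

text \<open>A primitive element lies in the first filtration term, where the comultiplication is
  explicit; four pairs of dual forms isolate its four coefficients, and each of them
  vanishes.\<close>

lemma primitive_zero:
 assumes z: "z \<in> carrier H" and c: "\<And>\<alpha> \<mu>. linform H \<alpha> \<Longrightarrow> linform H \<mu> \<Longrightarrow> conv H \<alpha> \<mu> z = \<alpha> z * \<mu> \<one> + \<alpha> \<one> * \<mu> z"
 shows "z = \<zero>"
proof -
 have z1: "z \<in> coradical_filtration H 1" by (rule H1I[OF z]) (auto dest!: cor_ann simp: c)
 note * = c[OF \<xi> \<xi>, unfolded conv_H1[OF z1 \<xi> \<xi>]]
 have "\<xi> 2 z = 0" "\<xi> 3 z = 0" "\<xi> 0 z = 0" "\<xi> 1 z = 0"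
  using *[of 1 2] *[of 3 1] *[of 0 0] *[of 1 0] by (simp_all add: xi char2_field[OF char2] del: One_nat_def)
 then show ?thesis by (subst span[OF z1]) (simp add: vs_smult_zero[OF V] vs_norm del: One_nat_def)
qed

lemma skew_primitive_1:
 assumes z: "z \<in> carrier H" and c: "\<And>\<alpha> \<mu>. linform H \<alpha> \<Longrightarrow> linform H \<mu> \<Longrightarrow> conv H \<alpha> \<mu> z = \<alpha> z * \<mu> \<one> + \<alpha> g * \<mu> z"
 obtains s t where "z = s \<odot> x \<oplus> t \<odot> (\<one> \<oplus> g)"
proof -
 have z1: "z \<in> coradical_filtration H 1" by (rule H1I[OF z]) (auto dest!: cor_ann simp: c)
 note * = c[OF \<xi> \<xi>, unfolded conv_H1[OF z1 \<xi> \<xi>]]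
 have "\<xi> 3 z = 0" "\<xi> 1 z + \<xi> 0 z = 0"
  using *[of 3 1] *[of 1 0] by (simp_all add: xi del: One_nat_def)
 then have "\<xi> 3 z = 0" "\<xi> 1 z = \<xi> 0 z" using char2_field(1)[OF char2, of "\<xi> 0 z"] by (simp_all, metis add_right_imp_eq)
 then have "z = \<xi> 2 z \<odot> x \<oplus> \<xi> 0 z \<odot> (\<one> \<oplus> g)"
  by (subst span[OF z1]) (simp add: vs_smult_zero[OF V] vs_norm del: One_nat_def)
 then show thesis by (rule that)
qed

text \<open>Multiplication by \<open>g\<close> exchanges the two kinds of skew-primitive elements
  and is its own inverse.\<close>

lemma skew_primitive_2:
 assumes z: "z \<in> carrier H" and c: "\<And>\<alpha> \<mu>. linform H \<alpha> \<Longrightarrow> linform H \<mu> \<Longrightarrow> conv H \<alpha> \<mu> z = \<alpha> z * \<mu> g + \<alpha> \<one> * \<mu> z"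
 obtains s t where "z = s \<odot> (g \<otimes> x) \<oplus> t \<odot> (\<one> \<oplus> g)"
proof -
 have "g \<otimes> z \<in> carrier H" "\<And>\<alpha> \<mu>. linform H \<alpha> \<Longrightarrow> linform H \<mu> \<Longrightarrow> conv H \<alpha> \<mu> (g \<otimes> z) = \<alpha> (g \<otimes> z) * \<mu> \<one> + \<alpha> g * \<mu> (g \<otimes> z)"
  using z by (simp_all add: conv_gz c linform_mult gg alg)
 then obtain s t where st: "g \<otimes> z = s \<odot> x \<oplus> t \<odot> (\<one> \<oplus> g)" by (rule skew_primitive_1)
 have "z = g \<otimes> (g \<otimes> z)" using z by (simp add: ggz)
 also have "\<dots> = s \<odot> (g \<otimes> x) \<oplus> t \<odot> (\<one> \<oplus> g)" unfolding st by (simp add: alg gg vs_norm)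
 finally show thesis by (rule that)
qed

lemma primitive_g_zero:
 assumes z: "z \<in> carrier H" and c: "\<And>\<alpha> \<mu>. linform H \<alpha> \<Longrightarrow> linform H \<mu> \<Longrightarrow> conv H \<alpha> \<mu> z = \<alpha> z * \<mu> g + \<alpha> g * \<mu> z"
 shows "z = \<zero>"
proof -
 have "g \<otimes> z = \<zero>" using z by (intro primitive_zero) (simp_all add: conv_gz c linform_mult gg alg)
 then show ?thesis using ggz[OF z] by (simp add: alg_r_null[OF H_alg])
qed

text \<open>The product x g is skew-primitive of the kind of g x, hence s (g x) + t (1 + g). Right
  multiplication by g is an involution, so s * s = 1, and in characteristic two this forces s =
  1.\<close>

lemma commutation_x: obtains s where "x \<otimes> g = g \<otimes> x \<oplus> s \<odot> (\<one> \<oplus> g)"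
proof (rule skew_primitive_2[of "x \<otimes> g"])
 fix s t assume st: "x \<otimes> g = s \<odot> (g \<otimes> x) \<oplus> t \<odot> (\<one> \<oplus> g)"
 have "x = (x \<otimes> g) \<otimes> g" by (simp add: alg gg)
 also have "\<dots> = s \<odot> (g \<otimes> (x \<otimes> g)) \<oplus> t \<odot> (g \<oplus> \<one>)" by (subst st) (simp add: alg gg)
 finally have "\<xi> 2 x = \<xi> 2 (s \<odot> (g \<otimes> (s \<odot> (g \<otimes> x) \<oplus> t \<odot> (\<one> \<oplus> g))) \<oplus> t \<odot> (g \<oplus> \<one>))" unfolding st by (rule arg_cong)
 then have "s * s = 1" by (simp add: lin[OF \<xi>] alg ggz gg xi)
 then have "(s + 1) * (s + 1) = 0" by (simp add: ring_norm char2)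
 then have "s = 1" using char2_field(4)[OF char2, of s 1] by simp
 then show thesis using that[of t] st by (simp add: vs_smult_one[OF V])
qed (simp_all add: conv_simps)

lemma rescale:
 assumes s: "s \<noteq> 0"
 shows "skew_lifting H g (s \<odot> x) (\<lambda>i z. if i < 2 then \<xi> i z else inverse s * \<xi> i z)"
proof (rule skew_lifting.intro; (rule hopf fd pt char2 grouplikes gg)?)
 fix \<alpha> \<mu> i j z
 show "s \<odot> x \<in> carrier H" by simp
 show "linform H \<alpha> \<Longrightarrow> linform H \<mu> \<Longrightarrow> conv H \<alpha> \<mu> (s \<odot> x) = \<alpha> (s \<odot> x) * \<mu> \<one> + \<alpha> g * \<mu> (s \<odot> x)"
  by (simp add: conv_simps lin distrib_left mult.left_commute)
 show "linform H (\<lambda>z. if i < 2 then \<xi> i z else inverse s * \<xi> i z)" using \<xi> linform_scale[OF \<xi>] by (cases "i < 2") simp_all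
 have four: "n = 0 \<or> n = 1 \<or> n = 2 \<or> n = 3" if "n < 4" for n :: nat using that by auto
 show "(if i < 2 then \<xi> i ([\<one>, g, s \<odot> x, g \<otimes> (s \<odot> x)] ! j) else inverse s * \<xi> i ([\<one>, g, s \<odot> x, g \<otimes> (s \<odot> x)] ! j)) = (if i = j then 1 else 0)"
  if ij: "i < 4" "j < 4"
  using s four[OF ij(1)] four[OF ij(2)] by (elim disjE) (simp_all add: xi alg lin[OF \<xi>] xi[unfolded One_nat_def])
 show "z \<in> coradical_filtration H 1 \<Longrightarrow> z = (if 0 < (2::nat) then \<xi> 0 z else inverse s * \<xi> 0 z) \<odot> \<one> \<oplus>
  ((if 1 < (2::nat) then \<xi> 1 z else inverse s * \<xi> 1 z) \<odot> g \<oplus> ((if 2 < (2::nat) then \<xi> 2 z else inverse s * \<xi> 2 z) \<odot> (s \<odot> x) \<oplus>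
  (if 3 < (2::nat) then \<xi> 3 z else inverse s * \<xi> 3 z) \<odot> (g \<otimes> (s \<odot> x))))"
  using span[of z] s by (simp add: alg vs_smult_assoc[OF V, symmetric] mult.commute[of _ s] mult.assoc[symmetric] del: One_nat_def)
qed

text \<open>The defect of \<open>y\<close> is a 2-cocycle on the dual of the first filtration term; being a coboundary, it can
 be removed.\<close>

lemma second_order_lift:
 assumes y: "y \<in> carrier H"
  and l: "\<And>\<alpha> \<mu>. \<alpha> \<in> ann H (coradical_filtration H 1) \<Longrightarrow> linform H \<mu> \<Longrightarrow> conv H \<alpha> \<mu> y = \<alpha> y * \<mu> \<one> \<and> conv H \<mu> \<alpha> y = \<mu> \<one> * \<alpha> y"
  and m: "\<And>\<alpha> \<mu>. \<alpha> \<in> ann H (coradical H) \<Longrightarrow> \<mu> \<in> ann H (coradical H) \<Longrightarrow> conv H \<alpha> \<mu> y = \<alpha> (x \<otimes> g) * \<mu> x"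
  and xg: "x \<otimes> g = g \<otimes> x \<oplus> \<nu> \<odot> (\<one> \<oplus> g)"
 obtains y' where "y' \<in> carrier H" "\<And>\<alpha> \<mu>. linform H \<alpha> \<Longrightarrow> linform H \<mu> \<Longrightarrow>
  conv H \<alpha> \<mu> y' = \<alpha> y' * \<mu> \<one> + \<alpha> \<one> * \<mu> y' + \<alpha> (x \<otimes> g) * \<mu> x"
proof -
 let ?e = "\<lambda>i. [\<one>, g, x, g \<otimes> x] ! i"
 let ?T = "tensor_space H H"
 \<comment> \<open>The defect of \<open>y\<close> from the wanted comultiplication, with sums in
   place of differences in characteristic two. Hypothesis \<open>l\<close> puts it into the tensor
   square of the first filtration term, so it is a matrix of 16 entries
   \<open>w i j\<close>.\<close>
 define T where "T = comul H y \<oplus>\<^bsub>?T\<^esub> (pure_tensor H H y \<one> \<oplus>\<^bsub>?T\<^esub> (pure_tensor H H \<one> y \<oplus>\<^bsub>?T\<^esub> pure_tensor H H (x \<otimes> g) x))"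
 note Tc = vs_add[OF vspace_tensor[OF V V]] pure_closed[OF V V] coalg_comul[OF H_coalg]
 have TT: "T \<in> carrier ?T" using y by (simp add: T_def Tc)
 have tev: "tev \<alpha> \<mu> T = conv H \<alpha> \<mu> y + (\<alpha> y * \<mu> \<one> + (\<alpha> \<one> * \<mu> y + \<alpha> (x \<otimes> g) * \<mu> x))" if "linform H \<alpha>" "linform H \<mu>" for \<alpha> \<mu>
  using that y by (simp add: T_def Tc linformD(1)[OF linform_tev[OF V V]] tev_pure[OF V V] conv_def)
 have sum4: "(\<Sum>i<4. F i) = F 0 + (F 1 + (F 2 + F 3))" for F :: "nat \<Rightarrow> 'k" by (simp add: numeral_eq_Suc)
 define w where "w i j = tev (\<xi> i) (\<xi> j) T" for i j
 have e1: "?e i \<in> coradical_filtration H 1" if "i < 4" for i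
 proof -
  have "i = 0 \<or> i = 1 \<or> i = 2 \<or> i = 3" using that by auto
  then show ?thesis by (elim disjE) (auto intro!: H1I dest!: cor_ann simp: conv_simps simp del: One_nat_def coradical_filtration.simps)
 qed
 have W: "tev \<alpha> \<mu> T = (\<Sum>i<4. \<Sum>j<4. \<alpha> (?e i) * \<mu> (?e j) * w i j)" if ll: "linform H \<alpha>" "linform H \<mu>" for \<alpha> \<mu>
  unfolding w_def
 proof (rule tev_factor[OF V TT \<xi> _ _ ll])
  fix \<alpha> assume a: "linform H \<alpha>"
  show "(\<lambda>z. \<alpha> z - (\<Sum>i<4. \<alpha> (?e i) * \<xi> i z)) \<in> ann H (coradical_filtration H 1)"
  proof (rule annI)
   show "linform H (\<lambda>z. \<alpha> z - (\<Sum>i<4. \<alpha> (?e i) * \<xi> i z))" using \<xi> by (intro linform_diff a linform_sum linform_scale)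
   fix z assume z: "z \<in> coradical_filtration H 1"
   have "\<alpha> z = \<alpha> (\<xi> 0 z \<odot> \<one> \<oplus> (\<xi> 1 z \<odot> g \<oplus> (\<xi> 2 z \<odot> x \<oplus> \<xi> 3 z \<odot> (g \<otimes> x))))" using span[OF z] by simp
   then show "\<alpha> z - (\<Sum>i<4. \<alpha> (?e i) * \<xi> i z) = 0" by (simp add: lin[OF a] sum4 mult.commute)
  qed
 next
  fix \<alpha> \<mu> assume a: "\<alpha> \<in> ann H (coradical_filtration H 1)" and mu: "linform H \<mu>"
  have a0: "\<alpha> \<one> = 0" "\<alpha> g = 0" "\<alpha> x = 0" "\<alpha> (g \<otimes> x) = 0"
   using annD(2)[OF a e1[of 0]] annD(2)[OF a e1[of 1]] annD(2)[OF a e1[of 2]] annD(2)[OF a e1[of 3]] by simp_all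
  show "tev \<alpha> \<mu> T = 0 \<and> tev \<mu> \<alpha> T = 0"
   using l[OF a mu] by (simp add: tev annD(1)[OF a] mu a0 xg lin[OF annD(1)[OF a]] char2_field[OF char2])
 qed
 have conv_y: "conv H \<alpha> \<mu> y = \<alpha> y * \<mu> \<one> + (\<alpha> \<one> * \<mu> y + (\<alpha> (x \<otimes> g) * \<mu> x + (\<Sum>i<4. \<Sum>j<4. \<alpha> (?e i) * \<mu> (?e j) * w i j)))"
  if "linform H \<alpha>" "linform H \<mu>" for \<alpha> \<mu>
  unfolding W[OF that, symmetric] tev[OF that] by (simp add: ring_norm)
 \<comment> \<open>The forms with index 2 and 3 vanish on the coradical, where hypothesis
   \<open>m\<close> already gives the wanted comultiplication.\<close>
 have w0: "w i j = 0" if "2 \<le> i" "i < 4" "2 \<le> j" "j < 4" for i j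
 proof -
  have "\<xi> k \<in> ann H (coradical H)" if k: "2 \<le> k" "k < 4" for k
  proof -
   have "k = 2 \<or> k = 3" using k by auto
   then show ?thesis
    unfolding pt[unfolded pointed_def] by (intro ann_lin_span[OF V _ \<xi>]) (auto simp: grouplikes xi)
  qed
  from m[OF this[OF that(1,2)] this[OF that(3,4)]] annD(2)[OF this[OF that(1,2)] cor_mem(1)] annD(2)[OF this[OF that(3,4)] cor_mem(1)]
  show ?thesis unfolding w_def by (simp add: tev \<xi> char2_field[OF char2])
 qed
 \<comment> \<open>Coassociativity of \<open>y\<close> at triples of dual forms yields the cocycle
   equations. Each chosen triple isolates one linear equation between entries of
   \<open>w\<close>.\<close>
 note assoc = conv_assoc[OF H_coalg \<xi> \<xi> \<xi> y]
 note expand = conv_y linform_conv[OF H_coalg] \<xi> sum4 conv_simps xi lin[OF \<xi>] xg w0 char2_field[OF char2]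
 have w1: "w 1 1 + w 1 0 = 0" using assoc[of 1 1 0] by (simp add: expand del: One_nat_def)
 have w2: "w 1 1 + w 0 1 = 0" using assoc[of 0 1 1] by (simp add: expand del: One_nat_def)
 have w3: "w 1 2 + w 0 2 = 0" using assoc[of 0 1 2] by (simp add: expand del: One_nat_def)
 have w4: "w 3 1 + w 3 0 = 0" using assoc[of 3 1 0] by (simp add: expand del: One_nat_def)
 have w5: "w 2 0 = 0" using assoc[of 2 0 0] by (simp add: expand del: One_nat_def)
 have w6: "w 2 1 = 0" using assoc[of 2 0 1] by (simp add: expand del: One_nat_def)
 have w7: "w 0 3 = 0" using assoc[of 0 0 3] by (simp add: expand del: One_nat_def)
 have w8: "w 1 3 = 0" using assoc[of 0 1 3] by (simp add: expand del: One_nat_def)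
 have eq: "a = b" if "a + b = 0" for a b :: 'k using that char2_field(1)[OF char2, of b] by (metis add_right_imp_eq)
 note w' = eq[OF w1] eq[OF w2] eq[OF w3] eq[OF w4] w5 w6 w7 w8
 \<comment> \<open>The equations leave four free entries. The matrix they describe is exactly the
   defect of \<open>?z\<close> itself, so adding \<open>?z\<close> cancels it.\<close>
 let ?z = "w 0 0 \<odot> \<one> \<oplus> (w 0 1 \<odot> g \<oplus> (w 0 2 \<odot> x \<oplus> w 3 0 \<odot> (g \<otimes> x)))"
 have w10: "w 1 0 = w 0 1" using w'(1,2) by simp
 show thesis
 proof (rule that)
  show "y \<oplus> ?z \<in> carrier H" using y by simp
  fix \<alpha> \<mu> assume ll: "linform H \<alpha>" "linform H \<mu>"
  show "conv H \<alpha> \<mu> (y \<oplus> ?z) = \<alpha> (y \<oplus> ?z) * \<mu> \<one> + \<alpha> \<one> * \<mu> (y \<oplus> ?z) + \<alpha> (x \<otimes> g) * \<mu> x"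
   by (simp add: conv_lin conv_y ll y lin sum4 conv_simps w0 w'(2-8) w10 del: One_nat_def; simp add: ring_norm del: One_nat_def)
 qed
qed

end

text \<open>Of the relations only those for g g and x g are given; everything that involves y or the
  square of x is to be derived from the comultiplications.\<close>

locale second_lifting = skew_lifting H g x \<xi>
 for H :: "('k::field, 'h, 'm) bialg_scheme" (structure) and g x :: 'h and \<xi> :: "nat \<Rightarrow> 'h \<Rightarrow> 'k" +
 fixes y :: 'h and \<epsilon> :: 'k
 assumes idem: "\<epsilon> * \<epsilon> = \<epsilon>" and xg: "x \<otimes> g = g \<otimes> x \<oplus> \<epsilon> \<odot> (\<one> \<oplus> g)" and y [simp]: "y \<in> carrier H"
  and conv_y: "\<And>\<alpha> \<mu>. linform H \<alpha> \<Longrightarrow> linform H \<mu> \<Longrightarrow> conv H \<alpha> \<mu> y = \<alpha> y * \<mu> \<one> + \<alpha> \<one> * \<mu> y + \<alpha> (x \<otimes> g) * \<mu> x"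
begin

lemma comul_y: "comul H y = pure_tensor H H y \<one> \<oplus>\<^bsub>tensor_space H H\<^esub>
  (pure_tensor H H \<one> y \<oplus>\<^bsub>tensor_space H H\<^esub> pure_tensor H H (x \<otimes> g) x)"
 by (rule comul_eqI[OF H_coalg fd])
  (simp_all add: conv_y tev_pure[OF V V] linformD(1)[OF linform_tev[OF V V]] vs_add[OF vspace_tensor[OF V V]] pure_closed[OF V V])

lemma conv_yz: "linform H \<alpha> \<Longrightarrow> linform H \<mu> \<Longrightarrow> z \<in> carrier H \<Longrightarrow>
  conv H \<alpha> \<mu> (y \<otimes> z) = conv H (\<lambda>w. \<alpha> (y \<otimes> w)) \<mu> z +
   (conv H \<alpha> (\<lambda>w. \<mu> (y \<otimes> w)) z + conv H (\<lambda>w. \<alpha> ((x \<otimes> g) \<otimes> w)) (\<lambda>w. \<mu> (x \<otimes> w)) z)"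
 by (rule conv_mult_second_order[OF conv_mults _ _ _ _ _ _ comul_y]) simp_all

lemma linform_mult': "linform H \<alpha> \<Longrightarrow> linform H (\<lambda>w. \<alpha> ((x \<otimes> g) \<otimes> w))"
 by (rule linform_mult(1)) simp_all

lemma eps: "\<epsilon> * (\<epsilon> * c) = \<epsilon> * c"
 by (simp add: mult.assoc[symmetric] idem)

lemma word_x: "z \<in> carrier H \<Longrightarrow> x \<otimes> (g \<otimes> z) = g \<otimes> (x \<otimes> z) \<oplus> \<epsilon> \<odot> (z \<oplus> g \<otimes> z)"
 using alg(1)[of x g z] by (simp add: xg alg)

lemmas xg_rules = alg gg ggz xg word_x

lemmas conv_rules = conv_one conv_g conv_x conv_y conv_gz conv_xz conv_yz conv_lin linform_mult(1) linform_mult'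

lemma rel_xx: "x \<otimes> x = \<epsilon> \<odot> x"
proof -
 have "x \<otimes> x \<oplus> \<epsilon> \<odot> x = \<zero>"
 proof (rule primitive_zero)
  fix \<alpha> \<mu> assume l: "linform H \<alpha>" "linform H \<mu>"
  show "conv H \<alpha> \<mu> (x \<otimes> x \<oplus> \<epsilon> \<odot> x) = \<alpha> (x \<otimes> x \<oplus> \<epsilon> \<odot> x) * \<mu> \<one> + \<alpha> \<one> * \<mu> (x \<otimes> x \<oplus> \<epsilon> \<odot> x)"
   by (simp add: conv_rules l; simp add: xg_rules lin l; simp add: ring_norm eps)
 qed simp
 then show ?thesis by (simp add: vs2_eq_iff[OF char2 V])
qed

lemma word_xx: "z \<in> carrier H \<Longrightarrow> x \<otimes> (x \<otimes> z) = \<epsilon> \<odot> (x \<otimes> z)"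
 using alg(1)[of x x z] by (simp add: rel_xx alg)

lemma rel_yg: "y \<otimes> g = g \<otimes> y \<oplus> \<epsilon> \<odot> (x \<oplus> g \<otimes> x)"
proof -
 let ?d = "y \<otimes> g \<oplus> (g \<otimes> y \<oplus> \<epsilon> \<odot> (x \<oplus> g \<otimes> x))"
 have "?d = \<zero>"
 proof (rule primitive_g_zero)
  fix \<alpha> \<mu> assume l: "linform H \<alpha>" "linform H \<mu>"
  show "conv H \<alpha> \<mu> ?d = \<alpha> ?d * \<mu> g + \<alpha> g * \<mu> ?d"
   by (simp add: conv_rules l; simp add: xg_rules lin l; simp add: ring_norm idem eps)
 qed simp
 then show ?thesis by (simp add: vs2_eq_iff[OF char2 V])
qed

lemma word_yg: "z \<in> carrier H \<Longrightarrow> y \<otimes> (g \<otimes> z) = g \<otimes> (y \<otimes> z) \<oplus> \<epsilon> \<odot> (x \<otimes> z \<oplus> g \<otimes> (x \<otimes> z))"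
 using alg(1)[of y g z] by (simp add: rel_yg alg)

lemmas yg_rules = xg_rules rel_xx word_xx rel_yg word_yg

lemma vs_cancel: "u \<in> carrier H \<Longrightarrow> v \<in> carrier H \<Longrightarrow> u \<oplus> v = w \<Longrightarrow> v = u \<oplus> w"
 by (auto simp: vs2_add_self_left[OF char2 V])

text \<open>The element x y + y x is skew-primitive and thus equal to \<sigma> x + \<tau> (1 + g).
  The comultiplication does not exclude \<sigma>; it is eliminated by comparing the two bracketings
  of y x x and of y y x under \<open>\<xi> 2\<close>, the coefficient of x.\<close>

lemma q_algebra_lifting: obtains \<tau> where "q_algebra H g x y \<epsilon> \<tau>"
proof -
 let ?c = "x \<otimes> y \<oplus> y \<otimes> x"
 have c: "conv H \<alpha> \<mu> ?c = \<alpha> ?c * \<mu> \<one> + \<alpha> g * \<mu> ?c" if l: "linform H \<alpha>" "linform H \<mu>" for \<alpha> \<mu>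
  by (simp add: conv_rules l; simp add: yg_rules lin l; simp add: ring_norm idem eps)
 obtain \<sigma> \<tau> where "?c = \<sigma> \<odot> x \<oplus> \<tau> \<odot> (\<one> \<oplus> g)"
  by (rule skew_primitive_1[of ?c, OF _ c]) simp_all
 then have yx: "y \<otimes> x = x \<otimes> y \<oplus> (\<sigma> \<odot> x \<oplus> \<tau> \<odot> (\<one> \<oplus> g))" by (rule vs_cancel[rotated 2]) simp_all
 have word_yx: "y \<otimes> (x \<otimes> z) = x \<otimes> (y \<otimes> z) \<oplus> (\<sigma> \<odot> (x \<otimes> z) \<oplus> \<tau> \<odot> (z \<oplus> g \<otimes> z))" if "z \<in> carrier H" for z
  using alg(1)[of y x z] that by (simp add: yx alg)
 \<comment> \<open>This yields \<open>\<epsilon> * \<sigma> = 0\<close>, which is required for the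
   element \<open>?d\<close> below to be primitive.\<close>
 have "y \<otimes> (x \<otimes> x) = (y \<otimes> x) \<otimes> x" by (simp add: alg)
 then have "\<xi> 2 (y \<otimes> (x \<otimes> x)) = \<xi> 2 ((y \<otimes> x) \<otimes> x)" by (rule arg_cong)
 then have es: "\<epsilon> * \<sigma> = 0"
  by (simp add: yg_rules yx; simp add: yx word_yx yg_rules lin[OF \<xi>] xi; simp add: ring_norm eps)
 have es': "\<epsilon> * (\<sigma> * c) = 0" for c using es by (simp add: mult.assoc[symmetric])
 let ?d = "y \<otimes> y \<oplus> (\<epsilon> \<odot> y \<oplus> \<tau> \<odot> (x \<oplus> x \<otimes> g))"
 have "?d = \<zero>"
 proof (rule primitive_zero)
  fix \<alpha> \<mu> assume l: "linform H \<alpha>" "linform H \<mu>"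
  show "conv H \<alpha> \<mu> ?d = \<alpha> ?d * \<mu> \<one> + \<alpha> \<one> * \<mu> ?d"
   by (simp add: conv_rules l; simp add: yx word_yx yg_rules lin l; simp add: ring_norm idem eps es')
 qed simp
 then have yy: "y \<otimes> y = \<epsilon> \<odot> y \<oplus> \<tau> \<odot> (x \<oplus> x \<otimes> g)" by (simp add: vs2_eq_iff[OF char2 V])
 \<comment> \<open>With y y known, the coefficient of x in the two bracketings differs by \<sigma>
   squared.\<close>
 have "y \<otimes> (y \<otimes> x) = (y \<otimes> y) \<otimes> x" by (simp add: alg)
 then have "\<xi> 2 (y \<otimes> (y \<otimes> x)) = \<xi> 2 ((y \<otimes> y) \<otimes> x)" by (rule arg_cong)
 then have "\<sigma> * \<sigma> = 0"
  by (simp add: yx word_yx yg_rules yy lin[OF \<xi>] xi; simp add: ring_norm eps idem es es')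
 then have "\<sigma> = 0" by simp
 then have yx': "y \<otimes> x = x \<otimes> y \<oplus> \<tau> \<odot> (\<one> \<oplus> g)" using yx by (simp add: vs_smult_zero[OF V] vs_l_zero[OF V])
 show thesis
  by (rule that[of \<tau>]) (intro q_algebra.intro H_alg char2 idem g x y gg xg rel_yg yx' rel_xx; simp add: yy xg vs_norm)
qed

text \<open>As \<Delta> y contains x g \<otimes> x, scaling x by s forces y to be scaled by s *
  s.\<close>

lemma rescale_y:
 assumes "\<epsilon> = 0" "s \<noteq> 0"
 shows "second_lifting H g (s \<odot> x) (\<lambda>i z. if i < 2 then \<xi> i z else inverse s * \<xi> i z) (s * s \<odot> y) 0"
 using assms(1)
 by (intro second_lifting.intro second_lifting_axioms.intro rescale assms(2))
  (simp_all add: xg alg vs_smult_zero[OF V] vs_r_zero[OF V] conv_lin conv_y lin ring_norm)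

end

section \<open>Construction of x and y in the lifting\<close>

context graded_model
begin

lemma one_grouplike: "\<one> \<in> grouplikes H"
 by (simp add: grouplikes_eq)

lemma H_comul_mult: "u \<in> carrier H \<Longrightarrow> z \<in> carrier H \<Longrightarrow> comul H (u \<otimes> z) = comul H u \<otimes>\<^bsub>tensor_alg H H\<^esub> comul H z"
 using k_bialgebra.comul_hom[OF H_bialg] by (simp add: ring_hom_def)

lemmas H_closed = vs_add[OF H_V] vs_smult[OF H_V] alg_mult[OF H_alg] alg_one[OF H_alg] g_ch(2)

lemma conv_g_mult:
 assumes "linform H \<alpha>" "linform H \<mu>" "z \<in> carrier H"
 shows "conv H \<alpha> \<mu> (g \<otimes> z) = conv H (\<lambda>w. \<alpha> (g \<otimes> w)) (\<lambda>w. \<mu> (g \<otimes> w)) z"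
 using g_grouplike(1) assms
 by (intro conv_mult_grouplike[OF H_alg coalg_comul_linear[OF H_coalg] H_comul_mult]) (auto simp: grouplikes_def)

lemma g_linform: "linform H \<alpha> \<Longrightarrow> linform H (\<lambda>w. \<alpha> (g \<otimes> w))"
 by (rule linform_mult_left[OF H_alg _ g_ch(2)])

text \<open>The square of g is group-like, hence 1 or g. The antipode provides an inverse of g, so g
  g = g would give g = 1.\<close>

lemma gg_eq: "g \<otimes> g = \<one>"
proof -
 note gc = g_ch(2)
 have "comul H (g \<otimes> g) = pure_tensor H H (g \<otimes> g) (g \<otimes> g)"
  by (rule comul_eqI[OF H_coalg fd])
   (simp_all add: H_closed pure_closed[OF H_V H_V] conv_g_mult conv_grouplike[OF H_coalg g_grouplike(1)] g_linform tev_pure[OF H_V H_V])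
 moreover have "counit H (g \<otimes> g) = 1"
  using k_bialgebra.counit_hom[OF H_bialg] g_grouplike(1) by (simp add: ring_hom_def grouplikes_def base_alg_simps)
 ultimately have "g \<otimes> g \<in> grouplikes H" by (simp add: grouplikes_def H_closed)
 moreover have "g \<otimes> g \<noteq> g"
 proof
  assume eq: "g \<otimes> g = g"
  obtain S where S: "is_antipode H S" using hopf_algebra.antipode_exists[OF hopf] by auto
  then have Sl: "linear_map H H S" by (simp add: is_antipode_def)
  have bl: "bilin H H H (\<lambda>u v. S u \<otimes> v)"
   by (intro bilinI linear_mapI; simp add: linear_mapD[OF Sl] H_closed alg_l_distr[OF H_alg] alg_r_distr[OF H_alg]
    alg_smult_left[OF H_alg] alg_smult_right[OF H_alg])
  have "tensor_lift H (\<lambda>u v. S u \<otimes> v) (comul H g) = counit H g \<odot> \<one>"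
   using S gc by (simp add: is_antipode_def)
  then have Sg: "S g \<otimes> g = \<one>"
   using g_grouplike(1) by (simp add: grouplikes_def tensor_lift_pure[OF H_V H_V H_V bl] gc vs_smult_one[OF H_V] H_closed)
  then have "(S g \<otimes> g) \<otimes> g = g" by (simp add: alg_l_one[OF H_alg] gc)
  moreover have "(S g \<otimes> g) \<otimes> g = S g \<otimes> (g \<otimes> g)"
   by (rule alg_assoc[OF H_alg linear_mapD(1)[OF Sl gc] gc gc])
  ultimately show False using Sg g_grouplike(2) by (simp add: eq)
 qed
 ultimately show ?thesis by (simp add: grouplikes_eq)
qed

lemma second_lifting_exists: "\<exists>x \<xi> y \<epsilon>. second_lifting H g x \<xi> y \<epsilon> \<and> (\<epsilon> = 0 \<or> \<epsilon> = 1)"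
proof -
 let ?e = "\<one>"
 note ch2 = char2_field[OF A.char2] and cl = H_closed lift_closed
 have lin: "linform H \<alpha> \<Longrightarrow> u \<in> carrier H \<Longrightarrow> v \<in> carrier H \<Longrightarrow> \<alpha> (u \<oplus> v) = \<alpha> u + \<alpha> v"
  "linform H \<alpha> \<Longrightarrow> u \<in> carrier H \<Longrightarrow> \<alpha> (c \<odot> u) = c * \<alpha> u" for \<alpha> u v c by (rule linformD; assumption)+
 note gl = conv_grouplike[OF H_coalg one_grouplike] conv_grouplike[OF H_coalg g_grouplike(1)]
 obtain \<phi> where p: "linform H \<phi>" "\<phi> g \<noteq> \<phi> ?e"
  using linform_eqI[OF H_V fd g_ch(2) alg_one[OF H_alg]] g_grouplike(2) by blast
 have cu: "linform H (counit H)" "counit H ?e = 1" "counit H g = 1"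
  using coalg_counit[OF H_coalg] one_grouplike g_grouplike(1) by (auto simp: grouplikes_def)
 \<comment> \<open>Forms dual to 1 and g. The counit is 1 on both; \<phi> minus \<phi>(1) times the
   counit vanishes at 1 but not at g, and is normalized there.\<close>
 define a where "a i = (if i = 0 then (\<lambda>z. counit H z - inverse (\<phi> g - \<phi> ?e) * (\<phi> z - \<phi> ?e * counit H z))
  else (\<lambda>z. inverse (\<phi> g - \<phi> ?e) * (\<phi> z - \<phi> ?e * counit H z)))" for i :: nat
 have al: "linform H (a i)" for i using p cu by (auto simp: a_def intro!: linform_diff linform_scale)
 have av: "a 0 ?e = 1" "a 0 g = 0" "a 1 ?e = 0" "a 1 g = 1" using p cu by (simp_all add: a_def)
 have two: "(\<Sum>i<2. F i) = F 0 + F 1" for F :: "nat \<Rightarrow> 'k" by (simp add: numeral_2_eq_2)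
 let ?E = "\<lambda>i. [?e, g] ! i"
 have U: "(\<lambda>z. \<alpha> z - (\<Sum>i<2. \<alpha> (?E i) * a i z)) \<in> ann H (coradical H)" if l: "linform H \<alpha>" for \<alpha>
  unfolding coradical_span
  by (rule ann_lin_span[OF H_V]) (auto simp: cl two av av[unfolded One_nat_def] intro!: linform_diff linform_add linform_scale l al)
 have ann0: "\<alpha> ?e = 0" "\<alpha> g = 0" "linform H \<alpha>" if "\<alpha> \<in> ann H (coradical H)" for \<alpha>
  using annD[OF that] one_ch g_ch(1) by auto
 \<comment> \<open>The defect of \<open>X0\<close> from being skew-primitive. It is killed by forms
   that vanish on the coradical, so it is a matrix in terms of 1 and g.\<close>
 define T where "T = comul H X0 \<oplus>\<^bsub>tensor_space H H\<^esub> (pure_tensor H H X0 ?e \<oplus>\<^bsub>tensor_space H H\<^esub> pure_tensor H H g X0)"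
 note Tc = vs_add[OF vspace_tensor[OF H_V H_V]] pure_closed[OF H_V H_V] coalg_comul[OF H_coalg]
 have TT: "T \<in> carrier (tensor_space H H)" by (simp add: T_def Tc cl)
 have tev: "tev \<alpha> \<mu> T = conv H \<alpha> \<mu> X0 + (\<alpha> X0 * \<mu> ?e + \<alpha> g * \<mu> X0)" if "linform H \<alpha>" "linform H \<mu>" for \<alpha> \<mu>
  using that by (simp add: T_def Tc cl linformD(1)[OF linform_tev[OF H_V H_V]] tev_pure[OF H_V H_V] conv_def)
 define w where "w i j = tev (a i) (a j) T" for i j
 have W: "tev \<alpha> \<mu> T = (\<Sum>i<2. \<Sum>j<2. \<alpha> (?E i) * \<mu> (?E j) * w i j)" if l: "linform H \<alpha>" "linform H \<mu>" for \<alpha> \<mu>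
  unfolding w_def
  by (rule tev_factor[OF H_V TT al U _ l]) (simp_all add: tev ann0 conv_X0 ch2)
 have cX: "conv H \<alpha> \<mu> X0 = \<alpha> X0 * \<mu> ?e + (\<alpha> g * \<mu> X0 + (\<Sum>i<2. \<Sum>j<2. \<alpha> (?E i) * \<mu> (?E j) * w i j))"
  if "linform H \<alpha>" "linform H \<mu>" for \<alpha> \<mu>
  unfolding W[OF that, symmetric] tev[OF that] by (simp add: ch2 add_ac)
 note assoc = conv_assoc[OF H_coalg al al al lift_closed(4)]
 note expand = cX linform_conv[OF H_coalg] al two gl av ch2
 \<comment> \<open>Coassociativity leaves only the entry \<open>w 1 0\<close>. It is the defect of
   the unit element, so adding \<open>w 1 0\<close> times the unit to \<open>X0\<close> makes it
   skew-primitive.\<close>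
 have w1: "w 0 0 = 0" using assoc[of 0 0 0] by (simp add: expand del: One_nat_def)
 have w2: "w 0 1 = 0" using assoc[of 0 0 1] by (simp add: expand del: One_nat_def)
 have w3: "w 1 1 = 0" using assoc[of 1 1 1] by (simp add: expand del: One_nat_def)
 define x where "x = X0 \<oplus> w 1 0 \<odot> ?e"
 have xc: "x \<in> carrier H" by (simp add: x_def cl)
 have conv_x: "conv H \<alpha> \<mu> x = \<alpha> x * \<mu> ?e + \<alpha> g * \<mu> x" if "linform H \<alpha>" "linform H \<mu>" for \<alpha> \<mu>
  using that by (simp add: x_def lin linform_conv[OF H_coalg] cl cX two w1 w2 w3 gl del: One_nat_def)
   (simp add: ch2 algebra_simps)
 let ?gx = "g \<otimes> x"
 have gxc: "?gx \<in> carrier H" by (simp add: cl xc)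
 have ggx: "g \<otimes> ?gx = x" using alg_assoc[OF H_alg g_ch(2) g_ch(2) xc] by (simp add: gg_eq alg_l_one[OF H_alg] xc)
 have conv_gx: "conv H \<alpha> \<mu> ?gx = \<alpha> ?gx * \<mu> g + \<alpha> ?e * \<mu> ?gx" if "linform H \<alpha>" "linform H \<mu>" for \<alpha> \<mu>
  using that by (simp add: conv_g_mult xc conv_x g_linform gg_eq alg_r_one[OF H_alg] cl)
 have Xx: "\<alpha> X0 = \<alpha> x" if "\<alpha> \<in> ann H (coradical H)" for \<alpha>
  using ann0[OF that] by (simp add: x_def lin cl)
 have H0: "\<alpha> z = \<alpha> ?e * a 0 z + \<alpha> g * a 1 z" if "z \<in> coradical H" "linform H \<alpha>" for z \<alpha>
  using annD(2)[OF U[OF that(2)] that(1)] by (simp add: two)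
 note sc = submodule_coradical[OF H_graded]
 have "x \<notin> coradical H"
 proof
  assume "x \<in> coradical H"
  then have "\<alpha> X0 = 0" if "\<alpha> \<in> ann H (coradical H)" for \<alpha> using annD(2)[OF that] Xx[OF that] by simp
  then show False using X0_notin ann_sep[OF H_V fd sc lift_closed(4)] by blast
 qed
 then obtain \<phi>2 where p2: "\<phi>2 \<in> ann H (coradical H)" "\<phi>2 x = 1" using ann_separates[OF H_V fd sc xc] by blast
 have "?gx \<notin> coradical H"
 proof
  assume z: "?gx \<in> coradical H"
  have "\<phi>2 (g \<otimes> ?gx) = \<phi>2 (g \<otimes> ?e) * a 0 ?gx + \<phi>2 (g \<otimes> g) * a 1 ?gx"
   by (rule H0[OF z g_linform[OF annD(1)[OF p2(1)]]])
  then show False using ann0[OF p2(1)] p2(2) by (simp add: ggx gg_eq alg_r_one[OF H_alg] g_ch(2))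
 qed
 then obtain \<phi>3 where p3: "\<phi>3 \<in> ann H (coradical H)" "\<phi>3 ?gx = 1" using ann_separates[OF H_V fd sc gxc] by blast
 \<comment> \<open>Modulo the coradical, x carries 1 on its right leg and g x carries g. Convolving
   on the right with the form dual to 1 or to g therefore separates x from g x, which \<phi>2 and
   \<phi>3 alone need not do.\<close>
 define b2 where "b2 = conv H \<phi>2 (a 0)"
 define b3 where "b3 = conv H \<phi>3 (a 1)"
 have bl: "linform H b2" "linform H b3" using p2 p3 al by (auto simp: b2_def b3_def annD(1) intro!: linform_conv[OF H_coalg])
 have bv: "b2 ?e = 0" "b2 g = 0" "b2 x = 1" "b2 ?gx = 0" "b3 ?e = 0" "b3 g = 0" "b3 x = 0" "b3 ?gx = 1"
  using ann0[OF p2(1)] ann0[OF p3(1)] p2(2) p3(2) av by (simp_all add: b2_def b3_def gl conv_x conv_gx al)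
 have b_ann: "b2 \<in> ann H (coradical H)" "b3 \<in> ann H (coradical H)"
  unfolding coradical_span by (rule ann_lin_span[OF H_V]; auto simp: cl bl bv)+
 have gx1: "?gx \<in> ch 1"
  using coradical_filtration_Suc_iff[OF H_graded, of ?gx 0] by (simp add: gxc conv_gx ann0)
 have span1: "\<exists>r c. \<forall>\<alpha>\<in>ann H (coradical H). \<alpha> z = r * \<alpha> x + c * \<alpha> Y0" if z: "z \<in> ch 1" for z
 proof (rule H1_span[OF z])
  fix r c assume *: "z \<ominus> (r \<odot> X0 \<oplus> c \<odot> Y0) \<in> coradical H"
  have zc: "z \<in> carrier H" by (rule C_closed[OF H_graded z])
  have "\<alpha> z = r * \<alpha> x + c * \<alpha> Y0" if al: "\<alpha> \<in> ann H (coradical H)" for \<alpha>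
   using annD(2)[OF al *] by (simp add: vs2_minus[OF A.char2 H_V] zc cl lin ann0[OF al] Xx[OF al] ch2(3) eq_neg_iff_add_eq_0[symmetric])
  then show ?thesis by blast
 qed
 obtain r c where rc: "\<And>\<alpha>. \<alpha> \<in> ann H (coradical H) \<Longrightarrow> \<alpha> ?gx = r * \<alpha> x + c * \<alpha> Y0" using span1[OF gx1] by blast
 \<comment> \<open>Hence \<open>c\<close> is invertible, and x, g x may replace x, \<open>Y0\<close>
   as generators of the first filtration term modulo the coradical.\<close>
 have c: "c * b3 Y0 = 1" "r + c * b2 Y0 = 0" using rc[OF b_ann(2)] rc[OF b_ann(1)] bv by simp_all
 have span2: "\<beta> z = b2 z * \<beta> x + b3 z * \<beta> ?gx" if z: "z \<in> ch 1" and b: "\<beta> \<in> ann H (coradical H)" for z \<beta>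
 proof -
  obtain r' c' where rc': "\<And>\<alpha>. \<alpha> \<in> ann H (coradical H) \<Longrightarrow> \<alpha> z = r' * \<alpha> x + c' * \<alpha> Y0" using span1[OF z] by blast
  have "r = c * b2 Y0" using c(2) ch2(1)[of "c * b2 Y0"] by (metis add_right_imp_eq)
  then have k: "b3 Y0 * r = b2 Y0" "b3 Y0 * c = 1" using arg_cong[OF c(1), of "\<lambda>z. z * b2 Y0"] c(1) by (simp_all add: mult_ac)
  have "b2 z * \<beta> x + b3 z * \<beta> ?gx = (r' + c' * b2 Y0) * \<beta> x + (c' * (b3 Y0 * r) * \<beta> x + c' * (b3 Y0 * c) * \<beta> Y0)"
   using rc'[OF b_ann(1)] rc'[OF b_ann(2)] rc[OF b] bv by (simp add: algebra_simps)
  also have "\<dots> = r' * \<beta> x + c' * \<beta> Y0" unfolding k by (simp add: algebra_simps ch2)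
  finally show ?thesis using rc'[OF b] by simp
 qed
 \<comment> \<open>The forms dual to 1 and g are corrected so as to vanish on x and g x.\<close>
 define \<xi> where "\<xi> i = (if i < 2 then (\<lambda>z. a i z + (a i x * b2 z + a i ?gx * b3 z)) else if i = 2 then b2 else b3)" for i :: nat
 have "skew_lifting H g x \<xi>"
 proof (rule skew_lifting.intro; (rule hopf fd pt A.char2 grouplikes_eq gg_eq xc conv_x; assumption)?)
  show xl: "linform H (\<xi> i)" for i by (auto simp: \<xi>_def al bl intro!: linform_add linform_scale)
  show "\<xi> i ([?e, g, x, ?gx] ! j) = (if i = j then 1 else 0)" if ij: "i < 4" "j < 4" for i j
  proof -
   have four: "n = 0 \<or> n = 1 \<or> n = 2 \<or> n = 3" if "n < 4" for n :: nat using that by auto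
   show ?thesis using four[OF ij(1)] four[OF ij(2)]
    by (elim disjE) (simp_all add: \<xi>_def av bv ch2 av[unfolded One_nat_def])
  qed
  fix z assume z: "z \<in> ch 1"
  show "z = \<xi> 0 z \<odot> ?e \<oplus> (\<xi> 1 z \<odot> g \<oplus> (\<xi> 2 z \<odot> x \<oplus> \<xi> 3 z \<odot> ?gx))"
  proof (rule linform_eqI[OF H_V fd C_closed[OF H_graded z]])
   fix \<alpha> assume l: "linform H \<alpha>"
   have "\<alpha> z + (\<alpha> ?e * a 0 z + \<alpha> g * a 1 z) = b2 z * (\<alpha> x + (\<alpha> ?e * a 0 x + \<alpha> g * a 1 x)) + b3 z * (\<alpha> ?gx + (\<alpha> ?e * a 0 ?gx + \<alpha> g * a 1 ?gx))"
    using span2[OF z U[OF l]] by (simp add: two ch2(4) del: One_nat_def)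
   then have "\<alpha> z = (\<alpha> ?e * a 0 z + \<alpha> g * a 1 z) + (b2 z * (\<alpha> x + (\<alpha> ?e * a 0 x + \<alpha> g * a 1 x)) + b3 z * (\<alpha> ?gx + (\<alpha> ?e * a 0 ?gx + \<alpha> g * a 1 ?gx)))"
    using ch2(2)[of "\<alpha> ?e * a 0 z + \<alpha> g * a 1 z" "\<alpha> z"] by (metis add.commute)
   then show "\<alpha> z = \<alpha> (\<xi> 0 z \<odot> ?e \<oplus> (\<xi> 1 z \<odot> g \<oplus> (\<xi> 2 z \<odot> x \<oplus> \<xi> 3 z \<odot> ?gx)))"
    by (simp add: lin l cl xc gxc \<xi>_def algebra_simps del: One_nat_def)
  qed (simp add: cl xc gxc)
 qed
 then interpret L: skew_lifting H g x \<xi> .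
 \<comment> \<open>On its right leg \<open>Y0\<close> carries g, where \<open>\<xi> 0\<close>
   vanishes. The same convolution computed in the basis of the first filtration term is the
   coefficient of x in \<open>Y0\<close>; so modulo the coradical \<open>Y0\<close> is a multiple of
   g x.\<close>
 have "conv H b2 (\<xi> 0) Y0 = 0" using conv_Y0[OF b_ann(1) L.\<xi>[of 0]] L.xi(2) by simp
 then have b2Y0: "b2 Y0 = 0"
  using L.conv_H1[OF lift_closed(2) bl(1) L.\<xi>[of 0]] bv L.xi(1) by (simp add: \<xi>_def[of 2])
 have Y0: "\<beta> Y0 = b3 Y0 * \<beta> ?gx" if "\<beta> \<in> ann H (coradical H)" for \<beta>
  using span2[OF lift_closed(2) that] b2Y0 by simp
 obtain s where s: "x \<otimes> g = ?gx \<oplus> s \<odot> (?e \<oplus> g)" by (rule L.commutation_x)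
 \<comment> \<open>Scaling x by \<open>r'\<close> multiplies the constant \<open>s\<close> by
   \<open>r'\<close>, which brings it to 0 or 1.\<close>
 define r' where "r' = (if s = 0 then 1 else inverse s)"
 have r': "r' \<noteq> 0" "r' * s = 0 \<or> r' * s = 1" by (auto simp: r'_def)
 define x' where "x' = r' \<odot> x"
 define \<xi>' where "\<xi>' = (\<lambda>i z. if i < 2 then \<xi> i z else inverse r' * \<xi> i z)"
 have L': "skew_lifting H g x' \<xi>'" unfolding x'_def \<xi>'_def by (rule L.rescale[OF r'(1)])
 then interpret L': skew_lifting H g x' \<xi>' .
 have xg': "x' \<otimes> g = g \<otimes> x' \<oplus> (r' * s) \<odot> (?e \<oplus> g)"
  by (simp add: x'_def L.alg s vs_smult_r_distr[OF H_V] vs_smult_assoc[OF H_V] xc)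
 \<comment> \<open>The factor \<open>c\<close> compensates the multiple of g x that
   \<open>Y0\<close> is, since \<open>c * b3 Y0 = 1\<close>; the square of \<open>r'\<close>
   accounts for x occurring in both legs of x g \<otimes> x.\<close>
 let ?y = "(r' * r' * c) \<odot> y0"
 have m: "conv H \<beta> \<gamma> ?y = \<beta> (x' \<otimes> g) * \<gamma> x'" if b: "\<beta> \<in> ann H (coradical H)" "\<gamma> \<in> ann H (coradical H)" for \<beta> \<gamma>
 proof -
  have "conv H \<beta> \<gamma> ?y = r' * r' * (c * b3 Y0) * (\<beta> ?gx * \<gamma> x)"
   by (simp add: lin linform_conv[OF H_coalg] annD(1)[OF b(1)] annD(1)[OF b(2)] lift_closed conv_y0(3)[OF b] Y0[OF b(1)] Xx[OF b(2)] mult_ac)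
  moreover have "\<beta> (x' \<otimes> g) = r' * \<beta> ?gx" "\<gamma> x' = r' * \<gamma> x"
   unfolding xg' by (simp_all add: x'_def lin annD(1)[OF b(1)] annD(1)[OF b(2)] L.alg ann0[OF b(1)] xc gxc cl)
  ultimately show ?thesis using c(1) by (simp add: mult_ac)
 qed
 have l: "conv H \<alpha> \<mu> ?y = \<alpha> ?y * \<mu> ?e \<and> conv H \<mu> \<alpha> ?y = \<mu> ?e * \<alpha> ?y" if b: "\<alpha> \<in> ann H (ch 1)" "linform H \<mu>" for \<alpha> \<mu>
  by (simp add: lin linform_conv[OF H_coalg] annD(1)[OF b(1)] b(2) lift_closed conv_y0(1)[OF b] conv_y0(2)[OF b(2,1)] mult_ac del: One_nat_def)
 obtain y where y: "y \<in> carrier H" "\<And>\<alpha> \<mu>. linform H \<alpha> \<Longrightarrow> linform H \<mu> \<Longrightarrow>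
   conv H \<alpha> \<mu> y = \<alpha> y * \<mu> ?e + \<alpha> ?e * \<mu> y + \<alpha> (x' \<otimes> g) * \<mu> x'"
  by (rule L'.second_order_lift[of ?y, OF _ l m xg']) (simp_all add: cl)
 have "(r' * s) * (r' * s) = r' * s" using r'(2) by auto
 then have "second_lifting H g x' \<xi>' y (r' * s)"
  by (intro second_lifting.intro L' second_lifting_axioms.intro xg' y)
 then show ?thesis using r'(2) by blast
qed

end

section \<open>Isomorphism with Q\<close>

lemma basis_dual_system:
 fixes M (structure)
 assumes M: "vspace (M :: ('k::field, 'a, 'm) module_scheme)" and dim: "has_dimension M n"
 obtains \<beta> l where "dual_system M {..<n} \<beta> l"
proof -
 interpret M: module base_ring M by (rule M)
 obtain B where bas: "is_basis M B" and "card B = n" using dim by (auto simp: has_dimension_def)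
 then have B: "finite B" "B \<subseteq> carrier M" "card B = n" by (simp_all only: is_basis_def)
 have ex: "\<exists>!c. c \<in> B \<rightarrow>\<^sub>E UNIV \<and> x = (\<Oplus>b\<in>B. c b \<odot> b)" if "x \<in> carrier M" for x
  using bas unfolding is_basis_def by (elim conjE) (erule bspec[OF _ that])
 define c where "c x = (THE c. c \<in> B \<rightarrow>\<^sub>E UNIV \<and> x = (\<Oplus>b\<in>B. c b \<odot> b))" for x
 have c: "x = (\<Oplus>b\<in>B. c x b \<odot> b)" if "x \<in> carrier M" for x
  using theI'[OF ex[OF that]] by (simp add: c_def)
 have u: "c x = restrict d B" if "x \<in> carrier M" "x = (\<Oplus>b\<in>B. d b \<odot> b)" for x d
 proof -
  have "x = (\<Oplus>b\<in>B. restrict d B b \<odot> b)"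
   unfolding that(2) using B(2) by (intro M.M.finsum_cong') (auto simp: vs_smult[OF M])
  then show ?thesis unfolding c_def by (intro the1_equality[OF ex[OF that(1)]]) simp
 qed
 have "linform M (\<lambda>x. c x b)" if b: "b \<in> B" for b
 proof (rule linformI)
  fix x y assume xy: "x \<in> carrier M" "y \<in> carrier M"
  have eq: "x \<oplus> y = (\<Oplus>b\<in>B. (c x b + c y b) \<odot> b)"
  proof -
   have "x \<oplus> y = (\<Oplus>b\<in>B. c x b \<odot> b) \<oplus> (\<Oplus>b\<in>B. c y b \<odot> b)"
    using c[OF xy(1)] c[OF xy(2)] by simp
   also have "\<dots> = (\<Oplus>b\<in>B. c x b \<odot> b \<oplus> c y b \<odot> b)"
    using B(2) by (intro M.M.finsum_addf[symmetric]) (auto simp: vs_smult[OF M])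
   also have "\<dots> = (\<Oplus>b\<in>B. (c x b + c y b) \<odot> b)"
    using B(2) by (intro M.M.finsum_cong') (auto simp: vs_smult[OF M] vs_smult_l_distr[OF M])
   finally show ?thesis .
  qed
  show "c (x \<oplus> y) b = c x b + c y b" using u[OF vs_add[OF M xy] eq] b by simp
 next
  fix a x assume x: "x \<in> carrier M"
  have eq: "a \<odot> x = (\<Oplus>b\<in>B. (a * c x b) \<odot> b)"
  proof -
   have lin: "linear_map M M (\<lambda>v. a \<odot> v)"
    by (intro linear_mapI) (simp_all add: vs_smult[OF M] vs_smult_r_distr[OF M] vs_smult_assoc[OF M, symmetric] mult.commute)
   have "a \<odot> x = a \<odot> (\<Oplus>b\<in>B. c x b \<odot> b)" using c[OF x] by simp
   also have "\<dots> = (\<Oplus>b\<in>B. a \<odot> (c x b \<odot> b))"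
    using B(2) by (intro linear_map_finsum[OF M M lin]) (auto simp: vs_smult[OF M])
   also have "\<dots> = (\<Oplus>b\<in>B. (a * c x b) \<odot> b)"
    using B(2) by (intro M.M.finsum_cong') (auto simp: vs_smult[OF M] vs_smult_assoc[OF M])
   finally show ?thesis .
  qed
  show "c (a \<odot> x) b = a * c x b" using u[OF vs_smult[OF M x] eq] b by simp
 qed
 then have d: "dual_system M B (\<lambda>b. b) (\<lambda>b x. c x b)"
  using B c by (auto simp: dual_system_def)
 obtain h where "bij_betw h {0..<n} B" using ex_bij_betw_nat_finite[OF B(1)] B(3) by auto
 then have "bij_betw h {..<n} B" by (simp add: atLeast0LessThan)
 then show thesis by (rule that[OF dual_system_reindex[OF M d]])
qed

text \<open>More unknowns than equations. If the last column is zero it can be ignored; otherwise a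
  pivot row \<open>p\<close> clears it, and the relation found for the remaining rows determines the
  coefficient of the pivot row.\<close>

lemma nontrivial_relation:
 fixes A :: "nat \<Rightarrow> nat \<Rightarrow> 'k::field"
 shows "\<exists>c.  (\<exists>j\<le>n. c j \<noteq> 0) \<and> (\<forall>i<n. (\<Sum>j\<le>n. c j * A j i) = 0)"
proof (induct n arbitrary: A)
 case 0
 show ?case by (rule exI[of _ "\<lambda>_. 1"]) simp
next
 case (Suc n)
 show ?case
 proof (cases "\<forall>j\<le>Suc n. A j n = 0")
  case True
  obtain c where "(\<exists>j\<le>n. c j \<noteq> 0) \<and> (\<forall>i<n. (\<Sum>j\<le>n. c j * A j i) = 0)" using Suc[of A] by (rule exE)
  then have c: "\<exists>j\<le>n. c j \<noteq> 0" "\<And>i. i < n \<Longrightarrow> (\<Sum>j\<le>n. c j * A j i) = 0" by simp_all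
  have "(\<Sum>j\<le>Suc n. (if j \<le> n then c j else 0) * A j i) = 0" if "i < Suc n" for i
   using c(2)[of i] True that by (cases "i = n") simp_all
  moreover have "\<exists>j\<le>Suc n. (if j \<le> n then c j else 0) \<noteq> 0" using c(1) by (metis le_SucI)
  ultimately show ?thesis by (intro exI[of _ "\<lambda>j. if j \<le> n then c j else 0"]) simp
 next
  case False
  then obtain p where p: "p \<le> Suc n" "A p n \<noteq> 0" by auto
  let ?q = "\<lambda>j. if j = p then Suc n else j"
  define k where "k j = A (?q j) n / A p n" for j
  obtain c where "(\<exists>j\<le>n. c j \<noteq> 0) \<and> (\<forall>i<n. (\<Sum>j\<le>n. c j * (A (?q j) i - k j * A p i)) = 0)"
   using Suc[of "\<lambda>j i. A (?q j) i - k j * A p i"] by (rule exE)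
  then have c: "\<exists>j\<le>n. c j \<noteq> 0" "\<And>i. i < n \<Longrightarrow> (\<Sum>j\<le>n. c j * (A (?q j) i - k j * A p i)) = 0" by simp_all
  \<comment> \<open>The reduced system is indexed by \<open>?q\<close>, which fills the gap at
    \<open>p\<close> with the last row. Accordingly the last row receives \<open>c p\<close>, and
    the pivot row minus the sum of what was subtracted.\<close>
  let ?c = "\<lambda>j. if j = p then - (\<Sum>j\<le>n. c j * k j) else if j = Suc n then c p else c j"
  have sum: "(\<Sum>j\<le>Suc n. ?c j * A j i) = (\<Sum>j\<le>n. c j * (A (?q j) i - k j * A p i))" for i
  proof (cases "p = Suc n")
   case True
   then show ?thesis by (simp add: right_diff_distrib sum_subtractf sum_distrib_right mult.assoc)
  next
   case False
   then have pn: "p \<in> {..n}" using p(1) by simp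
   have "(\<Sum>j\<le>Suc n. ?c j * A j i) = c p * A (Suc n) i - (\<Sum>j\<le>n. c j * k j) * A p i + (\<Sum>j\<in>{..n} - {p}. c j * A j i)"
    using False by (simp add: sum.remove[OF _ pn]) (simp add: algebra_simps)
   also have "(\<Sum>j\<in>{..n} - {p}. c j * A j i) = (\<Sum>j\<in>{..n} - {p}. c j * A (?q j) i)" by (intro sum.cong) auto
   also have "c p * A (Suc n) i - (\<Sum>j\<le>n. c j * k j) * A p i + (\<Sum>j\<in>{..n} - {p}. c j * A (?q j) i) =
    (\<Sum>j\<le>n. c j * A (?q j) i) - (\<Sum>j\<le>n. c j * k j) * A p i"
    by (simp add: sum.remove[OF _ pn, of "\<lambda>j. c j * A (?q j) i"])
   finally show ?thesis by (simp add: right_diff_distrib sum_subtractf sum_distrib_right mult.assoc)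
  qed
  have "(\<Sum>j\<le>Suc n. ?c j * A j i) = 0" if "i < Suc n" for i
   unfolding sum using c(2)[of i] that p(2) by (cases "i = n") (simp_all add: k_def)
  moreover have "\<exists>j\<le>Suc n. ?c j \<noteq> 0"
  proof -
   obtain j where j: "j \<le> n" "c j \<noteq> 0" using c(1) by blast
   show ?thesis by (rule exI[of _ "?q j"]) (use j in auto)
  qed
  ultimately show ?thesis by (intro exI[of _ ?c]) blast
 qed
qed

text \<open>For surjectivity, the images of the \<open>n\<close> basis vectors together with
  \<open>w\<close> satisfy a nontrivial relation in \<open>n\<close> coordinates. By injectivity the
  coefficient of \<open>w\<close> is nonzero, so \<open>w\<close> is an image.\<close>

lemma injective_bij:
 fixes M :: "('k::field, 'a, 'm) module_scheme" and W :: "('k, 'b, 'n) module_scheme" (structure) and n :: nat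
 assumes M: "vspace M" and W: "vspace W"
  and d: "dual_system M {..<n} b k" and e: "dual_system W {..<n} \<beta> l"
  and kb: "\<And>i j. i < n \<Longrightarrow> j < n \<Longrightarrow> k i (b j) = (if i = j then 1 else 0)"
  and f: "linear_map M W f" and inj: "\<And>z. z \<in> carrier M \<Longrightarrow> f z = \<zero> \<Longrightarrow> z = \<zero>\<^bsub>M\<^esub>"
 shows "bij_betw f (carrier M) (carrier W)"
 unfolding bij_betw_def
proof
 interpret M: module base_ring M by (rule M)
 interpret W: module base_ring W by (rule W)
 show "inj_on f (carrier M)"
 proof (rule inj_onI)
  fix x y assume xy: "x \<in> carrier M" "y \<in> carrier M" "f x = f y"
  have "f (x \<ominus>\<^bsub>M\<^esub> y) = \<zero>"
   using xy linear_map_minus[OF M W f xy(1,2)] linear_mapD(1)[OF f xy(2)] by (simp add: W.M.minus_eq W.M.r_neg)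
  then show "x = y" using inj[of "x \<ominus>\<^bsub>M\<^esub> y"] xy vs_minus_eq_zero[OF M xy(1,2)] by simp
 qed
 show "f ` carrier M = carrier W"
 proof
  show "f ` carrier M \<subseteq> carrier W" using linear_mapD(1)[OF f] by auto
  show "carrier W \<subseteq> f ` carrier M"
  proof
   fix w assume w: "w \<in> carrier W"
   obtain c where "(\<exists>j\<le>n. c j \<noteq> 0) \<and> (\<forall>i<n. (\<Sum>j\<le>n. c j * (if j < n then l i (f (b j)) else l i w)) = 0)"
    using nontrivial_relation[of n "\<lambda>j i. if j < n then l i (f (b j)) else l i w"] by (rule exE)
   then have c: "\<exists>j\<le>n. c j \<noteq> 0" "\<And>i. i < n \<Longrightarrow> (\<Sum>j\<le>n. c j * (if j < n then l i (f (b j)) else l i w)) = 0" by simp_all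
   define z where "z = (\<Oplus>\<^bsub>M\<^esub>j\<in>{..<n}. c j \<odot>\<^bsub>M\<^esub> b j)"
   have Pi: "(\<lambda>j. c j \<odot>\<^bsub>M\<^esub> b j) \<in> {..<n} \<rightarrow> carrier M" using dual_systemD(2)[OF d] by (auto simp: vs_smult[OF M])
   have z: "z \<in> carrier M" unfolding z_def by (rule vs_finsum[OF M Pi])
   have sum: "\<alpha> z = (\<Sum>j<n. c j * \<alpha> (b j))" if a: "linform M \<alpha>" for \<alpha>
    unfolding z_def linform_finsum[OF M a Pi] using dual_systemD(2)[OF d] by (intro sum.cong refl) (simp add: linformD[OF a])
   have rel: "f z \<oplus> c n \<odot> w = \<zero>"
   proof (rule dual_system_eqI[OF W e])
    fix i assume i: "i \<in> {..<n}"
    note li = dual_systemD(3)[OF e i]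
    have "(\<Sum>j<n. c j * l i (f (b j))) + c n * l i w = 0"
     using c(2)[of i] i unfolding lessThan_Suc_atMost[symmetric] sum.lessThan_Suc by (simp cong: sum.cong_simp)
    then show "l i (f z \<oplus> c n \<odot> w) = l i \<zero>"
     using sum[OF linform_comp[OF f li]] w linear_mapD(1)[OF f z]
     by (simp add: linformD[OF li] linform_zero[OF W li] vs_smult[OF W])
   qed (use w linear_mapD(1)[OF f z] in \<open>simp_all add: vs_smult[OF W] vs_add[OF W]\<close>)
   have cn: "c n \<noteq> 0"
   proof
    assume "c n = 0"
    then have "f z = \<zero>" using rel w linear_mapD(1)[OF f z] by (simp add: vs_smult_zero[OF W] vs_r_zero[OF W])
    then have "z = \<zero>\<^bsub>M\<^esub>" by (rule inj[OF z])
    then have "c j = 0" if "j < n" for j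
     using sum[OF dual_systemD(3)[OF d, of j]] that kb linform_zero[OF M dual_systemD(3)[OF d, of j]] by (simp add: sum.delta' if_distrib cong: if_cong)
    then show False using c(1) \<open>c n = 0\<close> by (metis le_neq_implies_less)
   qed
   let ?v = "(- inverse (c n)) \<odot>\<^bsub>M\<^esub> z"
   have "f ?v = w"
   proof (rule dual_system_eqI[OF W e _ w])
    fix i assume i: "i \<in> {..<n}"
    note li = dual_systemD(3)[OF e i]
    have "l i (f z) + c n * l i w = 0"
     using arg_cong[OF rel, of "l i"] w linear_mapD(1)[OF f z] by (simp add: linformD[OF li] linform_zero[OF W li] vs_smult[OF W])
    then have "l i (f z) = - (c n * l i w)" by (simp add: eq_neg_iff_add_eq_0)
    then show "l i (f ?v) = l i w"
     using cn linear_mapD(1)[OF f z] by (simp add: linear_mapD(3)[OF f z] linformD[OF li])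
   qed (simp add: linear_mapD(3)[OF f z] vs_smult[OF W] linear_mapD(1)[OF f z])
   then show "w \<in> f ` carrier M" using vs_smult[OF M z, of "- inverse (c n)"] by (metis imageI)
  qed
 qed
qed

context second_lifting
begin

lemma counit_generators: "counit H \<one> = 1" "counit H g = 1" "counit H x = 0" "counit H y = 0"
proof -
 note e = coalg_counit[OF H_coalg]
 show 1: "counit H \<one> = 1" "counit H g = 1" using gl by (auto simp: grouplikes_def)
 show x0: "counit H x = 0" using conv_counit(1)[OF H_coalg e x] by (simp add: conv_x e 1 char2_field[OF char2])
 show "counit H y = 0" using conv_counit(1)[OF H_coalg e y] by (simp add: conv_y e 1 x0 char2_field[OF char2])
qed

text \<open>The generators of Q are sent to g, x and y in \<open>H\<close>. Injectivity is tested
  with forms on \<open>H\<close>, so the independence of the monomials in \<open>H\<close> is a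
  consequence; the inverse of the bijection is the isomorphism.\<close>

lemma hopf_isomorphic_Q:
 assumes q: "q_algebra H g x y \<epsilon> \<tau>" and dim: "has_dimension H 8"
 shows "hopf_isomorphic H (Q_alg \<epsilon> \<tau>)"
proof -
 interpret K: q_algebra H g x y \<epsilon> \<tau> by (rule q)
 note qp = q_presentation_Q[OF char2 idem]
 interpret Q: q_presentation Q_g Q_x Q_y \<epsilon> \<tau> by (rule qp)
 define F where "F i = (case i of Q_g \<Rightarrow> g | Q_x \<Rightarrow> x | Q_y \<Rightarrow> y)" for i
 have F: "F Q_g = g" "F Q_x = x" "F Q_y = y" by (simp_all add: F_def)
 have Fc: "F i \<in> carrier H" for i by (cases i) (simp_all add: F)
 have vanish: "r \<in> Q.R \<Longrightarrow> free_lift H F r = \<zero>" for r by (rule Q.relations_vanish[OF _ Fc]) (simp_all add: F q)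
 note lift = H_alg Fc vanish
 define p where "p = presented_lift H F"
 have p: "linear_map Q.P H p" "p \<one>\<^bsub>Q.P\<^esub> = \<one>" "p Q.cg = g" "p Q.cx = x" "p Q.cy = y"
  using presented_lift_linear[OF lift] presented_lift_one[OF lift] presented_lift_gen[OF lift] by (simp_all add: p_def F)
 have pm: "p (u \<otimes>\<^bsub>Q.P\<^esub> v) = p u \<otimes> p v" if "u \<in> carrier Q.P" "v \<in> carrier Q.P" for u v
  unfolding p_def by (rule presented_lift_mult[OF lift that])
 have pc: "z \<in> carrier Q.P \<Longrightarrow> p z \<in> carrier H" for z by (rule linear_mapD(1)[OF p(1)])
 have pb: "p (Q.b 0) = \<one>" "p (Q.b 1) = g" "p (Q.b 2) = x" "p (Q.b 3) = g \<otimes> x" "p (Q.b 4) = y" "p (Q.b 5) = g \<otimes> y"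
  "p (Q.b 6) = x \<otimes> y" "p (Q.b 7) = g \<otimes> (x \<otimes> y)"
  by (simp_all add: Q.P.monomial_simps pm p Q.P.closed del: One_nat_def)
 have pl: "linform H \<alpha> \<Longrightarrow> linform Q.P (\<lambda>z. \<alpha> (p z))" for \<alpha> by (rule linform_comp[OF p(1)])
 have compat: "conv H \<alpha> \<mu> (p z) = conv Q.D (\<lambda>z. \<alpha> (p z)) (\<lambda>z. \<mu> (p z)) z" if l: "linform H \<alpha>" "linform H \<mu>" and z: "z \<in> carrier Q.P" for \<alpha> \<mu> z
 proof (rule Q.linform_eq_on_monomials[OF pl[OF linform_conv[OF H_coalg l]] Q.linform_conv_D[OF pl[OF l(1)] pl[OF l(2)]] _ z])
  fix n :: nat assume "n < 8"
  then show "conv H \<alpha> \<mu> (p (Q.b n)) = conv Q.D (\<lambda>z. \<alpha> (p z)) (\<lambda>z. \<mu> (p z)) (Q.b n)"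
   unfolding Q.less8
   by (elim disjE; hypsubst; simp only: Q.conv_monomial[OF pl[OF l(1)] pl[OF l(2)]] pb;
    simp add: conv_rules linform_mult(2) l; simp add: yg_rules lin l; simp add: ring_norm idem eps)
 qed
 have cu: "counit H (p z) = counit Q.D z" if z: "z \<in> carrier Q.P" for z
 proof (rule Q.linform_eq_on_monomials[OF pl[OF coalg_counit[OF H_coalg]] Q.linform_counit_D[unfolded Q.linform_D] _ z])
  have m: "counit H (u \<otimes> v) = counit H u * counit H v" if "u \<in> carrier H" "v \<in> carrier H" for u v
   using k_bialgebra.counit_hom[OF H_bialg] that by (simp add: ring_hom_def base_alg_simps)
  fix n :: nat assume "n < 8"
  then show "counit H (p (Q.b n)) = counit Q.D (Q.b n)"
   using Q.counit_monomial[of n] unfolding Q.less8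
   by (elim disjE; hypsubst; simp only: pb; simp add: m counit_generators)
 qed
 have cm: "conv H \<alpha> \<mu> (p (Q.b n)) = conv Q.D (\<lambda>z. \<alpha> (p z)) (\<lambda>z. \<mu> (p z)) (Q.b n)" if "linform H \<alpha>" "linform H \<mu>" "n < 8" for \<alpha> \<mu> n
  by (rule compat[OF that(1,2) Q.P.monomial_closed[OF that(3)]])
 have m: "conv H \<alpha> \<mu> \<one> = \<alpha> \<one> * \<mu> \<one>" "conv H \<alpha> \<mu> g = \<alpha> g * \<mu> g" "conv H \<alpha> \<mu> x = \<alpha> x * \<mu> \<one> + \<alpha> g * \<mu> x"
  "conv H \<alpha> \<mu> (g \<otimes> x) = \<alpha> (g \<otimes> x) * \<mu> g + \<alpha> \<one> * \<mu> (g \<otimes> x)"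
  "conv H \<alpha> \<mu> y = \<alpha> y * \<mu> \<one> + \<alpha> \<one> * \<mu> y + (\<alpha> (g \<otimes> x) + \<epsilon> * (\<alpha> \<one> + \<alpha> g)) * \<mu> x"
  "conv H \<alpha> \<mu> (g \<otimes> y) = \<alpha> (g \<otimes> y) * \<mu> g + \<alpha> g * \<mu> (g \<otimes> y) + (\<alpha> x + \<epsilon> * (\<alpha> \<one> + \<alpha> g)) * \<mu> (g \<otimes> x)"
  "conv H \<alpha> \<mu> (x \<otimes> y) = \<alpha> (x \<otimes> y) * \<mu> \<one> + \<alpha> x * \<mu> y + \<alpha> (g \<otimes> y) * \<mu> x + \<alpha> g * \<mu> (x \<otimes> y) + \<epsilon> * (\<alpha> x + \<alpha> (g \<otimes> x)) * \<mu> x"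
  "conv H \<alpha> \<mu> (g \<otimes> (x \<otimes> y)) = \<alpha> (g \<otimes> (x \<otimes> y)) * \<mu> g + \<alpha> (g \<otimes> x) * \<mu> (g \<otimes> y) + \<alpha> y * \<mu> (g \<otimes> x) + \<alpha> \<one> * \<mu> (g \<otimes> (x \<otimes> y)) +
   \<epsilon> * (\<alpha> x + \<alpha> (g \<otimes> x)) * \<mu> (g \<otimes> x)" if l: "linform H \<alpha>" "linform H \<mu>" for \<alpha> \<mu>
  using cm[OF l, of 0] cm[OF l, of 1] cm[OF l, of 2] cm[OF l, of 3] cm[OF l, of 4] cm[OF l, of 5] cm[OF l, of 6] cm[OF l, of 7]
  unfolding Q.conv_monomial[OF pl[OF l(1)] pl[OF l(2)]] pb by simp_all
 \<comment> \<open>Forms that detect the monomials outside the first filtration term: \<Delta> y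
   contains g x \<otimes> x and \<Delta>(g y) contains x \<otimes> g x, while \<Delta>(x y) contains
   x \<otimes> y and \<Delta>(g x y) contains g x \<otimes> g y.\<close>
 define \<eta>4 \<eta>5 where "\<eta>4 = conv H (\<xi> 3) (\<xi> 2)" and "\<eta>5 = conv H (\<xi> 2) (\<xi> 3)"
 have l4: "linform H \<eta>4" "linform H \<eta>5" by (simp_all add: \<eta>4_def \<eta>5_def linform_conv[OF H_coalg] \<xi>)
 define \<eta>6 \<eta>7 where "\<eta>6 = conv H (\<xi> 2) \<eta>4" and "\<eta>7 = conv H (\<xi> 3) \<eta>5"
 have l6: "linform H \<eta>6" "linform H \<eta>7" by (simp_all add: \<eta>6_def \<eta>7_def linform_conv[OF H_coalg] \<xi> l4)
 have v4: "\<eta>4 \<one> = 0" "\<eta>4 g = 0" "\<eta>4 x = 0" "\<eta>4 (g \<otimes> x) = 0" "\<eta>4 y = 1" "\<eta>4 (g \<otimes> y) = 0"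
  "\<eta>5 \<one> = 0" "\<eta>5 g = 0" "\<eta>5 x = 0" "\<eta>5 (g \<otimes> x) = 0" "\<eta>5 y = 0" "\<eta>5 (g \<otimes> y) = 1"
  by (simp_all add: \<eta>4_def \<eta>5_def m \<xi> xi)
 have v6: "\<eta>6 \<one> = 0" "\<eta>6 g = 0" "\<eta>6 x = 0" "\<eta>6 (g \<otimes> x) = 0" "\<eta>6 y = 0" "\<eta>6 (g \<otimes> y) = 0" "\<eta>6 (x \<otimes> y) = 1" "\<eta>6 (g \<otimes> (x \<otimes> y)) = 0"
  "\<eta>7 \<one> = 0" "\<eta>7 g = 0" "\<eta>7 x = 0" "\<eta>7 (g \<otimes> x) = 0" "\<eta>7 y = 0" "\<eta>7 (g \<otimes> y) = 0" "\<eta>7 (x \<otimes> y) = 0" "\<eta>7 (g \<otimes> (x \<otimes> y)) = 1"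
  by (simp_all add: \<eta>6_def \<eta>7_def m \<xi> xi l4 v4)
 have inj: "z = \<zero>\<^bsub>Q.P\<^esub>" if z: "z \<in> carrier Q.P" and 0: "p z = \<zero>" for z
 proof -
  have S: "Q.coord 0 z * \<alpha> \<one> + Q.coord 1 z * \<alpha> g + Q.coord 2 z * \<alpha> x + Q.coord 3 z * \<alpha> (g \<otimes> x) + Q.coord 4 z * \<alpha> y +
   Q.coord 5 z * \<alpha> (g \<otimes> y) + Q.coord 6 z * \<alpha> (x \<otimes> y) + Q.coord 7 z * \<alpha> (g \<otimes> (x \<otimes> y)) = 0" if a: "linform H \<alpha>" for \<alpha>
   using linform_expand[OF Q.P.V Q.dual_monomials pl[OF a] z] linform_zero[OF V a]
   by (simp add: 0 Q.lessThan_8 pb del: One_nat_def)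
  \<comment> \<open>The forms are triangular on the monomials: the last two vanish on all but their
    own, the middle two on everything below. Coordinates are eliminated from the top.\<close>
  have c67: "Q.coord 6 z = 0" "Q.coord 7 z = 0" using S[OF l6(1)] S[OF l6(2)] by (simp_all add: v6)
  have c45: "Q.coord 4 z = 0" "Q.coord 5 z = 0" using S[OF l4(1)] S[OF l4(2)] by (simp_all add: v4 c67)
  have "Q.coord 0 z = 0" "Q.coord 1 z = 0" "Q.coord 2 z = 0" "Q.coord 3 z = 0"
   using S[OF \<xi>[of 0]] S[OF \<xi>[of 1]] S[OF \<xi>[of 2]] S[OF \<xi>[of 3]] by (simp_all add: xi c67 c45 del: One_nat_def)
  with c67 c45 have "Q.coord n z = 0" if "n < 8" for n using that unfolding Q.less8 by auto
  then show ?thesis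
   by (intro dual_system_eqI[OF Q.P.V Q.dual_monomials z Q.P.closed(5)]) (simp add: linform_zero[OF Q.P.V Q.linform_coord])
 qed
 obtain \<beta> l where d: "dual_system H {..<8::nat} \<beta> l" by (rule basis_dual_system[OF V dim])
 have bij: "bij_betw p (carrier Q.P) (carrier H)"
  by (rule injective_bij[OF Q.P.V V Q.dual_monomials d Q.coord_b p(1) inj])
 define r where "r = inv_into (carrier Q.D) p"
 have iso: "p \<in> ring_iso Q.D H"
  using bij pm pc p by (auto simp: ring_iso_def ring_hom_def Q.D_simps linear_mapD(2)[OF p(1)])
 have rl: "linear_map H Q.D r"
  unfolding r_def by (rule linear_map_inv_into[OF Q.vspace_D]) (use p(1) bij in \<open>simp_all add: linear_map_def Q.D_simps\<close>)
 have rp: "r (p z) = z" if "z \<in> carrier Q.P" for z using bij that by (simp add: r_def bij_betw_def Q.D_simps)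
 have "comul Q.D (r u) = tensor_map Q.D Q.D r r (comul H u)" if u: "u \<in> carrier H" for u
 proof -
  obtain z where z: "z \<in> carrier Q.P" "u = p z" using u bij by (auto simp: bij_betw_def)
  have "conv Q.D \<alpha> \<mu> z = tev \<alpha> \<mu> (tensor_map Q.D Q.D r r (comul H u))" if l: "linform Q.D \<alpha>" "linform Q.D \<mu>" for \<alpha> \<mu>
  proof -
   note rl' = linform_comp[OF rl l(1)] linform_comp[OF rl l(2)]
   have "tev \<alpha> \<mu> (tensor_map Q.D Q.D r r (comul H u)) = conv H (\<lambda>v. \<alpha> (r v)) (\<lambda>v. \<mu> (r v)) u"
    unfolding conv_def by (rule tev_tensor_map[OF V V Q.vspace_D Q.vspace_D rl rl l coalg_comul[OF H_coalg u]])
   also have "\<dots> = conv Q.D (\<lambda>v. \<alpha> (r (p v))) (\<lambda>v. \<mu> (r (p v))) z" unfolding z(2) by (rule compat[OF rl' z(1)])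
   also have "\<dots> = conv Q.D \<alpha> \<mu> z"
    using pl[OF rl'(1)] pl[OF rl'(2)] l z(1) by (intro conv_cong[OF Q.k_coalgebra_D]) (simp_all add: Q.linform_D rp Q.D_simps)
   finally show ?thesis by simp
  qed
  then show ?thesis
   using z linear_mapD(1)[OF tensor_map_linear[OF V V Q.vspace_D Q.vspace_D rl rl] coalg_comul[OF H_coalg u]]
   by (intro comul_eqI[OF Q.k_coalgebra_D Q.fin_dim_D]) (simp_all add: rp Q.D_simps)
 qed
 moreover have "counit Q.D (r u) = counit H u" if u: "u \<in> carrier H" for u
 proof -
  obtain z where z: "z \<in> carrier Q.P" "u = p z" using u bij by (auto simp: bij_betw_def)
  then show ?thesis using cu[OF z(1)] by (simp add: rp)
 qed
 moreover have "r \<in> ring_iso H Q.D"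
  unfolding r_def by (rule ring_iso_set_sym[OF alg_ring[OF Q.k_algebra_D] iso])
 ultimately have "r \<in> hopf_iso H Q.D" using rl by (simp add: hopf_iso_def)
 then show ?thesis unfolding hopf_isomorphic_def Q_alg_eq[OF qp] by blast
qed

end

theorem mainTheorem4:
 assumes "CHAR('k::alg_closed_field) = 2"
 shows "(\<forall>H :: ('k, 'h) bialg.
      hopf_algebra H \<and> pointed H \<and> has_dimension H 8 \<and>
      hopf_isomorphic (gr H) (A_alg :: ('k, _) bialg) \<longrightarrow>
      (\<exists>(\<epsilon>, \<tau>) \<in> Q_parameters. hopf_isomorphic H (Q_alg \<epsilon> \<tau>))) \<and>
     \<not> hopf_isomorphic (Q_alg (0::'k) 0) (Q_alg (0::'k) 1) \<and>
     (\<forall>(\<epsilon> :: 'k, \<tau>) \<in> Q_parameters.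
      hopf_algebra (Q_alg \<epsilon> \<tau>) \<and> pointed (Q_alg \<epsilon> \<tau>) \<and>
      has_dimension (Q_alg \<epsilon> \<tau>) 8 \<and> graded_iso_to_A (Q_alg \<epsilon> \<tau>))"
proof (intro conjI allI impI ballI)
 have c2: "(1::'k) + 1 = 0" using of_nat_CHAR[where 'a = 'k] assms by simp
 show "\<not> hopf_isomorphic (Q_alg (0::'k) 0) (Q_alg (0::'k) 1)" by (rule Q_alg_not_isomorphic[OF c2]) simp
 show "case et of (\<epsilon>, \<tau>) \<Rightarrow> hopf_algebra (Q_alg \<epsilon> \<tau>) \<and> pointed (Q_alg \<epsilon> \<tau>) \<and> has_dimension (Q_alg \<epsilon> \<tau>) 8 \<and> graded_iso_to_A (Q_alg \<epsilon> \<tau>)"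
  if "et \<in> Q_parameters" for et :: "'k \<times> 'k"
  using that Q_alg_properties[OF c2] by (auto simp: Q_parameters_def)
 fix H :: "('k, 'h) bialg"
 assume "hopf_algebra H \<and> pointed H \<and> has_dimension H 8 \<and> hopf_isomorphic (gr H) (A_alg :: ('k, _) bialg)"
 then have H: "hopf_algebra H" "pointed H" "has_dimension H 8" and iso: "hopf_isomorphic (gr H) (A_alg :: ('k, _) bialg)" by auto
 note a = q_presentation_A[OF c2]
 obtain f where f: "f \<in> hopf_iso (gr H) (q_presentation.D A_g A_a A_b (0::'k) 0)"
  using iso unfolding hopf_isomorphic_def A_alg_eq(1)[OF a] by blast
 have V: "vspace H" using H(1) by (simp add: hopf_algebra_def k_bialgebra_def k_coalgebra_def)
 obtain \<beta> l where "dual_system H {..<8::nat} \<beta> l" by (rule basis_dual_system[OF V H(3)])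
 then have fd: "fin_dim H" by (rule fin_dimI[OF V])
 interpret graded_model A_g A_a A_b H f
  by (intro graded_model.intro a graded_model_axioms.intro H fd f)
 obtain x \<xi> y \<epsilon> where L: "second_lifting H g x \<xi> y \<epsilon>" and \<epsilon>: "\<epsilon> = 0 \<or> \<epsilon> = 1" using second_lifting_exists by blast
 interpret L: second_lifting H g x \<xi> y \<epsilon> by (rule L)
 obtain \<tau> where q: "q_algebra H g x y \<epsilon> \<tau>" by (rule L.q_algebra_lifting)
 have "\<exists>\<epsilon> \<tau>. (\<epsilon>, \<tau>) \<in> Q_parameters \<and> hopf_isomorphic H (Q_alg \<epsilon> \<tau>)"
 \<comment> \<open>For \<epsilon> = 1 every \<tau> is a parameter of the family, so only a nonzero
   \<tau> with \<epsilon> = 0 has to be normalized.\<close>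
 proof (cases "\<epsilon> = 1 \<or> \<tau> = 0")
  case True
  then have "(\<epsilon>, \<tau>) \<in> Q_parameters" using \<epsilon> by (auto simp: Q_parameters_def)
  then show ?thesis using L.hopf_isomorphic_Q[OF q H(3)] by blast
 next
  case False
  then have e0: "\<epsilon> = 0" and t: "\<tau> \<noteq> 0" using \<epsilon> by auto
  \<comment> \<open>Scaling x by s and y by s * s multiplies \<tau> by s ^ 3. The field is
    algebraically closed, so a cube root of the inverse of \<tau> brings it to 1.\<close>
  obtain s where s: "s ^ 3 = inverse \<tau>" using nth_root_exists[of 3 "inverse \<tau>"] by auto
  then have s0: "s \<noteq> 0" and s3: "s * (s * (s * \<tau>)) = 1" using t by (auto simp: power3_eq_cube field_simps)
  have s4: "\<tau> * (s * (s * s)) = 1" "\<tau> * (s * (s * (s * s))) = s"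
   using s3 arg_cong[OF s3, of "\<lambda>z. s * z"] by (simp_all add: mult_ac)
  interpret K: q_algebra H g x y 0 \<tau> using q e0 by simp
  note L' = L.rescale_y[OF e0 s0]
  have "q_algebra H g (s \<odot>\<^bsub>H\<^esub> x) (s * s \<odot>\<^bsub>H\<^esub> y) 0 1"
  proof (rule q_algebra.intro; (rule K.B K.char2 K.gen_closed K.rel_gg)?)
  qed (simp_all add: K.word_simps K.vs_norm vs_smult_zero[OF V] vs_smult_one[OF V] vs_smult_r_null[OF V] s4 mult_ac)
  then have "hopf_isomorphic H (Q_alg 0 1)" by (rule second_lifting.hopf_isomorphic_Q[OF L' _ H(3)])
  then show ?thesis by (intro exI[of _ 0] exI[of _ 1]) (simp add: Q_parameters_def)
 qed
 then show "\<exists>(\<epsilon>, \<tau>) \<in> Q_parameters. hopf_isomorphic H (Q_alg \<epsilon> \<tau>)" by auto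
qed

end
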